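(* The forgetful functor $U_c$ from PROPs to properads admits a left adjoint, given by the construction $S_\otimes$: $$S_\otimes:\ \text{properads}\ \rightleftarrows\ \text{PROPs}\ :U_c .$$
   Context: $k$ is a field of characteristic $0$. An $\mathbb{S}$-bimodule is a family $P=(P(m,n))_{m,n}$ of $k$-modules with commuting left $\mathbb{S}_m$- and right $\mathbb{S}_n$-actions; all are reduced ($P(m,n)=0$ if $m=0$ or $n=0$). Graphs are finite, non-planar, directed by a global flow (no directed cycles); each vertex $\nu$ has sets $In(\nu),Out(\nu)$ of at least one incoming and one outgoing edge, labelled by integers; global inputs and outputs are labelled. $\mathcal{Q}\boxtimes P$ is the direct sum over two-level graphs, not necessarily connected (global inputs enter level 1 on top, all outputs of level-1 vertices are joined to inputs of level-2 vertices, outputs of level-2 vertices are the global outputs), of $\bigotimes_{\nu\in\text{level }2}\mathcal{Q}(|Out(\nu)|,|In(\nu)|)\otimes\bigotimes_{\nu\in\text{level }1}P(|Out(\nu)|,|In(\nu)|)$, modulo the identification of relabelling the edges of a vertex with the symmetric group actions. $\mathcal{Q}\boxtimes_cP$ is the part given by connected graphs. $I(1,1)=k$, $I(m,n)=0$ otherwise. $(\mathbb{S}\text{-bimodules},\boxtimes_c,I)$ is a monoidal category and a properad is a monoid in it. Concatenation product: $(P\otimes Q)(m,n)=\bigoplus_{m'+m''=m,\,n'+n''=n}k[\mathbb{S}_m]\otimes_{\mathbb{S}_{m'}\times\mathbb{S}_{m''}}(P(m',n')\otimes_kQ(m'',n''))\otimes_{\mathbb{S}_{n'}\times\mathbb{S}_{n''}}k[\mathbb{S}_n]$;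 it is symmetric monoidal. $S_\otimes(P)=\bigoplus_{n\ge1}(P^{\otimes n})_{\mathbb{S}_n}$ is the truncated free symmetric algebra; one has $S_\otimes(\mathcal{Q}\boxtimes_cP)=\mathcal{Q}\boxtimes P$ and $S_\otimes(I)=\bigoplus_{n\ge1}k[\mathbb{S}_n]$. A PROP is an $\mathbb{S}$-bimodule $P$ with an associative vertical composition $\mu:P\boxtimes P\to P$ (equivalently, associative maps $P(m,N)\otimes_{\mathbb{S}_N}P(N,n)\to P(m,n)$), an associative and commutative horizontal composition $P\otimes P\to P$, and a unit $S_\otimes(I)\to P$ for vertical composition, such that vertical and horizontal compositions satisfy the interchange law. $U_c$ sends a PROP to the properad with the same underlying $\mathbb{S}$-bimodule, obtained by forgetting the horizontal composition and keeping only vertical compositions along connected graphs. For a properad $(P,\mu,\eta)$, $S_\otimes(P)$ is a PROP with horizontal composition the product of the free symmetric algebra, vertical composition induced by $S_\otimes(P\boxtimes_cP)\xrightarrow{S_\otimes(\mu)}S_\otimes(P)$ and unit $S_\otimes(\eta)$.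
   Formalization: The unit S_⊗(I) → P of a PROP is additionally required to be multiplicative for horizontal composition (id_m ⊗ id_n = id_{m+n}), the usual PROP axiom; without it U_c(P) need not be a properad (e.g. zero horizontal composition). *)

theory Defs
  imports
    "HOL-Algebra.Module"
    "HOL-Algebra.Algebraic_Closure_Type"
    "HOL-Combinatorics.Permutations"
    "HOL-Library.Poly_Mapping"
    "HOL-Library.FuncSet"
begin

section \<open>Modules given by generators and relations\<close>

abbreviation scalars :: "'k::field ring" where
  "scalars \<equiv> ring_of_type_algebra"

definition linear_map ::
    "('k::field, 'a) module \<Rightarrow> ('k, 'b) module \<Rightarrow> ('a \<Rightarrow> 'b) \<Rightarrow> bool" where
  "linear_map M N f \<longleftrightarrow>
     f \<in> carrier M \<rightarrow> carrier N \<and>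
     (\<forall>x\<in>carrier M. \<forall>y\<in>carrier M. f (x \<oplus>\<^bsub>M\<^esub> y) = f x \<oplus>\<^bsub>N\<^esub> f y) \<and>
     (\<forall>c. \<forall>x\<in>carrier M. f (c \<odot>\<^bsub>M\<^esub> x) = c \<odot>\<^bsub>N\<^esub> f x)"

definition bilinear_map ::
    "('k::field, 'a) module \<Rightarrow> ('k, 'b) module \<Rightarrow> ('k, 'c) module \<Rightarrow> ('a \<Rightarrow> 'b \<Rightarrow> 'c) \<Rightarrow> bool" where
  "bilinear_map L M N f \<longleftrightarrow>
     (\<forall>x\<in>carrier L. linear_map M N (f x)) \<and>
     (\<forall>y\<in>carrier M. linear_map L N (\<lambda>x. f x y))"

text \<open>The free module on \<open>'g\<close> is the type of finitely supported functions.\<close>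

definition pscale :: "'k::field \<Rightarrow> ('g \<Rightarrow>\<^sub>0 'k) \<Rightarrow> ('g \<Rightarrow>\<^sub>0 'k)" where
  "pscale c = Poly_Mapping.map (\<lambda>d. c * d)"

definition gen :: "'g \<Rightarrow> ('g \<Rightarrow>\<^sub>0 'k::field)" where
  "gen g = Poly_Mapping.single g 1"

definition coset :: "('g \<Rightarrow>\<^sub>0 'k::field) set \<Rightarrow> ('g \<Rightarrow>\<^sub>0 'k) \<Rightarrow> ('g \<Rightarrow>\<^sub>0 'k) set" where
  "coset R x = {y. y - x \<in> Modules.module.span pscale R}"

text \<open>The quotient of the free module on the set \<open>G\<close> by the submodule spanned by \<open>R\<close>.\<close>

definition presented ::
    "'g set \<Rightarrow> ('g \<Rightarrow>\<^sub>0 'k::field) set \<Rightarrow> ('k, ('g \<Rightarrow>\<^sub>0 'k) set) module" where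
  "presented G R =
     \<lparr>carrier = coset R ` {x. Poly_Mapping.keys x \<subseteq> G},
      monoid.mult = undefined, monoid.one = undefined,
      ring.zero = coset R 0,
      ring.add = (\<lambda>A B. \<Union>x\<in>A. \<Union>y\<in>B. coset R (x + y)),
      module.smult = (\<lambda>c A. \<Union>x\<in>A. coset R (pscale c x))\<rparr>"

text \<open>
  The linear map out of a quotient of a free module with prescribed values on the generators.
  The choice of the representative is irrelevant whenever the values respect the relations.
\<close>

definition lift :: "('k::field, 'b) module \<Rightarrow> ('g \<Rightarrow> 'b) \<Rightarrow> ('g \<Rightarrow>\<^sub>0 'k) set \<Rightarrow> 'b" where
  "lift M \<phi> A = (let x = (SOME x. x \<in> A) in
     \<Oplus>\<^bsub>M\<^esub>g\<in>Poly_Mapping.keys x. Poly_Mapping.lookup x g \<odot>\<^bsub>M\<^esub> \<phi> g)"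


section \<open>Bimodules over the symmetric groups\<close>

text \<open>
  \<open>\<S>\<^sub>n\<close> is the group of permutations of \<open>{..<n}\<close>, multiplied by composition.
  In \<open>md P m n\<close> the index \<open>m\<close> counts outputs and \<open>n\<close> counts inputs.
\<close>

record ('k, 'a) sbimod =
  md :: "nat \<Rightarrow> nat \<Rightarrow> ('k, 'a) module"
  lact :: "nat \<Rightarrow> nat \<Rightarrow> (nat \<Rightarrow> nat) \<Rightarrow> 'a \<Rightarrow> 'a"
  ract :: "nat \<Rightarrow> nat \<Rightarrow> (nat \<Rightarrow> nat) \<Rightarrow> 'a \<Rightarrow> 'a"

abbreviation elts :: "('k, 'a, 'x) sbimod_scheme \<Rightarrow> nat \<Rightarrow> nat \<Rightarrow> 'a set" where
  "elts P m n \<equiv> carrier (md P m n)"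

definition sbimodule :: "('k::field, 'a, 'x) sbimod_scheme \<Rightarrow> bool" where
  "sbimodule P \<longleftrightarrow>
     (\<forall>m n. Module.module scalars (md P m n)) \<and>
     (\<forall>m n. m = 0 \<or> n = 0 \<longrightarrow> elts P m n = {\<zero>\<^bsub>md P m n\<^esub>}) \<and>
     (\<forall>m n \<sigma>. \<sigma> permutes {..<m} \<longrightarrow> linear_map (md P m n) (md P m n) (lact P m n \<sigma>)) \<and>
     (\<forall>m n \<tau>. \<tau> permutes {..<n} \<longrightarrow> linear_map (md P m n) (md P m n) (ract P m n \<tau>)) \<and>
     (\<forall>m n. \<forall>x\<in>elts P m n. lact P m n id x = x \<and> ract P m n id x = x) \<and>
     (\<forall>m n \<sigma> \<sigma>'. \<forall>x\<in>elts P m n. \<sigma> permutes {..<m} \<and> \<sigma>' permutes {..<m} \<longrightarrow>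
        lact P m n (\<sigma> \<circ> \<sigma>') x = lact P m n \<sigma> (lact P m n \<sigma>' x)) \<and>
     (\<forall>m n \<tau> \<tau>'. \<forall>x\<in>elts P m n. \<tau> permutes {..<n} \<and> \<tau>' permutes {..<n} \<longrightarrow>
        ract P m n (\<tau> \<circ> \<tau>') x = ract P m n \<tau>' (ract P m n \<tau> x)) \<and>
     (\<forall>m n \<sigma> \<tau>. \<forall>x\<in>elts P m n. \<sigma> permutes {..<m} \<and> \<tau> permutes {..<n} \<longrightarrow>
        lact P m n \<sigma> (ract P m n \<tau> x) = ract P m n \<tau> (lact P m n \<sigma> x))"

type_synonym ('a, 'b) mor = "nat \<Rightarrow> nat \<Rightarrow> 'a \<Rightarrow> 'b"

definition sbimod_map ::
    "('k::field, 'a, 'x) sbimod_scheme \<Rightarrow> ('k, 'b, 'y) sbimod_scheme \<Rightarrow> ('a, 'b) mor \<Rightarrow> bool" where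
  "sbimod_map P Q f \<longleftrightarrow>
     (\<forall>m n. linear_map (md P m n) (md Q m n) (f m n)) \<and>
     (\<forall>m n \<sigma>. \<forall>x\<in>elts P m n. \<sigma> permutes {..<m} \<longrightarrow>
        f m n (lact P m n \<sigma> x) = lact Q m n \<sigma> (f m n x)) \<and>
     (\<forall>m n \<tau>. \<forall>x\<in>elts P m n. \<tau> permutes {..<n} \<longrightarrow>
        f m n (ract P m n \<tau> x) = ract Q m n \<tau> (f m n x))"

text \<open>
  Morphisms, as elements of Hom-sets, are functions restricted to the carriers
  so that extensional equality is equality.
\<close>

definition extensional_mor :: "('k, 'a, 'x) sbimod_scheme \<Rightarrow> ('a, 'b) mor \<Rightarrow> bool" where
  "extensional_mor P f \<longleftrightarrow> (\<forall>m n. f m n \<in> extensional (elts P m n))"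

definition id_mor :: "('k, 'a, 'x) sbimod_scheme \<Rightarrow> ('a, 'a) mor" where
  "id_mor P = (\<lambda>m n. restrict (\<lambda>x. x) (elts P m n))"

definition comp_mor ::
    "('k, 'a, 'x) sbimod_scheme \<Rightarrow> ('b, 'c) mor \<Rightarrow> ('a, 'b) mor \<Rightarrow> ('a, 'c) mor" where
  "comp_mor P g f = (\<lambda>m n. compose (elts P m n) (g m n) (f m n))"

definition Ibim :: "('k::field, 'k) sbimod" where
  "Ibim = \<lparr>md = (\<lambda>m n.
       \<lparr>carrier = (if m = 1 \<and> n = 1 then UNIV else {0}),
        monoid.mult = undefined, monoid.one = undefined, ring.zero = 0, ring.add = (+), module.smult = (*)\<rparr>),
     lact = (\<lambda>m n \<sigma> x. x), ract = (\<lambda>m n \<tau> x. x)\<rparr>"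


section \<open>Decorated levelled graphs\<close>

text \<open>
  In a vertex, \<open>outs\<close> and \<open>ins\<close> list the edges attached to its output slots \<open>0, 1, \<dots>\<close>
  and to its input slots \<open>0, 1, \<dots>\<close>.  Global inputs and outputs are edges named by
  \<open>{..<n}\<close> and \<open>{..<m}\<close>; internal edges have arbitrary names.
  The slot \<open>i\<close> of \<open>p\<close> is the output slot \<open>\<sigma> i\<close> of \<open>\<sigma> \<cdot> p\<close>, and the input
  slot \<open>i\<close> of \<open>p \<cdot> \<tau>\<close> is the input slot \<open>\<tau> i\<close> of \<open>p\<close>.
\<close>

datatype 'a vertex = Vertex (outs: "nat list") (ins: "nat list") (deco: 'a)

definition relabel :: "(nat \<Rightarrow> nat) \<Rightarrow> (nat \<Rightarrow> nat) \<Rightarrow> 'a vertex \<Rightarrow> 'a vertex" where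
  "relabel f g v = Vertex (map f (outs v)) (map g (ins v)) (deco v)"

definition vmap :: "('a, 'b) mor \<Rightarrow> 'a vertex \<Rightarrow> 'b vertex" where
  "vmap f v = Vertex (outs v) (ins v) (f (length (outs v)) (length (ins v)) (deco v))"

abbreviation all_outs :: "'a vertex list \<Rightarrow> nat list" where
  "all_outs vs \<equiv> concat (map outs vs)"

abbreviation all_ins :: "'a vertex list \<Rightarrow> nat list" where
  "all_ins vs \<equiv> concat (map ins vs)"

definition is_level ::
    "('k, 'a, 'x) sbimod_scheme \<Rightarrow> nat set \<Rightarrow> nat set \<Rightarrow> 'a vertex list \<Rightarrow> bool" where
  "is_level P Out In vs \<longleftrightarrow>
     (\<forall>v\<in>set vs. outs v \<noteq> [] \<and> ins v \<noteq> [] \<and>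
        deco v \<in> elts P (length (outs v)) (length (ins v))) \<and>
     distinct (all_outs vs) \<and> set (all_outs vs) = Out \<and>
     distinct (all_ins vs) \<and> set (all_ins vs) = In"

text \<open>
  The underlying graph: a list of levels, the first one carrying the global outputs.
  A vertex is a pair of its level and its lists of edges; by disjointness of the edge
  sets no two vertices of the same level are identified.
\<close>

abbreviation shape :: "'a vertex \<Rightarrow> nat list \<times> nat list" where
  "shape v \<equiv> (outs v, ins v)"

definition nodes :: "(nat list \<times> nat list) list list \<Rightarrow> (nat \<times> nat list \<times> nat list) set" where
  "nodes L = {(l, s). l < length L \<and> s \<in> set (L ! l)}"

definition adjacent ::
    "(nat list \<times> nat list) list list \<Rightarrow>
     ((nat \<times> nat list \<times> nat list) \<times> (nat \<times> nat list \<times> nat list)) set" where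
  "adjacent L = {((l, s), (Suc l, t)) |l s t.
     (l, s) \<in> nodes L \<and> (Suc l, t) \<in> nodes L \<and> set (snd s) \<inter> set (fst t) \<noteq> {}}"

definition linked ::
    "(nat list \<times> nat list) list list \<Rightarrow>
     ((nat \<times> nat list \<times> nat list) \<times> (nat \<times> nat list \<times> nat list)) set" where
  "linked L = (adjacent L \<union> (adjacent L)\<inverse>)\<^sup>*"

definition connected_graph :: "(nat list \<times> nat list) list list \<Rightarrow> bool" where
  "connected_graph L \<longleftrightarrow> nodes L \<noteq> {} \<and> (\<forall>x\<in>nodes L. \<forall>y\<in>nodes L. (x, y) \<in> linked L)"

text \<open>
  Relations for the vertices of one level: the decorated level is an element of the
  tensor product over its (unordered) vertices, and relabelling the slots of a vertex agrees
  with the symmetric group actions.  The function \<open>K\<close> inserts the level into a graph,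
  and \<open>G\<close> is the set of admissible graphs.
\<close>

definition level_rels ::
    "('k::field, 'a, 'x) sbimod_scheme \<Rightarrow> 'g set \<Rightarrow> ('a vertex list \<Rightarrow> 'g) \<Rightarrow> ('g \<Rightarrow>\<^sub>0 'k) set" where
  "level_rels P G K =
     {gen (K (xs @ Vertex os is (p \<oplus>\<^bsub>md P (length os) (length is)\<^esub> q) # ys))
        - gen (K (xs @ Vertex os is p # ys)) - gen (K (xs @ Vertex os is q # ys)) |xs os is p q ys.
        K (xs @ Vertex os is p # ys) \<in> G \<and> K (xs @ Vertex os is q # ys) \<in> G} \<union>
     {gen (K (xs @ Vertex os is (c \<odot>\<^bsub>md P (length os) (length is)\<^esub> p) # ys))
        - pscale c (gen (K (xs @ Vertex os is p # ys))) |xs os is c p ys.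
        K (xs @ Vertex os is p # ys) \<in> G} \<union>
     {gen (K (xs @ Vertex os is (lact P (length os) (length is) \<sigma> p) # ys))
        - gen (K (xs @ Vertex (permute_list \<sigma> os) is p # ys)) |xs os is \<sigma> p ys.
        \<sigma> permutes {..<length os} \<and> K (xs @ Vertex os is p # ys) \<in> G} \<union>
     {gen (K (xs @ Vertex os (permute_list \<tau> is) (ract P (length os) (length is) \<tau> p) # ys))
        - gen (K (xs @ Vertex os is p # ys)) |xs os is \<tau> p ys.
        \<tau> permutes {..<length is} \<and> K (xs @ Vertex os is p # ys) \<in> G} \<union>
     {gen (K xs) - gen (K ys) |xs ys. mset xs = mset ys \<and> K xs \<in> G \<and> K ys \<in> G}"


section \<open>The truncated free symmetric algebra\<close>

text \<open>
  \<open>(P\<^sup>\<otimes>\<^sup>r)\<^bsub>\<S>\<^sub>r\<^esub>(m,n)\<close> is spanned by the one-level graphs with \<open>r\<close> vertices: the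
  factors \<open>k[\<S>\<^sub>m]\<close> and \<open>k[\<S>\<^sub>n]\<close> of the concatenation product distribute the
  labels of the global outputs and inputs over the vertices.
\<close>

definition Sgraphs :: "('k, 'a, 'x) sbimod_scheme \<Rightarrow> nat \<Rightarrow> nat \<Rightarrow> 'a vertex list set" where
  "Sgraphs P m n = {vs. vs \<noteq> [] \<and> is_level P {..<m} {..<n} vs}"

definition Srels ::
    "('k::field, 'a, 'x) sbimod_scheme \<Rightarrow> nat \<Rightarrow> nat \<Rightarrow> ('a vertex list \<Rightarrow>\<^sub>0 'k) set" where
  "Srels P m n = level_rels P (Sgraphs P m n) (\<lambda>vs. vs)"

definition Sclass ::
    "('k::field, 'a, 'x) sbimod_scheme \<Rightarrow> nat \<Rightarrow> nat \<Rightarrow> 'a vertex list \<Rightarrow>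
     ('a vertex list \<Rightarrow>\<^sub>0 'k) set" where
  "Sclass P m n vs = coset (Srels P m n) (gen vs)"

definition Smod ::
    "('k::field, 'a, 'x) sbimod_scheme \<Rightarrow> nat \<Rightarrow> nat \<Rightarrow> ('k, ('a vertex list \<Rightarrow>\<^sub>0 'k) set) module" where
  "Smod P m n = presented (Sgraphs P m n) (Srels P m n)"

definition Sten :: "('k::field, 'a, 'x) sbimod_scheme \<Rightarrow> ('k, ('a vertex list \<Rightarrow>\<^sub>0 'k) set) sbimod" where
  "Sten P =
     \<lparr>md = Smod P,
      lact = (\<lambda>m n \<sigma>. lift (Smod P m n) (\<lambda>vs. Sclass P m n (map (relabel \<sigma> id) vs))),
      ract = (\<lambda>m n \<tau>. lift (Smod P m n) (\<lambda>vs. Sclass P m n (map (relabel id (inv_into UNIV \<tau>)) vs)))\<rparr>"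

definition Sten_map ::
    "('k::field, 'a, 'x) sbimod_scheme \<Rightarrow> ('k, 'b, 'y) sbimod_scheme \<Rightarrow> ('a, 'b) mor \<Rightarrow>
     (('a vertex list \<Rightarrow>\<^sub>0 'k) set, ('b vertex list \<Rightarrow>\<^sub>0 'k) set) mor" where
  "Sten_map P Q f = (\<lambda>m n.
     restrict (lift (Smod Q m n) (\<lambda>vs. Sclass Q m n (map (vmap f) vs))) (elts (Sten P) m n))"

definition Sincl ::
    "('k::field, 'a, 'x) sbimod_scheme \<Rightarrow> ('a, ('a vertex list \<Rightarrow>\<^sub>0 'k) set) mor" where
  "Sincl P m n p =
     (if m = 0 \<or> n = 0 then \<zero>\<^bsub>Smod P m n\<^esub> else Sclass P m n [Vertex [0..<m] [0..<n] p])"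

definition Sprod ::
    "('k::field, 'a, 'x) sbimod_scheme \<Rightarrow> nat \<Rightarrow> nat \<Rightarrow> nat \<Rightarrow> nat \<Rightarrow>
     ('a vertex list \<Rightarrow>\<^sub>0 'k) set \<Rightarrow> ('a vertex list \<Rightarrow>\<^sub>0 'k) set \<Rightarrow> ('a vertex list \<Rightarrow>\<^sub>0 'k) set" where
  "Sprod P m n m' n' A B =
     lift (Smod P (m + m') (n + n'))
       (\<lambda>us. lift (Smod P (m + m') (n + n'))
         (\<lambda>vs. Sclass P (m + m') (n + n') (us @ map (relabel ((+) m) ((+) n)) vs)) B) A"

text \<open>The unit permutation in \<open>S\<^sub>\<otimes>(I)(n,n) = k[\<S>\<^sub>n]\<close>.\<close>

definition idgraph :: "nat \<Rightarrow> 'k::field vertex list" where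
  "idgraph n = map (\<lambda>i. Vertex [i] [i] 1) [0..<n]"

definition Sone :: "nat \<Rightarrow> ('k::field vertex list \<Rightarrow>\<^sub>0 'k) set" where
  "Sone n = Sclass Ibim n n (idgraph n)"


section \<open>The connected composition product\<close>

text \<open>
  In a two-level graph \<open>(us, vs)\<close> the list \<open>vs\<close> is level 1, which carries the
  global inputs, and \<open>us\<close> is level 2, which carries the global outputs.
\<close>

type_synonym ('b, 'a) graph2 = "'b vertex list \<times> 'a vertex list"

definition Bgraphs ::
    "('k, 'b, 'y) sbimod_scheme \<Rightarrow> ('k, 'a, 'x) sbimod_scheme \<Rightarrow> nat \<Rightarrow> nat \<Rightarrow> ('b, 'a) graph2 set" where
  "Bgraphs Q P m n = {(us, vs).
     (\<exists>E. is_level Q {..<m} E us \<and> is_level P E {..<n} vs) \<and>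
     connected_graph [map shape us, map shape vs]}"

text \<open>The last set of relations identifies graphs differing by the names of internal edges.\<close>

definition Brels ::
    "('k::field, 'b, 'y) sbimod_scheme \<Rightarrow> ('k, 'a, 'x) sbimod_scheme \<Rightarrow> nat \<Rightarrow> nat \<Rightarrow>
     (('b, 'a) graph2 \<Rightarrow>\<^sub>0 'k) set" where
  "Brels Q P m n =
     (\<Union>vs. level_rels Q (Bgraphs Q P m n) (\<lambda>us. (us, vs))) \<union>
     (\<Union>us. level_rels P (Bgraphs Q P m n) (\<lambda>vs. (us, vs))) \<union>
     {gen (us, vs) - gen (map (relabel id f) us, map (relabel f id) vs) |us vs f.
        (us, vs) \<in> Bgraphs Q P m n \<and> inj_on f (set (all_ins us))}"

definition Bclass ::
    "('k::field, 'b, 'y) sbimod_scheme \<Rightarrow> ('k, 'a, 'x) sbimod_scheme \<Rightarrow> nat \<Rightarrow> nat \<Rightarrow>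
     ('b, 'a) graph2 \<Rightarrow> (('b, 'a) graph2 \<Rightarrow>\<^sub>0 'k) set" where
  "Bclass Q P m n g = coset (Brels Q P m n) (gen g)"

definition Bmod ::
    "('k::field, 'b, 'y) sbimod_scheme \<Rightarrow> ('k, 'a, 'x) sbimod_scheme \<Rightarrow> nat \<Rightarrow> nat \<Rightarrow>
     ('k, (('b, 'a) graph2 \<Rightarrow>\<^sub>0 'k) set) module" where
  "Bmod Q P m n = presented (Bgraphs Q P m n) (Brels Q P m n)"

definition Box ::
    "('k::field, 'b, 'y) sbimod_scheme \<Rightarrow> ('k, 'a, 'x) sbimod_scheme \<Rightarrow>
     ('k, (('b, 'a) graph2 \<Rightarrow>\<^sub>0 'k) set) sbimod" where
  "Box Q P =
     \<lparr>md = Bmod Q P,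
      lact = (\<lambda>m n \<sigma>. lift (Bmod Q P m n)
        (\<lambda>(us, vs). Bclass Q P m n (map (relabel \<sigma> id) us, vs))),
      ract = (\<lambda>m n \<tau>. lift (Bmod Q P m n)
        (\<lambda>(us, vs). Bclass Q P m n (us, map (relabel id (inv_into UNIV \<tau>)) vs)))\<rparr>"

text \<open>The morphism \<open>g \<boxtimes>\<^sub>c f\<close>; the bimodules are its targets.\<close>

definition Box_map ::
    "('k::field, 'd, 'y) sbimod_scheme \<Rightarrow> ('k, 'c, 'x) sbimod_scheme \<Rightarrow> ('b, 'd) mor \<Rightarrow> ('a, 'c) mor \<Rightarrow>
     ((('b, 'a) graph2 \<Rightarrow>\<^sub>0 'k) set, (('d, 'c) graph2 \<Rightarrow>\<^sub>0 'k) set) mor" where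
  "Box_map Q P g f = (\<lambda>m n. lift (Bmod Q P m n)
     (\<lambda>(us, vs). Bclass Q P m n (map (vmap g) us, map (vmap f) vs)))"

text \<open>
  Every component of a two-level graph meets both levels, so the components are
  listed by going through the vertices of level 2.
\<close>

definition components :: "('b, 'a) graph2 \<Rightarrow> ('b, 'a) graph2 list" where
  "components = (\<lambda>(us, vs).
     let L = linked [map shape us, map shape vs] in
     remdups (map (\<lambda>u. (filter (\<lambda>u'. ((0, shape u), (0, shape u')) \<in> L) us,
                        filter (\<lambda>v. ((0, shape u), (1, shape v)) \<in> L) vs)) us))"

definition position :: "nat list \<Rightarrow> nat \<Rightarrow> nat" where
  "position es = inv_into {..<length es} ((!) es)"

text \<open>
  Contracting each component of a two-level graph to one vertex, decorated by the
  class of that component in \<open>Q \<boxtimes>\<^sub>c P\<close>.  On generators this is the identification of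
  \<open>Q \<boxtimes> P\<close> with \<open>S\<^sub>\<otimes>(Q \<boxtimes>\<^sub>c P)\<close>.
\<close>

definition contract ::
    "('k::field, 'b, 'y) sbimod_scheme \<Rightarrow> ('k, 'a, 'x) sbimod_scheme \<Rightarrow>
     ('b, 'a) graph2 \<Rightarrow> (('b, 'a) graph2 \<Rightarrow>\<^sub>0 'k) set vertex list" where
  "contract Q P g = map (\<lambda>(us, vs).
     let os = all_outs us; is = all_ins vs in
     Vertex os is (Bclass Q P (length os) (length is)
       (map (relabel (position os) id) us, map (relabel id (position is)) vs))) (components g)"


section \<open>Properads\<close>

record (overloaded) ('k::zero, 'a) properad_data = "('k, 'a) sbimod" +
  mu :: "((('a, 'a) graph2 \<Rightarrow>\<^sub>0 'k) set, 'a) mor"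
  eta :: "('k, 'a) mor"

definition graphs3 ::
    "('k, 'a, 'x) sbimod_scheme \<Rightarrow> nat \<Rightarrow> nat \<Rightarrow> ('a vertex list \<times> 'a vertex list \<times> 'a vertex list) set" where
  "graphs3 P m n = {(us, vs, ws).
     (\<exists>E E'. is_level P {..<m} E us \<and> is_level P E E' vs \<and> is_level P E' {..<n} ws) \<and>
     connected_graph [map shape us, map shape vs, map shape ws]}"

text \<open>
  Monoids for \<open>\<boxtimes>\<^sub>c\<close>.  The graphs in the unit laws are the images of \<open>p\<close> under the inverse
  unitors \<open>P \<rightarrow> I \<boxtimes>\<^sub>c P\<close> and \<open>P \<rightarrow> P \<boxtimes>\<^sub>c I\<close>.  The associator
  \<open>(P \<boxtimes>\<^sub>c P) \<boxtimes>\<^sub>c P \<rightarrow> P \<boxtimes>\<^sub>c (P \<boxtimes>\<^sub>c P)\<close> matches the two ways of grouping the levels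
  of a connected three-level graph.
\<close>

definition is_properad :: "('k::field, 'a) properad_data \<Rightarrow> bool" where
  "is_properad P \<longleftrightarrow>
     sbimodule P \<and>
     sbimod_map (Box P P) P (mu P) \<and>
     sbimod_map Ibim P (eta P) \<and>
     (\<forall>m n. \<forall>p\<in>elts P m n. 0 < m \<and> 0 < n \<longrightarrow>
        mu P m n (Box_map P P (eta P) (\<lambda>_ _ x. x) m n
          (Bclass Ibim P m n (idgraph m, [Vertex [0..<m] [0..<n] p]))) = p) \<and>
     (\<forall>m n. \<forall>p\<in>elts P m n. 0 < m \<and> 0 < n \<longrightarrow>
        mu P m n (Box_map P P (\<lambda>_ _ x. x) (eta P) m n
          (Bclass P Ibim m n ([Vertex [0..<m] [0..<n] p], idgraph n))) = p) \<and>
     (\<forall>m n. \<forall>(us, vs, ws)\<in>graphs3 P m n.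
        mu P m n (Box_map P P (mu P) (\<lambda>_ _ x. x) m n
          (Bclass (Box P P) P m n (contract P P (us, vs), ws))) =
        mu P m n (Box_map P P (\<lambda>_ _ x. x) (mu P) m n
          (Bclass P (Box P P) m n (us, contract P P (vs, ws)))))"

definition Properad_Hom ::
    "('k::field, 'a) properad_data \<Rightarrow> ('k, 'b) properad_data \<Rightarrow> ('a, 'b) mor set" where
  "Properad_Hom P Q = {f. sbimod_map P Q f \<and> extensional_mor P f \<and>
     (\<forall>m n. \<forall>A\<in>elts (Box P P) m n. f m n (mu P m n A) = mu Q m n (Box_map Q Q f f m n A)) \<and>
     (\<forall>m n. \<forall>c\<in>elts Ibim m n. f m n (eta P m n c) = eta Q m n c)}"


section \<open>PROPs\<close>

record (overloaded) ('k::zero, 'a) PROP_data = "('k, 'a) sbimod" +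
  vcomp :: "nat \<Rightarrow> nat \<Rightarrow> nat \<Rightarrow> 'a \<Rightarrow> 'a \<Rightarrow> 'a"
  hcomp :: "nat \<Rightarrow> nat \<Rightarrow> nat \<Rightarrow> nat \<Rightarrow> 'a \<Rightarrow> 'a \<Rightarrow> 'a"
  unit :: "(('k vertex list \<Rightarrow>\<^sub>0 'k) set, 'a) mor"

definition block_sum :: "nat \<Rightarrow> (nat \<Rightarrow> nat) \<Rightarrow> (nat \<Rightarrow> nat) \<Rightarrow> nat \<Rightarrow> nat" where
  "block_sum m \<sigma> \<sigma>' i = (if i < m then \<sigma> i else m + \<sigma>' (i - m))"

definition block_swap :: "nat \<Rightarrow> nat \<Rightarrow> nat \<Rightarrow> nat" where
  "block_swap m m' i = (if i < m then i + m' else if i < m + m' then i - m else i)"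

text \<open>
  A map out of \<open>P(m,N) \<otimes>\<^bsub>\<S>\<^sub>N\<^esub> P(N,n)\<close> is a bilinear map balanced over \<open>\<S>\<^sub>N\<close>.  A bimodule map
  out of the concatenation product \<open>P \<otimes> P\<close>, whose summands are induced from block
  permutations, is a family of bilinear maps equivariant under block permutations; the
  symmetry of \<open>\<otimes>\<close> acts by block transpositions.  The unit \<open>S\<^sub>\<otimes>(I) \<rightarrow> P\<close> is a
  morphism of algebras for the horizontal composition.
\<close>

definition is_PROP :: "('k::field, 'a) PROP_data \<Rightarrow> bool" where
  "is_PROP P \<longleftrightarrow>
     sbimodule P \<and>
     \<comment> \<open>vertical composition\<close>
     (\<forall>m N n. bilinear_map (md P m N) (md P N n) (md P m n) (vcomp P m N n)) \<and>
     (\<forall>m N n. \<forall>x\<in>elts P m N. \<forall>y\<in>elts P N n. \<forall>\<sigma>. \<sigma> permutes {..<m} \<longrightarrow>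
        vcomp P m N n (lact P m N \<sigma> x) y = lact P m n \<sigma> (vcomp P m N n x y)) \<and>
     (\<forall>m N n. \<forall>x\<in>elts P m N. \<forall>y\<in>elts P N n. \<forall>\<tau>. \<tau> permutes {..<n} \<longrightarrow>
        vcomp P m N n x (ract P N n \<tau> y) = ract P m n \<tau> (vcomp P m N n x y)) \<and>
     (\<forall>m N n. \<forall>x\<in>elts P m N. \<forall>y\<in>elts P N n. \<forall>\<rho>. \<rho> permutes {..<N} \<longrightarrow>
        vcomp P m N n (ract P m N \<rho> x) y = vcomp P m N n x (lact P N n \<rho> y)) \<and>
     (\<forall>m M N n. \<forall>x\<in>elts P m M. \<forall>y\<in>elts P M N. \<forall>z\<in>elts P N n.
        vcomp P m N n (vcomp P m M N x y) z = vcomp P m M n x (vcomp P M N n y z)) \<and>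
     \<comment> \<open>horizontal composition\<close>
     (\<forall>m n m' n'. bilinear_map (md P m n) (md P m' n') (md P (m + m') (n + n'))
        (hcomp P m n m' n')) \<and>
     (\<forall>m n m' n'. \<forall>x\<in>elts P m n. \<forall>y\<in>elts P m' n'. \<forall>\<sigma> \<sigma>'.
        \<sigma> permutes {..<m} \<and> \<sigma>' permutes {..<m'} \<longrightarrow>
        hcomp P m n m' n' (lact P m n \<sigma> x) (lact P m' n' \<sigma>' y) =
        lact P (m + m') (n + n') (block_sum m \<sigma> \<sigma>') (hcomp P m n m' n' x y)) \<and>
     (\<forall>m n m' n'. \<forall>x\<in>elts P m n. \<forall>y\<in>elts P m' n'. \<forall>\<tau> \<tau>'.
        \<tau> permutes {..<n} \<and> \<tau>' permutes {..<n'} \<longrightarrow>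
        hcomp P m n m' n' (ract P m n \<tau> x) (ract P m' n' \<tau>' y) =
        ract P (m + m') (n + n') (block_sum n \<tau> \<tau>') (hcomp P m n m' n' x y)) \<and>
     (\<forall>m n m' n' m'' n''. \<forall>x\<in>elts P m n. \<forall>y\<in>elts P m' n'. \<forall>z\<in>elts P m'' n''.
        hcomp P (m + m') (n + n') m'' n'' (hcomp P m n m' n' x y) z =
        hcomp P m n (m' + m'') (n' + n'') x (hcomp P m' n' m'' n'' y z)) \<and>
     (\<forall>m n m' n'. \<forall>x\<in>elts P m n. \<forall>y\<in>elts P m' n'.
        hcomp P m' n' m n y x =
        lact P (m + m') (n + n') (block_swap m m')
          (ract P (m + m') (n + n') (block_swap n' n) (hcomp P m n m' n' x y))) \<and>
     \<comment> \<open>interchange law\<close>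
     (\<forall>m N n m' N' n'. \<forall>x\<in>elts P m N. \<forall>y\<in>elts P N n. \<forall>x'\<in>elts P m' N'. \<forall>y'\<in>elts P N' n'.
        vcomp P (m + m') (N + N') (n + n') (hcomp P m N m' N' x x') (hcomp P N n N' n' y y') =
        hcomp P m n m' n' (vcomp P m N n x y) (vcomp P m' N' n' x' y')) \<and>
     \<comment> \<open>unit\<close>
     sbimod_map (Sten Ibim) P (unit P) \<and>
     (\<forall>m n. \<forall>x\<in>elts P m n. 0 < m \<and> 0 < n \<longrightarrow>
        vcomp P m m n (unit P m m (Sone m)) x = x \<and>
        vcomp P m n n x (unit P n n (Sone n)) = x) \<and>
     (\<forall>m n m' n'. \<forall>A\<in>elts (Sten Ibim) m n. \<forall>B\<in>elts (Sten Ibim) m' n'.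
        unit P (m + m') (n + n') (Sprod Ibim m n m' n' A B) =
        hcomp P m n m' n' (unit P m n A) (unit P m' n' B))"

definition PROP_Hom ::
    "('k::field, 'a) PROP_data \<Rightarrow> ('k, 'b) PROP_data \<Rightarrow> ('a, 'b) mor set" where
  "PROP_Hom P Q = {f. sbimod_map P Q f \<and> extensional_mor P f \<and>
     (\<forall>m N n. \<forall>x\<in>elts P m N. \<forall>y\<in>elts P N n.
        f m n (vcomp P m N n x y) = vcomp Q m N n (f m N x) (f N n y)) \<and>
     (\<forall>m n m' n'. \<forall>x\<in>elts P m n. \<forall>y\<in>elts P m' n'.
        f (m + m') (n + n') (hcomp P m n m' n' x y) = hcomp Q m n m' n' (f m n x) (f m' n' y)) \<and>
     (\<forall>m n. \<forall>A\<in>elts (Sten Ibim) m n. f m n (unit P m n A) = unit Q m n A)}"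


section \<open>The forgetful functor\<close>

fun hcomp_list :: "('k::field, 'a) PROP_data \<Rightarrow> 'a vertex list \<Rightarrow> 'a" where
  "hcomp_list P [] = undefined"
| "hcomp_list P [v] = deco v"
| "hcomp_list P (v # w # ws) =
     hcomp P (length (outs v)) (length (ins v))
       (length (all_outs (w # ws))) (length (all_ins (w # ws))) (deco v) (hcomp_list P (w # ws))"

definition list_perm :: "nat list \<Rightarrow> nat \<Rightarrow> nat" where
  "list_perm es i = (if i < length es then es ! i else i)"

text \<open>
  The value of a one-level graph: the horizontal composite of its vertices, with the slots
  permuted into the order of the global labels.
\<close>

definition eval_level :: "('k::field, 'a) PROP_data \<Rightarrow> nat \<Rightarrow> nat \<Rightarrow> 'a vertex list \<Rightarrow> 'a" where
  "eval_level P m n vs =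
     lact P m n (list_perm (all_outs vs)) (ract P m n (inv_into UNIV (list_perm (all_ins vs))) (hcomp_list P vs))"

text \<open>
  The vertical composite of the two levels.  Internal edges are numbered by the order in which
  they occur at level 2; by balancedness any other numbering yields the same result.
\<close>

definition eval_graph :: "('k::field, 'a) PROP_data \<Rightarrow> nat \<Rightarrow> nat \<Rightarrow> ('a, 'a) graph2 \<Rightarrow> 'a" where
  "eval_graph P m n = (\<lambda>(us, vs). let es = all_ins us in
     vcomp P m (length es) n
       (eval_level P m (length es) (map (relabel id (position es)) us))
       (eval_level P (length es) n (map (relabel (position es) id) vs)))"

definition Uc :: "('k::field, 'a) PROP_data \<Rightarrow> ('k, 'a) properad_data" where
  "Uc P = \<lparr>md = md P, lact = lact P, ract = ract P,
     mu = (\<lambda>m n. lift (md P m n) (eval_graph P m n)),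
     eta = (\<lambda>m n c. unit P m n (Sincl Ibim m n c))\<rparr>"

definition Uc_map :: "('a, 'b) mor \<Rightarrow> ('a, 'b) mor" where
  "Uc_map f = f"


section \<open>The free PROP on a properad\<close>

text \<open>
  The vertical composition joins two one-level graphs to a two-level graph, contracts its
  components, which yields an element of \<open>S\<^sub>\<otimes>(P \<boxtimes>\<^sub>c P)\<close>, and applies \<open>S\<^sub>\<otimes>(\<mu>)\<close>.
\<close>

definition SPROP :: "('k::field, 'a) properad_data \<Rightarrow> ('k, ('a vertex list \<Rightarrow>\<^sub>0 'k) set) PROP_data" where
  "SPROP P = \<lparr>md = md (Sten P), lact = lact (Sten P), ract = ract (Sten P),
     vcomp = (\<lambda>m N n A B. Sten_map (Box P P) P (mu P) m n
       (lift (Smod (Box P P) m n)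
         (\<lambda>us. lift (Smod (Box P P) m n)
           (\<lambda>vs. Sclass (Box P P) m n (contract P P (us, vs))) B) A)),
     hcomp = Sprod P,
     unit = Sten_map Ibim P (eta P)\<rparr>"

text \<open>Restriction along the unit \<open>P \<rightarrow> U\<^sub>c(S\<^sub>\<otimes>(P))\<close> of the adjunction.\<close>

definition adj ::
    "('k::field, 'a) properad_data \<Rightarrow> (('a vertex list \<Rightarrow>\<^sub>0 'k) set, 'b) mor \<Rightarrow> ('a, 'b) mor" where
  "adj P h = comp_mor P (Uc_map h) (Sincl P)"

end

theory Submission
  imports Defs
begin

text \<open>
  A one-level graph with vertices \<open>v\<^sub>1, \<dots>, v\<^sub>r\<close> is, up to renaming its global edges, the horizontal
  product of its vertices, and a vertex is an element of \<open>P\<close>.  A morphism of PROPs out of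
  \<open>S\<^sub>\<otimes>(P)\<close> is therefore determined by its restriction to \<open>P\<close>, and the only possible extension of a
  morphism \<open>f : P \<rightarrow> U\<^sub>c(Q)\<close> sends a graph to the horizontal composite in \<open>Q\<close> of the images of its
  vertices, with the inputs and outputs permuted as the graph prescribes.  What has to be shown is
  that this extension respects vertical composition.

  The vertical composite of two one-level graphs in \<open>S\<^sub>\<otimes>(P)\<close> is obtained by splitting the two-level
  graph formed by them into connected components and composing every component in \<open>P\<close>.  The
  interchange law of \<open>Q\<close> says that composing the two levels of a graph in \<open>Q\<close> amounts to the same:
  compose each component and multiply the results horizontally (\<open>ev_decomp\<close>).  On a
  component, composition in \<open>Q\<close> is by definition composition in \<open>U\<^sub>c(Q)\<close>, and \<open>f\<close> respects that.
  The same lemma yields the associativity of \<open>U\<^sub>c(Q)\<close>: both ways of contracting a connected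
  three-level graph evaluate to the composite of three levels in \<open>Q\<close>.

  That \<open>S\<^sub>\<otimes>(P)\<close> is a PROP comes down to facts on components.  A decomposition of a two-level graph
  into connected pieces is unique (\<open>decomp_unique\<close>), so the components may be
  replaced by any other decomposition: the juxtaposition of two decompositions proves the
  interchange law, the pieces made of one vertex and the strands attached to it prove the unit laws.  For
  associativity, a three-level graph is connected if and only if the graph obtained by contracting the
  components of its upper two levels is connected (\<open>conn3_contract\<close>).  Hence the components of the graph obtained by composing the upper two
  levels first correspond to connected three-level graphs, to which the associativity of \<open>P\<close> applies
  (\<open>SPROP_vcomp_assoc_graphs\<close>).

  All modules are spanned by graphs modulo relations, so maps are defined and compared on graphs.
  Two devices keep this manageable.  The actions of the symmetric groups are expressed by lists of edge names, one
  list for the slots before the action and one for the slots after it (\<open>recoord\<close>); a function on graphs then respects the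
  relations if it ignores the order of vertices, ignores the listing of the slots of a vertex, and is linear in
  a vertex (\<open>level_compatibleI\<close>).  And levels are evaluated in \<open>Q\<close> for arbitrary listings of their
  outputs and inputs (\<open>ev\<close>), so that block permutations occur only where the axioms mention them.
\<close>

section \<open>Linear maps out of presented modules\<close>

abbreviation kmod :: "('k::field, 'a) module \<Rightarrow> bool" where
  "kmod M \<equiv> Module.module scalars M"

lemma scalars_simps [simp]:
  "carrier (scalars :: 'k::field ring) = UNIV" "x \<otimes>\<^bsub>scalars\<^esub> y = x * (y::'k)" "\<one>\<^bsub>scalars\<^esub> = (1::'k)"
  "\<zero>\<^bsub>scalars\<^esub> = (0::'k)" "x \<oplus>\<^bsub>scalars\<^esub> y = x + (y::'k)"
  by (simp_all add: ring_of_type_algebra_def)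

lemma kmodI:
  assumes "abelian_group M" "\<And>c x. x \<in> carrier M \<Longrightarrow> c \<odot>\<^bsub>M\<^esub> x \<in> carrier M"
    "\<And>c d x. x \<in> carrier M \<Longrightarrow> (c + d) \<odot>\<^bsub>M\<^esub> x = c \<odot>\<^bsub>M\<^esub> x \<oplus>\<^bsub>M\<^esub> d \<odot>\<^bsub>M\<^esub> x"
    "\<And>c x y. x \<in> carrier M \<Longrightarrow> y \<in> carrier M \<Longrightarrow> c \<odot>\<^bsub>M\<^esub> (x \<oplus>\<^bsub>M\<^esub> y) = c \<odot>\<^bsub>M\<^esub> x \<oplus>\<^bsub>M\<^esub> c \<odot>\<^bsub>M\<^esub> y"
    "\<And>c d x. x \<in> carrier M \<Longrightarrow> (c * d) \<odot>\<^bsub>M\<^esub> x = c \<odot>\<^bsub>M\<^esub> (d \<odot>\<^bsub>M\<^esub> x)"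
    "\<And>x. x \<in> carrier M \<Longrightarrow> 1 \<odot>\<^bsub>M\<^esub> x = x"
  shows "kmod (M :: ('k::field, 'a) module)"
  by (rule moduleI) (use assms in \<open>auto intro: cring_from_type_algebra\<close>)

lemma kmod_facts:
  assumes "kmod (M :: ('k::field, 'a) module)"
  shows "abelian_group M" "abelian_monoid M" "\<zero>\<^bsub>M\<^esub> \<in> carrier M"
    "\<And>x y. x \<in> carrier M \<Longrightarrow> y \<in> carrier M \<Longrightarrow> x \<oplus>\<^bsub>M\<^esub> y \<in> carrier M"
    "\<And>c x. x \<in> carrier M \<Longrightarrow> c \<odot>\<^bsub>M\<^esub> x \<in> carrier M"
    "\<And>c d x. x \<in> carrier M \<Longrightarrow> (c + d) \<odot>\<^bsub>M\<^esub> x = c \<odot>\<^bsub>M\<^esub> x \<oplus>\<^bsub>M\<^esub> d \<odot>\<^bsub>M\<^esub> x"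
    "\<And>c x y. x \<in> carrier M \<Longrightarrow> y \<in> carrier M \<Longrightarrow> c \<odot>\<^bsub>M\<^esub> (x \<oplus>\<^bsub>M\<^esub> y) = c \<odot>\<^bsub>M\<^esub> x \<oplus>\<^bsub>M\<^esub> c \<odot>\<^bsub>M\<^esub> y"
    "\<And>c d x. x \<in> carrier M \<Longrightarrow> (c * d) \<odot>\<^bsub>M\<^esub> x = c \<odot>\<^bsub>M\<^esub> (d \<odot>\<^bsub>M\<^esub> x)"
    "\<And>x. x \<in> carrier M \<Longrightarrow> 1 \<odot>\<^bsub>M\<^esub> x = x" "\<And>x. x \<in> carrier M \<Longrightarrow> 0 \<odot>\<^bsub>M\<^esub> x = \<zero>\<^bsub>M\<^esub>"
    "\<And>c. c \<odot>\<^bsub>M\<^esub> \<zero>\<^bsub>M\<^esub> = \<zero>\<^bsub>M\<^esub>"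
    "\<And>x. x \<in> carrier M \<Longrightarrow> \<zero>\<^bsub>M\<^esub> \<oplus>\<^bsub>M\<^esub> x = x" "\<And>x. x \<in> carrier M \<Longrightarrow> x \<oplus>\<^bsub>M\<^esub> \<zero>\<^bsub>M\<^esub> = x"
proof -
  interpret Module.module scalars M by fact
  show "abelian_group M" "abelian_monoid M" by unfold_locales
  show "0 \<odot>\<^bsub>M\<^esub> x = \<zero>\<^bsub>M\<^esub>" if "x \<in> carrier M" for x
    using smult_l_null[OF that] by simp
  show "c \<odot>\<^bsub>M\<^esub> \<zero>\<^bsub>M\<^esub> = \<zero>\<^bsub>M\<^esub>" for c
    using smult_r_null[of c] by simp
  show "\<And>c d x. x \<in> carrier M \<Longrightarrow> (c + d) \<odot>\<^bsub>M\<^esub> x = c \<odot>\<^bsub>M\<^esub> x \<oplus>\<^bsub>M\<^esub> d \<odot>\<^bsub>M\<^esub> x"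
    using smult_l_distr by simp
  show "\<And>c d x. x \<in> carrier M \<Longrightarrow> (c * d) \<odot>\<^bsub>M\<^esub> x = c \<odot>\<^bsub>M\<^esub> (d \<odot>\<^bsub>M\<^esub> x)"
    using smult_assoc1 by simp
  show "1 \<odot>\<^bsub>M\<^esub> x = x" if "x \<in> carrier M" for x
    using smult_one[OF that] by simp
qed (use assms in \<open>auto simp: Module.module_def Module.module_axioms_def abelian_group_def
      intro: abelian_monoid.zero_closed abelian_monoid.a_closed
      abelian_monoid.l_zero abelian_monoid.r_zero\<close>)

lemma linear_mapI:
  assumes "\<And>x. x \<in> carrier M \<Longrightarrow> f x \<in> carrier N"
    "\<And>x y. x \<in> carrier M \<Longrightarrow> y \<in> carrier M \<Longrightarrow> f (x \<oplus>\<^bsub>M\<^esub> y) = f x \<oplus>\<^bsub>N\<^esub> f y"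
    "\<And>c x. x \<in> carrier M \<Longrightarrow> f (c \<odot>\<^bsub>M\<^esub> x) = c \<odot>\<^bsub>N\<^esub> f x"
  shows "linear_map M N f"
  using assms by (auto simp: linear_map_def)

lemma linear_mapD:
  assumes "linear_map M N f"
  shows "\<And>x. x \<in> carrier M \<Longrightarrow> f x \<in> carrier N"
    "\<And>x y. x \<in> carrier M \<Longrightarrow> y \<in> carrier M \<Longrightarrow> f (x \<oplus>\<^bsub>M\<^esub> y) = f x \<oplus>\<^bsub>N\<^esub> f y"
    "\<And>c x. x \<in> carrier M \<Longrightarrow> f (c \<odot>\<^bsub>M\<^esub> x) = c \<odot>\<^bsub>N\<^esub> f x"
  using assms by (auto simp: linear_map_def)

lemma linear_map_comp:
  "linear_map L M f \<Longrightarrow> linear_map M N g \<Longrightarrow> linear_map L N (\<lambda>x. g (f x))"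
  by (rule linear_mapI) (simp_all add: linear_mapD)

lemma linear_map_id: "linear_map M M (\<lambda>x. x)"
  by (auto simp: linear_map_def)

lemma linear_map_cong:
  assumes "linear_map M N f" "\<And>x. x \<in> carrier M \<Longrightarrow> f x = g x" "kmod M"
  shows "linear_map M N g"
  using assms(1) kmod_facts(4,5)[OF assms(3)]
  by (intro linear_mapI) (simp_all flip: assms(2) add: linear_mapD)

lemma linear_map_zero:
  assumes "linear_map M N f" "kmod M" "kmod N" shows "f \<zero>\<^bsub>M\<^esub> = \<zero>\<^bsub>N\<^esub>"
proof -
  have "f (0 \<odot>\<^bsub>M\<^esub> \<zero>\<^bsub>M\<^esub>) = 0 \<odot>\<^bsub>N\<^esub> f \<zero>\<^bsub>M\<^esub>"
    using linear_mapD[OF assms(1)] kmod_facts[OF assms(2)] by blast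
  thus ?thesis
    using linear_mapD[OF assms(1)] kmod_facts[OF assms(2)] kmod_facts[OF assms(3)] by auto
qed

lemma bilinear_mapD:
  assumes "bilinear_map L M N f"
  shows "x \<in> carrier L \<Longrightarrow> linear_map M N (f x)" "y \<in> carrier M \<Longrightarrow> linear_map L N (\<lambda>x. f x y)"
    "x \<in> carrier L \<Longrightarrow> y \<in> carrier M \<Longrightarrow> f x y \<in> carrier N"
  using assms by (auto simp: bilinear_map_def dest: linear_mapD)

lemma lookup_pscale [simp]: "Poly_Mapping.lookup (pscale c x) g = c * Poly_Mapping.lookup x g"
  by (simp add: pscale_def Poly_Mapping.map.rep_eq when_def)

interpretation pm: Modules.module "pscale :: 'k::field \<Rightarrow> ('g \<Rightarrow>\<^sub>0 'k) \<Rightarrow> _"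
  by unfold_locales (auto intro!: poly_mapping_eqI simp: lookup_add algebra_simps)

lemma keys_pscale: "Poly_Mapping.keys (pscale c x) \<subseteq> Poly_Mapping.keys x"
  by (auto simp: in_keys_iff)

lemma keys_gen [simp]: "Poly_Mapping.keys (gen g :: _ \<Rightarrow>\<^sub>0 'k::field) = {g}"
  by (simp add: gen_def)

text \<open>
  The linear combination that \<open>lift\<close> forms for its representative.  Separating it from the choice of
  the representative makes additivity a statement about finitely supported functions.
\<close>

definition lin :: "('k::field, 'b) module \<Rightarrow> ('g \<Rightarrow> 'b) \<Rightarrow> ('g \<Rightarrow>\<^sub>0 'k) \<Rightarrow> 'b" where
  "lin M \<phi> x = (\<Oplus>\<^bsub>M\<^esub>g\<in>Poly_Mapping.keys x. Poly_Mapping.lookup x g \<odot>\<^bsub>M\<^esub> \<phi> g)"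

lemma lift_lin: "lift M \<phi> A = lin M \<phi> (SOME x. x \<in> A)"
  by (simp add: lift_def lin_def Let_def)

context
  fixes M :: "('k::field, 'b) module" and G :: "'g set" and \<phi>
  assumes M: "kmod M" and \<phi>: "\<And>g. g \<in> G \<Longrightarrow> \<phi> g \<in> carrier M"
begin

interpretation M: Module.module scalars M by (fact M)

text \<open>
  Different combinations have different supports; over a common finite set the sums can be added termwise.
\<close>

lemma lin_superset:
  assumes "finite A" "Poly_Mapping.keys x \<subseteq> A" "A \<subseteq> G"
  shows "lin M \<phi> x = (\<Oplus>\<^bsub>M\<^esub>g\<in>A. Poly_Mapping.lookup x g \<odot>\<^bsub>M\<^esub> \<phi> g)"
  unfolding lin_def using assms \<phi>
  by (intro M.add.finprod_mono_neutral_cong_left)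
     (auto simp: in_keys_iff kmod_facts(10)[OF M] intro!: kmod_facts(5)[OF M])

lemma lin_closed: "Poly_Mapping.keys x \<subseteq> G \<Longrightarrow> lin M \<phi> x \<in> carrier M"
  unfolding lin_def using \<phi> by (intro M.finsum_closed) (auto intro: kmod_facts(5)[OF M])

lemma lin_add:
  assumes "Poly_Mapping.keys x \<subseteq> G" "Poly_Mapping.keys y \<subseteq> G"
  shows "lin M \<phi> (x + y) = lin M \<phi> x \<oplus>\<^bsub>M\<^esub> lin M \<phi> y"
proof -
  let ?A = "Poly_Mapping.keys x \<union> Poly_Mapping.keys y"
  let ?t = "\<lambda>x g. Poly_Mapping.lookup x g \<odot>\<^bsub>M\<^esub> \<phi> g"
  have A: "finite ?A" "?A \<subseteq> G" using assms by auto
  have c: "?t x \<in> ?A \<rightarrow> carrier M" for x using A \<phi> kmod_facts(5)[OF M] by auto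
  have "lin M \<phi> (x + y) = (\<Oplus>\<^bsub>M\<^esub>g\<in>?A. ?t (x + y) g)"
    using A keys_add[of x y] by (intro lin_superset) auto
  also have "\<dots> = (\<Oplus>\<^bsub>M\<^esub>g\<in>?A. ?t x g \<oplus>\<^bsub>M\<^esub> ?t y g)"
  proof (rule M.finsum_cong')
    show "(\<lambda>g. ?t x g \<oplus>\<^bsub>M\<^esub> ?t y g) \<in> ?A \<rightarrow> carrier M"
      using c[of x] c[of y] kmod_facts(4)[OF M] by auto
    fix g assume "g \<in> ?A"
    hence "\<phi> g \<in> carrier M" using A \<phi> by blast
    thus "?t (x + y) g = ?t x g \<oplus>\<^bsub>M\<^esub> ?t y g" by (simp add: lookup_add kmod_facts(6)[OF M])
  qed simp
  also have "\<dots> = (\<Oplus>\<^bsub>M\<^esub>g\<in>?A. ?t x g) \<oplus>\<^bsub>M\<^esub> (\<Oplus>\<^bsub>M\<^esub>g\<in>?A. ?t y g)"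
    using c by (intro M.finsum_addf)
  also have "(\<Oplus>\<^bsub>M\<^esub>g\<in>?A. ?t x g) = lin M \<phi> x" using A by (intro lin_superset[symmetric]) auto
  also have "(\<Oplus>\<^bsub>M\<^esub>g\<in>?A. ?t y g) = lin M \<phi> y" using A by (intro lin_superset[symmetric]) auto
  finally show ?thesis .
qed

lemma lin_scale:
  assumes "Poly_Mapping.keys x \<subseteq> G"
  shows "lin M \<phi> (pscale c x) = c \<odot>\<^bsub>M\<^esub> lin M \<phi> x"
proof -
  have "lin M \<phi> (pscale c x) = (\<Oplus>\<^bsub>M\<^esub>g\<in>Poly_Mapping.keys x. c \<odot>\<^bsub>M\<^esub> (Poly_Mapping.lookup x g \<odot>\<^bsub>M\<^esub> \<phi> g))"
    using assms \<phi> keys_pscale[of c x] kmod_facts(5,8)[OF M]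
    by (auto simp: lin_superset[of "Poly_Mapping.keys x"] subset_iff intro!: M.finsum_cong')
  also have "\<dots> = c \<odot>\<^bsub>M\<^esub> lin M \<phi> x"
    unfolding lin_def using assms \<phi> kmod_facts(5)[OF M]
    by (intro M.finsum_smult_ldistr[symmetric]) auto
  finally show ?thesis .
qed

lemma lin_gen: "g \<in> G \<Longrightarrow> lin M \<phi> (gen g) = \<phi> g"
  using \<phi> by (simp add: lin_def gen_def kmod_facts[OF M] M.finsum_insert)

lemma lin_diff_eq_zero:
  assumes "Poly_Mapping.keys x \<subseteq> G" "Poly_Mapping.keys y \<subseteq> G" "lin M \<phi> x = lin M \<phi> y"
  shows "lin M \<phi> (x - y) = \<zero>\<^bsub>M\<^esub>"
proof -
  have k: "Poly_Mapping.keys (x - y) \<subseteq> G" using keys_diff[of x y] assms by auto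
  have "lin M \<phi> (x - y) \<oplus>\<^bsub>M\<^esub> lin M \<phi> y = \<zero>\<^bsub>M\<^esub> \<oplus>\<^bsub>M\<^esub> lin M \<phi> y"
    using lin_add[OF k assms(2)] assms lin_closed by simp
  thus ?thesis using lin_closed[OF k] lin_closed[OF assms(2)] by (simp add: M.add.r_cancel)
qed

end

text \<open>
  The relations involve generators only.  Then all representatives of a class of \<open>presented G R\<close>
  are supported in \<open>G\<close>, and the one chosen by \<open>lift\<close> lies where the prescribed values make sense.
\<close>

definition presentation :: "'g set \<Rightarrow> ('g \<Rightarrow>\<^sub>0 'k::field) set \<Rightarrow> bool" where
  "presentation G R \<longleftrightarrow> (\<forall>r\<in>R. Poly_Mapping.keys r \<subseteq> G)"

definition compatible :: "('k::field, 'b) module \<Rightarrow> 'g set \<Rightarrow> ('g \<Rightarrow>\<^sub>0 'k) set \<Rightarrow> ('g \<Rightarrow> 'b) \<Rightarrow> bool" where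
  "compatible M G R \<phi> \<longleftrightarrow> (\<forall>g\<in>G. \<phi> g \<in> carrier M) \<and> (\<forall>r\<in>R. lin M \<phi> r = \<zero>\<^bsub>M\<^esub>)"

lemma coset_eq_iff: "coset R x = coset R y \<longleftrightarrow> x - y \<in> pm.span R"
proof
  assume "coset R x = coset R y"
  moreover have "x \<in> coset R x" by (simp add: coset_def pm.span_zero)
  ultimately show "x - y \<in> pm.span R" by (auto simp: coset_def)
next
  assume *: "x - y \<in> pm.span R"
  have "z - x \<in> pm.span R \<longleftrightarrow> z - y \<in> pm.span R" for z
    using pm.span_add[OF _ *, of "z - x"] pm.span_diff[OF _ *, of "z - y"] by auto
  thus "coset R x = coset R y" by (simp add: coset_def)
qed

lemma coset_self: "x \<in> coset R x"
  by (simp add: coset_def pm.span_zero)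

lemma span_keys:
  assumes "presentation G R" "x \<in> pm.span R" shows "Poly_Mapping.keys x \<subseteq> G"
  using assms(2)
proof (induction rule: pm.span_induct_alt)
  case (step c x y)
  have "Poly_Mapping.keys x \<subseteq> G" using step assms(1) by (auto simp: presentation_def)
  thus ?case using step keys_pscale[of c x] keys_add[of "pscale c x" y] by blast
qed simp

lemma presented_simps:
  "\<zero>\<^bsub>presented G R\<^esub> = coset R 0"
  "coset R x \<oplus>\<^bsub>presented G R\<^esub> coset R y = coset R (x + y)"
  "c \<odot>\<^bsub>presented G R\<^esub> coset R x = coset R (pscale c x)"
  "A \<in> carrier (presented G R) \<longleftrightarrow> (\<exists>x. A = coset R x \<and> Poly_Mapping.keys x \<subseteq> G)"
proof -
  have "coset R (x' + y') = coset R (x + y)" if "x' \<in> coset R x" "y' \<in> coset R y" for x' y'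
  proof -
    have "(x' + y') - (x + y) = (x' - x) + (y' - y)" by simp
    thus ?thesis using that unfolding coset_eq_iff by (metis coset_def mem_Collect_eq pm.span_add)
  qed
  hence "(\<Union>x'\<in>coset R x. \<Union>y'\<in>coset R y. coset R (x' + y')) = coset R (x + y)"
    using coset_self by blast
  thus "coset R x \<oplus>\<^bsub>presented G R\<^esub> coset R y = coset R (x + y)"
    by (simp add: presented_def)
  have "coset R (pscale c x') = coset R (pscale c x)" if "x' \<in> coset R x" for x'
    using that unfolding coset_eq_iff
    by (metis coset_def mem_Collect_eq pm.span_scale pm.scale_right_diff_distrib)
  hence "(\<Union>x'\<in>coset R x. coset R (pscale c x')) = coset R (pscale c x)"
    using coset_self by blast
  thus "c \<odot>\<^bsub>presented G R\<^esub> coset R x = coset R (pscale c x)"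
    by (simp add: presented_def)
qed (auto simp: presented_def)

lemma presented_module: "kmod (presented G R)"
proof (rule kmodI)
  have k: "Poly_Mapping.keys x \<subseteq> G \<Longrightarrow> Poly_Mapping.keys y \<subseteq> G \<Longrightarrow> Poly_Mapping.keys (x + y) \<subseteq> G" for x y :: "_ \<Rightarrow>\<^sub>0 'a"
    using keys_add[of x y] by auto
  show "abelian_group (presented G R)"
  proof (rule abelian_groupI)
    fix A assume "A \<in> carrier (presented G R)"
    then obtain x where x: "A = coset R x" "Poly_Mapping.keys x \<subseteq> G" by (auto simp: presented_simps)
    thus "\<exists>B\<in>carrier (presented G R). B \<oplus>\<^bsub>presented G R\<^esub> A = \<zero>\<^bsub>presented G R\<^esub>"
      by (intro bexI[of _ "coset R (- x)"]) (auto simp: presented_simps intro!: exI[of _ "- x"])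
  next
    fix A B assume "A \<in> carrier (presented G R)" "B \<in> carrier (presented G R)"
    then obtain x y where "A = coset R x" "Poly_Mapping.keys x \<subseteq> G" "B = coset R y" "Poly_Mapping.keys y \<subseteq> G"
      by (auto simp: presented_simps)
    thus "A \<oplus>\<^bsub>presented G R\<^esub> B \<in> carrier (presented G R)"
      using k[of x y] by (auto simp: presented_simps)
  qed (auto simp: presented_simps algebra_simps intro: exI[of _ 0])
  show "c \<odot>\<^bsub>presented G R\<^esub> A \<in> carrier (presented G R)" if "A \<in> carrier (presented G R)" for c A
    using that keys_pscale by (fastforce simp: presented_simps)
qed (auto simp: presented_simps pm.scale_left_distrib pm.scale_right_distrib)

lemma compatible_span:
  assumes "kmod M" "presentation G R" "compatible M G R \<phi>" "x \<in> pm.span R"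
  shows "lin M \<phi> x = \<zero>\<^bsub>M\<^esub> \<and> Poly_Mapping.keys x \<subseteq> G"
  using assms(4)
proof (induction rule: pm.span_induct_alt)
  case base thus ?case by (simp add: lin_def abelian_monoid.finsum_empty[OF kmod_facts(2)[OF assms(1)]])
next
  case (step c x y)
  have \<phi>: "\<And>g. g \<in> G \<Longrightarrow> \<phi> g \<in> carrier M" using assms(3) by (simp add: compatible_def)
  have kx: "Poly_Mapping.keys x \<subseteq> G" using step assms(2) by (auto simp: presentation_def)
  have kc: "Poly_Mapping.keys (pscale c x) \<subseteq> G" using keys_pscale[of c x] kx by auto
  have ky: "Poly_Mapping.keys y \<subseteq> G" "lin M \<phi> y = \<zero>\<^bsub>M\<^esub>" using step(2) by auto
  hence "lin M \<phi> (pscale c x + y) = c \<odot>\<^bsub>M\<^esub> lin M \<phi> x \<oplus>\<^bsub>M\<^esub> lin M \<phi> y"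
    using lin_add[OF assms(1) \<phi> kc ky(1)] lin_scale[OF assms(1) \<phi> kx] by simp
  thus ?case
    using step(1) assms(3) kmod_facts(3,11,12)[OF assms(1)] ky
      subset_trans[OF keys_add[of "pscale c x" y] Un_least[OF kc ky(1)]]
    by (simp add: compatible_def)
qed

lemma compatible_span_zero:
  assumes "kmod M" "presentation G R" "compatible M G R \<phi>" "x \<in> pm.span R"
  shows "lin M \<phi> x = \<zero>\<^bsub>M\<^esub>"
  using compatible_span[OF assms] by simp

text \<open>
  Two representatives differ by an element of the span of the relations, on which a compatible
  assignment vanishes.
\<close>

lemma lift_coset:
  assumes "kmod M" "presentation G R" "compatible M G R \<phi>" "Poly_Mapping.keys x \<subseteq> G"
  shows "lift M \<phi> (coset R x) = lin M \<phi> x"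
proof -
  define y where "y = (SOME y. y \<in> coset R x)"
  have y: "y - x \<in> pm.span R"
    using someI[of "\<lambda>y. y \<in> coset R x", OF coset_self] by (simp add: y_def coset_def)
  have "lin M \<phi> ((y - x) + x) = lin M \<phi> (y - x) \<oplus>\<^bsub>M\<^esub> lin M \<phi> x"
    using assms span_keys[OF assms(2) y] by (intro lin_add[of M G]) (auto simp: compatible_def)
  also have "\<dots> = lin M \<phi> x"
    using compatible_span_zero[OF assms(1-3) y] assms lin_closed[of M G \<phi> x] kmod_facts(12)[OF assms(1)]
    by (simp add: compatible_def)
  finally show ?thesis by (simp add: lift_lin y_def)
qed

lemma lift_linear:
  assumes "kmod M" "presentation G R" "compatible M G R \<phi>"
  shows "linear_map (presented G R) M (lift M \<phi>)"
proof (rule linear_mapI)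
  have \<phi>: "\<And>g. g \<in> G \<Longrightarrow> \<phi> g \<in> carrier M" using assms(3) by (simp add: compatible_def)
  fix A assume "A \<in> carrier (presented G R)"
  then obtain x where x: "A = coset R x" "Poly_Mapping.keys x \<subseteq> G" by (auto simp: presented_simps)
  show "lift M \<phi> A \<in> carrier M"
    using x lift_coset[OF assms] lin_closed[OF assms(1) \<phi>] by simp
  show "lift M \<phi> (c \<odot>\<^bsub>presented G R\<^esub> A) = c \<odot>\<^bsub>M\<^esub> lift M \<phi> A" for c
    using x keys_pscale[of c x] by (simp add: presented_simps lift_coset[OF assms] lin_scale[OF assms(1) \<phi>])
  fix B assume "B \<in> carrier (presented G R)"
  then obtain y where y: "B = coset R y" "Poly_Mapping.keys y \<subseteq> G" by (auto simp: presented_simps)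
  show "lift M \<phi> (A \<oplus>\<^bsub>presented G R\<^esub> B) = lift M \<phi> A \<oplus>\<^bsub>M\<^esub> lift M \<phi> B"
    using x y subset_trans[OF keys_add[of x y] Un_least[OF x(2) y(2)]]
    by (simp add: presented_simps lift_coset[OF assms] lin_add[OF assms(1) \<phi> x(2) y(2)])
qed

lemma lift_gen:
  assumes "kmod M" "presentation G R" "compatible M G R \<phi>" "g \<in> G"
  shows "lift M \<phi> (coset R (gen g)) = \<phi> g"
  using assms lift_coset[OF assms(1-3), of "gen g"] lin_gen[of M G \<phi>] by (simp add: compatible_def)

lemma gen_coset_in: "g \<in> G \<Longrightarrow> coset R (gen g) \<in> carrier (presented G R)"
  by (auto simp: presented_simps)

text \<open>Generators span, so linear maps are compared on generators.\<close>

lemma presented_eqI: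
  assumes "kmod M" "linear_map (presented G R) M f" "linear_map (presented G R) M h"
    "\<And>g. g \<in> G \<Longrightarrow> f (coset R (gen g)) = h (coset R (gen g))" "A \<in> carrier (presented G R)"
  shows "f A = h A"
proof -
  obtain x where x: "A = coset R x" "Poly_Mapping.keys x \<subseteq> G" using assms(5) by (auto simp: presented_simps)
  have "finite F \<Longrightarrow> F \<subseteq> G \<Longrightarrow>
      f (coset R (\<Sum>g\<in>F. pscale (c g) (gen g))) = h (coset R (\<Sum>g\<in>F. pscale (c g) (gen g))) \<and>
      Poly_Mapping.keys (\<Sum>g\<in>F. pscale (c g) (gen g)) \<subseteq> G" for F c
  proof (induction F rule: finite_induct)
    case empty
    show ?case using linear_map_zero[OF assms(2) presented_module assms(1)]
      linear_map_zero[OF assms(3) presented_module assms(1)] by (simp add: presented_simps)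
  next
    case (insert g F)
    let ?y = "pscale (c g) (gen g)" and ?z = "\<Sum>g\<in>F. pscale (c g) (gen g)"
    have g: "coset R (gen g) \<in> carrier (presented G R)" using insert by (simp add: gen_coset_in)
    have k: "Poly_Mapping.keys ?y \<subseteq> G" using keys_pscale[of "c g" "gen g"] insert by auto
    have yz: "coset R ?y \<in> carrier (presented G R)" "coset R ?z \<in> carrier (presented G R)"
      using k insert by (auto simp: presented_simps)
    have "f (coset R ?y) = h (coset R ?y)"
      using linear_mapD(3)[OF assms(2) g] linear_mapD(3)[OF assms(3) g] assms(4)[of g] insert
      by (metis insert_subset presented_simps(3))
    moreover have "f (coset R (?y + ?z)) = f (coset R ?y) \<oplus>\<^bsub>M\<^esub> f (coset R ?z)"
      "h (coset R (?y + ?z)) = h (coset R ?y) \<oplus>\<^bsub>M\<^esub> h (coset R ?z)"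
      using linear_mapD(2)[OF assms(2) yz] linear_mapD(2)[OF assms(3) yz] by (simp_all add: presented_simps)
    moreover have "Poly_Mapping.keys (?y + ?z) \<subseteq> G" using keys_add[of ?y ?z] k insert by auto
    ultimately show ?case using insert by simp
  qed
  moreover have "x = (\<Sum>g\<in>Poly_Mapping.keys x. pscale (Poly_Mapping.lookup x g) (gen g))"
    by (rule poly_mapping_eqI)
       (auto simp: lookup_sum gen_def lookup_single when_def in_keys_iff sum.delta if_distrib cong: if_cong)
  ultimately show ?thesis using x finite_keys[of x] by metis
qed

lemma coset_relation:
  shows "gen a - gen b \<in> R \<Longrightarrow> coset R (gen a) = coset R (gen b)"
    "gen a - gen b - gen c \<in> R \<Longrightarrow> coset R (gen a) = coset R (gen b) \<oplus>\<^bsub>presented G R\<^esub> coset R (gen c)"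
    "gen a - pscale d (gen b) \<in> R \<Longrightarrow> coset R (gen a) = d \<odot>\<^bsub>presented G R\<^esub> coset R (gen b)"
  by (auto simp: presented_simps coset_eq_iff algebra_simps intro: pm.span_base)

lemma presented_trivial:
  assumes "G = {}" shows "carrier (presented G R) = {\<zero>\<^bsub>presented G R\<^esub>}"
  using assms by (auto simp: presented_def)

definition lift2 :: "('k::field, 'c) module \<Rightarrow> ('g \<Rightarrow> 'h \<Rightarrow> 'c) \<Rightarrow> ('g \<Rightarrow>\<^sub>0 'k) set \<Rightarrow> ('h \<Rightarrow>\<^sub>0 'k) set \<Rightarrow> 'c" where
  "lift2 M \<Phi> A B = lift M (\<lambda>g. lift M (\<Phi> g) B) A"

text \<open>
  A relation in the first argument has to vanish against every class in the second one.  The expression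
  is linear in that class, so it suffices that it vanishes against generators.
\<close>

lemma lift2_bilinear:
  assumes M: "kmod M" and p: "presentation G R" "presentation H S"
    and r1: "\<And>h. h \<in> H \<Longrightarrow> compatible M G R (\<lambda>g. \<Phi> g h)" and r2: "\<And>g. g \<in> G \<Longrightarrow> compatible M H S (\<Phi> g)"
  shows "bilinear_map (presented G R) (presented H S) M (lift2 M \<Phi>)"
    and "g \<in> G \<Longrightarrow> h \<in> H \<Longrightarrow> lift2 M \<Phi> (coset R (gen g)) (coset S (gen h)) = \<Phi> g h"
proof -
  interpret M: Module.module scalars M by (fact M)
  note lin = lin_add[OF M] lin_scale[OF M] lin_closed[OF M]
  have l2: "linear_map (presented H S) M (lift M (\<Phi> g))" if "g \<in> G" for g
    using lift_linear[OF M p(2) r2[OF that]] .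
  have r: "compatible M G R (\<lambda>g. lift M (\<Phi> g) B)" if B: "B \<in> carrier (presented H S)" for B
    unfolding compatible_def
  proof (intro conjI ballI)
    show "lift M (\<Phi> g) B \<in> carrier M" if "g \<in> G" for g
      using linear_mapD(1)[OF l2[OF that] B] .
    fix r assume r: "r \<in> R"
    hence k: "Poly_Mapping.keys r \<subseteq> G" using p(1) by (auto simp: presentation_def)
    have "linear_map (presented H S) M (\<lambda>B. lin M (\<lambda>g. lift M (\<Phi> g) B) r)"
    proof (rule linear_mapI)
      fix A assume A: "A \<in> carrier (presented H S)"
      note c = linear_mapD[OF l2]
      show "lin M (\<lambda>g. lift M (\<Phi> g) A) r \<in> carrier M"
        using c(1)[OF _ A] k by (intro lin(3)[of G]) auto
      show "lin M (\<lambda>g. lift M (\<Phi> g) (d \<odot>\<^bsub>presented H S\<^esub> A)) r = d \<odot>\<^bsub>M\<^esub> lin M (\<lambda>g. lift M (\<Phi> g) A) r" for d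
      proof -
        have "d \<odot>\<^bsub>M\<^esub> lin M (\<lambda>g. lift M (\<Phi> g) A) r =
          (\<Oplus>\<^bsub>M\<^esub>g\<in>Poly_Mapping.keys r. d \<odot>\<^bsub>M\<^esub> (Poly_Mapping.lookup r g \<odot>\<^bsub>M\<^esub> lift M (\<Phi> g) A))"
          unfolding lin_def using c(1)[OF _ A] k kmod_facts(5)[OF M] by (intro M.finsum_smult_ldistr) auto
        also have "\<dots> = lin M (\<lambda>g. lift M (\<Phi> g) (d \<odot>\<^bsub>presented H S\<^esub> A)) r"
          unfolding lin_def using c(1,3)[OF _ A] k kmod_facts(5,8)[OF M]
          by (intro M.finsum_cong') (auto simp: subset_iff mult.commute simp flip: kmod_facts(8)[OF M])
        finally show ?thesis by simp
      qed
      fix A' assume A': "A' \<in> carrier (presented H S)"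
      have "lin M (\<lambda>g. lift M (\<Phi> g) A) r \<oplus>\<^bsub>M\<^esub> lin M (\<lambda>g. lift M (\<Phi> g) A') r =
          (\<Oplus>\<^bsub>M\<^esub>g\<in>Poly_Mapping.keys r. Poly_Mapping.lookup r g \<odot>\<^bsub>M\<^esub> lift M (\<Phi> g) A \<oplus>\<^bsub>M\<^esub>
            Poly_Mapping.lookup r g \<odot>\<^bsub>M\<^esub> lift M (\<Phi> g) A')"
        unfolding lin_def using c(1)[OF _ A] c(1)[OF _ A'] k kmod_facts(5)[OF M]
        by (intro M.finsum_addf[symmetric]) auto
      also have "\<dots> = lin M (\<lambda>g. lift M (\<Phi> g) (A \<oplus>\<^bsub>presented H S\<^esub> A')) r"
        unfolding lin_def using c(1)[OF _ A] c(1)[OF _ A'] c(2)[OF _ A A'] k kmod_facts(4,5,7)[OF M]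
        by (intro M.finsum_cong') (auto simp: subset_iff)
      finally show "lin M (\<lambda>g. lift M (\<Phi> g) (A \<oplus>\<^bsub>presented H S\<^esub> A')) r =
        lin M (\<lambda>g. lift M (\<Phi> g) A) r \<oplus>\<^bsub>M\<^esub> lin M (\<lambda>g. lift M (\<Phi> g) A') r" by simp
    qed
    moreover have "linear_map (presented H S) M (\<lambda>_. \<zero>\<^bsub>M\<^esub>)"
      using kmod_facts[OF M] by (intro linear_mapI) auto
    moreover have "lin M (\<lambda>g. lift M (\<Phi> g) (coset S (gen h))) r = \<zero>\<^bsub>M\<^esub>" if h: "h \<in> H" for h
    proof -
      have "lin M (\<lambda>g. lift M (\<Phi> g) (coset S (gen h))) r = lin M (\<lambda>g. \<Phi> g h) r"
        unfolding lin_def using k r1[OF h] lift_gen[OF M p(2) r2 h] kmod_facts(5)[OF M]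
        by (intro M.finsum_cong') (auto simp: subset_iff compatible_def)
      thus ?thesis using r1[OF h] r by (simp add: compatible_def)
    qed
    ultimately show "lin M (\<lambda>g. lift M (\<Phi> g) B) r = \<zero>\<^bsub>M\<^esub>"
      using presented_eqI[OF M, of H S "\<lambda>B. lin M (\<lambda>g. lift M (\<Phi> g) B) r" "\<lambda>_. \<zero>\<^bsub>M\<^esub>"] B by blast
  qed
  show "g \<in> G \<Longrightarrow> h \<in> H \<Longrightarrow> lift2 M \<Phi> (coset R (gen g)) (coset S (gen h)) = \<Phi> g h"
    using lift_gen[OF M p(1) r[OF gen_coset_in]] lift_gen[OF M p(2) r2] by (simp add: lift2_def)
  have *: "linear_map (presented G R) M (\<lambda>A. lift2 M \<Phi> A B)" if "B \<in> carrier (presented H S)" for B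
    unfolding lift2_def by (rule lift_linear[OF M p(1) r[OF that]])
  have "linear_map (presented H S) M (lift2 M \<Phi> A)" if "A \<in> carrier (presented G R)" for A
  proof (rule linear_mapI)
    note 1 = linear_mapD[OF *] linear_mapD[OF l2]
    note kp = kmod_facts(4,5)[OF presented_module[of H S]]
    fix B assume B: "B \<in> carrier (presented H S)"
    show "lift2 M \<Phi> A B \<in> carrier M" using 1(1)[OF B that] .
    show "lift2 M \<Phi> A (d \<odot>\<^bsub>presented H S\<^esub> B) = d \<odot>\<^bsub>M\<^esub> lift2 M \<Phi> A B" for d
    proof (rule presented_eqI[OF M *[OF kp(2)[OF B]] _ _ that])
      show "linear_map (presented G R) M (\<lambda>A. d \<odot>\<^bsub>M\<^esub> lift2 M \<Phi> A B)"
        using 1(1-3)[OF B] kmod_facts[OF M]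
        by (intro linear_mapI) (auto simp: mult.commute simp flip: kmod_facts(8)[OF M])
    qed (use l2 B kp r in \<open>auto simp: lift2_def lift_gen[OF M p(1)] linear_mapD\<close>)
    fix B' assume B': "B' \<in> carrier (presented H S)"
    show "lift2 M \<Phi> A (B \<oplus>\<^bsub>presented H S\<^esub> B') = lift2 M \<Phi> A B \<oplus>\<^bsub>M\<^esub> lift2 M \<Phi> A B'"
    proof (rule presented_eqI[OF M *[OF kp(1)[OF B B']] _ _ that])
      show "linear_map (presented G R) M (\<lambda>A. lift2 M \<Phi> A B \<oplus>\<^bsub>M\<^esub> lift2 M \<Phi> A B')"
        using 1(1-3)[OF B] 1(1-3)[OF B'] kmod_facts[OF M]
        by (intro linear_mapI) (auto simp: M.add.m_ac)
    qed (use l2 B B' kp r in \<open>auto simp: lift2_def lift_gen[OF M p(1)] linear_mapD\<close>)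
  qed
  with * show "bilinear_map (presented G R) (presented H S) M (lift2 M \<Phi>)"
    by (simp add: bilinear_map_def)
qed

section \<open>Listings of edges and the permutations relating them\<close>

definition reord :: "nat list \<Rightarrow> nat list \<Rightarrow> bool" where
  "reord os as \<longleftrightarrow> distinct os \<and> distinct as \<and> set os = set as"

lemma reord_refl: "distinct os \<Longrightarrow> reord os os"
  and reord_sym: "reord os as \<Longrightarrow> reord as os"
  and reord_trans: "reord os as \<Longrightarrow> reord as bs \<Longrightarrow> reord os bs"
  and reord_length: "reord os as \<Longrightarrow> length os = length as"
  by (auto simp: reord_def) (metis distinct_card)

text \<open>
  If an edge sits in slot \<open>i\<close> of the listing \<open>as\<close>, it sits in slot \<open>tr os as i\<close> of \<open>os\<close>.
\<close>

definition tr :: "nat list \<Rightarrow> nat list \<Rightarrow> nat \<Rightarrow> nat" where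
  "tr os as = list_perm (map (position os) as)"

lemma position_nth [simp]: "distinct es \<Longrightarrow> i < length es \<Longrightarrow> position es (es ! i) = i"
  unfolding position_def by (rule inv_into_f_f) (auto intro: inj_on_nth)

lemma position_less [simp]: "distinct es \<Longrightarrow> x \<in> set es \<Longrightarrow> position es x < length es"
  by (metis in_set_conv_nth position_nth)

lemma nth_position [simp]: "distinct es \<Longrightarrow> x \<in> set es \<Longrightarrow> es ! position es x = x"
  by (metis in_set_conv_nth position_nth)

lemma inj_on_position: "distinct es \<Longrightarrow> inj_on (position es) (set es)"
  by (metis inj_onI nth_position)

lemma position_image: "distinct es \<Longrightarrow> position es ` set es = {..<length es}"
  by (force simp: image_iff in_set_conv_nth)

lemma position_map:
  "distinct es \<Longrightarrow> inj_on f (set es) \<Longrightarrow> x \<in> set es \<Longrightarrow> position (map f es) (f x) = position es x"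
  by (metis distinct_map length_map nth_map nth_position position_less position_nth)

lemma position_upt [simp]: "i < n \<Longrightarrow> position [0..<n] i = i"
  by (metis add.left_neutral diff_zero distinct_upt length_upt nth_upt position_nth)

lemma position_append1: "distinct (es @ fs) \<Longrightarrow> x \<in> set es \<Longrightarrow> position (es @ fs) x = position es x"
  by (metis distinct_append in_set_conv_nth length_append nth_append position_nth trans_less_add1)

lemma position_append2:
  "distinct (es @ fs) \<Longrightarrow> x \<in> set fs \<Longrightarrow> position (es @ fs) x = length es + position fs x"
  using position_nth[of "es @ fs" "length es + position fs x"] by (simp add: nth_append)

lemma map_position_self: "distinct es \<Longrightarrow> map (position es) es = [0..<length es]"
  by (rule nth_equalityI) auto

lemma tr_eq: "tr os as i = (if i < length as then position os (as ! i) else i)"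
  by (simp add: tr_def list_perm_def)

lemma tr_position: "reord os as \<Longrightarrow> x \<in> set os \<Longrightarrow> tr os as (position as x) = position os x"
  by (auto simp: tr_eq reord_def)

lemma tr_self: "distinct os \<Longrightarrow> tr os os = id"
  by (rule ext) (simp add: tr_eq)

lemma tr_comp: "reord os bs \<Longrightarrow> reord bs as \<Longrightarrow> tr os bs \<circ> tr bs as = tr os as"
proof (rule ext)
  fix i assume r: "reord os bs" "reord bs as"
  have "i < length as \<Longrightarrow> as ! i \<in> set bs" using r by (auto simp: reord_def)
  thus "(tr os bs \<circ> tr bs as) i = tr os as i"
    using r reord_length[OF r(1)] reord_length[OF r(2)] position_less[of bs "as ! i"]
    by (simp add: tr_eq reord_def)
qed

lemma tr_permutes: assumes "reord os as" shows "tr os as permutes {..<length os}"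
proof (rule bij_imp_permutes)
  have "tr os as ` {..<length os} = position os ` set as"
    using reord_length[OF assms] by (force simp: tr_eq image_iff set_conv_nth)
  hence im: "tr os as ` {..<length os} = {..<length os}"
    using assms position_image[of os] by (simp add: reord_def)
  thus "bij_betw (tr os as) {..<length os} {..<length os}"
    by (simp add: bij_betw_def eq_card_imp_inj_on)
qed (use reord_length[OF assms] in \<open>simp add: tr_eq\<close>)

lemma tr_permutes': "reord os as \<Longrightarrow> tr os as permutes {..<length as}"
  using tr_permutes[of os as] reord_length[of os as] by simp

lemma inv_tr: "reord os as \<Longrightarrow> inv_into UNIV (tr os as) = tr as os"
  by (rule inv_unique_comp) (auto simp: tr_comp tr_self reord_sym reord_def)

lemma permute_list_tr: assumes "reord os as" shows "permute_list (tr os as) os = as"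
proof (rule nth_equalityI)
  fix i assume i: "i < length (permute_list (tr os as) os)"
  have "permute_list (tr os as) os ! i = os ! tr os as i"
    using i by (intro permute_list_nth[OF tr_permutes[OF assms]]) simp
  thus "permute_list (tr os as) os ! i = as ! i"
    using i assms reord_length[OF assms] by (simp add: tr_eq reord_def)
qed (use reord_length[OF assms] in simp)

lemma tr_permute_list:
  assumes "distinct os" "\<sigma> permutes {..<length os}"
  shows "reord os (permute_list \<sigma> os)" "tr os (permute_list \<sigma> os) = \<sigma>"
proof -
  show "reord os (permute_list \<sigma> os)" using assms by (simp add: reord_def)
  show "tr os (permute_list \<sigma> os) = \<sigma>"
  proof
    fix i show "tr os (permute_list \<sigma> os) i = \<sigma> i"
      using assms permutes_in_image[OF assms(2), of i] permutes_not_in[OF assms(2), of i]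
      by (auto simp: tr_eq permute_list_nth)
  qed
qed

lemma reord_append:
  "reord os as \<Longrightarrow> reord os' as' \<Longrightarrow> set os \<inter> set os' = {} \<Longrightarrow> reord (os @ os') (as @ as')"
  by (auto simp: reord_def)

lemma tr_append:
  assumes "reord os as" "reord os' as'" "set os \<inter> set os' = {}"
  shows "tr (os @ os') (as @ as') = block_sum (length os) (tr os as) (tr os' as')"
proof
  fix i
  have d: "distinct (os @ os')" using reord_append[OF assms] by (simp add: reord_def)
  have "i - length as < length as' \<Longrightarrow> as' ! (i - length as) \<in> set os'" "i < length as \<Longrightarrow> as ! i \<in> set os"
    using assms by (auto simp: reord_def)
  thus "tr (os @ os') (as @ as') i = block_sum (length os) (tr os as) (tr os' as') i"
    using reord_length[OF assms(1)] reord_length[OF assms(2)]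
    by (auto simp: tr_eq block_sum_def nth_append position_append1[OF d] position_append2[OF d])
qed

lemma tr_swap:
  assumes "distinct (os @ os')"
  shows "tr (os' @ os) (os @ os') = block_swap (length os) (length os')"
proof
  fix i
  have d: "distinct (os' @ os)" using assms by auto
  show "tr (os' @ os) (os @ os') i = block_swap (length os) (length os') i"
    using assms by (auto simp: tr_eq block_swap_def nth_append position_append1[OF d] position_append2[OF d])
qed

lemma tr_map:
  assumes "inj_on f (set os)" "reord os as" shows "tr (map f os) (map f as) = tr os as"
proof
  fix i
  have "i < length as \<Longrightarrow> as ! i \<in> set os" using assms by (auto simp: reord_def)
  thus "tr (map f os) (map f as) i = tr os as i"
    using assms by (auto simp: tr_eq position_map reord_def)
qed

lemma reord_map: "inj_on f (set os) \<Longrightarrow> reord os as \<Longrightarrow> reord (map f os) (map f as)"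
  by (auto simp: reord_def distinct_map)

section \<open>Bimodules\<close>

lemma sbimoduleD:
  assumes "sbimodule P"
  shows "kmod (md P m n)" "m = 0 \<or> n = 0 \<Longrightarrow> elts P m n = {\<zero>\<^bsub>md P m n\<^esub>}"
    "\<sigma> permutes {..<m} \<Longrightarrow> linear_map (md P m n) (md P m n) (lact P m n \<sigma>)"
    "\<tau> permutes {..<n} \<Longrightarrow> linear_map (md P m n) (md P m n) (ract P m n \<tau>)"
    "x \<in> elts P m n \<Longrightarrow> lact P m n id x = x" "x \<in> elts P m n \<Longrightarrow> ract P m n id x = x"
    "x \<in> elts P m n \<Longrightarrow> \<sigma> permutes {..<m} \<Longrightarrow> \<sigma>' permutes {..<m} \<Longrightarrow>
      lact P m n (\<sigma> \<circ> \<sigma>') x = lact P m n \<sigma> (lact P m n \<sigma>' x)"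
    "x \<in> elts P m n \<Longrightarrow> \<tau> permutes {..<n} \<Longrightarrow> \<tau>' permutes {..<n} \<Longrightarrow>
      ract P m n (\<tau> \<circ> \<tau>') x = ract P m n \<tau>' (ract P m n \<tau> x)"
    "x \<in> elts P m n \<Longrightarrow> \<sigma> permutes {..<m} \<Longrightarrow> \<tau> permutes {..<n} \<Longrightarrow>
      lact P m n \<sigma> (ract P m n \<tau> x) = ract P m n \<tau> (lact P m n \<sigma> x)"
  using assms unfolding sbimodule_def by (simp, (elim disjE; simp), simp_all)

lemma act_closed:
  assumes "sbimodule P" "x \<in> elts P m n"
  shows "\<sigma> permutes {..<m} \<Longrightarrow> lact P m n \<sigma> x \<in> elts P m n"
    "\<tau> permutes {..<n} \<Longrightarrow> ract P m n \<tau> x \<in> elts P m n"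
  using linear_mapD(1)[OF sbimoduleD(3)[OF assms(1)] assms(2)]
    linear_mapD(1)[OF sbimoduleD(4)[OF assms(1)] assms(2)] by auto

text \<open>
  An element whose output and input slots are named by \<open>as\<close> and \<open>bs\<close> becomes the same operation with
  slots named by \<open>os\<close> and \<open>is\<close>.  In this form the two group actions compose like changes of
  coordinates (\<open>recoord_comp\<close>), and most arguments need no explicit permutation.
\<close>

definition recoord ::
    "('k, 'a, 'x) sbimod_scheme \<Rightarrow> nat list \<Rightarrow> nat list \<Rightarrow> nat list \<Rightarrow> nat list \<Rightarrow> 'a \<Rightarrow> 'a" where
  "recoord P os is as bs x =
     lact P (length os) (length is) (tr os as) (ract P (length os) (length is) (tr bs is) x)"

lemma recoord_linear:
  assumes "sbimodule P" "reord os as" "reord is bs"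
  shows "linear_map (md P (length as) (length bs)) (md P (length os) (length is)) (recoord P os is as bs)"
  unfolding recoord_def
  using linear_map_comp[OF sbimoduleD(4)[OF assms(1)] sbimoduleD(3)[OF assms(1)]]
    tr_permutes[OF assms(2)] tr_permutes'[OF reord_sym[OF assms(3)]] reord_length[OF assms(2)] reord_length[OF assms(3)]
  by simp

lemma recoord_closed:
  assumes "sbimodule P" "reord os as" "reord is bs" "x \<in> elts P (length as) (length bs)"
  shows "recoord P os is as bs x \<in> elts P (length os) (length is)"
  using linear_mapD(1)[OF recoord_linear[OF assms(1-3)] assms(4)] .

lemma recoord_self:
  "sbimodule P \<Longrightarrow> distinct os \<Longrightarrow> distinct is \<Longrightarrow> x \<in> elts P (length os) (length is) \<Longrightarrow> recoord P os is os is x = x"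
  by (simp add: recoord_def tr_self sbimoduleD)

lemma recoord_comp:
  assumes "sbimodule P" "reord os as" "reord is bs" "reord as cs" "reord bs ds" "x \<in> elts P (length cs) (length ds)"
  shows "recoord P os is as bs (recoord P as bs cs ds x) = recoord P os is cs ds x"
proof -
  have l: "length cs = length os" "length ds = length is" "length as = length os" "length bs = length is"
    using assms(2-5) reord_length by metis+
  let ?m = "length os" and ?n = "length is"
  have p: "tr os as permutes {..<?m}" "tr as cs permutes {..<?m}" "tr bs is permutes {..<?n}" "tr ds bs permutes {..<?n}"
    using tr_permutes'[OF assms(2)] tr_permutes'[OF assms(4)] tr_permutes[OF reord_sym[OF assms(3)]]
      tr_permutes[OF reord_sym[OF assms(5)]] l by simp_all
  note S = sbimoduleD[OF assms(1)] and c = act_closed[OF assms(1)]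
  have x: "x \<in> elts P ?m ?n" using assms(6) l by simp
  have "recoord P os is as bs (recoord P as bs cs ds x) =
      lact P ?m ?n (tr os as) (ract P ?m ?n (tr bs is) (lact P ?m ?n (tr as cs) (ract P ?m ?n (tr ds bs) x)))"
    by (simp add: recoord_def l)
  also have "\<dots> = lact P ?m ?n (tr os as) (lact P ?m ?n (tr as cs) (ract P ?m ?n (tr bs is) (ract P ?m ?n (tr ds bs) x)))"
    using S(9)[OF c(2)[OF x p(4)] p(2) p(3)] by simp
  also have "\<dots> = lact P ?m ?n (tr os as \<circ> tr as cs) (ract P ?m ?n (tr ds bs \<circ> tr bs is) x)"
    using S(7)[OF c(2)[OF c(2)[OF x p(4)] p(3)] p(1,2)] S(8)[OF x p(4,3)] by simp
  also have "\<dots> = recoord P os is cs ds x"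
    using tr_comp[OF assms(2,4)] tr_comp[OF reord_sym[OF assms(5)] reord_sym[OF assms(3)]]
    by (simp add: recoord_def)
  finally show ?thesis .
qed

lemma sbimod_mapD:
  assumes "sbimod_map P Q f"
  shows "linear_map (md P m n) (md Q m n) (f m n)" "x \<in> elts P m n \<Longrightarrow> f m n x \<in> elts Q m n"
    "x \<in> elts P m n \<Longrightarrow> \<sigma> permutes {..<m} \<Longrightarrow> f m n (lact P m n \<sigma> x) = lact Q m n \<sigma> (f m n x)"
    "x \<in> elts P m n \<Longrightarrow> \<tau> permutes {..<n} \<Longrightarrow> f m n (ract P m n \<tau> x) = ract Q m n \<tau> (f m n x)"
  using assms unfolding sbimod_map_def by (auto dest: linear_mapD)

lemma recoord_map:
  assumes "sbimodule P" "sbimod_map P Q f" "reord os as" "reord is bs" "x \<in> elts P (length as) (length bs)"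
  shows "f (length os) (length is) (recoord P os is as bs x) = recoord Q os is as bs (f (length as) (length bs) x)"
  using assms tr_permutes[OF assms(3)] tr_permutes'[OF reord_sym[OF assms(4)]]
    reord_length[OF assms(3)] reord_length[OF assms(4)]
  by (simp add: recoord_def sbimod_mapD act_closed)


section \<open>Relations on the vertices of one level\<close>

definition well_decorated :: "('k, 'a, 'x) sbimod_scheme \<Rightarrow> 'a vertex \<Rightarrow> bool" where
  "well_decorated P v \<longleftrightarrow> deco v \<in> elts P (length (outs v)) (length (ins v))"

text \<open>
  The identification of vertices generated by the two families of relations on the actions.
\<close>

definition veq :: "('k, 'a, 'x) sbimod_scheme \<Rightarrow> 'a vertex \<Rightarrow> 'a vertex \<Rightarrow> bool" where
  "veq P v v' \<longleftrightarrow> reord (outs v) (outs v') \<and> reord (ins v) (ins v') \<and> well_decorated P v' \<and>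
     deco v = recoord P (outs v) (ins v) (outs v') (ins v') (deco v')"

text \<open>
  Levels related in this way have the same class in every module presented by graphs (\<open>class_leveq\<close>).
\<close>

definition leveq :: "('k, 'a, 'x) sbimod_scheme \<Rightarrow> 'a vertex list \<Rightarrow> 'a vertex list \<Rightarrow> bool" where
  "leveq P xs ys \<longleftrightarrow> (\<exists>zs. list_all2 (veq P) xs zs \<and> mset zs = mset ys)"

lemma veq_refl:
  "sbimodule P \<Longrightarrow> well_decorated P v \<Longrightarrow> distinct (outs v) \<Longrightarrow> distinct (ins v) \<Longrightarrow> veq P v v"
  by (simp add: veq_def reord_refl recoord_self well_decorated_def)

lemma veq_well_decorated: "sbimodule P \<Longrightarrow> veq P v v' \<Longrightarrow> well_decorated P v \<and> well_decorated P v'"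
  by (auto simp: veq_def well_decorated_def recoord_closed)

lemma veq_sym: "sbimodule P \<Longrightarrow> veq P v v' \<Longrightarrow> veq P v' v"
  using veq_well_decorated[of P v v'] recoord_comp[of P "outs v'" "outs v" "ins v'" "ins v" "outs v'" "ins v'" "deco v'"]
  by (auto simp: veq_def reord_sym well_decorated_def recoord_self reord_def)

lemma veq_trans:
  assumes "sbimodule P" "veq P u v" "veq P v w" shows "veq P u w"
  using assms recoord_comp[OF assms(1), of "outs u" "outs v" "ins u" "ins v" "outs w" "ins w" "deco w"]
  by (auto simp: veq_def well_decorated_def intro: reord_trans)

text \<open>
  Graphs \<open>K xs\<close> with a distinguished level \<open>xs\<close>, belonging to a set that allows all
  the moves occurring in the relations of that level.
\<close>

definition admissible :: "('k, 'a, 'x) sbimod_scheme \<Rightarrow> 'g set \<Rightarrow> ('a vertex list \<Rightarrow> 'g) \<Rightarrow> bool" where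
  "admissible P G K \<longleftrightarrow>
     (\<forall>xs v ys. K (xs @ v # ys) \<in> G \<longrightarrow> well_decorated P v \<and> distinct (outs v) \<and> distinct (ins v)) \<and>
     (\<forall>xs v v' ys. K (xs @ v # ys) \<in> G \<and> reord (outs v) (outs v') \<and> reord (ins v) (ins v') \<and>
        well_decorated P v' \<longrightarrow> K (xs @ v' # ys) \<in> G) \<and>
     (\<forall>xs ys. K xs \<in> G \<and> mset xs = mset ys \<longrightarrow> K ys \<in> G)"

lemma admissibleD:
  assumes "admissible P G K"
  shows "K (xs @ v # ys) \<in> G \<Longrightarrow> well_decorated P v \<and> distinct (outs v) \<and> distinct (ins v)"
    "K (xs @ v # ys) \<in> G \<Longrightarrow> reord (outs v) (outs v') \<Longrightarrow> reord (ins v) (ins v') \<Longrightarrow> well_decorated P v' \<Longrightarrow>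
      K (xs @ v' # ys) \<in> G"
    "K xs \<in> G \<Longrightarrow> mset xs = mset ys \<Longrightarrow> K ys \<in> G"
  using assms unfolding admissible_def by blast+

lemma admissible_deco:
  assumes "admissible P G K" "K (xs @ v # ys) \<in> G" "p \<in> elts P (length (outs v)) (length (ins v))"
  shows "K (xs @ Vertex (outs v) (ins v) p # ys) \<in> G"
  using admissibleD(1,2)[OF assms(1,2)] assms(3) by (simp add: reord_refl well_decorated_def)

lemma veq_lact:
  assumes "sbimodule P" "p \<in> elts P (length os) (length is)" "distinct os" "distinct is" "\<sigma> permutes {..<length os}"
  shows "veq P (Vertex os is (lact P (length os) (length is) \<sigma> p)) (Vertex (permute_list \<sigma> os) is p)"
  using assms tr_permute_list[OF assms(3,5)]
  by (simp add: veq_def well_decorated_def recoord_def tr_self reord_refl sbimoduleD)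

lemma veq_ract:
  assumes "sbimodule P" "p \<in> elts P (length os) (length is)" "distinct os" "distinct is" "\<tau> permutes {..<length is}"
  shows "veq P (Vertex os (permute_list \<tau> is) (ract P (length os) (length is) \<tau> p)) (Vertex os is p)"
  using assms tr_permute_list[OF assms(4,5)] act_closed(2)[OF assms(1,2,5)]
  by (simp add: veq_def well_decorated_def recoord_def tr_self reord_refl sbimoduleD reord_sym)

lemma level_rels_cases:
  assumes "r \<in> level_rels P G K"
  obtains (add) xs os "is" p q ys where
      "r = gen (K (xs @ Vertex os is (p \<oplus>\<^bsub>md P (length os) (length is)\<^esub> q) # ys))
        - gen (K (xs @ Vertex os is p # ys)) - gen (K (xs @ Vertex os is q # ys))"
      "K (xs @ Vertex os is p # ys) \<in> G" "K (xs @ Vertex os is q # ys) \<in> G"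
  | (scale) xs os "is" c p ys where
      "r = gen (K (xs @ Vertex os is (c \<odot>\<^bsub>md P (length os) (length is)\<^esub> p) # ys))
        - pscale c (gen (K (xs @ Vertex os is p # ys)))"
      "K (xs @ Vertex os is p # ys) \<in> G"
  | (lact) xs os "is" \<sigma> p ys where
      "r = gen (K (xs @ Vertex os is (lact P (length os) (length is) \<sigma> p) # ys))
        - gen (K (xs @ Vertex (permute_list \<sigma> os) is p # ys))"
      "\<sigma> permutes {..<length os}" "K (xs @ Vertex os is p # ys) \<in> G"
  | (ract) xs os "is" \<tau> p ys where
      "r = gen (K (xs @ Vertex os (permute_list \<tau> is) (ract P (length os) (length is) \<tau> p) # ys))
        - gen (K (xs @ Vertex os is p # ys))"
      "\<tau> permutes {..<length is}" "K (xs @ Vertex os is p # ys) \<in> G"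
  | (mset) xs ys where "r = gen (K xs) - gen (K ys)" "mset xs = mset ys" "K xs \<in> G" "K ys \<in> G"
  using assms unfolding level_rels_def Un_iff mem_Collect_eq
proof (elim disjE exE conjE)
qed (rule add scale lact ract mset; assumption)+

lemma level_relsI:
  "K (xs @ Vertex os is p # ys) \<in> G \<Longrightarrow> K (xs @ Vertex os is q # ys) \<in> G \<Longrightarrow>
    gen (K (xs @ Vertex os is (p \<oplus>\<^bsub>md P (length os) (length is)\<^esub> q) # ys))
        - gen (K (xs @ Vertex os is p # ys)) - gen (K (xs @ Vertex os is q # ys)) \<in> level_rels P G K"
  "K (xs @ Vertex os is p # ys) \<in> G \<Longrightarrow>
    gen (K (xs @ Vertex os is (c \<odot>\<^bsub>md P (length os) (length is)\<^esub> p) # ys))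
        - pscale c (gen (K (xs @ Vertex os is p # ys))) \<in> level_rels P G K"
  "\<sigma> permutes {..<length os} \<Longrightarrow> K (xs @ Vertex os is p # ys) \<in> G \<Longrightarrow>
    gen (K (xs @ Vertex os is (lact P (length os) (length is) \<sigma> p) # ys))
        - gen (K (xs @ Vertex (permute_list \<sigma> os) is p # ys)) \<in> level_rels P G K"
  "\<tau> permutes {..<length is} \<Longrightarrow> K (xs @ Vertex os is p # ys) \<in> G \<Longrightarrow>
    gen (K (xs @ Vertex os (permute_list \<tau> is) (ract P (length os) (length is) \<tau> p) # ys))
        - gen (K (xs @ Vertex os is p # ys)) \<in> level_rels P G K"
  "mset xs' = mset ys' \<Longrightarrow> K xs' \<in> G \<Longrightarrow> K ys' \<in> G \<Longrightarrow> gen (K xs') - gen (K ys') \<in> level_rels P G K"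
  unfolding level_rels_def
      apply (rule UnI1, rule UnI1, rule UnI1, rule UnI1, rule CollectI, intro exI conjI, rule refl, assumption+)
     apply (rule UnI1, rule UnI1, rule UnI1, rule UnI2, rule CollectI, intro exI conjI, rule refl, assumption+)
    apply (rule UnI1, rule UnI1, rule UnI2, rule CollectI, intro exI conjI, rule refl, assumption+)
   apply (rule UnI1, rule UnI2, rule CollectI, intro exI conjI, rule refl, assumption+)
  apply (rule UnI2, rule CollectI, intro exI conjI, rule refl, assumption+)
  done

text \<open>
  Every relation can be moved to the first vertex by reordering, and both actions are instances of
  changing the listings of a vertex.  So three conditions, none of which mentions a permutation, replace the five
  families of relations.  The supports of the relations are bounded along the way.
\<close>

lemma level_compatibleI:
  assumes P: "sbimodule P" and A: "admissible P G K" and M: "kmod M" and \<phi>: "\<And>g. g \<in> G \<Longrightarrow> \<phi> g \<in> carrier M"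
    and m: "\<And>xs ys. K xs \<in> G \<Longrightarrow> mset xs = mset ys \<Longrightarrow> \<phi> (K xs) = \<phi> (K ys)"
    and v: "\<And>v v' ys. K (v # ys) \<in> G \<Longrightarrow> veq P v v' \<Longrightarrow> \<phi> (K (v # ys)) = \<phi> (K (v' # ys))"
    and l: "\<And>v ys. K (v # ys) \<in> G \<Longrightarrow>
      linear_map (md P (length (outs v)) (length (ins v))) M (\<lambda>p. \<phi> (K (Vertex (outs v) (ins v) p # ys)))"
    and r: "r \<in> level_rels P G K"
  shows "lin M \<phi> r = \<zero>\<^bsub>M\<^esub>" "Poly_Mapping.keys r \<subseteq> G"
proof -
  note a = admissibleD[OF A] and S = sbimoduleD[OF P]
  have front: "K (w # xs @ ys) \<in> G" "\<phi> (K (xs @ w # ys)) = \<phi> (K (w # xs @ ys))" if "K (xs @ w # ys) \<in> G" for xs w ys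
  proof -
    have "mset (xs @ w # ys) = mset (w # xs @ ys)" by simp
    thus "K (w # xs @ ys) \<in> G" "\<phi> (K (xs @ w # ys)) = \<phi> (K (w # xs @ ys))"
      using a(3)[OF that] m[OF that] by blast+
  qed
  have diff: "lin M \<phi> (gen g - gen h) = \<zero>\<^bsub>M\<^esub> \<and> Poly_Mapping.keys (gen g - gen h :: _ \<Rightarrow>\<^sub>0 'a) \<subseteq> G"
    if "g \<in> G" "h \<in> G" "\<phi> g = \<phi> h" for g h
    using lin_diff_eq_zero[of M G \<phi> "gen g" "gen h"] lin_gen[of M G \<phi>] that M \<phi>
      keys_diff[of "gen g" "gen h"] by auto
  have vq: "lin M \<phi> (gen (K (xs @ w # ys)) - gen (K (xs @ w' # ys))) = \<zero>\<^bsub>M\<^esub> \<and>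
      Poly_Mapping.keys (gen (K (xs @ w # ys)) - gen (K (xs @ w' # ys)) :: _ \<Rightarrow>\<^sub>0 'a) \<subseteq> G"
    if "K (xs @ w # ys) \<in> G" "veq P w w'" for xs w w' ys
  proof -
    have "K (xs @ w' # ys) \<in> G" using a(2)[OF that(1)] that(2) by (simp add: veq_def)
    thus ?thesis using diff that front[of xs w ys] front[of xs w' ys] v[of w "xs @ ys" w'] by metis
  qed
  from r have "lin M \<phi> r = \<zero>\<^bsub>M\<^esub> \<and> Poly_Mapping.keys r \<subseteq> G"
  proof (cases rule: level_rels_cases)
    case (add xs os "is" p q ys)
    let ?K = "\<lambda>p. K (xs @ Vertex os is p # ys)"
    have pq: "p \<in> elts P (length os) (length is)" "q \<in> elts P (length os) (length is)"
      using a(1)[OF add(2)] a(1)[OF add(3)] by (auto simp: well_decorated_def)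
    hence s: "?K (p \<oplus>\<^bsub>md P (length os) (length is)\<^esub> q) \<in> G"
      using admissible_deco[OF A add(2)] kmod_facts(4)[OF S(1)] by simp
    let ?\<phi> = "\<lambda>p. \<phi> (K (Vertex os is p # xs @ ys))"
    have L: "linear_map (md P (length os) (length is)) M ?\<phi>"
      using l[OF front(1)[OF add(2)]] by simp
    have "lin M \<phi> (gen (?K p) + gen (?K q)) = \<phi> (?K p) \<oplus>\<^bsub>M\<^esub> \<phi> (?K q)"
      using add \<phi> by (simp add: lin_add[of M G] lin_gen[of M G] M)
    also have "\<dots> = lin M \<phi> (gen (?K (p \<oplus>\<^bsub>md P (length os) (length is)\<^esub> q)))"
      using linear_mapD(2)[OF L pq] add s \<phi> by (simp add: lin_gen[of M G] M front)
    finally have "lin M \<phi> (gen (?K (p \<oplus>\<^bsub>md P (length os) (length is)\<^esub> q)) - (gen (?K p) + gen (?K q))) = \<zero>\<^bsub>M\<^esub>"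
      using add s keys_add[of "gen (?K p) :: _ \<Rightarrow>\<^sub>0 'a" "gen (?K q)"] \<phi> by (intro lin_diff_eq_zero[of M G] M) auto
    moreover have "Poly_Mapping.keys r \<subseteq> G"
      unfolding add(1) using add s keys_diff[of "gen (?K (p \<oplus>\<^bsub>md P (length os) (length is)\<^esub> q)) :: _ \<Rightarrow>\<^sub>0 'a" "gen (?K p)"]
        keys_diff[of "gen (?K (p \<oplus>\<^bsub>md P (length os) (length is)\<^esub> q)) - gen (?K p) :: _ \<Rightarrow>\<^sub>0 'a" "gen (?K q)"] by auto
    ultimately show ?thesis by (simp add: add(1) diff_diff_add)
  next
    case (scale xs os "is" c p ys)
    let ?K = "\<lambda>p. K (xs @ Vertex os is p # ys)"
    have p: "p \<in> elts P (length os) (length is)"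
      using a(1)[OF scale(2)] by (auto simp: well_decorated_def)
    hence s: "?K (c \<odot>\<^bsub>md P (length os) (length is)\<^esub> p) \<in> G"
      using admissible_deco[OF A scale(2)] kmod_facts(5)[OF S(1)] by simp
    have L: "linear_map (md P (length os) (length is)) M (\<lambda>p. \<phi> (K (Vertex os is p # xs @ ys)))"
      using l[OF front(1)[OF scale(2)]] by simp
    have k: "Poly_Mapping.keys (pscale c (gen (?K p))) \<subseteq> G"
      using keys_pscale[of c "gen (?K p)"] scale(2) by auto
    have "lin M \<phi> (pscale c (gen (?K p))) = c \<odot>\<^bsub>M\<^esub> \<phi> (?K p)"
      using scale \<phi> by (simp add: lin_scale[of M G] lin_gen[of M G] M)
    also have "\<dots> = lin M \<phi> (gen (?K (c \<odot>\<^bsub>md P (length os) (length is)\<^esub> p)))"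
      using linear_mapD(3)[OF L p] scale s \<phi> by (simp add: lin_gen[of M G] M front)
    finally have "lin M \<phi> r = \<zero>\<^bsub>M\<^esub>"
      unfolding scale(1) using s k \<phi> by (intro lin_diff_eq_zero[of M G] M) auto
    thus ?thesis
      using k s keys_diff[of "gen (?K (c \<odot>\<^bsub>md P (length os) (length is)\<^esub> p)) :: _ \<Rightarrow>\<^sub>0 'a" "pscale c (gen (?K p))"]
      by (auto simp: scale(1))
  next
    case (lact xs os "is" \<sigma> p ys)
    have w: "p \<in> elts P (length os) (length is)" "distinct os" "distinct is"
      using a(1)[OF lact(3)] by (simp_all add: well_decorated_def)
    have "K (xs @ Vertex os is (sbimod.lact P (length os) (length is) \<sigma> p) # ys) \<in> G"
      using admissible_deco[OF A lact(3)] act_closed(1)[OF P w(1) lact(2)] by simp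
    thus ?thesis unfolding lact(1) using vq veq_lact[OF P w lact(2)] by blast
  next
    case (ract xs os "is" \<tau> p ys)
    have w: "p \<in> elts P (length os) (length is)" "distinct os" "distinct is"
      using a(1)[OF ract(3)] by (simp_all add: well_decorated_def)
    have "K (xs @ Vertex os (permute_list \<tau> is) (sbimod.ract P (length os) (length is) \<tau> p) # ys) \<in> G"
      using a(2)[OF ract(3), of "Vertex os (permute_list \<tau> is) (sbimod.ract P (length os) (length is) \<tau> p)"]
        act_closed(2)[OF P w(1) ract(2)] w tr_permute_list(1)[OF w(3) ract(2)]
      by (simp add: well_decorated_def reord_refl)
    thus ?thesis unfolding ract(1) using vq veq_ract[OF P w ract(2)] by blast
  next
    case (mset xs ys)
    thus ?thesis using diff[OF mset(3,4) m[OF mset(3,2)]] by simp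
  qed
  thus "lin M \<phi> r = \<zero>\<^bsub>M\<^esub>" "Poly_Mapping.keys r \<subseteq> G" by auto
qed

lemma leveqI: "list_all2 (veq P) xs ys \<Longrightarrow> leveq P xs ys"
  by (auto simp: leveq_def)

text \<open>Conversely, the class of a graph has these properties.\<close>

context
  fixes P :: "('k::field, 'a, 'x) sbimod_scheme" and G :: "'g set" and K R
  assumes P: "sbimodule P" and A: "admissible P G K" and R: "level_rels P G K \<subseteq> R"
begin

lemma class_mset:
  assumes "K xs \<in> G" "mset xs = mset ys" shows "coset R (gen (K xs)) = coset R (gen (K ys))"
  by (intro coset_relation(1) subsetD[OF R] level_relsI(5) assms admissibleD(3)[OF A assms])

lemma class_linear:
  assumes "K (xs @ v # ys) \<in> G"
  shows "linear_map (md P (length (outs v)) (length (ins v))) (presented G R)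
    (\<lambda>p. coset R (gen (K (xs @ Vertex (outs v) (ins v) p # ys))))"
proof (rule linear_mapI)
  fix p assume p: "p \<in> elts P (length (outs v)) (length (ins v))"
  note k = admissible_deco[OF A assms]
  show "coset R (gen (K (xs @ Vertex (outs v) (ins v) p # ys))) \<in> carrier (presented G R)"
    using k[OF p] by (rule gen_coset_in)
  show "coset R (gen (K (xs @ Vertex (outs v) (ins v) (c \<odot>\<^bsub>md P (length (outs v)) (length (ins v))\<^esub> p) # ys))) =
      c \<odot>\<^bsub>presented G R\<^esub> coset R (gen (K (xs @ Vertex (outs v) (ins v) p # ys)))" for c
    by (intro coset_relation(3) subsetD[OF R] level_relsI(2) k[OF p])
  fix q assume q: "q \<in> elts P (length (outs v)) (length (ins v))"
  show "coset R (gen (K (xs @ Vertex (outs v) (ins v) (p \<oplus>\<^bsub>md P (length (outs v)) (length (ins v))\<^esub> q) # ys))) =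
      coset R (gen (K (xs @ Vertex (outs v) (ins v) p # ys))) \<oplus>\<^bsub>presented G R\<^esub>
      coset R (gen (K (xs @ Vertex (outs v) (ins v) q # ys)))"
    by (intro coset_relation(2) subsetD[OF R] level_relsI(1) k[OF p] k[OF q])
qed

text \<open>
  A change of both listings is a right action followed by a left action, that is, two relations.
\<close>

lemma class_veq:
  assumes g: "K (xs @ v # ys) \<in> G" and v: "veq P v v'"
  shows "coset R (gen (K (xs @ v # ys))) = coset R (gen (K (xs @ v' # ys)))" "K (xs @ v' # ys) \<in> G"
proof -
  let ?os = "outs v" and ?is = "ins v" and ?os' = "outs v'" and ?is' = "ins v'" and ?p = "deco v'"
  have r: "reord ?os ?os'" "reord ?is ?is'" and w: "well_decorated P v'"
    and d: "deco v = recoord P ?os ?is ?os' ?is' ?p"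
    using v by (auto simp: veq_def)
  note l = reord_length[OF r(1)] reord_length[OF r(2)]
  let ?q = "ract P (length ?os) (length ?is) (tr ?is' ?is) ?p"
  have p: "tr ?os ?os' permutes {..<length ?os}" "tr ?is' ?is permutes {..<length ?is'}"
    using tr_permutes r reord_sym by blast+
  have q: "?q \<in> elts P (length ?os) (length ?is)"
    using act_closed(2)[OF P, of ?p] w p l by (simp add: well_decorated_def)
  have v_eq: "v = Vertex ?os ?is (lact P (length ?os) (length ?is) (tr ?os ?os') ?q)"
    using d by (cases v) (simp add: recoord_def)
  have g1: "K (xs @ Vertex ?os ?is ?q # ys) \<in> G" using admissible_deco[OF A g q] .
  have "coset R (gen (K (xs @ v # ys))) = coset R (gen (K (xs @ Vertex (permute_list (tr ?os ?os') ?os) ?is ?q # ys)))"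
    by (subst v_eq, intro coset_relation(1) subsetD[OF R] level_relsI(3) g1 p)
  also have "permute_list (tr ?os ?os') ?os = ?os'" using permute_list_tr[OF r(1)] .
  also have "Vertex ?os' ?is ?q = Vertex ?os' (permute_list (tr ?is' ?is) ?is') ?q"
    using permute_list_tr[OF reord_sym[OF r(2)]] by simp
  finally have 1: "coset R (gen (K (xs @ v # ys))) =
    coset R (gen (K (xs @ Vertex ?os' (permute_list (tr ?is' ?is) ?is') ?q # ys)))" .
  show g2: "K (xs @ v' # ys) \<in> G" using admissibleD(2)[OF A g r w] .
  have "?q = ract P (length ?os') (length ?is') (tr ?is' ?is) ?p" using l by simp
  moreover have "coset R (gen (K (xs @ Vertex ?os' (permute_list (tr ?is' ?is) ?is')
      (ract P (length ?os') (length ?is') (tr ?is' ?is) ?p) # ys))) = coset R (gen (K (xs @ Vertex ?os' ?is' ?p # ys)))"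
    using g2 by (intro coset_relation(1) subsetD[OF R] level_relsI(4) p) simp
  ultimately show "coset R (gen (K (xs @ v # ys))) = coset R (gen (K (xs @ v' # ys)))"
    using 1 by simp
qed

lemma class_leveq:
  assumes "K xs \<in> G" "leveq P xs ys"
  shows "coset R (gen (K xs)) = coset R (gen (K ys))" "K ys \<in> G"
proof -
  have *: "list_all2 (veq P) us ws \<Longrightarrow> K (us0 @ us) \<in> G \<Longrightarrow>
    coset R (gen (K (us0 @ us))) = coset R (gen (K (us0 @ ws))) \<and> K (us0 @ ws) \<in> G" for us0 us ws
  proof (induction us ws arbitrary: us0 rule: list_all2_induct)
    case (Cons u us w ws)
    have "coset R (gen (K (us0 @ u # us))) = coset R (gen (K (us0 @ w # us)))" "K (us0 @ w # us) \<in> G"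
      using class_veq[OF Cons(4,1)] by auto
    thus ?case using Cons(3)[of "us0 @ [w]"] by simp
  qed simp
  obtain zs where zs: "list_all2 (veq P) xs zs" "mset zs = mset ys" using assms(2) by (auto simp: leveq_def)
  have "coset R (gen (K xs)) = coset R (gen (K zs))" "K zs \<in> G"
    using *[OF zs(1), of "[]"] assms by simp_all
  thus "coset R (gen (K xs)) = coset R (gen (K ys))" "K ys \<in> G"
    using class_mset[OF _ zs(2)] admissibleD(3)[OF A _ zs(2)] by simp_all
qed

end

text \<open>
  Renaming edges and mapping decorations in one step: the group actions rename and functoriality maps
  decorations, so that one compatibility lemma covers both.
\<close>

definition vrelabel :: "(nat \<Rightarrow> nat) \<Rightarrow> (nat \<Rightarrow> nat) \<Rightarrow> ('a, 'b) mor \<Rightarrow> 'a vertex \<Rightarrow> 'b vertex" where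
  "vrelabel f g h v = relabel f g (vmap h v)"

lemma vertex_simps [simp]:
  "outs (relabel f g v) = map f (outs v)" "ins (relabel f g v) = map g (ins v)" "deco (relabel f g v) = deco v"
  "outs (vmap h v) = outs v" "ins (vmap h v) = ins v"
  "deco (vmap h v) = h (length (outs v)) (length (ins v)) (deco v)"
  "outs (vrelabel f g h v) = map f (outs v)" "ins (vrelabel f g h v) = map g (ins v)"
  "deco (vrelabel f g h v) = h (length (outs v)) (length (ins v)) (deco v)"
  by (simp_all add: relabel_def vmap_def vrelabel_def)

lemma vertex_eqI: "outs v = outs w \<Longrightarrow> ins v = ins w \<Longrightarrow> deco v = deco w \<Longrightarrow> v = w"
  by (cases v; cases w) simp

lemma all_simps [simp]:
  "all_outs (map (relabel f g) vs) = map f (all_outs vs)" "all_ins (map (relabel f g) vs) = map g (all_ins vs)"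
  "all_outs (map (vmap h) vs) = all_outs vs" "all_ins (map (vmap h) vs) = all_ins vs"
  "all_outs (map (vrelabel f g h) vs) = map f (all_outs vs)" "all_ins (map (vrelabel f g h) vs) = map g (all_ins vs)"
  by (induction vs) auto

lemma vrelabel_id: "vrelabel f g (\<lambda>_ _ x. x) = relabel f g" "vrelabel id id h = vmap h"
  by (auto intro!: ext vertex_eqI)

lemma veq_vrelabel:
  assumes "sbimodule P" "sbimod_map P P' h" "veq P v v'" "inj_on f (set (outs v))" "inj_on g (set (ins v))"
  shows "veq P' (vrelabel f g h v) (vrelabel f g h v')"
proof -
  have r: "reord (outs v) (outs v')" "reord (ins v) (ins v')" "deco v' \<in> elts P (length (outs v')) (length (ins v'))"
    "deco v = recoord P (outs v) (ins v) (outs v') (ins v') (deco v')"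
    using assms(3) by (auto simp: veq_def well_decorated_def)
  have "inj_on g (set (ins v'))" using r assms(5) by (simp add: reord_def)
  thus ?thesis
    using recoord_map[OF assms(1,2) r(1-3)] sbimod_mapD(2)[OF assms(2) r(3)] reord_map[OF assms(4) r(1)] reord_map[OF assms(5) r(2)]
      r(4) tr_map[OF assms(4) r(1)] tr_map[OF _ reord_sym[OF r(2)], of g]
    by (simp add: veq_def well_decorated_def recoord_def)
qed

lemma leveq_vrelabel:
  assumes P: "sbimodule P" "sbimod_map P P' h" and l: "leveq P xs ys"
    and inj: "inj_on f (set (all_outs xs))" "inj_on g (set (all_ins xs))"
  shows "leveq P' (map (vrelabel f g h) xs) (map (vrelabel f g h) ys)"
proof -
  obtain zs where zs: "list_all2 (veq P) xs zs" "mset zs = mset ys" using l by (auto simp: leveq_def)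
  from zs(1) inj have "list_all2 (veq P') (map (vrelabel f g h) xs) (map (vrelabel f g h) zs)"
  proof (induction rule: list_all2_induct)
    case (Cons x xs y ys)
    thus ?case by (auto intro!: veq_vrelabel[OF P] simp: inj_on_Un)
  qed simp
  moreover have "mset (map (vrelabel f g h) zs) = mset (map (vrelabel f g h) ys)"
    using zs(2) by (metis mset_map)
  ultimately show ?thesis unfolding leveq_def by blast
qed

text \<open>
  The source of all maps between presented modules that rename edges and map decorations: the actions,
  functoriality, and, with a fixed part of the level inside \<open>K'\<close>, juxtaposition.
\<close>

lemma level_compatible_map:
  assumes P: "sbimodule P" "sbimodule P'" and h: "sbimod_map P P' h" and A: "admissible P G K"
    and A': "admissible P' G' K'" and R': "level_rels P' G' K' \<subseteq> R'"
    and T: "\<And>xs. K xs \<in> G \<Longrightarrow> T (K xs) = K' (map (vrelabel f g h) xs)" "\<And>x. x \<in> G \<Longrightarrow> T x \<in> G'"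
    and r: "r \<in> level_rels P G K"
  shows "lin (presented G' R') (\<lambda>x. coset R' (gen (T x))) r = \<zero>\<^bsub>presented G' R'\<^esub>"
proof (rule level_compatibleI(1)[OF P(1) A presented_module _ _ _ _ r])
  note cl = class_mset[OF P(2) A' R'] class_veq(1)[OF P(2) A' R'] class_linear[OF P(2) A' R']
  fix xs ys assume x: "K xs \<in> G" "mset xs = mset ys"
  moreover have "K ys \<in> G" using x admissibleD(3)[OF A] by blast
  ultimately show "coset R' (gen (T (K xs))) = coset R' (gen (T (K ys)))"
    using cl(1)[of "map (vrelabel f g h) xs" "map (vrelabel f g h) ys"] T by (metis mset_map)
next
  note cl = class_mset[OF P(2) A' R'] class_veq(1)[OF P(2) A' R'] class_linear[OF P(2) A' R']
  fix v ys assume x: "K (v # ys) \<in> G"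
  have g': "K' ([] @ vrelabel f g h v # map (vrelabel f g h) ys) \<in> G'" using T(1)[of "v # ys"] T(2)[OF x] x by simp
  have d: "distinct (map f (outs v))" "distinct (map g (ins v))"
    using admissibleD(1)[OF A' g'] by simp_all
  show "coset R' (gen (T (K (v # ys)))) = coset R' (gen (T (K (v' # ys))))" if "veq P v v'" for v'
  proof -
    have "K (v' # ys) \<in> G" using admissibleD(2)[OF A, of "[]" v ys v'] x that by (simp add: veq_def)
    moreover have "veq P' (vrelabel f g h v) (vrelabel f g h v')"
      using veq_vrelabel[OF P(1) h that] d by (simp add: distinct_map)
    ultimately show ?thesis using cl(2)[OF g'] T(1) x by simp
  qed
  have eq: "T (K (Vertex (outs v) (ins v) p # ys)) =
      K' (Vertex (map f (outs v)) (map g (ins v)) (h (length (outs v)) (length (ins v)) p) # map (vrelabel f g h) ys)"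
    if "p \<in> elts P (length (outs v)) (length (ins v))" for p
    using T(1)[OF admissible_deco[OF A, of "[]" v ys p, simplified, OF x that]]
    by (simp add: vrelabel_def relabel_def vmap_def)
  show "linear_map (md P (length (outs v)) (length (ins v))) (presented G' R')
    (\<lambda>p. coset R' (gen (T (K (Vertex (outs v) (ins v) p # ys)))))"
    using linear_map_cong[OF linear_map_comp[OF sbimod_mapD(1)[OF h] cl(3)[OF g', simplified]] _ sbimoduleD(1)[OF P(1)]]
      eq by simp
qed (use T in \<open>auto intro: gen_coset_in\<close>)

section \<open>Levels and connected graphs\<close>

text \<open>
  The conditions of \<open>is_level\<close> apart from the decorations and the prescribed sets of edges.
\<close>

definition lvl :: "'a vertex list \<Rightarrow> bool" where
  "lvl vs \<longleftrightarrow> (\<forall>v\<in>set vs. outs v \<noteq> [] \<and> ins v \<noteq> []) \<and> distinct (all_outs vs) \<and> distinct (all_ins vs)"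

definition matching :: "'b vertex list \<Rightarrow> 'a vertex list \<Rightarrow> bool" where
  "matching us vs \<longleftrightarrow> lvl us \<and> lvl vs \<and> set (all_ins us) = set (all_outs vs)"

lemma is_level_iff:
  "is_level P Z Y vs \<longleftrightarrow> lvl vs \<and> (\<forall>v\<in>set vs. well_decorated P v) \<and> set (all_outs vs) = Z \<and> set (all_ins vs) = Y"
  by (auto simp: is_level_def lvl_def well_decorated_def)

lemma mset_concat_map: "mset (concat (map f xs)) = \<Sum>\<^sub># (image_mset (\<lambda>x. mset (f x)) (mset xs))"
  by (induction xs) auto

lemma mset_all:
  assumes "mset us = mset vs"
  shows "mset (all_outs us) = mset (all_outs vs)" "mset (all_ins us) = mset (all_ins vs)" "set us = set vs"
    "set (all_outs us) = set (all_outs vs)" "set (all_ins us) = set (all_ins vs)"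
  using assms mset_eq_setD[OF assms] by (simp_all add: mset_concat_map)

lemma lvl_mset: "mset us = mset vs \<Longrightarrow> lvl us \<longleftrightarrow> lvl vs"
  using mset_all[of us vs] by (auto simp: lvl_def dest: mset_eq_imp_distinct_iff)

lemma lvl_Cons: "lvl (v # vs) \<longleftrightarrow> outs v \<noteq> [] \<and> ins v \<noteq> [] \<and> distinct (outs v) \<and> distinct (ins v) \<and> lvl vs \<and>
    set (outs v) \<inter> set (all_outs vs) = {} \<and> set (ins v) \<inter> set (all_ins vs) = {}"
  by (auto simp: lvl_def)

lemma lvl_append: "lvl (us @ vs) \<longleftrightarrow> lvl us \<and> lvl vs \<and>
    set (all_outs us) \<inter> set (all_outs vs) = {} \<and> set (all_ins us) \<inter> set (all_ins vs) = {}"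
  by (auto simp: lvl_def)

lemma lvl_Nil [simp]: "lvl []" by (simp add: lvl_def)

lemma lvl_relabel:
  assumes "lvl vs" "inj_on f (set (all_outs vs))" "inj_on g (set (all_ins vs))"
  shows "lvl (map (vrelabel f g h) vs)"
  using assms unfolding lvl_def all_simps by (auto simp: distinct_map)

lemma lvl_vmap: "lvl (map (vmap h) vs) = lvl vs"
  unfolding lvl_def all_simps by simp

lemma lvl_distinct: "lvl vs \<Longrightarrow> distinct vs"
proof (induction vs)
  case (Cons v vs)
  then obtain e where e: "e \<in> set (outs v)" by (cases "outs v") (auto simp: lvl_Cons)
  have "v \<notin> set vs" using Cons(2) e unfolding lvl_Cons by auto
  thus ?case using Cons by (simp add: lvl_Cons)
qed simp

lemma distinct_concat_unique:
  "distinct (concat (map f xs)) \<Longrightarrow> x \<in> set xs \<Longrightarrow> y \<in> set xs \<Longrightarrow> e \<in> set (f x) \<Longrightarrow> e \<in> set (f y) \<Longrightarrow> x = y"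
  by (induction xs) auto

lemma lvl_unique:
  assumes "lvl vs" "v \<in> set vs" "w \<in> set vs"
  shows "e \<in> set (outs v) \<Longrightarrow> e \<in> set (outs w) \<Longrightarrow> v = w" "e \<in> set (ins v) \<Longrightarrow> e \<in> set (ins w) \<Longrightarrow> v = w"
  using assms distinct_concat_unique[of outs vs v w e] distinct_concat_unique[of ins vs v w e]
  by (simp_all add: lvl_def)

lemma lvl_same_edges:
  assumes "lvl (us @ v # ws)" "reord (outs v) (outs v')" "reord (ins v) (ins v')"
  shows "lvl (us @ v' # ws)"
  using assms by (auto simp: lvl_Cons lvl_append reord_def)

definition in_sets :: "'a vertex list \<Rightarrow> nat set set" where
  "in_sets us = (\<lambda>u. set (ins u)) ` set us"

definition out_sets :: "'a vertex list \<Rightarrow> nat set set" where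
  "out_sets vs = (\<lambda>v. set (outs v)) ` set vs"

text \<open>
  Connectedness without paths: a set of internal edges that contains all or none of the internal edges of
  every vertex contains all or none of the internal edges.  Such sets can be restricted to pieces and extended from
  contracted graphs by set algebra.  For three levels there is one set for each of the two places between
  levels, and a middle vertex ties its outputs to its inputs.
\<close>

definition conn2 :: "'b vertex list \<Rightarrow> 'a vertex list \<Rightarrow> bool" where
  "conn2 us vs \<longleftrightarrow> us \<noteq> [] \<and>
     (\<forall>C. (\<forall>Z\<in>in_sets us \<union> out_sets vs. Z \<subseteq> C \<or> Z \<inter> C = {}) \<longrightarrow>
       set (all_ins us) \<subseteq> C \<or> set (all_ins us) \<inter> C = {})"

definition conn3 :: "'c vertex list \<Rightarrow> 'b vertex list \<Rightarrow> 'a vertex list \<Rightarrow> bool" where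
  "conn3 us vs ws \<longleftrightarrow> us \<noteq> [] \<and>
     (\<forall>C C'. (\<forall>u\<in>set us. set (ins u) \<subseteq> C \<or> set (ins u) \<inter> C = {}) \<and>
        (\<forall>v\<in>set vs. (set (outs v) \<subseteq> C \<and> set (ins v) \<subseteq> C') \<or> (set (outs v) \<inter> C = {} \<and> set (ins v) \<inter> C' = {})) \<and>
        (\<forall>w\<in>set ws. set (outs w) \<subseteq> C' \<or> set (outs w) \<inter> C' = {}) \<longrightarrow>
       (set (all_ins us) \<subseteq> C \<and> set (all_ins vs) \<subseteq> C') \<or> (set (all_ins us) \<inter> C = {} \<and> set (all_ins vs) \<inter> C' = {}))"

text \<open>
  The nodes linked to a given one are the smallest set that contains it and is closed under adjacency.
\<close>

lemma connected_graph_iff: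
  "connected_graph L \<longleftrightarrow> nodes L \<noteq> {} \<and>
     (\<forall>S. S \<subseteq> nodes L \<and> S \<noteq> {} \<and> (\<forall>x y. (x, y) \<in> adjacent L \<longrightarrow> (x \<in> S \<longleftrightarrow> y \<in> S)) \<longrightarrow> S = nodes L)"
proof
  assume c: "connected_graph L"
  have "S = nodes L" if S: "S \<subseteq> nodes L" "S \<noteq> {}" "\<forall>x y. (x, y) \<in> adjacent L \<longrightarrow> (x \<in> S \<longleftrightarrow> y \<in> S)" for S
  proof -
    obtain x where x: "x \<in> S" using S by blast
    have "y \<in> S" if "(x, y) \<in> linked L" for y
      using that unfolding linked_def by (induction rule: rtrancl_induct) (use x S in auto)
    thus ?thesis using c S x unfolding connected_graph_def by blast
  qed
  thus "nodes L \<noteq> {} \<and> (\<forall>S. S \<subseteq> nodes L \<and> S \<noteq> {} \<and> (\<forall>x y. (x, y) \<in> adjacent L \<longrightarrow> (x \<in> S \<longleftrightarrow> y \<in> S)) \<longrightarrow> S = nodes L)"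
    using c unfolding connected_graph_def by blast
next
  assume r: "nodes L \<noteq> {} \<and> (\<forall>S. S \<subseteq> nodes L \<and> S \<noteq> {} \<and> (\<forall>x y. (x, y) \<in> adjacent L \<longrightarrow> (x \<in> S \<longleftrightarrow> y \<in> S)) \<longrightarrow> S = nodes L)"
  have "(x, y) \<in> linked L" if "x \<in> nodes L" "y \<in> nodes L" for x y
  proof -
    let ?S = "{y \<in> nodes L. (x, y) \<in> linked L}"
    have "?S = nodes L"
    proof (rule r[THEN conjunct2, rule_format], intro conjI allI impI)
      have "x \<in> ?S" using that by (simp add: linked_def)
      thus "?S \<noteq> {}" by blast
      fix y z assume a: "(y, z) \<in> adjacent L"
      hence "y \<in> nodes L" "z \<in> nodes L" by (auto simp: adjacent_def)
      moreover have "(x, y) \<in> linked L \<longleftrightarrow> (x, z) \<in> linked L"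
        using a unfolding linked_def by (meson UnCI converse.intros rtrancl.rtrancl_into_rtrancl)
      ultimately show "y \<in> ?S \<longleftrightarrow> z \<in> ?S" by simp
    qed auto
    thus ?thesis using that by blast
  qed
  thus "connected_graph L" using r unfolding connected_graph_def by blast
qed

lemma nodes2: "(l, s) \<in> nodes [A, B] \<longleftrightarrow> l = 0 \<and> s \<in> set A \<or> l = 1 \<and> s \<in> set B"
  by (auto simp: nodes_def less_Suc_eq)

lemma nodes3: "(l, s) \<in> nodes [A, B, C] \<longleftrightarrow> l = 0 \<and> s \<in> set A \<or> l = 1 \<and> s \<in> set B \<or> l = 2 \<and> s \<in> set C"
  by (auto simp: nodes_def less_Suc_eq numeral_2_eq_2)

lemma adjacent2: "((l, s), (k, t)) \<in> adjacent [A, B] \<longleftrightarrow>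
    l = 0 \<and> k = 1 \<and> s \<in> set A \<and> t \<in> set B \<and> set (snd s) \<inter> set (fst t) \<noteq> {}"
  by (cases s; cases t) (auto simp: adjacent_def nodes2)

lemma adjacent3: "((l, s), (k, t)) \<in> adjacent [A, B, C] \<longleftrightarrow> set (snd s) \<inter> set (fst t) \<noteq> {} \<and>
    (l = 0 \<and> k = 1 \<and> s \<in> set A \<and> t \<in> set B \<or> l = 1 \<and> k = 2 \<and> s \<in> set B \<and> t \<in> set C)"
  by (cases s; cases t) (auto simp: adjacent_def nodes3)

text \<open>
  Since every vertex has an internal edge and adjacent vertices share one, sets of nodes closed under
  adjacency correspond to sets of internal edges that no vertex cuts.
\<close>

lemma connected_graph2:
  assumes m: "matching us vs"
  shows "connected_graph [map shape us, map shape vs] \<longleftrightarrow> conn2 us vs"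
proof
  let ?L = "[map shape us, map shape vs]"
  assume c: "connected_graph ?L"
  have "set (all_ins us) \<subseteq> C" if C: "\<forall>Z\<in>in_sets us \<union> out_sets vs. Z \<subseteq> C \<or> Z \<inter> C = {}" and ne: "set (all_ins us) \<inter> C \<noteq> {}" for C
  proof -
    let ?S = "{(l, s) \<in> nodes ?L. l = 0 \<and> set (snd s) \<subseteq> C \<or> l = 1 \<and> set (fst s) \<subseteq> C}"
    obtain u where u: "u \<in> set us" "set (ins u) \<subseteq> C" using C ne by (auto simp: in_sets_def)
    have "?S = nodes ?L"
    proof (rule c[unfolded connected_graph_iff, THEN conjunct2, rule_format], intro conjI allI impI)
      have "(0, shape u) \<in> ?S" using u by (auto simp: nodes2)
      thus "?S \<noteq> {}" by blast
      fix x y assume a: "(x, y) \<in> adjacent ?L"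
      then obtain u v where xy: "x = (0, shape u)" "y = (1, shape v)" "u \<in> set us" "v \<in> set vs" "set (ins u) \<inter> set (outs v) \<noteq> {}"
        by (cases x; cases y) (auto simp: adjacent2)
      hence "set (ins u) \<subseteq> C \<longleftrightarrow> set (outs v) \<subseteq> C" using C unfolding in_sets_def out_sets_def by blast
      thus "x \<in> ?S \<longleftrightarrow> y \<in> ?S" using xy by (auto simp: nodes2)
    qed auto
    hence "\<forall>u\<in>set us. (0, shape u) \<in> ?S" by (simp add: nodes2)
    thus ?thesis by (auto simp: nodes2)
  qed
  moreover have "us \<noteq> []"
  proof
    assume "us = []"
    moreover from this m have "vs = []" by (cases vs) (auto simp: matching_def lvl_Cons)
    ultimately show False using c by (auto simp: connected_graph_def nodes2)
  qed
  ultimately show "conn2 us vs" unfolding conn2_def by blast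
next
  let ?L = "[map shape us, map shape vs]"
  assume c: "conn2 us vs"
  have l: "lvl us" "lvl vs" "set (all_ins us) = set (all_outs vs)" using m by (auto simp: matching_def)
  have "S = nodes ?L" if S: "S \<subseteq> nodes ?L" "S \<noteq> {}" "\<forall>x y. (x, y) \<in> adjacent ?L \<longrightarrow> (x \<in> S \<longleftrightarrow> y \<in> S)" for S
  proof -
    have S': "(0, shape u) \<in> S \<longleftrightarrow> (1, shape v) \<in> S" if "u \<in> set us" "v \<in> set vs" "e \<in> set (ins u)" "e \<in> set (outs v)" for u v e
      using S(3)[rule_format, of "(0, shape u)" "(1, shape v)"] that by (auto simp: adjacent2)
    have up: "\<exists>u\<in>set us. e \<in> set (ins u)" if "v \<in> set vs" "e \<in> set (outs v)" for v e
      using l(3) that by auto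
    have down: "\<exists>v\<in>set vs. e \<in> set (outs v)" if "u \<in> set us" "e \<in> set (ins u)" for u e
      using l(3) that by auto
    \<comment> \<open>the internal edges of the nodes in \<open>S\<close>\<close>
    define C where "C = {e. \<exists>u\<in>set us. (0, shape u) \<in> S \<and> e \<in> set (ins u)}"
    have CS: "(0, shape u) \<in> S" if "u \<in> set us" "e \<in> set (ins u)" "e \<in> C" for u e
      using that lvl_unique(2)[OF l(1)] by (auto simp: C_def)
    have ne: "ins u \<noteq> []" if "u \<in> set us" for u using that l(1) by (auto simp: lvl_def)
    have ne': "outs v \<noteq> []" if "v \<in> set vs" for v using that l(2) by (auto simp: lvl_def)
    have "Z \<subseteq> C \<or> Z \<inter> C = {}" if "Z \<in> in_sets us" for Z
      using that CS unfolding in_sets_def C_def by blast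
    moreover have "Z \<subseteq> C \<or> Z \<inter> C = {}" if Z: "Z \<in> out_sets vs" for Z
    proof (rule disjCI)
      obtain v where v: "v \<in> set vs" "Z = set (outs v)" using Z by (auto simp: out_sets_def)
      assume "Z \<inter> C \<noteq> {}"
      then obtain e u where "e \<in> Z" "u \<in> set us" "(0, shape u) \<in> S" "e \<in> set (ins u)" by (auto simp: C_def)
      hence "(1, shape v) \<in> S" using S' v by blast
      thus "Z \<subseteq> C" using up[OF v(1)] S'[OF _ v(1)] v unfolding C_def by blast
    qed
    ultimately have "set (all_ins us) \<subseteq> C \<or> set (all_ins us) \<inter> C = {}" using c unfolding conn2_def by blast
    moreover obtain u where u: "u \<in> set us" "(0, shape u) \<in> S"
    proof -
      obtain l s where ls: "(l, s) \<in> S" using S by auto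
      hence "(l, s) \<in> nodes ?L" using S by blast
      then consider u where "u \<in> set us" "(l, s) = (0, shape u)" | v where "v \<in> set vs" "(l, s) = (1, shape v)"
        by (auto simp: nodes2)
      thus thesis
      proof cases
        case 2
        thus thesis using that S' ls up[OF 2(1) hd_in_set[OF ne'[OF 2(1)]]] hd_in_set[OF ne'[OF 2(1)]] by metis
      qed (use that ls in metis)
    qed
    moreover have "hd (ins u) \<in> set (all_ins us) \<inter> C"
      using u hd_in_set[OF ne[OF u(1)]] by (auto simp: C_def)
    ultimately have E: "set (all_ins us) \<subseteq> C" by (metis empty_iff)
    have uS: "(0, shape u) \<in> S" if u: "u \<in> set us" for u
      using CS[OF u hd_in_set[OF ne[OF u]]] hd_in_set[OF ne[OF u]] E u by auto
    have "(1, shape v) \<in> S" if v: "v \<in> set vs" for v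
      using up[OF v hd_in_set[OF ne'[OF v]]] S' v hd_in_set[OF ne'[OF v]] uS by blast
    with uS have "nodes ?L \<subseteq> S" by (auto simp: nodes2)
    thus ?thesis using S by blast
  qed
  moreover have "nodes ?L \<noteq> {}"
  proof -
    have "(0, shape (hd us)) \<in> nodes ?L" using c unfolding nodes2 conn2_def by simp
    thus ?thesis by blast
  qed
  ultimately show "connected_graph ?L" unfolding connected_graph_iff by blast
qed

lemma connected_graph3:
  assumes m: "matching us vs" "matching vs ws"
  shows "connected_graph [map shape us, map shape vs, map shape ws] \<longleftrightarrow> conn3 us vs ws"
proof
  let ?L = "[map shape us, map shape vs, map shape ws]"
  have l: "lvl us" "lvl vs" "lvl ws" "set (all_ins us) = set (all_outs vs)" "set (all_ins vs) = set (all_outs ws)"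
    using m by (auto simp: matching_def)
  {
    assume c: "connected_graph ?L"
    have key: "(set (all_ins us) \<subseteq> C \<and> set (all_ins vs) \<subseteq> C') \<or> (set (all_ins us) \<inter> C = {} \<and> set (all_ins vs) \<inter> C' = {})"
      if C: "\<forall>u\<in>set us. set (ins u) \<subseteq> C \<or> set (ins u) \<inter> C = {}"
        "\<forall>v\<in>set vs. (set (outs v) \<subseteq> C \<and> set (ins v) \<subseteq> C') \<or> (set (outs v) \<inter> C = {} \<and> set (ins v) \<inter> C' = {})"
        "\<forall>w\<in>set ws. set (outs w) \<subseteq> C' \<or> set (outs w) \<inter> C' = {}" for C C'
    proof -
      let ?S = "{(l, s) \<in> nodes ?L. l = 0 \<and> set (snd s) \<subseteq> C \<or> l = 1 \<and> set (fst s) \<subseteq> C \<or> l = 2 \<and> set (fst s) \<subseteq> C'}"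
      have ne: "v \<in> set vs \<Longrightarrow> outs v \<noteq> [] \<and> ins v \<noteq> []" for v using l(2) by (auto simp: lvl_def)
      have v2: "set (outs v) \<subseteq> C \<longleftrightarrow> set (ins v) \<subseteq> C'" if "v \<in> set vs" for v
      proof -
        have "hd (outs v) \<in> set (outs v)" "hd (ins v) \<in> set (ins v)" using ne[OF that] by auto
        thus ?thesis using C(2)[rule_format, OF that] by blast
      qed
      have all: "?S = nodes ?L" if nonempty: "?S \<noteq> {}"
      proof (rule c[unfolded connected_graph_iff, THEN conjunct2, rule_format], intro conjI allI impI)
        fix x y assume a: "(x, y) \<in> adjacent ?L"
        then obtain l k s t where xy: "x = (l, s)" "y = (k, t)" "set (snd s) \<inter> set (fst t) \<noteq> {}"
          "l = 0 \<and> k = 1 \<and> s \<in> shape ` set us \<and> t \<in> shape ` set vs \<or>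
           l = 1 \<and> k = 2 \<and> s \<in> shape ` set vs \<and> t \<in> shape ` set ws"
          by (cases x; cases y) (simp add: adjacent3)
        from xy(4) consider u v where "x = (0, shape u)" "y = (1, shape v)" "u \<in> set us" "v \<in> set vs" "set (ins u) \<inter> set (outs v) \<noteq> {}"
          | v w where "x = (1, shape v)" "y = (2, shape w)" "v \<in> set vs" "w \<in> set ws" "set (ins v) \<inter> set (outs w) \<noteq> {}"
          using xy(1-3) by (elim disjE conjE imageE) simp_all
        thus "x \<in> ?S \<longleftrightarrow> y \<in> ?S"
        proof cases
          case 1
          hence "set (ins u) \<subseteq> C \<longleftrightarrow> set (outs v) \<subseteq> C" using C by blast
          thus ?thesis using 1 by (auto simp: nodes3)
        next
          case 2
          hence "set (ins v) \<subseteq> C' \<longleftrightarrow> set (outs w) \<subseteq> C'" using C by blast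
          thus ?thesis using 2 v2 by (auto simp: nodes3)
        qed
      next
        show "?S \<noteq> {}" by (fact nonempty)
      qed auto
      show ?thesis
      proof (cases "?S = {}")
        case True
        hence "\<forall>u\<in>set us. (0, shape u) \<notin> ?S" "\<forall>v\<in>set vs. (1, shape v) \<notin> ?S" by blast+
        hence "\<forall>u\<in>set us. \<not> set (ins u) \<subseteq> C" "\<forall>v\<in>set vs. \<not> set (outs v) \<subseteq> C" by (simp_all add: nodes3)
        hence "\<forall>u\<in>set us. set (ins u) \<inter> C = {}" "\<forall>v\<in>set vs. set (ins v) \<inter> C' = {}" using C by blast+
        thus ?thesis by auto
      next
        case False
        hence "?S = nodes ?L" by (rule all)
        hence "\<forall>u\<in>set us. (0, shape u) \<in> ?S" "\<forall>v\<in>set vs. (1, shape v) \<in> ?S" by (simp_all add: nodes3)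
        hence "\<forall>u\<in>set us. set (ins u) \<subseteq> C" "\<forall>v\<in>set vs. set (ins v) \<subseteq> C'" using v2 by (simp_all add: nodes3)
        thus ?thesis by auto
      qed
    qed
    have ne: "us \<noteq> []"
    proof
      assume "us = []"
      moreover from this l have "vs = []" by (cases vs) (auto simp: lvl_Cons)
      moreover from this l have "ws = []" by (cases ws) (auto simp: lvl_Cons)
      ultimately show False using c by (auto simp: connected_graph_def nodes3)
    qed
    show "conn3 us vs ws" unfolding conn3_def
      by (intro conjI allI impI ne) (elim conjE, rule key, assumption+)
  }
  assume c: "conn3 us vs ws"
  have "S = nodes ?L" if S: "S \<subseteq> nodes ?L" "S \<noteq> {}" "\<forall>x y. (x, y) \<in> adjacent ?L \<longrightarrow> (x \<in> S \<longleftrightarrow> y \<in> S)" for S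
  proof -
    have S1: "(0, shape u) \<in> S \<longleftrightarrow> (1, shape v) \<in> S" if "u \<in> set us" "v \<in> set vs" "e \<in> set (ins u)" "e \<in> set (outs v)" for u v e
      using S(3)[rule_format, of "(0, shape u)" "(1, shape v)"] that by (auto simp: adjacent3)
    have S2: "(1, shape v) \<in> S \<longleftrightarrow> (2, shape w) \<in> S" if "v \<in> set vs" "w \<in> set ws" "e \<in> set (ins v)" "e \<in> set (outs w)" for v w e
      using S(3)[rule_format, of "(1, shape v)" "(2, shape w)"] that by (auto simp: adjacent3)
    have ne: "u \<in> set us \<Longrightarrow> \<exists>e. e \<in> set (ins u)" "v \<in> set vs \<Longrightarrow> \<exists>e. e \<in> set (ins v)"
      "v \<in> set vs \<Longrightarrow> \<exists>e. e \<in> set (outs v)" "w \<in> set ws \<Longrightarrow> \<exists>e. e \<in> set (outs w)" for u v w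
      using l(1-3) hd_in_set[of "ins u"] hd_in_set[of "ins v"] hd_in_set[of "outs v"] hd_in_set[of "outs w"]
      by (auto simp only: lvl_def)
    have up: "v \<in> set vs \<Longrightarrow> e \<in> set (outs v) \<Longrightarrow> \<exists>u\<in>set us. e \<in> set (ins u)"
      "w \<in> set ws \<Longrightarrow> e \<in> set (outs w) \<Longrightarrow> \<exists>v\<in>set vs. e \<in> set (ins v)" for v w e
      using l(4,5) by auto
    have down: "u \<in> set us \<Longrightarrow> e \<in> set (ins u) \<Longrightarrow> \<exists>v\<in>set vs. e \<in> set (outs v)" for u e
      using l(4) by auto
    \<comment> \<open>the edges at the nodes in \<open>S\<close>, separately for the two places between levels\<close>
    define C where "C = {e. \<exists>u\<in>set us. (0, shape u) \<in> S \<and> e \<in> set (ins u)}"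
    define C' where "C' = {e. \<exists>v\<in>set vs. (1, shape v) \<in> S \<and> e \<in> set (ins v)}"
    have CS: "(0, shape u) \<in> S" if "u \<in> set us" "e \<in> set (ins u)" "e \<in> C" for u e
      using that lvl_unique(2)[OF l(1)] by (auto simp: C_def)
    have CS': "(1, shape v) \<in> S" if "v \<in> set vs" "e \<in> set (ins v)" "e \<in> C'" for v e
      using that lvl_unique(2)[OF l(2)] by (auto simp: C'_def)
    have sat1: "\<forall>u\<in>set us. set (ins u) \<subseteq> C \<or> set (ins u) \<inter> C = {}"
      using CS unfolding C_def by blast
    have sat2: "\<forall>v\<in>set vs. (set (outs v) \<subseteq> C \<and> set (ins v) \<subseteq> C') \<or> (set (outs v) \<inter> C = {} \<and> set (ins v) \<inter> C' = {})"
    proof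
      fix v assume v: "v \<in> set vs"
      show "(set (outs v) \<subseteq> C \<and> set (ins v) \<subseteq> C') \<or> (set (outs v) \<inter> C = {} \<and> set (ins v) \<inter> C' = {})"
      proof (cases "(1, shape v) \<in> S")
        case True
        have "set (outs v) \<subseteq> C" using up(1)[OF v] S1[OF _ v] True unfolding C_def by blast
        moreover have "set (ins v) \<subseteq> C'" using v True unfolding C'_def by blast
        ultimately show ?thesis by simp
      next
        case False
        have "set (outs v) \<inter> C = {}" using S1[OF _ v] False unfolding C_def by blast
        moreover have "set (ins v) \<inter> C' = {}" using CS'[OF v] False by blast
        ultimately show ?thesis by simp
      qed
    qed
    have sat3: "\<forall>w\<in>set ws. set (outs w) \<subseteq> C' \<or> set (outs w) \<inter> C' = {}"
    proof
      fix w assume w: "w \<in> set ws"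
      show "set (outs w) \<subseteq> C' \<or> set (outs w) \<inter> C' = {}"
      proof (cases "(2, shape w) \<in> S")
        case True
        thus ?thesis using up(2)[OF w] S2[OF _ w] unfolding C'_def by blast
      next
        case False
        thus ?thesis using S2[OF _ w] unfolding C'_def by blast
      qed
    qed
    have "(set (all_ins us) \<subseteq> C \<and> set (all_ins vs) \<subseteq> C') \<or> (set (all_ins us) \<inter> C = {} \<and> set (all_ins vs) \<inter> C' = {})"
      using c[unfolded conn3_def, THEN conjunct2, rule_format, OF conjI[OF sat1 conjI[OF sat2 sat3]]] .
    moreover obtain v where v: "v \<in> set vs" "(1, shape v) \<in> S"
    proof -
      obtain l s where ls: "(l, s) \<in> S" using S by auto
      hence "(l, s) \<in> nodes ?L" using S by blast
      then consider u where "u \<in> set us" "(l, s) = (0, shape u)" | v where "v \<in> set vs" "(l, s) = (1, shape v)"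
        | w where "w \<in> set ws" "(l, s) = (2, shape w)"
        by (auto simp: nodes3)
      thus thesis
      proof cases
        case 1
        thus thesis using that S1 ls ne(1)[OF 1(1)] down[OF 1(1)] by metis
      next
        case 3
        thus thesis using that S2 ls ne(4)[OF 3(1)] up(2)[OF 3(1)] by metis
      qed (use that ls in metis)
    qed
    moreover obtain e where e: "e \<in> set (ins v)" using ne v by blast
    hence "e \<in> C'" "e \<in> set (all_ins vs)" using v unfolding C'_def by auto
    ultimately have E: "set (all_ins us) \<subseteq> C" "set (all_ins vs) \<subseteq> C'" by (metis disjoint_iff)+
    have uS: "(0, shape u) \<in> S" if "u \<in> set us" for u using ne(1)[OF that] CS[OF that] E that by auto
    have vS: "(1, shape v) \<in> S" if "v \<in> set vs" for v using ne(2)[OF that] CS'[OF that] E that by auto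
    have wS: "(2, shape w) \<in> S" if "w \<in> set ws" for w using ne(4)[OF that] up(2)[OF that] S2 that vS by blast
    have "nodes ?L \<subseteq> S" using uS vS wS by (auto simp: nodes3)
    thus ?thesis using S by blast
  qed
  moreover have "nodes ?L \<noteq> {}"
  proof -
    have "(0, shape (hd us)) \<in> nodes ?L" using c unfolding nodes3 conn3_def by simp
    thus ?thesis by blast
  qed
  ultimately show "connected_graph ?L" unfolding connected_graph_iff by blast
qed

lemma conn2_cong:
  assumes "in_sets us = in_sets us'" "out_sets vs = out_sets vs'" shows "conn2 us vs = conn2 us' vs'"
proof -
  have "set (all_ins us) = \<Union> (in_sets us)" for us :: "'z vertex list" by (auto simp: in_sets_def)
  moreover have "set (all_ins us) = \<Union> (in_sets us)" for us :: "'y vertex list" by (auto simp: in_sets_def)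
  moreover have "us = [] \<longleftrightarrow> us' = []" using assms(1) by (auto simp: in_sets_def)
  ultimately show ?thesis unfolding conn2_def using assms by (simp add: in_sets_def)
qed

lemma conn2_rename:
  assumes c: "conn2 us vs" and m: "set (all_ins us) = set (all_outs vs)" and f: "inj_on f (set (all_ins us))"
  shows "conn2 (map (vrelabel a f h) us) (map (vrelabel f b h') vs)"
proof -
  have "f ` set (all_ins us) \<subseteq> C \<or> f ` set (all_ins us) \<inter> C = {}"
    if "\<forall>Z\<in>in_sets us \<union> out_sets vs. f ` Z \<subseteq> C \<or> f ` Z \<inter> C = {}" for C
  proof -
    have "\<forall>Z\<in>in_sets us \<union> out_sets vs. Z \<subseteq> f -` C \<or> Z \<inter> f -` C = {}" using that by blast
    hence "set (all_ins us) \<subseteq> f -` C \<or> set (all_ins us) \<inter> f -` C = {}" using c unfolding conn2_def by blast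
    thus ?thesis by blast
  qed
  moreover have "in_sets (map (vrelabel a f h) us) = (`) f ` in_sets us" "out_sets (map (vrelabel f b h') vs) = (`) f ` out_sets vs"
    by (simp_all add: in_sets_def out_sets_def image_image)
  moreover have "us \<noteq> []" using c by (simp add: conn2_def)
  ultimately show ?thesis unfolding conn2_def all_simps set_map by (simp add: ball_Un)
qed

text \<open>Pieces of a graph are pairs of levels; quantified pieces are kept as single variables.\<close>

declare split_paired_All [simp del] split_paired_Ex [simp del]

section \<open>Decompositions into connected components\<close>

definition tops :: "('b, 'a) graph2 list \<Rightarrow> 'b vertex list" where "tops D = concat (map fst D)"

definition bots :: "('b, 'a) graph2 list \<Rightarrow> 'a vertex list" where "bots D = concat (map snd D)"

lemma vertex_edges: "v \<in> set vs \<Longrightarrow> set (outs v) \<subseteq> set (all_outs vs)" "v \<in> set vs \<Longrightarrow> set (ins v) \<subseteq> set (all_ins vs)"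
  by auto

text \<open>
  Connected pieces that together make up the graph, up to the order of the vertices.  Arbitrary
  decompositions, unlike the list of components, can be concatenated, renamed and refined.
\<close>

definition decomp :: "('b, 'a) graph2 list \<Rightarrow> 'b vertex list \<Rightarrow> 'a vertex list \<Rightarrow> bool" where
  "decomp D us vs \<longleftrightarrow> (\<forall>d\<in>set D. set (all_ins (fst d)) = set (all_outs (snd d)) \<and> conn2 (fst d) (snd d)) \<and>
     mset (tops D) = mset us \<and> mset (bots D) = mset vs"

lemma tops_simps [simp]: "tops [] = []" "tops (d # D) = fst d @ tops D" "tops (D @ D') = tops D @ tops D'"
    "bots [] = []" "bots (d # D) = snd d @ bots D" "bots (D @ D') = bots D @ bots D'"
  by (simp_all add: tops_def bots_def)

lemma mset_tops: "mset D = mset D' \<Longrightarrow> mset (tops D) = mset (tops D')"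
  and mset_bots: "mset D = mset D' \<Longrightarrow> mset (bots D) = mset (bots D')"
  by (simp_all add: tops_def bots_def mset_concat_map)

lemma decomp_cong:
  "decomp D us vs \<Longrightarrow> mset D = mset D' \<Longrightarrow> mset us = mset us' \<Longrightarrow> mset vs = mset vs' \<Longrightarrow> decomp D' us' vs'"
  using mset_tops[of D D'] mset_bots[of D D'] mset_eq_setD[of D D'] unfolding decomp_def by simp

lemma matching_mset:
  "matching us vs \<Longrightarrow> mset us = mset us' \<Longrightarrow> mset vs = mset vs' \<Longrightarrow> matching us' vs'"
  using lvl_mset[of us us'] lvl_mset[of vs vs'] mset_all[of us us'] mset_all[of vs vs'] by (simp add: matching_def)

lemma decomp_self: "decomp D us vs \<Longrightarrow> decomp D (tops D) (bots D)"
  by (simp add: decomp_def)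

lemma decomp_Cons: "decomp (d # D) (tops (d # D)) (bots (d # D)) \<longleftrightarrow>
    set (all_ins (fst d)) = set (all_outs (snd d)) \<and> conn2 (fst d) (snd d) \<and> decomp D (tops D) (bots D)"
  by (auto simp: decomp_def)

lemma decomp_edges: "decomp D us vs \<Longrightarrow> set (all_ins (tops D)) = set (all_outs (bots D))"
  by (auto simp: decomp_def tops_def bots_def)

lemma decomp_matching:
  assumes "decomp D us vs" "matching us vs" shows "matching (tops D) (bots D)"
  using assms matching_mset[OF assms(2), of "tops D" "bots D"] by (simp add: decomp_def)

lemma decomp_matching_Cons:
  assumes "decomp (d # D) us vs" "matching us vs"
  shows "matching (fst d) (snd d)" "conn2 (fst d) (snd d)" "matching (tops D) (bots D)" "decomp D (tops D) (bots D)"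
    "set (all_ins (fst d)) \<inter> set (all_ins (tops D)) = {}" "set (all_outs (snd d)) \<inter> set (all_outs (bots D)) = {}"
    "set (all_outs (fst d)) \<inter> set (all_outs (tops D)) = {}" "set (all_ins (snd d)) \<inter> set (all_ins (bots D)) = {}"
proof -
  have d: "decomp (d # D) (tops (d # D)) (bots (d # D))" using assms(1) by (rule decomp_self)
  hence d': "decomp D (tops D) (bots D)" "set (all_ins (fst d)) = set (all_outs (snd d))" unfolding decomp_Cons by auto
  have l: "lvl (fst d @ tops D)" "lvl (snd d @ bots D)" using decomp_matching[OF assms] by (simp_all add: matching_def)
  show "matching (fst d) (snd d)" "matching (tops D) (bots D)"
    using l d' decomp_edges[OF d'(1)] unfolding matching_def lvl_append by blast+
  show "conn2 (fst d) (snd d)" "decomp D (tops D) (bots D)" using d unfolding decomp_Cons by auto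
  show "set (all_ins (fst d)) \<inter> set (all_ins (tops D)) = {}" "set (all_outs (snd d)) \<inter> set (all_outs (bots D)) = {}"
    "set (all_outs (fst d)) \<inter> set (all_outs (tops D)) = {}" "set (all_ins (snd d)) \<inter> set (all_ins (bots D)) = {}"
    using l unfolding lvl_append by blast+
qed

lemma decomp_front:
  assumes "decomp D us vs" "d \<in> set D"
  obtains D' where "mset (d # D') = mset D" "decomp (d # D') us vs"
proof -
  have "mset (d # remove1 d D) = mset D" using assms(2) by simp
  thus thesis using that decomp_cong[OF assms(1), of "d # remove1 d D"] by metis
qed

lemma decomp_piece:
  assumes "decomp D us vs" "matching us vs" "d \<in> set D"
  shows "matching (fst d) (snd d)" "conn2 (fst d) (snd d)" "set (fst d) \<subseteq> set us" "set (snd d) \<subseteq> set vs"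
proof -
  obtain D' where D': "decomp (d # D') us vs" using decomp_front[OF assms(1,3)] .
  show "matching (fst d) (snd d)" "conn2 (fst d) (snd d)" using decomp_matching_Cons[OF D' assms(2)] by auto
  have "mset (tops (d # D')) = mset us" "mset (bots (d # D')) = mset vs" using D' unfolding decomp_def by blast+
  hence "set (tops (d # D')) = set us" "set (bots (d # D')) = set vs" by (metis set_mset_mset)+
  thus "set (fst d) \<subseteq> set us" "set (snd d) \<subseteq> set vs" by auto
qed

lemma decomp_append:
  "decomp D us vs \<Longrightarrow> decomp D' us' vs' \<Longrightarrow> decomp (D @ D') (us @ us') (vs @ vs')"
  unfolding decomp_def by (simp del: set_concat add: ball_Un)

lemma decomp_concat:
  "(\<And>t. t \<in> set T \<Longrightarrow> decomp (f t) (g t) (h t)) \<Longrightarrow>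
    decomp (concat (map f T)) (concat (map g T)) (concat (map h T))"
proof (induction T)
  case Nil thus ?case by (simp add: decomp_def)
next
  case (Cons t T) thus ?case by (simp add: decomp_append)
qed

lemma decomp_relabel:
  assumes "decomp D us vs" "matching us vs" "inj_on e (set (all_ins us))"
  shows "decomp (map (map_prod (map (vrelabel f e h)) (map (vrelabel e g h'))) D)
    (map (vrelabel f e h) us) (map (vrelabel e g h') vs)"
proof -
  have "conn2 (map (vrelabel f e h) (fst d)) (map (vrelabel e g h') (snd d)) \<and>
      e ` set (all_ins (fst d)) = e ` set (all_outs (snd d))" if d: "d \<in> set D" for d
  proof -
    note p = decomp_piece[OF assms(1,2) d]
    have "set (all_ins (fst d)) \<subseteq> set (all_ins us)" using p(3) by auto
    hence "inj_on e (set (all_ins (fst d)))" by (rule inj_on_subset[OF assms(3)])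
    thus ?thesis using conn2_rename[OF p(2)] p(1) by (simp add: matching_def del: set_concat)
  qed
  moreover have "tops (map (map_prod (map (vrelabel f e h)) (map (vrelabel e g h'))) D) = map (vrelabel f e h) (tops D)"
    "bots (map (map_prod (map (vrelabel f e h)) (map (vrelabel e g h'))) D) = map (vrelabel e g h') (bots D)"
    by (simp_all add: tops_def bots_def map_concat comp_def)
  moreover have "mset (map (vrelabel f e h) (tops D)) = mset (map (vrelabel f e h) us)"
    "mset (map (vrelabel e g h') (bots D)) = mset (map (vrelabel e g h') vs)"
    using assms(1) unfolding decomp_def mset_map by simp_all
  ultimately show ?thesis unfolding decomp_def all_simps
    by (simp del: mset_map all_simps add: set_map) (simp add: image_UN)
qed

text \<open>
  An edge of a component determines it: the internal edges of a piece of one decomposition are saturated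
  for the pieces of any other one.
\<close>

lemma decomp_same_edges:
  assumes m: "matching us vs" and D: "decomp (d # D) us vs" and D': "decomp (d' # D') us vs"
    and u: "u \<in> set (fst d)" "u \<in> set (fst d')"
  shows "set (all_ins (fst d)) \<subseteq> set (all_ins (fst d'))"
proof -
  note c = decomp_matching_Cons[OF D m] and c' = decomp_matching_Cons[OF D' m]
  have s: "mset (fst d @ tops D) = mset (fst d' @ tops D')" "mset (snd d @ bots D) = mset (snd d' @ bots D')"
    using D D' by (simp_all add: decomp_def)
  let ?C = "set (all_ins (fst d'))"
  have E: "?C = set (all_outs (snd d'))" using c'(1) by (simp add: matching_def)
  have "\<forall>Z\<in>in_sets (fst d) \<union> out_sets (snd d). Z \<subseteq> ?C \<or> Z \<inter> ?C = {}"
  proof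
    fix Z assume "Z \<in> in_sets (fst d) \<union> out_sets (snd d)"
    thus "Z \<subseteq> ?C \<or> Z \<inter> ?C = {}"
    proof
      assume "Z \<in> in_sets (fst d)"
      then obtain w where w: "w \<in> set (fst d)" "Z = set (ins w)" by (auto simp: in_sets_def)
      have "set (fst d @ tops D) = set (fst d' @ tops D')" using s(1) by (rule mset_eq_setD)
      hence "w \<in> set (fst d') \<or> w \<in> set (tops D')" using w by auto
      thus ?thesis
      proof
        assume "w \<in> set (tops D')"
        hence "Z \<subseteq> set (all_ins (tops D'))" using w by auto
        thus ?thesis using c'(5) by blast
      qed (use w in auto)
    next
      assume "Z \<in> out_sets (snd d)"
      then obtain w where w: "w \<in> set (snd d)" "Z = set (outs w)" by (auto simp: out_sets_def)
      have "set (snd d @ bots D) = set (snd d' @ bots D')" using s(2) by (rule mset_eq_setD)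
      hence "w \<in> set (snd d') \<or> w \<in> set (bots D')" using w by auto
      thus ?thesis
      proof
        assume "w \<in> set (bots D')"
        hence "Z \<subseteq> set (all_outs (bots D'))" using w by auto
        thus ?thesis using c'(6) E by blast
      next
        assume "w \<in> set (snd d')"
        hence "Z \<subseteq> set (all_outs (snd d'))" using w by auto
        thus ?thesis using E by blast
      qed
    qed
  qed
  hence "set (all_ins (fst d)) \<subseteq> ?C \<or> set (all_ins (fst d)) \<inter> ?C = {}" using c(2) by (simp add: conn2_def)
  moreover have "ins u \<noteq> []" using c(1) u by (auto simp: matching_def lvl_def)
  hence "last (ins u) \<in> set (ins u)" by simp
  hence "last (ins u) \<in> set (all_ins (fst d))" "last (ins u) \<in> ?C"
    using u unfolding set_concat set_map by blast+
  ultimately show ?thesis by (metis disjoint_iff)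
qed

text \<open>
  Two pieces with a common vertex have the same internal edges, hence the same vertices, because every vertex
  has an internal edge.  They are removed from both decompositions.
\<close>

lemma decomp_unique:
  assumes "matching us vs" "decomp D us vs" "decomp D' us vs"
  shows "\<exists>D''. mset D'' = mset D' \<and>
    list_all2 (\<lambda>d d'. mset (fst d) = mset (fst d') \<and> mset (snd d) = mset (snd d')) D D''"
  using assms
proof (induction D arbitrary: us vs D')
  case Nil
  have "D' = []"
  proof (rule ccontr)
    assume "D' \<noteq> []"
    then obtain d' D1 where "D' = d' # D1" by (cases D') auto
    thus False using Nil by (auto simp: decomp_def conn2_def)
  qed
  thus ?case by simp
next
  case (Cons d D)
  note c = decomp_matching_Cons[OF Cons(3,2)]
  have "fst d \<noteq> []" using c(2) by (simp add: conn2_def)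
  then obtain u where u: "u \<in> set (fst d)" by (cases "fst d") auto
  have "set (tops (d # D)) = set (tops D')" using Cons(3,4) unfolding decomp_def by (metis set_mset_mset)
  hence "u \<in> set (tops D')" using u by auto
  then obtain d' where d': "d' \<in> set D'" "u \<in> set (fst d')" unfolding tops_def set_concat set_map by blast
  obtain D1 where D1: "mset (d' # D1) = mset D'" "decomp (d' # D1) us vs" using decomp_front[OF Cons(4) d'(1)] .
  note c' = decomp_matching_Cons[OF D1(2) Cons(2)]
  have E: "set (all_ins (fst d)) = set (all_ins (fst d'))"
    using decomp_same_edges[OF Cons(2,3) D1(2) u d'(2)] decomp_same_edges[OF Cons(2) D1(2) Cons(3) d'(2) u] by blast
  have E': "set (all_outs (snd d)) = set (all_outs (snd d'))"
    using E c(1) c'(1) by (simp add: matching_def)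
  have m: "mset (fst d @ tops D) = mset (fst d' @ tops D1)" "mset (snd d @ bots D) = mset (snd d' @ bots D1)"
    using Cons(3) D1(2) by (simp_all add: decomp_def)
  have "set (fst d) \<subseteq> set (fst d')" if m: "mset (fst d @ tops D) = mset (fst d' @ tops D1)" and l: "lvl (fst d)"
    and E: "set (all_ins (fst d)) = set (all_ins (fst d'))" and c5: "set (all_ins (fst d')) \<inter> set (all_ins (tops D1)) = {}"
    for d d' :: "('a, 'b) graph2" and D D1
  proof
    fix w assume w: "w \<in> set (fst d)"
    have "set (fst d @ tops D) = set (fst d' @ tops D1)" using m by (rule mset_eq_setD)
    hence "w \<in> set (fst d') \<or> w \<in> set (tops D1)" using w by auto
    moreover have "w \<notin> set (tops D1)"
    proof
      assume "w \<in> set (tops D1)"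
      moreover have "ins w \<noteq> []" using l w by (auto simp: lvl_def)
      ultimately have "last (ins w) \<in> set (all_ins (tops D1))" "last (ins w) \<in> set (all_ins (fst d))"
        using w last_in_set[of "ins w"] vertex_edges[of w "tops D1"] vertex_edges[of w "fst d"] by blast+
      thus False using E c5 by blast
    qed
    ultimately show "w \<in> set (fst d')" by blast
  qed
  hence "set (fst d) = set (fst d')"
    using m(1) E c(1,5) c'(1,5) unfolding matching_def by (metis subset_antisym)
  hence t: "mset (fst d) = mset (fst d')"
    using lvl_distinct[of "fst d"] lvl_distinct[of "fst d'"] c(1) c'(1) set_eq_iff_mset_eq_distinct
    unfolding matching_def by blast
  have "set (snd d) \<subseteq> set (snd d')" if m: "mset (snd d @ bots D) = mset (snd d' @ bots D1)" and l: "lvl (snd d)"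
    and E: "set (all_outs (snd d)) = set (all_outs (snd d'))" and c5: "set (all_outs (snd d')) \<inter> set (all_outs (bots D1)) = {}"
    for d d' :: "('a, 'b) graph2" and D D1
  proof
    fix w assume w: "w \<in> set (snd d)"
    have "set (snd d @ bots D) = set (snd d' @ bots D1)" using m by (rule mset_eq_setD)
    hence "w \<in> set (snd d') \<or> w \<in> set (bots D1)" using w by auto
    moreover have "w \<notin> set (bots D1)"
    proof
      assume "w \<in> set (bots D1)"
      moreover have "outs w \<noteq> []" using l w by (auto simp: lvl_def)
      ultimately have "last (outs w) \<in> set (all_outs (bots D1))" "last (outs w) \<in> set (all_outs (snd d))"
        using w last_in_set[of "outs w"] vertex_edges[of w "bots D1"] vertex_edges[of w "snd d"] by blast+
      thus False using E c5 by blast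
    qed
    ultimately show "w \<in> set (snd d')" by blast
  qed
  hence "set (snd d) = set (snd d')"
    using m(2) E' c(1,6) c'(1,6) unfolding matching_def by (metis subset_antisym)
  hence b: "mset (snd d) = mset (snd d')"
    using lvl_distinct[of "snd d"] lvl_distinct[of "snd d'"] c(1) c'(1) set_eq_iff_mset_eq_distinct
    unfolding matching_def by blast
  have "decomp D1 (tops D) (bots D)"
    using decomp_cong[OF c'(4) refl, of "tops D" "bots D"] m t b by simp
  then obtain D'' where "mset D'' = mset D1" "list_all2 (\<lambda>d d'. mset (fst d) = mset (fst d') \<and> mset (snd d) = mset (snd d')) D D''"
    using Cons(1)[OF c(3,4)] by blast
  thus ?case using t b D1(1) by (intro exI[of _ "d' # D''"]) simp
qed

lemma mset_concat_filter:
  assumes "distinct cs" "\<forall>x\<in>set xs. k x \<in> set cs"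
  shows "mset (concat (map (\<lambda>c. filter (\<lambda>x. k x = c) xs) cs)) = mset xs"
proof -
  have *: "mset (concat (map (\<lambda>c. filter (\<lambda>x. k x = c) xs) cs)) = mset (filter (\<lambda>x. k x \<in> set cs) xs)"
    using assms(1)
  proof (induction cs)
    case (Cons c cs)
    have "mset (filter (\<lambda>x. k x = c) xs) + mset (filter (\<lambda>x. k x \<in> set cs) xs) =
        mset (filter (\<lambda>x. k x \<in> set (c # cs)) xs)"
      using Cons(2) by (induction xs) auto
    thus ?case using Cons by simp
  qed simp
  have "filter (\<lambda>x. k x \<in> set cs) xs = xs" using assms(2) by (induction xs) auto
  thus ?thesis unfolding * by simp
qed

text \<open>
  The components are found from the vertices of level 2.  A vertex of level 1 belongs to the component of any vertex of
  level 2 to which it is linked, and such a vertex exists because its outputs are internal edges.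
\<close>

lemma decomp_components:
  fixes us :: "'b vertex list" and vs :: "'a vertex list"
  assumes m: "matching us vs" shows "decomp (components (us, vs)) us vs"
proof -
  define L where "L = linked [map shape us, map shape vs]"
  let ?A = "adjacent [map shape us, map shape vs]"
  have l: "lvl us" "lvl vs" "set (all_ins us) = set (all_outs vs)" using m by (auto simp: matching_def)
  have Lsym: "(x, y) \<in> L \<Longrightarrow> (y, x) \<in> L" for x y
    unfolding L_def linked_def by (rule symD[OF sym_rtrancl[OF sym_Un_converse]])
  have Ltr: "(x, y) \<in> L \<Longrightarrow> (y, z) \<in> L \<Longrightarrow> (x, z) \<in> L" for x y z
    unfolding L_def linked_def by (rule rtrancl_trans)
  have Lrefl: "(x, x) \<in> L" for x unfolding L_def linked_def by simp
  have adj: "((0, shape u), (1, shape v)) \<in> L" if "u \<in> set us" "v \<in> set vs" "e \<in> set (ins u)" "e \<in> set (outs v)" for u v e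
    unfolding L_def linked_def using that by (intro r_into_rtrancl UnI1) (auto simp: adjacent2)
  define F where "F = (\<lambda>u::'b vertex. (filter (\<lambda>u'. ((0, shape u), (0, shape u')) \<in> L) us, filter (\<lambda>v. ((0, shape u), (1, shape v)) \<in> L) vs))"
  have comps: "components (us, vs) = remdups (map F us)"
    by (simp add: components_def F_def L_def Let_def)
  have Feq: "((0, shape u), (0, shape u')) \<in> L \<longleftrightarrow> F u = F u'" if u: "u \<in> set us" "u' \<in> set us" for u u'
  proof
    assume r: "((0, shape u), (0, shape u')) \<in> L"
    have "((0, shape u), x) \<in> L \<longleftrightarrow> ((0, shape u'), x) \<in> L" for x using Ltr[OF r] Ltr[OF Lsym[OF r]] by blast
    thus "F u = F u'" by (simp add: F_def)
  next
    assume "F u = F u'"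
    hence "filter (\<lambda>x. ((0, shape u), (0, shape x)) \<in> L) us = filter (\<lambda>x. ((0, shape u'), (0, shape x)) \<in> L) us"
      by (simp add: F_def)
    moreover have "u' \<in> set (filter (\<lambda>x. ((0, shape u'), (0, shape x)) \<in> L) us)" using Lrefl u by simp
    ultimately have "u' \<in> set (filter (\<lambda>x. ((0, shape u), (0, shape x)) \<in> L) us)" by simp
    thus "((0, shape u), (0, shape u')) \<in> L" by simp
  qed
  have ex: "\<exists>u\<in>set us. ((0, shape u), (1, shape v)) \<in> L" if v: "v \<in> set vs" for v
  proof -
    have "outs v \<noteq> []" using l(2) v by (auto simp: lvl_def)
    hence "last (outs v) \<in> set (all_outs vs)" using v last_in_set[of "outs v"] vertex_edges(1)[OF v] by blast
    then obtain u where "u \<in> set us" "last (outs v) \<in> set (ins u)" using l(3) by auto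
    thus ?thesis using adj v \<open>outs v \<noteq> []\<close> last_in_set by blast
  qed
  \<comment> \<open>the component of \<open>v\<close>, named by some vertex of level 2 linked to \<open>v\<close>\<close>
  define k where "k = (\<lambda>v::'a vertex. F (SOME u. u \<in> set us \<and> ((0, shape u), (1, shape v)) \<in> L))"
  have k: "k v = F u" if v: "v \<in> set vs" and u: "u \<in> set us" "((0, shape u), (1, shape v)) \<in> L" for u v
  proof -
    let ?w = "SOME u. u \<in> set us \<and> ((0, shape u), (1, shape v)) \<in> L"
    have w: "?w \<in> set us \<and> ((0, shape ?w), (1, shape v)) \<in> L" by (rule someI[of _ u]) (use u in simp)
    hence "((0, shape ?w), (0, shape u)) \<in> L" using Ltr[OF _ Lsym[OF u(2)]] by blast
    thus ?thesis using Feq[of ?w u] w u by (simp add: k_def)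
  qed
  have fstF: "fst c = filter (\<lambda>u. F u = c) us" and sndF: "snd c = filter (\<lambda>v. k v = c) vs" if c: "c \<in> F ` set us" for c
  proof -
    obtain u where u: "u \<in> set us" "c = F u" using c by blast
    have "fst c = filter (\<lambda>u'. ((0, shape u), (0, shape u')) \<in> L) us" by (simp add: u F_def)
    also have "\<dots> = filter (\<lambda>u'. F u' = c) us" using Feq[OF u(1)] u(2) by (intro filter_cong) auto
    finally show "fst c = filter (\<lambda>u. F u = c) us" .
    have kc: "((0, shape u), (1, shape v)) \<in> L \<longleftrightarrow> k v = c" if v: "v \<in> set vs" for v
    proof
      assume "k v = c"
      obtain w where w: "w \<in> set us" "((0, shape w), (1, shape v)) \<in> L" using ex[OF v] by blast
      hence "F w = F u" using k[OF v w] \<open>k v = c\<close> u by simp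
      hence "((0, shape u), (0, shape w)) \<in> L" using Feq[OF u(1) w(1)] by simp
      thus "((0, shape u), (1, shape v)) \<in> L" using Ltr w by blast
    next
      assume "((0, shape u), (1, shape v)) \<in> L"
      from k[OF v u(1) this] show "k v = c" by (simp only: u(2))
    qed
    have "snd c = filter (\<lambda>v. ((0, shape u), (1, shape v)) \<in> L) vs" by (simp add: u F_def)
    also have "\<dots> = filter (\<lambda>v. k v = c) vs" by (intro filter_cong refl kc)
    finally show "snd c = filter (\<lambda>v. k v = c) vs" .
  qed
  let ?cs = "remdups (map F us)"
  have "mset (tops ?cs) = mset us"
  proof -
    have "map fst ?cs = map (\<lambda>c. filter (\<lambda>u. F u = c) us) ?cs" using fstF by simp
    thus ?thesis unfolding tops_def by (simp only:) (intro mset_concat_filter, auto)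
  qed
  moreover have "mset (bots ?cs) = mset vs"
  proof -
    have "map snd ?cs = map (\<lambda>c. filter (\<lambda>v. k v = c) vs) ?cs" using sndF by simp
    moreover have "\<forall>v\<in>set vs. k v \<in> set ?cs" using ex k by fastforce
    ultimately show ?thesis unfolding bots_def by (simp only:) (intro mset_concat_filter, auto)
  qed
  moreover have "set (all_ins (fst d)) = set (all_outs (snd d)) \<and> conn2 (fst d) (snd d)" if d: "d \<in> set ?cs" for d
  proof -
    obtain u0 where u0: "u0 \<in> set us" "d = F u0" using d by auto
    have f: "u \<in> set (fst d) \<longleftrightarrow> u \<in> set us \<and> ((0, shape u0), (0, shape u)) \<in> L"
      "v \<in> set (snd d) \<longleftrightarrow> v \<in> set vs \<and> ((0, shape u0), (1, shape v)) \<in> L" for u v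
      by (auto simp: u0 F_def)
    have "e \<in> set (all_ins (fst d)) \<longleftrightarrow> e \<in> set (all_outs (snd d))" for e
    proof
      assume "e \<in> set (all_ins (fst d))"
      then obtain u where u: "u \<in> set (fst d)" "e \<in> set (ins u)" by auto
      hence "e \<in> set (all_ins us)" using f by auto
      then obtain v where v: "v \<in> set vs" "e \<in> set (outs v)" using l(3) by auto
      hence "v \<in> set (snd d)" using adj[of u v e] u f Ltr by blast
      thus "e \<in> set (all_outs (snd d))" using v by auto
    next
      assume "e \<in> set (all_outs (snd d))"
      then obtain v where v: "v \<in> set (snd d)" "e \<in> set (outs v)" by auto
      hence "e \<in> set (all_outs vs)" using f by auto
      then obtain u where u: "u \<in> set us" "e \<in> set (ins u)" using l(3) by auto
      hence "u \<in> set (fst d)" using adj[of u v e] v f Ltr Lsym by blast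
      thus "e \<in> set (all_ins (fst d))" using u by auto
    qed
    hence E: "set (all_ins (fst d)) = set (all_outs (snd d))" by blast
    have "set (all_ins (fst d)) \<subseteq> C" if sat: "\<forall>Z\<in>in_sets (fst d) \<union> out_sets (snd d). Z \<subseteq> C \<or> Z \<inter> C = {}"
      and ne: "set (all_ins (fst d)) \<inter> C \<noteq> {}" for C
    proof -
      obtain u1 where u1: "u1 \<in> set (fst d)" "set (ins u1) \<inter> C \<noteq> {}" using ne by auto
      have satu: "set (ins u) \<subseteq> C \<or> set (ins u) \<inter> C = {}" if "u \<in> set (fst d)" for u
        using sat that by (auto simp: in_sets_def)
      have satv: "set (outs v) \<subseteq> C \<or> set (outs v) \<inter> C = {}" if "v \<in> set (snd d)" for v
        using sat that by (auto simp: out_sets_def)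
      \<comment> \<open>nodes whose internal edges lie in \<open>C\<close>; this passes along adjacency\<close>
      define good where "good = (\<lambda>x::nat \<times> nat list \<times> nat list. if fst x = 0 then set (snd (snd x)) \<subseteq> C else set (fst (snd x)) \<subseteq> C)"
      have "good y \<and> ((0, shape u0), y) \<in> L" if "((0, shape u1), y) \<in> L" for y
        using that unfolding L_def linked_def
      proof (induction rule: rtrancl_induct)
        case base
        thus ?case using u1 satu[OF u1(1)] f(1)[of u1] by (simp add: good_def L_def linked_def)
      next
        case (step y z)
        have yz: "(y, z) \<in> L" using step(2) unfolding L_def linked_def by blast
        have z: "((0, shape u0), z) \<in> L" using step(3) Ltr[OF _ yz] by (simp add: L_def linked_def)
        have y: "((0, shape u0), y) \<in> L" "good y" using step(3) by (simp_all add: L_def linked_def)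
        from step(2) consider "(y, z) \<in> ?A" | "(z, y) \<in> ?A" by blast
        hence "good z"
        proof cases
          case 1
          obtain i s j t where ij: "y = (i, s)" "z = (j, t)" by (cases y; cases z)
          with 1 have ad: "i = 0" "j = 1" "t \<in> shape ` set vs" "set (snd s) \<inter> set (fst t) \<noteq> {}"
            by (simp_all add: adjacent2)
          then obtain v where v: "i = 0" "j = 1" "v \<in> set vs" "t = shape v" "set (snd s) \<inter> set (outs v) \<noteq> {}"
            by (elim imageE) simp
          have "v \<in> set (snd d)" using f z ij v by simp
          from satv[OF this] show ?thesis using y(2) ij v by (auto simp: good_def)
        next
          case 2
          obtain i s j t where ij: "z = (i, s)" "y = (j, t)" by (cases y; cases z)
          with 2 have ad: "i = 0" "j = 1" "s \<in> shape ` set us" "set (snd s) \<inter> set (fst t) \<noteq> {}"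
            by (simp_all add: adjacent2)
          then obtain u where u: "i = 0" "j = 1" "u \<in> set us" "s = shape u" "set (ins u) \<inter> set (fst t) \<noteq> {}"
            by (elim imageE) simp
          have "u \<in> set (fst d)" using f z ij u by simp
          from satu[OF this] show ?thesis using y(2) ij u by (auto simp: good_def)
        qed
        thus ?case using z by (simp add: L_def linked_def)
      qed
      hence "set (ins u) \<subseteq> C" if "u \<in> set (fst d)" for u
        using f(1)[of u] f(1)[of u1] u1 that Ltr Lsym unfolding good_def by (metis fst_conv snd_conv)
      thus ?thesis by auto
    qed
    moreover have "fst d \<noteq> []" using f(1)[of u0] u0 Lrefl by auto
    ultimately show ?thesis using E unfolding conn2_def by blast
  qed
  ultimately show ?thesis unfolding comps decomp_def by blast
qed

lemma decomp_same_sets: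
  assumes "decomp ((a, b) # D) us vs" "mset (a' @ tops D) = mset us'" "mset (b' @ bots D) = mset vs'"
    and "in_sets a = in_sets a'" "out_sets b = out_sets b'"
  shows "decomp ((a', b') # D) us' vs'"
proof -
  have "set (all_ins a) = \<Union> (in_sets a)" "set (all_ins a') = \<Union> (in_sets a')"
    "set (all_outs b) = \<Union> (out_sets b)" "set (all_outs b') = \<Union> (out_sets b')"
    by (auto simp: in_sets_def out_sets_def)
  thus ?thesis using assms conn2_cong[of a a' b b'] by (auto simp: decomp_def)
qed

text \<open>
  Relations are tested at the first vertex of a level, so this vertex is made the first one of the
  first piece.
\<close>

lemma decomp_bot_vertex:
  assumes "matching us (v # vs)"
  obtains a b D where "decomp ((a, v # b) # D) us (v # vs)"
proof -
  let ?D = "components (us, v # vs)"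
  have D: "decomp ?D us (v # vs)" using decomp_components[OF assms] .
  hence "set (bots ?D) = set (v # vs)" unfolding decomp_def by (metis set_mset_mset)
  hence "v \<in> set (bots ?D)" by simp
  then obtain d where d: "d \<in> set ?D" "v \<in> set (snd d)" unfolding bots_def set_concat set_map by blast
  obtain D' where D': "decomp (d # D') us (v # vs)" using decomp_front[OF D d(1)] .
  have m: "mset (v # remove1 v (snd d)) = mset (snd d)" using d(2) by simp
  have "mset ((v # remove1 v (snd d)) @ bots D') = mset (snd d @ bots D')" using m unfolding mset_append by (rule arg_cong)
  moreover have "out_sets (v # remove1 v (snd d)) = out_sets (snd d)" using mset_eq_setD[OF m] unfolding out_sets_def by (rule arg_cong)
  moreover have "mset (fst d @ tops D') = mset (us)" "mset (snd d @ bots D') = mset (v # vs)"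
    using D' by (simp_all add: decomp_def)
  ultimately have "decomp ((fst d, v # remove1 v (snd d)) # D') us (v # vs)"
    using D' by (intro decomp_same_sets[of "fst d" "snd d" D' "us" "v # vs" "fst d" "us" "v # remove1 v (snd d)" "v # vs"]) (simp_all only: prod.collapse)
  thus thesis by (rule that)
qed

lemma decomp_top_vertex:
  assumes "matching (u # us) vs"
  obtains a b D where "decomp ((u # a, b) # D) (u # us) vs"
proof -
  let ?D = "components (u # us, vs)"
  have D: "decomp ?D (u # us) vs" using decomp_components[OF assms] .
  hence "set (tops ?D) = set (u # us)" unfolding decomp_def by (metis set_mset_mset)
  hence "u \<in> set (tops ?D)" by simp
  then obtain d where d: "d \<in> set ?D" "u \<in> set (fst d)" unfolding tops_def set_concat set_map by blast
  obtain D' where D': "decomp (d # D') (u # us) vs" using decomp_front[OF D d(1)] .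
  have m: "mset (u # remove1 u (fst d)) = mset (fst d)" using d(2) by simp
  have "mset ((u # remove1 u (fst d)) @ tops D') = mset (fst d @ tops D')" using m unfolding mset_append by (rule arg_cong)
  moreover have "in_sets (u # remove1 u (fst d)) = in_sets (fst d)" using mset_eq_setD[OF m] unfolding in_sets_def by (rule arg_cong)
  moreover have "mset (fst d @ tops D') = mset (u # us)" "mset (snd d @ bots D') = mset (vs)"
    using D' by (simp_all add: decomp_def)
  ultimately have "decomp ((u # remove1 u (fst d), snd d) # D') (u # us) vs"
    using D' by (intro decomp_same_sets[of "fst d" "snd d" D' "u # us" "vs" "u # remove1 u (fst d)" "u # us" "snd d" "vs"]) (simp_all only: prod.collapse)
  thus thesis by (rule that)
qed


section \<open>Contraction of components\<close>

text \<open>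
  Contraction of a piece to a vertex with unspecified decoration: the decoration will be the class of the
  piece in \<open>P \<boxtimes>\<^sub>c P\<close>, its composite in a properad, or its value in a PROP.
\<close>

definition contracts :: "(('b, 'a) graph2 \<Rightarrow> 'c vertex) \<Rightarrow> bool" where
  "contracts c \<longleftrightarrow> (\<forall>d. outs (c d) = all_outs (fst d) \<and> ins (c d) = all_ins (snd d))"

lemma contracts_all:
  assumes "contracts c"
  shows "all_outs (map c D) = all_outs (tops D)" "all_ins (map c D) = all_ins (bots D)"
  using assms by (induction D) (simp_all add: contracts_def)

lemma contracts_edges:
  assumes "contracts c" "decomp D us vs"
  shows "set (all_outs (map c D)) = set (all_outs us)" "set (all_ins (map c D)) = set (all_ins vs)"
  using assms contracts_all[OF assms(1), of D] mset_all(4)[of "tops D" us] mset_all(5)[of "bots D" vs]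
  by (simp_all add: decomp_def del: set_concat)

lemma contracts_lvl:
  assumes c: "contracts c" and D: "decomp D us vs" "matching us vs" shows "lvl (map c D)"
proof -
  have "outs (c d) \<noteq> [] \<and> ins (c d) \<noteq> []" if d: "d \<in> set D" for d
  proof -
    note p = decomp_piece[OF D d]
    obtain u us' where u: "fst d = u # us'" using p(2) by (cases "fst d") (auto simp: conn2_def)
    have "outs u \<noteq> []" "ins u \<noteq> []" "set (ins u) \<subseteq> set (all_outs (snd d))"
      using p(1) u by (auto simp: matching_def lvl_Cons)
    moreover from this obtain v where "v \<in> set (snd d)" by (cases "ins u") auto
    moreover from this have "ins v \<noteq> []" using p(1) by (auto simp: matching_def lvl_def)
    ultimately show ?thesis using c u by (simp add: contracts_def del: set_concat) blast
  qed
  moreover have "distinct (all_outs (tops D))" "distinct (all_ins (bots D))"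
    using decomp_matching[OF D] by (simp_all add: matching_def lvl_def)
  ultimately show ?thesis unfolding lvl_def contracts_all[OF c] by auto
qed

lemma decomp_disjoint:
  assumes D: "decomp D us vs" "matching us vs" and d: "d \<in> set D" "d' \<in> set D" and e: "e \<in> set (all_ins (fst d))" "e \<in> set (all_ins (fst d'))"
  shows "d = d'"
proof -
  obtain D' where D': "mset (d # D') = mset D" "decomp (d # D') us vs" using decomp_front[OF D(1) d(1)] .
  have "set (d # D') = set D" using D'(1) by (rule mset_eq_setD)
  moreover have "d' \<notin> set D'"
  proof
    assume "d' \<in> set D'"
    hence "set (fst d') \<subseteq> set (tops D')" by (auto simp: tops_def)
    hence "e \<in> set (all_ins (tops D'))" using e(2) by auto
    thus False using decomp_matching_Cons(5)[OF D'(2) D(2)] e(1) by blast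
  qed
  ultimately show ?thesis using d(2) by auto
qed

text \<open>A saturated set of edges of the contracted graph extends by the internal edges of the pieces that it touches.\<close>

lemma conn3_contract:
  assumes c: "contracts c" and m: "matching us vs" "matching vs ws" and D: "decomp D us vs"
  shows "conn3 us vs ws \<longleftrightarrow> conn2 (map c D) ws"
proof
  have outsc: "outs (c d) = all_outs (fst d)" "ins (c d) = all_ins (snd d)" for d using c by (simp_all add: contracts_def)
  have su: "set us = set (tops D)" "set vs = set (bots D)" using D unfolding decomp_def by (metis set_mset_mset)+
  have E': "set (all_ins (map c D)) = set (all_ins vs)" using contracts_edges[OF c D] by simp
  have Ed: "set (all_ins (fst d)) = set (all_outs (snd d))" if "d \<in> set D" for d using D that by (auto simp: decomp_def)
  have us: "us = [] \<longleftrightarrow> D = []"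
    using D by (cases D) (auto simp: decomp_def conn2_def)
  have nv: "v \<in> set vs \<Longrightarrow> last (ins v) \<in> set (ins v) \<and> last (outs v) \<in> set (outs v)" for v
    using m(1) by (auto simp: matching_def lvl_def)
  {
    assume c3: "conn3 us vs ws"
    have "set (all_ins vs) \<subseteq> C' \<or> set (all_ins vs) \<inter> C' = {}"
      if sat: "\<forall>Z\<in>in_sets (map c D) \<union> out_sets ws. Z \<subseteq> C' \<or> Z \<inter> C' = {}" for C'
    proof -
      \<comment> \<open>the internal edges of the pieces whose inputs lie in \<open>C'\<close>\<close>
      define C where "C = {e. \<exists>d\<in>set D. e \<in> set (all_ins (fst d)) \<and> set (all_ins (snd d)) \<subseteq> C'}"
      have satd: "set (all_ins (snd d)) \<subseteq> C' \<or> set (all_ins (snd d)) \<inter> C' = {}" if d: "d \<in> set D" for d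
      proof -
        have "set (ins (c d)) \<in> in_sets (map c D)" using d unfolding in_sets_def set_map by blast
        thus ?thesis using sat unfolding outsc by blast
      qed
      have Cd: "e \<in> C \<longleftrightarrow> set (all_ins (snd d)) \<subseteq> C'" if "d \<in> set D" "e \<in> set (all_ins (fst d))" for d e
        using decomp_disjoint[OF D m(1)] that unfolding C_def by blast
      have s1: "\<forall>u\<in>set us. set (ins u) \<subseteq> C \<or> set (ins u) \<inter> C = {}"
      proof
        fix u assume "u \<in> set us"
        then obtain d where d: "d \<in> set D" "u \<in> set (fst d)" unfolding su by (auto simp: tops_def)
        hence "set (ins u) \<subseteq> set (all_ins (fst d))" by auto
        thus "set (ins u) \<subseteq> C \<or> set (ins u) \<inter> C = {}" using Cd[OF d(1)] by blast
      qed
      have s2: "\<forall>v\<in>set vs. (set (outs v) \<subseteq> C \<and> set (ins v) \<subseteq> C') \<or> (set (outs v) \<inter> C = {} \<and> set (ins v) \<inter> C' = {})"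
      proof
        fix v assume v: "v \<in> set vs"
        then obtain d where d: "d \<in> set D" "v \<in> set (snd d)" unfolding su by (auto simp: bots_def)
        hence s: "set (ins v) \<subseteq> set (all_ins (snd d))" "set (outs v) \<subseteq> set (all_ins (fst d))" using Ed[OF d(1)] by auto
        show "(set (outs v) \<subseteq> C \<and> set (ins v) \<subseteq> C') \<or> (set (outs v) \<inter> C = {} \<and> set (ins v) \<inter> C' = {})"
        proof (cases "set (all_ins (snd d)) \<subseteq> C'")
          case True
          thus ?thesis using s Cd[OF d(1)] by blast
        next
          case False
          hence "set (all_ins (snd d)) \<inter> C' = {}" using satd[OF d(1)] by blast
          thus ?thesis using s Cd[OF d(1)] False by blast
        qed
      qed
      have s3: "\<forall>w\<in>set ws. set (outs w) \<subseteq> C' \<or> set (outs w) \<inter> C' = {}"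
        using sat by (auto simp: out_sets_def)
      show ?thesis using c3[unfolded conn3_def, THEN conjunct2, rule_format, OF conjI[OF s1 conjI[OF s2 s3]]] by argo
    qed
    moreover have "us \<noteq> []" using c3 by (simp add: conn3_def)
    ultimately show "conn2 (map c D) ws" using us unfolding conn2_def E' by simp
  }
  assume c2: "conn2 (map c D) ws"
  have key: "(set (all_ins us) \<subseteq> C \<and> set (all_ins vs) \<subseteq> C') \<or> (set (all_ins us) \<inter> C = {} \<and> set (all_ins vs) \<inter> C' = {})"
    if C: "\<forall>u\<in>set us. set (ins u) \<subseteq> C \<or> set (ins u) \<inter> C = {}"
      "\<forall>v\<in>set vs. (set (outs v) \<subseteq> C \<and> set (ins v) \<subseteq> C') \<or> (set (outs v) \<inter> C = {} \<and> set (ins v) \<inter> C' = {})"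
      "\<forall>w\<in>set ws. set (outs w) \<subseteq> C' \<or> set (outs w) \<inter> C' = {}" for C C'
  proof -
    have v2: "(set (outs v) \<subseteq> C \<longleftrightarrow> set (ins v) \<subseteq> C') \<and> (set (outs v) \<inter> C = {} \<longleftrightarrow> set (ins v) \<inter> C' = {})" if v: "v \<in> set vs" for v
      using C(2)[rule_format, OF v] nv[OF v] by blast
    have sd: "set (snd d) \<subseteq> set vs" "set (fst d) \<subseteq> set us" if "d \<in> set D" for d
      using decomp_piece(3,4)[OF D m(1) that] by auto
    have satd: "set (all_ins (snd d)) \<subseteq> C' \<or> set (all_ins (snd d)) \<inter> C' = {}" if d: "d \<in> set D" for d
    proof -
      have "\<forall>Z\<in>in_sets (fst d) \<union> out_sets (snd d). Z \<subseteq> C \<or> Z \<inter> C = {}"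
        using C(1,2) sd[OF d] by (auto simp: in_sets_def out_sets_def)
      hence "set (all_ins (fst d)) \<subseteq> C \<or> set (all_ins (fst d)) \<inter> C = {}"
        using D d unfolding decomp_def conn2_def by blast
      thus ?thesis
      proof
        assume "set (all_ins (fst d)) \<subseteq> C"
        hence "\<forall>v\<in>set (snd d). set (outs v) \<subseteq> C" using Ed[OF d] by auto
        hence "\<forall>v\<in>set (snd d). set (ins v) \<subseteq> C'" using v2 sd[OF d] by blast
        thus ?thesis by auto
      next
        assume "set (all_ins (fst d)) \<inter> C = {}"
        hence "\<forall>v\<in>set (snd d). set (outs v) \<inter> C = {}" using Ed[OF d] by auto
        hence "\<forall>v\<in>set (snd d). set (ins v) \<inter> C' = {}" using v2 sd[OF d] by blast
        thus ?thesis by auto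
      qed
    qed
    have "\<forall>Z\<in>in_sets (map c D) \<union> out_sets ws. Z \<subseteq> C' \<or> Z \<inter> C' = {}"
    proof
      fix Z assume "Z \<in> in_sets (map c D) \<union> out_sets ws"
      then consider d where "d \<in> set D" "Z = set (all_ins (snd d))" | w where "w \<in> set ws" "Z = set (outs w)"
        unfolding in_sets_def out_sets_def set_map image_image outsc by blast
      thus "Z \<subseteq> C' \<or> Z \<inter> C' = {}" using satd C(3) by cases auto
    qed
    hence "set (all_ins vs) \<subseteq> C' \<or> set (all_ins vs) \<inter> C' = {}"
      using c2 E' unfolding conn2_def by simp
    thus ?thesis
    proof
      assume a: "set (all_ins vs) \<subseteq> C'"
      hence "\<forall>v\<in>set vs. set (ins v) \<subseteq> C'" by auto
      hence "\<forall>v\<in>set vs. set (outs v) \<subseteq> C" using v2 by blast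
      thus ?thesis using a m(1) by (auto simp: matching_def)
    next
      assume a: "set (all_ins vs) \<inter> C' = {}"
      hence "\<forall>v\<in>set vs. set (ins v) \<inter> C' = {}" by auto
      hence "\<forall>v\<in>set vs. set (outs v) \<inter> C = {}" using v2 by blast
      hence "set (all_outs vs) \<inter> C = {}" by auto
      thus ?thesis using a m(1) by (simp add: matching_def)
    qed
  qed
  have ne: "us \<noteq> []" using c2 us by (auto simp: conn2_def)
  show "conn3 us vs ws" unfolding conn3_def
    by (intro conjI allI impI ne) (elim conjE, rule key, assumption+)
qed

text \<open>
  The mirror image for contracting the lower two levels: the set is extended by the internal edges of the
  pieces whose outputs it contains.
\<close>

lemma conn3_contract':
  assumes c: "contracts c" and m: "matching us vs" "matching vs ws" and D: "decomp D vs ws" and c3: "conn3 us vs ws"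
  shows "conn2 us (map c D)"
proof -
  have outsc: "outs (c d) = all_outs (fst d)" "ins (c d) = all_ins (snd d)" for d using c by (simp_all add: contracts_def)
  have su: "set vs = set (tops D)" "set ws = set (bots D)" using D unfolding decomp_def by (metis set_mset_mset)+
  have Ed: "set (all_ins (fst d)) = set (all_outs (snd d))" if "d \<in> set D" for d using D that by (auto simp: decomp_def)
  have "set (all_ins us) \<subseteq> C' \<or> set (all_ins us) \<inter> C' = {}"
    if sat: "\<forall>Z\<in>in_sets us \<union> out_sets (map c D). Z \<subseteq> C' \<or> Z \<inter> C' = {}" for C'
  proof -
    define C where "C = {e. \<exists>d\<in>set D. e \<in> set (all_ins (fst d)) \<and> set (all_outs (fst d)) \<subseteq> C'}"
    have satd: "set (all_outs (fst d)) \<subseteq> C' \<or> set (all_outs (fst d)) \<inter> C' = {}" if d: "d \<in> set D" for d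
    proof -
      have "set (outs (c d)) \<in> out_sets (map c D)" using d unfolding out_sets_def set_map by blast
      thus ?thesis using sat unfolding outsc by blast
    qed
    have Cd: "e \<in> C \<longleftrightarrow> set (all_outs (fst d)) \<subseteq> C'" if "d \<in> set D" "e \<in> set (all_ins (fst d))" for d e
      using decomp_disjoint[OF D m(2)] that unfolding C_def by blast
    have s3: "\<forall>w\<in>set ws. set (outs w) \<subseteq> C \<or> set (outs w) \<inter> C = {}"
    proof
      fix w assume "w \<in> set ws"
      then obtain d where d: "d \<in> set D" "w \<in> set (snd d)" unfolding su by (auto simp: bots_def)
      hence "set (outs w) \<subseteq> set (all_ins (fst d))" using Ed by auto
      thus "set (outs w) \<subseteq> C \<or> set (outs w) \<inter> C = {}" using Cd[OF d(1)] by blast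
    qed
    have s2: "\<forall>v\<in>set vs. (set (outs v) \<subseteq> C' \<and> set (ins v) \<subseteq> C) \<or> (set (outs v) \<inter> C' = {} \<and> set (ins v) \<inter> C = {})"
    proof
      fix v assume v: "v \<in> set vs"
      then obtain d where d: "d \<in> set D" "v \<in> set (fst d)" unfolding su by (auto simp: tops_def)
      hence s: "set (outs v) \<subseteq> set (all_outs (fst d))" "set (ins v) \<subseteq> set (all_ins (fst d))" by auto
      show "(set (outs v) \<subseteq> C' \<and> set (ins v) \<subseteq> C) \<or> (set (outs v) \<inter> C' = {} \<and> set (ins v) \<inter> C = {})"
      proof (cases "set (all_outs (fst d)) \<subseteq> C'")
        case True
        thus ?thesis using s Cd[OF d(1)] by blast
      next
        case False
        hence "set (all_outs (fst d)) \<inter> C' = {}" using satd[OF d(1)] by blast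
        thus ?thesis using s Cd[OF d(1)] False by blast
      qed
    qed
    have s1: "\<forall>u\<in>set us. set (ins u) \<subseteq> C' \<or> set (ins u) \<inter> C' = {}"
      using sat by (auto simp: in_sets_def)
    show ?thesis using c3[unfolded conn3_def, THEN conjunct2, rule_format, OF conjI[OF s1 conjI[OF s2 s3]]] by argo
  qed
  moreover have "us \<noteq> []" using c3 by (simp add: conn3_def)
  ultimately show ?thesis unfolding conn2_def by simp
qed

text \<open>
  A partition of contracted vertices comes from a partition of the pieces that were contracted.
\<close>

lemma mset_map_split:
  assumes "mset (concat yss) = mset (map f xs)"
  shows "\<exists>xss. map (map f) xss = yss \<and> mset (concat xss) = mset xs"
proof -
  obtain p where p: "p permutes {..<length (map f xs)}" "permute_list p (map f xs) = concat yss"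
    using mset_eq_permutation[OF assms] by blast
  hence "map f (permute_list p xs) = concat yss" by (simp add: permute_list_map)
  moreover have "mset (permute_list p xs) = mset xs" using p by simp
  moreover have "map f zs = concat yss \<Longrightarrow> \<exists>xss. map (map f) xss = yss \<and> concat xss = zs" for zs
  proof (induction yss arbitrary: zs)
    case (Cons ys yss)
    then obtain a b where ab: "zs = a @ b" "map f a = ys" "map f b = concat yss"
      by (auto simp: map_eq_append_conv)
    obtain xss where "map (map f) xss = yss" "concat xss = b" using Cons(1)[OF ab(3)] by blast
    thus ?case using ab by (intro exI[of _ "a # xss"]) simp
  qed simp
  ultimately show ?thesis by metis
qed

section \<open>Bimodules presented by graphs\<close>

text \<open>
  The common pattern of \<open>S\<^sub>\<otimes>(P)\<close> and \<open>Q \<boxtimes>\<^sub>c P\<close>: modules presented by graphs, on which permutations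
  act by renaming global edges.  Both renamings are written as left actions here, and \<open>pbim\<close> turns
  the second one into a right action by an inverse.
\<close>

definition bim_presentation ::
    "(nat \<Rightarrow> nat \<Rightarrow> 'g set) \<Rightarrow> (nat \<Rightarrow> nat \<Rightarrow> ('g \<Rightarrow>\<^sub>0 'k::field) set) \<Rightarrow>
     ((nat \<Rightarrow> nat) \<Rightarrow> 'g \<Rightarrow> 'g) \<Rightarrow> ((nat \<Rightarrow> nat) \<Rightarrow> 'g \<Rightarrow> 'g) \<Rightarrow> bool" where
  "bim_presentation G R La Ra \<longleftrightarrow>
     (\<forall>m n. presentation (G m n) (R m n)) \<and> (\<forall>m n. m = 0 \<or> n = 0 \<longrightarrow> G m n = {}) \<and>
     (\<forall>m n \<sigma>. \<sigma> permutes {..<m} \<longrightarrow> (\<forall>g\<in>G m n. La \<sigma> g \<in> G m n) \<and>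
        compatible (presented (G m n) (R m n)) (G m n) (R m n) (\<lambda>g. coset (R m n) (gen (La \<sigma> g)))) \<and>
     (\<forall>m n \<tau>. \<tau> permutes {..<n} \<longrightarrow> (\<forall>g\<in>G m n. Ra \<tau> g \<in> G m n) \<and>
        compatible (presented (G m n) (R m n)) (G m n) (R m n) (\<lambda>g. coset (R m n) (gen (Ra \<tau> g)))) \<and>
     (\<forall>g. La id g = g \<and> Ra id g = g) \<and>
     (\<forall>\<sigma> \<sigma>' g. La (\<sigma> \<circ> \<sigma>') g = La \<sigma> (La \<sigma>' g) \<and> Ra (\<sigma> \<circ> \<sigma>') g = Ra \<sigma> (Ra \<sigma>' g) \<and>
        La \<sigma> (Ra \<sigma>' g) = Ra \<sigma>' (La \<sigma> g))"

definition pbim ::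
    "(nat \<Rightarrow> nat \<Rightarrow> 'g set) \<Rightarrow> (nat \<Rightarrow> nat \<Rightarrow> ('g \<Rightarrow>\<^sub>0 'k::field) set) \<Rightarrow>
     ((nat \<Rightarrow> nat) \<Rightarrow> 'g \<Rightarrow> 'g) \<Rightarrow> ((nat \<Rightarrow> nat) \<Rightarrow> 'g \<Rightarrow> 'g) \<Rightarrow> ('k, ('g \<Rightarrow>\<^sub>0 'k) set) sbimod" where
  "pbim G R La Ra = \<lparr>md = (\<lambda>m n. presented (G m n) (R m n)),
     lact = (\<lambda>m n \<sigma>. lift (presented (G m n) (R m n)) (\<lambda>g. coset (R m n) (gen (La \<sigma> g)))),
     ract = (\<lambda>m n \<tau>. lift (presented (G m n) (R m n)) (\<lambda>g. coset (R m n) (gen (Ra (inv_into UNIV \<tau>) g))))\<rparr>"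

lemma pbim_gen:
  assumes B: "bim_presentation G R La Ra" and g: "g \<in> G m n"
  shows "\<sigma> permutes {..<m} \<Longrightarrow> lact (pbim G R La Ra) m n \<sigma> (coset (R m n) (gen g)) = coset (R m n) (gen (La \<sigma> g))"
    "\<tau> permutes {..<n} \<Longrightarrow> ract (pbim G R La Ra) m n \<tau> (coset (R m n) (gen g)) = coset (R m n) (gen (Ra (inv_into UNIV \<tau>) g))"
  using lift_gen[OF presented_module, of "G m n" "R m n" "G m n" "R m n" _ g] B g permutes_inv[of \<tau> "{..<n}"]
  by (simp_all add: pbim_def bim_presentation_def)

lemma pbim_linear:
  assumes B: "bim_presentation G R La Ra"
  shows "\<sigma> permutes {..<m} \<Longrightarrow> linear_map (presented (G m n) (R m n)) (presented (G m n) (R m n)) (lact (pbim G R La Ra) m n \<sigma>)"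
    "\<tau> permutes {..<n} \<Longrightarrow> linear_map (presented (G m n) (R m n)) (presented (G m n) (R m n)) (ract (pbim G R La Ra) m n \<tau>)"
  using lift_linear[OF presented_module, of "G m n" "R m n" "G m n" "R m n"] B permutes_inv[of \<tau> "{..<n}"]
  by (simp_all add: pbim_def bim_presentation_def)

lemma pbim_sbimodule:
  assumes B: "bim_presentation G R La Ra" shows "sbimodule (pbim G R La Ra)"
proof -
  let ?B = "pbim G R La Ra"
  have md: "md ?B m n = presented (G m n) (R m n)" for m n by (simp add: pbim_def)
  note lin = pbim_linear[OF B, folded md] and gn = pbim_gen[OF B]
  have cl: "\<sigma> permutes {..<m} \<Longrightarrow> g \<in> G m n \<Longrightarrow> La \<sigma> g \<in> G m n" "\<sigma> permutes {..<n} \<Longrightarrow> g \<in> G m n \<Longrightarrow> Ra \<sigma> g \<in> G m n"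
    and fn: "La id g = g" "Ra id g = g" "La (\<sigma> \<circ> \<sigma>') g = La \<sigma> (La \<sigma>' g)" "Ra (\<sigma> \<circ> \<sigma>') g = Ra \<sigma> (Ra \<sigma>' g)"
      "La \<sigma> (Ra \<sigma>' g) = Ra \<sigma>' (La \<sigma> g)" for \<sigma> \<sigma>' g m n
    using B unfolding bim_presentation_def by simp_all
  have eqI: "f A = h A" if "linear_map (md ?B m n) (md ?B m n) f" "linear_map (md ?B m n) (md ?B m n) h"
    "\<And>g. g \<in> G m n \<Longrightarrow> f (coset (R m n) (gen g)) = h (coset (R m n) (gen g))" "A \<in> elts ?B m n" for f h m n A
    using presented_eqI[OF presented_module that(1,2)[unfolded md] that(3)] that(4) unfolding md by blast
  note pid = permutes_id[of "{..<m}" for m]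
  show ?thesis
    unfolding sbimodule_def
  proof (intro conjI allI impI ballI; (elim conjE)?)
    fix m n show "kmod (md ?B m n)" unfolding md by (rule presented_module)
    show "elts ?B m n = {\<zero>\<^bsub>md ?B m n\<^esub>}" if "m = 0 \<or> n = 0"
      unfolding md using B that by (intro presented_trivial) (auto simp: bim_presentation_def)
    fix \<sigma> show "linear_map (md ?B m n) (md ?B m n) (lact ?B m n \<sigma>)" if "\<sigma> permutes {..<m}" using lin(1)[OF that] .
    show "linear_map (md ?B m n) (md ?B m n) (ract ?B m n \<sigma>)" if "\<sigma> permutes {..<n}" using lin(2)[OF that] .
  next
    fix m n A assume A: "A \<in> elts ?B m n"
    show "lact ?B m n id A = A"
      by (rule eqI[OF lin(1)[OF pid] linear_map_id _ A]) (simp add: gn(1)[OF _ pid] fn)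
    show "ract ?B m n id A = A"
      by (rule eqI[OF lin(2)[OF pid] linear_map_id _ A]) (simp add: gn(2)[OF _ pid] fn del: id_apply)
  next
    fix m n \<sigma> \<sigma>' A assume A: "A \<in> elts ?B m n" and s: "\<sigma> permutes {..<m}" "\<sigma>' permutes {..<m}"
    show "lact ?B m n (\<sigma> \<circ> \<sigma>') A = lact ?B m n \<sigma> (lact ?B m n \<sigma>' A)"
      by (rule eqI[OF lin(1)[OF permutes_compose[OF s(2,1)]] linear_map_comp[OF lin(1)[OF s(2)] lin(1)[OF s(1)]] _ A])
         (simp add: gn(1) s permutes_compose cl fn)
  next
    fix m n \<tau> \<tau>' A assume A: "A \<in> elts ?B m n" and s: "\<tau> permutes {..<n}" "\<tau>' permutes {..<n}"
    have "inv_into UNIV (\<tau> \<circ> \<tau>') = inv_into UNIV \<tau>' \<circ> inv_into UNIV \<tau>"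
      using s by (intro o_inv_distrib) (auto simp: permutes_bij)
    thus "ract ?B m n (\<tau> \<circ> \<tau>') A = ract ?B m n \<tau>' (ract ?B m n \<tau> A)"
      by (intro eqI[OF lin(2)[OF permutes_compose[OF s(2,1)]] linear_map_comp[OF lin(2)[OF s(1)] lin(2)[OF s(2)]] _ A])
         (simp add: gn(2) s permutes_compose permutes_inv cl fn)
  next
    fix m n \<sigma> \<tau> A assume A: "A \<in> elts ?B m n" and s: "\<sigma> permutes {..<m}" "\<tau> permutes {..<n}"
    show "lact ?B m n \<sigma> (ract ?B m n \<tau> A) = ract ?B m n \<tau> (lact ?B m n \<sigma> A)"
      by (rule eqI[OF linear_map_comp[OF lin(2)[OF s(2)] lin(1)[OF s(1)]] linear_map_comp[OF lin(1)[OF s(1)] lin(2)[OF s(2)]] _ A])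
         (simp add: gn s permutes_inv cl fn)
  qed
qed

lemma pbim_map:
  assumes B: "bim_presentation G R La Ra" and Q: "sbimodule Q"
    and \<phi>: "\<And>m n. compatible (md Q m n) (G m n) (R m n) (\<phi> m n)"
    and l: "\<And>m n g \<sigma>. g \<in> G m n \<Longrightarrow> \<sigma> permutes {..<m} \<Longrightarrow> \<phi> m n (La \<sigma> g) = lact Q m n \<sigma> (\<phi> m n g)"
    and r: "\<And>m n g \<tau>. g \<in> G m n \<Longrightarrow> \<tau> permutes {..<n} \<Longrightarrow> \<phi> m n (Ra (inv_into UNIV \<tau>) g) = ract Q m n \<tau> (\<phi> m n g)"
  shows "sbimod_map (pbim G R La Ra) Q (\<lambda>m n. lift (md Q m n) (\<phi> m n))"
proof -
  let ?B = "pbim G R La Ra"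
  have md: "md ?B m n = presented (G m n) (R m n)" for m n by (simp add: pbim_def)
  have p: "presentation (G m n) (R m n)" for m n using B by (simp add: bim_presentation_def)
  have cl: "\<sigma> permutes {..<m} \<Longrightarrow> g \<in> G m n \<Longrightarrow> La \<sigma> g \<in> G m n" "\<sigma> permutes {..<n} \<Longrightarrow> g \<in> G m n \<Longrightarrow> Ra \<sigma> g \<in> G m n" for \<sigma> g m n
    using B unfolding bim_presentation_def by simp_all
  note S = sbimoduleD[OF Q]
  have L: "linear_map (md ?B m n) (md Q m n) (lift (md Q m n) (\<phi> m n))" for m n
    unfolding md by (rule lift_linear[OF S(1) p \<phi>])
  note gn = lift_gen[OF S(1) p \<phi>]
  show ?thesis unfolding sbimod_map_def
  proof (intro conjI allI ballI impI L)
    fix m n \<sigma> A assume A: "A \<in> elts ?B m n" and s: "\<sigma> permutes {..<m}"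
    show "lift (md Q m n) (\<phi> m n) (lact ?B m n \<sigma> A) = lact Q m n \<sigma> (lift (md Q m n) (\<phi> m n) A)"
      by (rule presented_eqI[OF S(1) linear_map_comp[OF pbim_linear(1)[OF B s] L[unfolded md]] linear_map_comp[OF L[unfolded md] S(3)[OF s]] _ A[unfolded md]])
         (simp add: pbim_gen[OF B] s gn cl l)
  next
    fix m n \<tau> A assume A: "A \<in> elts ?B m n" and s: "\<tau> permutes {..<n}"
    show "lift (md Q m n) (\<phi> m n) (ract ?B m n \<tau> A) = ract Q m n \<tau> (lift (md Q m n) (\<phi> m n) A)"
      by (rule presented_eqI[OF S(1) linear_map_comp[OF pbim_linear(2)[OF B s] L[unfolded md]] linear_map_comp[OF L[unfolded md] S(4)[OF s]] _ A[unfolded md]])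
         (simp add: pbim_gen[OF B] s gn cl permutes_inv r)
  qed
qed

text \<open>
  The support is bounded by \<open>level_compatibleI\<close>, which is applied to a zero map.
\<close>

lemma level_presentation:
  assumes "sbimodule P" "admissible P G K" "r \<in> level_rels P G K"
  shows "Poly_Mapping.keys r \<subseteq> G"
proof -
  let ?M = "presented {} {} :: ('a, (unit \<Rightarrow>\<^sub>0 'a) set) module"
  have M: "kmod ?M" by (rule presented_module)
  have "linear_map N ?M (\<lambda>_. \<zero>\<^bsub>?M\<^esub>)" for N :: "('a, 'b) module"
    using kmod_facts(3,11,12)[OF M] by (intro linear_mapI) auto
  thus ?thesis
    using level_compatibleI(2)[OF assms(1,2) M, of "\<lambda>_. \<zero>\<^bsub>?M\<^esub>"] assms(3) kmod_facts(3)[OF M] by blast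
qed

lemma sbimod_map_cong:
  assumes f: "sbimod_map P Q f" and eq: "\<And>m n x. x \<in> elts P m n \<Longrightarrow> f m n x = g m n x" and P: "sbimodule P"
  shows "sbimod_map P Q g"
  unfolding sbimod_map_def
proof (intro conjI allI ballI impI)
  show "linear_map (md P m n) (md Q m n) (g m n)" for m n
    using linear_map_cong[OF sbimod_mapD(1)[OF f] eq sbimoduleD(1)[OF P]] .
qed (simp_all add: act_closed[OF P] sbimod_mapD[OF f] flip: eq)

lemma compatible_map:
  assumes "sbimodule P" "sbimodule P'" "sbimod_map P P' h" "admissible P G K" "admissible P' G' K'" "level_rels P' G' K' \<subseteq> R'"
    "\<And>xs. K xs \<in> G \<Longrightarrow> T (K xs) = K' (map (vrelabel f g h) xs)" "\<And>x. x \<in> G \<Longrightarrow> T x \<in> G'"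
  shows "compatible (presented G' R') G (level_rels P G K) (\<lambda>x. coset R' (gen (T x)))"
  unfolding compatible_def
proof (intro conjI ballI)
  show "coset R' (gen (T x)) \<in> carrier (presented G' R')" if "x \<in> G" for x
    using assms(8)[OF that] by (rule gen_coset_in)
  show "lin (presented G' R') (\<lambda>x. coset R' (gen (T x))) r = \<zero>\<^bsub>presented G' R'\<^esub>" if "r \<in> level_rels P G K" for r
    by (rule level_compatible_map[OF assms that])
qed

lemma relabel_comp: "relabel f g (relabel f' g' v) = relabel (f \<circ> f') (g \<circ> g') v"
  "relabel id id v = v" "relabel (\<lambda>x. x) (\<lambda>x. x) v = v"
  by (auto intro!: vertex_eqI)

lemma map_relabel_id: "map (relabel id id) vs = vs"
  by (simp add: relabel_comp map_idI)


section \<open>The bimodules of one-level graphs\<close>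

lemma Sgraphs_iff: "vs \<in> Sgraphs P m n \<longleftrightarrow> vs \<noteq> [] \<and> lvl vs \<and> (\<forall>v\<in>set vs. well_decorated P v) \<and>
    set (all_outs vs) = {..<m} \<and> set (all_ins vs) = {..<n}"
  by (auto simp: Sgraphs_def is_level_iff)

lemma Sgraphs_admissible: "admissible P (Sgraphs P m n) (\<lambda>vs. vs)"
  unfolding admissible_def
proof (intro conjI allI impI; (elim conjE)?)
  fix xs v ys assume v: "xs @ v # ys \<in> Sgraphs P m n"
  thus "well_decorated P v" "distinct (outs v)" "distinct (ins v)"
    by (auto simp: Sgraphs_iff lvl_append lvl_Cons)
  fix v' assume "reord (outs v) (outs v')" "reord (ins v) (ins v')" "well_decorated P v'"
  thus "xs @ v' # ys \<in> Sgraphs P m n"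
    using v lvl_same_edges[of xs v ys v'] by (auto simp: Sgraphs_iff reord_def)
next
  fix xs ys assume "xs \<in> Sgraphs P m n" "mset xs = mset ys"
  thus "ys \<in> Sgraphs P m n"
    using lvl_mset[of xs ys] mset_all(3-5)[of xs ys] by (auto simp: Sgraphs_iff simp del: set_concat)
qed

lemma level_rels_context: "level_rels P G (\<lambda>xs. as @ xs @ bs) \<subseteq> level_rels P G (\<lambda>xs. xs)"
proof
  fix r assume "r \<in> level_rels P G (\<lambda>xs. as @ xs @ bs)"
  thus "r \<in> level_rels P G (\<lambda>xs. xs)"
  proof (cases rule: level_rels_cases)
    case (add xs os "is" p q ys) thus ?thesis using level_relsI(1)[of "\<lambda>xs. xs" "as @ xs" os "is" p "ys @ bs" G q P] by simp
  next
    case (scale xs os "is" c p ys) thus ?thesis using level_relsI(2)[of "\<lambda>xs. xs" "as @ xs" os "is" p "ys @ bs" G P c] by simp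
  next
    case (lact xs os "is" \<sigma> p ys)
    thus ?thesis using level_relsI(3)[of \<sigma> os "\<lambda>xs. xs" "as @ xs" "is" p "ys @ bs" G P] by simp
  next
    case (ract xs os "is" \<tau> p ys)
    thus ?thesis using level_relsI(4)[of \<tau> "is" "\<lambda>xs. xs" "as @ xs" os p "ys @ bs" G P] by simp
  next
    case (mset xs ys)
    thus ?thesis using level_relsI(5)[of "as @ xs @ bs" "as @ ys @ bs" "\<lambda>xs. xs" G P] by simp
  qed
qed

lemma admissible_context:
  assumes "admissible P G (\<lambda>xs. xs)" shows "admissible P G (\<lambda>xs. as @ xs @ bs)"
  unfolding admissible_def
proof (intro conjI allI impI; (elim conjE)?)
  fix xs v ys assume v: "as @ (xs @ v # ys) @ bs \<in> G"
  hence v': "(as @ xs) @ v # (ys @ bs) \<in> G" by simp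
  show "well_decorated P v" "distinct (outs v)" "distinct (ins v)" using admissibleD(1)[OF assms v'] by auto
  fix v' assume "reord (outs v) (outs v')" "reord (ins v) (ins v')" "well_decorated P v'"
  thus "as @ (xs @ v' # ys) @ bs \<in> G" using admissibleD(2)[OF assms v'] by simp
next
  fix xs ys assume "as @ xs @ bs \<in> G" "mset xs = mset ys"
  thus "as @ ys @ bs \<in> G" using admissibleD(3)[OF assms, of "as @ xs @ bs" "as @ ys @ bs"] by simp
qed

lemma Srels_presentation: "sbimodule P \<Longrightarrow> presentation (Sgraphs P m n) (Srels P m n)"
  unfolding presentation_def Srels_def using level_presentation[OF _ Sgraphs_admissible] by blast

lemma Sgraphs_vrelabel:
  assumes vs: "vs \<in> Sgraphs P m n" and h: "sbimod_map P P' h" and f: "inj_on f {..<m}" "inj_on g {..<n}"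
  shows "lvl (map (vrelabel f g h) vs)" "\<forall>v\<in>set (map (vrelabel f g h) vs). well_decorated P' v"
    "set (all_outs (map (vrelabel f g h) vs)) = f ` {..<m}" "set (all_ins (map (vrelabel f g h) vs)) = g ` {..<n}"
proof -
  have o: "set (all_outs vs) = {..<m}" "set (all_ins vs) = {..<n}" using vs by (simp_all add: Sgraphs_iff)
  show "lvl (map (vrelabel f g h) vs)" using vs f unfolding Sgraphs_iff by (intro lvl_relabel) simp_all
  show "\<forall>v\<in>set (map (vrelabel f g h) vs). well_decorated P' v"
    using vs sbimod_mapD(2)[OF h] by (auto simp: Sgraphs_iff well_decorated_def)
  show "set (all_outs (map (vrelabel f g h) vs)) = f ` {..<m}" "set (all_ins (map (vrelabel f g h) vs)) = g ` {..<n}"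
    unfolding all_simps set_map o by simp_all
qed

lemma Smap_compatible:
  assumes P: "sbimodule P" "sbimodule P'" and h: "sbimod_map P P' h" and f: "f permutes {..<m}" "g permutes {..<n}"
  shows "compatible (Smod P' m n) (Sgraphs P m n) (Srels P m n) (\<lambda>vs. Sclass P' m n (map (vrelabel f g h) vs))"
    "vs \<in> Sgraphs P m n \<Longrightarrow> map (vrelabel f g h) vs \<in> Sgraphs P' m n"
proof -
  have G: "map (vrelabel f g h) vs \<in> Sgraphs P' m n" if vs: "vs \<in> Sgraphs P m n" for vs
    using Sgraphs_vrelabel[OF vs h permutes_inj_on[OF f(1)] permutes_inj_on[OF f(2)]] vs
    unfolding Sgraphs_iff permutes_image[OF f(1)] permutes_image[OF f(2)] by simp
  show "vs \<in> Sgraphs P m n \<Longrightarrow> map (vrelabel f g h) vs \<in> Sgraphs P' m n" by (rule G)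
  show "compatible (Smod P' m n) (Sgraphs P m n) (Srels P m n) (\<lambda>vs. Sclass P' m n (map (vrelabel f g h) vs))"
    unfolding Smod_def Sclass_def Srels_def
    by (rule compatible_map[OF P h Sgraphs_admissible Sgraphs_admissible subset_refl refl G])
qed

lemma sbimod_map_id: "sbimod_map P P (\<lambda>_ _ x. x)"
  by (simp add: sbimod_map_def linear_map_id)

lemma Sten_pbim:
  "Sten P = pbim (Sgraphs P) (Srels P) (\<lambda>\<sigma>. map (relabel \<sigma> id)) (\<lambda>\<tau>. map (relabel id \<tau>))"
  by (simp add: Sten_def pbim_def Smod_def Sclass_def fun_eq_iff)

lemma Sten_presentation:
  assumes P: "sbimodule P"
  shows "bim_presentation (Sgraphs P) (Srels P) (\<lambda>\<sigma>. map (relabel \<sigma> id)) (\<lambda>\<tau>. map (relabel id \<tau>))"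
  unfolding bim_presentation_def
proof (intro conjI allI impI ballI)
  show "presentation (Sgraphs P m n) (Srels P m n)" for m n by (rule Srels_presentation[OF P])
  show "Sgraphs P m n = {}" if "m = 0 \<or> n = 0" for m n
  proof -
    have "vs \<notin> Sgraphs P m n" for vs using that by (cases vs) (auto simp: Sgraphs_iff lvl_Cons)
    thus ?thesis by blast
  qed
  note c = Smap_compatible[OF P P sbimod_map_id, unfolded vrelabel_id]
  fix m n
  show "map (relabel \<sigma> id) vs \<in> Sgraphs P m n" if "\<sigma> permutes {..<m}" "vs \<in> Sgraphs P m n" for \<sigma> vs
    using c(2)[OF that(1) permutes_id that(2)] .
  show "compatible (presented (Sgraphs P m n) (Srels P m n)) (Sgraphs P m n) (Srels P m n)
      (\<lambda>g. coset (Srels P m n) (gen (map (relabel \<sigma> id) g)))" if "\<sigma> permutes {..<m}" for \<sigma>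
    using c(1)[OF that permutes_id] by (simp add: Smod_def Sclass_def)
  show "map (relabel id \<tau>) vs \<in> Sgraphs P m n" if "\<tau> permutes {..<n}" "vs \<in> Sgraphs P m n" for \<tau> vs
    using c(2)[OF permutes_id that] .
  show "compatible (presented (Sgraphs P m n) (Srels P m n)) (Sgraphs P m n) (Srels P m n)
      (\<lambda>g. coset (Srels P m n) (gen (map (relabel id \<tau>) g)))" if "\<tau> permutes {..<n}" for \<tau>
    using c(1)[OF permutes_id that] by (simp add: Smod_def Sclass_def)
qed (auto simp: map_relabel_id intro!: vertex_eqI)

lemma Sten_sbimodule: "sbimodule P \<Longrightarrow> sbimodule (Sten P)"
  unfolding Sten_pbim by (rule pbim_sbimodule[OF Sten_presentation])

lemma md_Sten [simp]: "md (Sten P) m n = Smod P m n"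
  by (simp add: Sten_def)

lemma Smod_module: "kmod (Smod P m n)"
  unfolding Smod_def by (rule presented_module)

lemma Sclass_in: "vs \<in> Sgraphs P m n \<Longrightarrow> Sclass P m n vs \<in> carrier (Smod P m n)"
  unfolding Smod_def Sclass_def by (rule gen_coset_in)

lemma Smod_eqI:
  assumes "kmod M" "linear_map (Smod P m n) M f" "linear_map (Smod P m n) M h"
    "\<And>vs. vs \<in> Sgraphs P m n \<Longrightarrow> f (Sclass P m n vs) = h (Sclass P m n vs)" "A \<in> carrier (Smod P m n)"
  shows "f A = h A"
  using presented_eqI[OF assms(1) assms(2,3)[unfolded Smod_def]] assms(4,5) unfolding Smod_def Sclass_def by blast

lemma Sten_gen:
  assumes "sbimodule P" "vs \<in> Sgraphs P m n"
  shows "\<sigma> permutes {..<m} \<Longrightarrow> lact (Sten P) m n \<sigma> (Sclass P m n vs) = Sclass P m n (map (relabel \<sigma> id) vs)"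
    "\<tau> permutes {..<n} \<Longrightarrow> ract (Sten P) m n \<tau> (Sclass P m n vs) = Sclass P m n (map (relabel id (inv_into UNIV \<tau>)) vs)"
  using pbim_gen[OF Sten_presentation[OF assms(1)] assms(2)] unfolding Sten_pbim Sclass_def by simp_all

lemma lift_Smod:
  assumes "sbimodule P" "kmod M" "compatible M (Sgraphs P m n) (Srels P m n) \<phi>"
  shows "linear_map (Smod P m n) M (lift M \<phi>)" "vs \<in> Sgraphs P m n \<Longrightarrow> lift M \<phi> (Sclass P m n vs) = \<phi> vs"
  using lift_linear[OF assms(2) Srels_presentation[OF assms(1)] assms(3)]
    lift_gen[OF assms(2) Srels_presentation[OF assms(1)] assms(3)] by (simp_all add: Smod_def Sclass_def)

lemma Sclass_leveq:
  assumes "sbimodule P" "vs \<in> Sgraphs P m n" "leveq P vs vs'"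
  shows "Sclass P m n vs = Sclass P m n vs'" "vs' \<in> Sgraphs P m n"
  using class_leveq[OF assms(1) Sgraphs_admissible _ assms(2,3), of "Srels P m n"]
  by (simp_all add: Srels_def Sclass_def)

lemma Sclass_linear:
  assumes "sbimodule P" "v # vs \<in> Sgraphs P m n"
  shows "linear_map (md P (length (outs v)) (length (ins v))) (Smod P m n)
    (\<lambda>p. Sclass P m n (Vertex (outs v) (ins v) p # vs))"
  using class_linear[OF assms(1) Sgraphs_admissible[of P m n], of "Srels P m n" "[]" v vs] assms
  by (simp add: Srels_def Sclass_def Smod_def)

lemma Sten_map_gen:
  assumes P: "sbimodule P" "sbimodule P'" and h: "sbimod_map P P' h" and vs: "vs \<in> Sgraphs P m n"
  shows "Sten_map P P' h m n (Sclass P m n vs) = Sclass P' m n (map (vmap h) vs)" "map (vmap h) vs \<in> Sgraphs P' m n"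
  using lift_Smod(2)[OF P(1) Smod_module Smap_compatible(1)[OF P h permutes_id permutes_id] vs]
    Smap_compatible(2)[OF P h permutes_id permutes_id vs] Sclass_in[OF vs]
  by (simp_all add: Sten_map_def vrelabel_id)

lemma Sten_map_sbimod:
  assumes P: "sbimodule P" "sbimodule P'" and h: "sbimod_map P P' h"
  shows "sbimod_map (Sten P) (Sten P') (Sten_map P P' h)"
proof -
  have "sbimod_map (Sten P) (Sten P') (\<lambda>m n. lift (md (Sten P') m n) (\<lambda>vs. Sclass P' m n (map (vmap h) vs)))"
    unfolding Sten_pbim[of P]
  proof (rule pbim_map[OF Sten_presentation[OF P(1)] Sten_sbimodule[OF P(2)]])
    fix m n show "compatible (md (Sten P') m n) (Sgraphs P m n) (Srels P m n) (\<lambda>vs. Sclass P' m n (map (vmap h) vs))"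
      using Smap_compatible(1)[OF P h permutes_id permutes_id] by (simp add: vrelabel_id)
    fix vs assume vs: "vs \<in> Sgraphs P m n"
    note g = Sten_gen[OF P(2) Sten_map_gen(2)[OF P h vs]]
    have eq: "map (vmap h) (map (relabel f g) vs) = map (relabel f g) (map (vmap h) vs)" for f g
      by (auto intro: vertex_eqI)
    show "Sclass P' m n (map (vmap h) (map (relabel \<sigma> id) vs)) = lact (Sten P') m n \<sigma> (Sclass P' m n (map (vmap h) vs))"
      if "\<sigma> permutes {..<m}" for \<sigma> unfolding eq using g(1)[OF that] by simp
    show "Sclass P' m n (map (vmap h) (map (relabel id (inv_into UNIV \<tau>)) vs)) = ract (Sten P') m n \<tau> (Sclass P' m n (map (vmap h) vs))"
      if "\<tau> permutes {..<n}" for \<tau> unfolding eq using g(2)[OF that] by simp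
  qed
  thus ?thesis
    by (rule sbimod_map_cong[OF _ _ Sten_sbimodule[OF P(1)]]) (simp add: Sten_map_def)
qed

lemma Sincl_graph: "0 < m \<Longrightarrow> 0 < n \<Longrightarrow> p \<in> elts P m n \<Longrightarrow> [Vertex [0..<m] [0..<n] p] \<in> Sgraphs P m n"
  by (auto simp: Sgraphs_iff lvl_def well_decorated_def)

lemma Sincl_sbimod:
  assumes P: "sbimodule P" shows "sbimod_map P (Sten P) (Sincl P)"
  unfolding sbimod_map_def
proof (intro conjI allI ballI impI)
  note S = sbimoduleD[OF P] and S' = sbimoduleD[OF Sten_sbimodule[OF P]]
  fix m n
  have lin0: "linear_map (md P m n) (Smod P m n) (\<lambda>_. \<zero>\<^bsub>Smod P m n\<^esub>)"
    using kmod_facts(3,11,12)[OF Smod_module[of P m n]] by (intro linear_mapI) auto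
  have lin1: "linear_map (md P m n) (Smod P m n) (\<lambda>p. Sclass P m n [Vertex [0..<m] [0..<n] p])" if "0 < m" "0 < n"
    using Sclass_linear[OF P Sincl_graph[OF that kmod_facts(3)[OF S(1)]]] by simp
  show "linear_map (md P m n) (md (Sten P) m n) (Sincl P m n)"
    using lin0 lin1 by (cases "m = 0 \<or> n = 0") (simp_all add: Sincl_def[abs_def])
  fix \<sigma> p assume p: "p \<in> elts P m n"
  have z: "lact (Sten P) m n \<sigma> \<zero>\<^bsub>Smod P m n\<^esub> = \<zero>\<^bsub>Smod P m n\<^esub>" if "\<sigma> permutes {..<m}"
    using linear_map_zero[OF S'(3)[OF that] S'(1) S'(1)] by simp
  have z': "ract (Sten P) m n \<sigma> \<zero>\<^bsub>Smod P m n\<^esub> = \<zero>\<^bsub>Smod P m n\<^esub>" if "\<sigma> permutes {..<n}"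
    using linear_map_zero[OF S'(4)[OF that] S'(1) S'(1)] by simp
  have pl: "permute_list \<sigma> [0..<k] = map \<sigma> [0..<k]" if "\<sigma> permutes {..<k}" for k
    using that permutes_in_image[OF that] by (auto simp: permute_list_def)
  show "Sincl P m n (lact P m n \<sigma> p) = lact (Sten P) m n \<sigma> (Sincl P m n p)" if s: "\<sigma> permutes {..<m}"
  proof (cases "m = 0 \<or> n = 0")
    case False
    have "leveq P [Vertex [0..<m] [0..<n] (lact P m n \<sigma> p)] [Vertex (map \<sigma> [0..<m]) [0..<n] p]"
      using veq_lact[OF P, of p "[0..<m]" "[0..<n]" \<sigma>] p s pl[OF s] by (intro leveqI) simp
    hence "Sclass P m n [Vertex [0..<m] [0..<n] (lact P m n \<sigma> p)] = Sclass P m n [Vertex (map \<sigma> [0..<m]) [0..<n] p]"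
      using Sclass_leveq(1)[OF P Sincl_graph[OF _ _ act_closed(1)[OF P p s]]] False by simp
    also have "\<dots> = lact (Sten P) m n \<sigma> (Sclass P m n [Vertex [0..<m] [0..<n] p])"
      using Sten_gen(1)[OF P Sincl_graph[OF _ _ p] s] False by (simp add: relabel_def)
    finally show ?thesis using False by (simp add: Sincl_def)
  next
    case True
    thus ?thesis by (simp only: Sincl_def if_True z[OF s])
  qed
  show "Sincl P m n (ract P m n \<sigma> p) = ract (Sten P) m n \<sigma> (Sincl P m n p)" if s: "\<sigma> permutes {..<n}"
  proof (cases "m = 0 \<or> n = 0")
    case False
    have di: "distinct (map (inv_into UNIV \<sigma>) [0..<n])"
      using permutes_inj_on[OF permutes_inv[OF s]] by (simp add: distinct_map)
    have "permute_list \<sigma> (map (inv_into UNIV \<sigma>) [0..<n]) = map (inv_into UNIV \<sigma>) (map \<sigma> [0..<n])"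
      using s pl[OF s] by (simp add: permute_list_map)
    also have "\<dots> = [0..<n]" using permutes_inverses(2)[OF s] by (auto intro: map_idI)
    finally have "leveq P [Vertex [0..<m] [0..<n] (ract P m n \<sigma> p)] [Vertex [0..<m] (map (inv_into UNIV \<sigma>) [0..<n]) p]"
      using veq_ract[OF P _ _ di, of p "[0..<m]" \<sigma>] p s by (intro leveqI) simp
    hence "Sclass P m n [Vertex [0..<m] [0..<n] (ract P m n \<sigma> p)] = Sclass P m n [Vertex [0..<m] (map (inv_into UNIV \<sigma>) [0..<n]) p]"
      using Sclass_leveq(1)[OF P Sincl_graph[OF _ _ act_closed(2)[OF P p s]]] False by simp
    also have "\<dots> = ract (Sten P) m n \<sigma> (Sclass P m n [Vertex [0..<m] [0..<n] p])"
      using Sten_gen(2)[OF P Sincl_graph[OF _ _ p] s] False by (simp add: relabel_def)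
    finally show ?thesis using False by (simp add: Sincl_def)
  next
    case True
    thus ?thesis by (simp only: Sincl_def if_True z'[OF s])
  qed
qed

text \<open>The horizontal product places two one-level graphs side by side.\<close>

lemma Sprod_graph:
  fixes P :: "('k::field, 'a, 'x) sbimod_scheme"
  assumes "us \<in> Sgraphs P m n" "vs \<in> Sgraphs P m' n'"
  shows "us @ map (relabel ((+) m) ((+) n)) vs \<in> Sgraphs P (m + m') (n + n')"
proof -
  have s: "(+) k ` {..<l} = {k..<k + l}" for k l :: nat
    using image_add_atLeastLessThan[of k 0 l] by (simp add: lessThan_atLeast0 add.commute)
  note v = Sgraphs_vrelabel[OF assms(2) sbimod_map_id, of "(+) m" "(+) n", unfolded vrelabel_id s]
  have u: "set (all_outs us) = {..<m}" "set (all_ins us) = {..<n}" "us \<noteq> []" "lvl us" "\<forall>u\<in>set us. well_decorated P u"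
    using assms(1) by (simp_all add: Sgraphs_iff del: set_concat)
  have "{..<k} \<inter> {k..<k + l} = {}" "{..<k} \<union> {k..<k + l} = {..<k + l}" for k l :: nat by auto
  thus ?thesis
    unfolding Sgraphs_iff lvl_append map_append concat_append set_append ball_Un u(1,2) v(3,4)[OF inj_on_add inj_on_add]
    using u(3-5) v(1,2)[OF inj_on_add inj_on_add] by simp
qed

lemma Sprod_bilinear:
  assumes P: "sbimodule P"
  shows "bilinear_map (Smod P m n) (Smod P m' n') (Smod P (m + m') (n + n')) (Sprod P m n m' n')"
    and "us \<in> Sgraphs P m n \<Longrightarrow> vs \<in> Sgraphs P m' n' \<Longrightarrow> Sprod P m n m' n' (Sclass P m n us) (Sclass P m' n' vs) =
      Sclass P (m + m') (n + n') (us @ map (relabel ((+) m) ((+) n)) vs)"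
proof -
  let ?\<Phi> = "\<lambda>us vs. Sclass P (m + m') (n + n') (us @ map (relabel ((+) m) ((+) n)) vs)"
  note ctx = admissible_context[OF Sgraphs_admissible[of P "m + m'" "n + n'"]]
  have sub: "level_rels P (Sgraphs P (m + m') (n + n')) (\<lambda>xs. as @ xs @ bs) \<subseteq> Srels P (m + m') (n + n')" for as bs
    unfolding Srels_def by (rule level_rels_context)
  have c1: "compatible (Smod P (m + m') (n + n')) (Sgraphs P m n) (Srels P m n) (\<lambda>us. ?\<Phi> us vs)" if vs: "vs \<in> Sgraphs P m' n'" for vs
  proof -
    let ?w = "map (relabel ((+) m) ((+) n)) vs"
    show ?thesis unfolding Sclass_def Smod_def Srels_def[of P m n]
      by (rule compatible_map[OF P P sbimod_map_id Sgraphs_admissible ctx[of "[]" ?w] sub[of "[]" ?w], where f = id and g = id])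
         (simp_all add: vrelabel_id map_relabel_id Sprod_graph[OF _ vs])
  qed
  have c2: "compatible (Smod P (m + m') (n + n')) (Sgraphs P m' n') (Srels P m' n') (?\<Phi> us)" if us: "us \<in> Sgraphs P m n" for us
    unfolding Sclass_def Smod_def Srels_def[of P m' n']
    by (rule compatible_map[OF P P sbimod_map_id Sgraphs_admissible ctx[of us "[]"] sub[of us "[]"], where f = "(+) m" and g = "(+) n"])
       (simp_all add: vrelabel_id Sprod_graph[OF us])
  have eq: "Sprod P m n m' n' = lift2 (Smod P (m + m') (n + n')) ?\<Phi>"
    by (simp add: fun_eq_iff Sprod_def lift2_def)
  note b = lift2_bilinear[OF Smod_module Srels_presentation[OF P, of m n] Srels_presentation[OF P, of m' n'] c1 c2]
  show "bilinear_map (Smod P m n) (Smod P m' n') (Smod P (m + m') (n + n')) (Sprod P m n m' n')"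
    unfolding eq using b(1) by (simp add: Smod_def)
  show "us \<in> Sgraphs P m n \<Longrightarrow> vs \<in> Sgraphs P m' n' \<Longrightarrow> Sprod P m n m' n' (Sclass P m n us) (Sclass P m' n' vs) = ?\<Phi> us vs"
    unfolding eq Sclass_def[of P m n] Sclass_def[of P m' n'] using b(2) by blast
qed

section \<open>The bimodule of connected two-level graphs\<close>

lemma all_simps_comp [simp]:
  "concat (map (outs \<circ> relabel f g) vs) = map f (all_outs vs)" "concat (map (ins \<circ> relabel f g) vs) = map g (all_ins vs)"
  "concat (map (outs \<circ> vmap h) vs) = all_outs vs" "concat (map (ins \<circ> vmap h) vs) = all_ins vs"
  "concat (map (outs \<circ> vrelabel f g h) vs) = map f (all_outs vs)" "concat (map (ins \<circ> vrelabel f g h) vs) = map g (all_ins vs)"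
  by (induction vs) auto

definition cgraph :: "('k, 'b, 'y) sbimod_scheme \<Rightarrow> ('k, 'a, 'x) sbimod_scheme \<Rightarrow> ('b, 'a) graph2 \<Rightarrow> bool" where
  "cgraph Q P d \<longleftrightarrow> matching (fst d) (snd d) \<and> conn2 (fst d) (snd d) \<and>
     (\<forall>u\<in>set (fst d). well_decorated Q u) \<and> (\<forall>v\<in>set (snd d). well_decorated P v)"

lemma Bgraphs_iff:
  "d \<in> Bgraphs Q P m n \<longleftrightarrow> cgraph Q P d \<and> set (all_outs (fst d)) = {..<m} \<and> set (all_ins (snd d)) = {..<n}"
proof -
  obtain us vs where d: "d = (us, vs)" by (cases d)
  have "(us, vs) \<in> Bgraphs Q P m n \<longleftrightarrow> matching us vs \<and> connected_graph [map shape us, map shape vs] \<and>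
    (\<forall>u\<in>set us. well_decorated Q u) \<and> (\<forall>v\<in>set vs. well_decorated P v) \<and>
    set (all_outs us) = {..<m} \<and> set (all_ins vs) = {..<n}"
    by (auto simp: Bgraphs_def is_level_iff matching_def simp del: set_concat)
  thus ?thesis using connected_graph2[of us vs] by (auto simp: d cgraph_def simp del: set_concat)
qed

lemma in_sets_simps: "in_sets (v # vs) = insert (set (ins v)) (in_sets vs)" "in_sets (vs @ ws) = in_sets vs \<union> in_sets ws"
  "out_sets (v # vs) = insert (set (outs v)) (out_sets vs)" "out_sets (vs @ ws) = out_sets vs \<union> out_sets ws"
  by (auto simp: in_sets_def out_sets_def)

lemma sets_mset: "mset xs = mset ys \<Longrightarrow> in_sets xs = in_sets ys" "mset xs = mset ys \<Longrightarrow> out_sets xs = out_sets ys"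
  by (auto simp: in_sets_def out_sets_def dest: mset_eq_setD)

lemma all_Union: "set (all_ins vs) = \<Union> (in_sets vs)" "set (all_outs vs) = \<Union> (out_sets vs)"
  by (auto simp: in_sets_def out_sets_def)

lemma cgraph_same_sets:
  assumes "cgraph Q P (us, vs)" "lvl us'" "lvl vs'" "in_sets us = in_sets us'" "out_sets vs = out_sets vs'"
    "\<forall>u\<in>set us'. well_decorated Q u" "\<forall>v\<in>set vs'. well_decorated P v"
  shows "cgraph Q P (us', vs')"
  using assms conn2_cong[OF assms(4,5)] unfolding cgraph_def matching_def fst_conv snd_conv all_Union by simp

lemma Bgraphs_admissible_top: "admissible Q (Bgraphs Q P m n) (\<lambda>us. (us, vs))"
  unfolding admissible_def
proof (intro conjI allI impI; (elim conjE)?)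
  fix xs v ys assume v: "(xs @ v # ys, vs) \<in> Bgraphs Q P m n"
  hence l: "lvl (xs @ v # ys)" "lvl vs" by (auto simp: Bgraphs_iff cgraph_def matching_def)
  thus "well_decorated Q v" "distinct (outs v)" "distinct (ins v)"
    using v by (auto simp: Bgraphs_iff cgraph_def lvl_append lvl_Cons)
  fix v' assume r: "reord (outs v) (outs v')" "reord (ins v) (ins v')" "well_decorated Q v'"
  hence "in_sets (xs @ v # ys) = in_sets (xs @ v' # ys)" "out_sets (xs @ v # ys) = out_sets (xs @ v' # ys)"
    by (simp_all add: in_sets_simps reord_def)
  thus "(xs @ v' # ys, vs) \<in> Bgraphs Q P m n"
    using v r lvl_same_edges[OF l(1) r(1,2)] l(2) cgraph_same_sets[of Q P "xs @ v # ys" vs "xs @ v' # ys" vs]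
    unfolding Bgraphs_iff all_Union by (auto simp: cgraph_def)
next
  fix xs ys assume "(xs, vs) \<in> Bgraphs Q P m n" "mset xs = mset ys"
  thus "(ys, vs) \<in> Bgraphs Q P m n"
    using lvl_mset[of xs ys] mset_all(3)[of xs ys] sets_mset[of xs ys] cgraph_same_sets[of Q P xs vs ys vs]
    unfolding Bgraphs_iff all_Union by (auto simp: cgraph_def matching_def)
qed

lemma Bgraphs_admissible_bot: "admissible P (Bgraphs Q P m n) (\<lambda>vs. (us, vs))"
  unfolding admissible_def
proof (intro conjI allI impI; (elim conjE)?)
  fix xs v ys assume v: "(us, xs @ v # ys) \<in> Bgraphs Q P m n"
  hence l: "lvl (xs @ v # ys)" "lvl us" by (auto simp: Bgraphs_iff cgraph_def matching_def)
  thus "well_decorated P v" "distinct (outs v)" "distinct (ins v)"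
    using v by (auto simp: Bgraphs_iff cgraph_def lvl_append lvl_Cons)
  fix v' assume r: "reord (outs v) (outs v')" "reord (ins v) (ins v')" "well_decorated P v'"
  hence "in_sets (xs @ v # ys) = in_sets (xs @ v' # ys)" "out_sets (xs @ v # ys) = out_sets (xs @ v' # ys)"
    by (simp_all add: in_sets_simps reord_def)
  thus "(us, xs @ v' # ys) \<in> Bgraphs Q P m n"
    using v r lvl_same_edges[OF l(1) r(1,2)] l(2) cgraph_same_sets[of Q P us "xs @ v # ys" us "xs @ v' # ys"]
    unfolding Bgraphs_iff all_Union by (auto simp: cgraph_def)
next
  fix xs ys assume "(us, xs) \<in> Bgraphs Q P m n" "mset xs = mset ys"
  thus "(us, ys) \<in> Bgraphs Q P m n"
    using lvl_mset[of xs ys] mset_all(3)[of xs ys] sets_mset[of xs ys] cgraph_same_sets[of Q P us xs us ys]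
    unfolding Bgraphs_iff all_Union by (auto simp: cgraph_def matching_def)
qed

lemma cgraph_vrelabel:
  assumes d: "cgraph Q P (us, vs)" and h: "sbimod_map Q Q' h" "sbimod_map P P' h'"
    and inj: "inj_on f (set (all_outs us))" "inj_on e (set (all_ins us))" "inj_on g (set (all_ins vs))"
  shows "cgraph Q' P' (map (vrelabel f e h) us, map (vrelabel e g h') vs)"
proof -
  have m: "lvl us" "lvl vs" "set (all_ins us) = set (all_outs vs)" "conn2 us vs" using d by (auto simp: cgraph_def matching_def)
  have "lvl (map (vrelabel f e h) us)" "lvl (map (vrelabel e g h') vs)"
    using lvl_relabel[OF m(1) inj(1,2)] lvl_relabel[OF m(2) _ inj(3)] inj(2) m(3) by auto
  thus ?thesis
    using conn2_rename[OF m(4,3) inj(2)] d m(3) sbimod_mapD(2)[OF h(1)] sbimod_mapD(2)[OF h(2)]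
    unfolding cgraph_def matching_def fst_conv snd_conv all_simps set_map
    by (auto simp: well_decorated_def simp del: set_concat)
qed

lemma Brels_presentation:
  assumes "sbimodule Q" "sbimodule P" shows "presentation (Bgraphs Q P m n) (Brels Q P m n)"
  unfolding presentation_def
proof
  fix r assume "r \<in> Brels Q P m n"
  then consider vs where "r \<in> level_rels Q (Bgraphs Q P m n) (\<lambda>us. (us, vs))" | us where "r \<in> level_rels P (Bgraphs Q P m n) (\<lambda>vs. (us, vs))"
    | us vs f where "r = gen (us, vs) - gen (map (relabel id f) us, map (relabel f id) vs)"
        "(us, vs) \<in> Bgraphs Q P m n" "inj_on f (set (all_ins us))"
    unfolding Brels_def by blast
  thus "Poly_Mapping.keys r \<subseteq> Bgraphs Q P m n"
  proof cases
    case 3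
    have "(map (relabel id f) us, map (relabel f id) vs) \<in> Bgraphs Q P m n"
      using cgraph_vrelabel[OF _ sbimod_map_id sbimod_map_id _ 3(3), of Q P vs id id] 3(2)
      unfolding vrelabel_id Bgraphs_iff by (simp del: set_concat)
    thus ?thesis using 3 keys_diff[of "gen (us, vs)" "gen (map (relabel id f) us, map (relabel f id) vs)"] by auto
  qed (use level_presentation[OF assms(1) Bgraphs_admissible_top] level_presentation[OF assms(2) Bgraphs_admissible_bot] in blast)+
qed

lemma Box_compatibleI:
  assumes Q: "sbimodule Q" and P: "sbimodule P" and M: "kmod M" and \<phi>: "\<And>g. g \<in> Bgraphs Q P m n \<Longrightarrow> \<phi> g \<in> carrier M"
    and top: "\<And>vs r. r \<in> level_rels Q (Bgraphs Q P m n) (\<lambda>us. (us, vs)) \<Longrightarrow> lin M \<phi> r = \<zero>\<^bsub>M\<^esub>"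
    and bot: "\<And>us r. r \<in> level_rels P (Bgraphs Q P m n) (\<lambda>vs. (us, vs)) \<Longrightarrow> lin M \<phi> r = \<zero>\<^bsub>M\<^esub>"
    and ren: "\<And>us vs f. (us, vs) \<in> Bgraphs Q P m n \<Longrightarrow> inj_on f (set (all_ins us)) \<Longrightarrow>
      \<phi> (map (relabel id f) us, map (relabel f id) vs) = \<phi> (us, vs)"
  shows "compatible M (Bgraphs Q P m n) (Brels Q P m n) \<phi>"
  unfolding compatible_def
proof (intro conjI ballI \<phi>)
  fix r assume "r \<in> Brels Q P m n"
  then consider vs where "r \<in> level_rels Q (Bgraphs Q P m n) (\<lambda>us. (us, vs))" | us where "r \<in> level_rels P (Bgraphs Q P m n) (\<lambda>vs. (us, vs))"
    | us vs f where "r = gen (us, vs) - gen (map (relabel id f) us, map (relabel f id) vs)"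
        "(us, vs) \<in> Bgraphs Q P m n" "inj_on f (set (all_ins us))"
    unfolding Brels_def by blast
  thus "lin M \<phi> r = \<zero>\<^bsub>M\<^esub>"
  proof cases
    case 3
    have g: "(map (relabel id f) us, map (relabel f id) vs) \<in> Bgraphs Q P m n"
      using cgraph_vrelabel[OF _ sbimod_map_id sbimod_map_id _ 3(3), of Q P vs id id] 3(2)
      unfolding vrelabel_id Bgraphs_iff by (simp del: set_concat)
    show ?thesis unfolding 3(1)
    proof (rule lin_diff_eq_zero[of M "Bgraphs Q P m n"])
      show "lin M \<phi> (gen (us, vs)) = lin M \<phi> (gen (map (relabel id f) us, map (relabel f id) vs))"
        using lin_gen[of M "Bgraphs Q P m n" \<phi>] M \<phi> 3(2) g ren[OF 3(2,3)] by metis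
    qed (use M \<phi> 3(2) g in simp_all)
  qed (use top bot in blast)+
qed

lemma Bclass_rename:
  assumes "(us, vs) \<in> Bgraphs Q P m n" "inj_on f (set (all_ins us))"
  shows "Bclass Q P m n (map (relabel id f) us, map (relabel f id) vs) = Bclass Q P m n (us, vs)"
  unfolding Bclass_def
  by (rule coset_relation(1)[symmetric]) (use assms in \<open>unfold Brels_def, blast\<close>)

lemma Brels_levels:
  "level_rels Q (Bgraphs Q P m n) (\<lambda>us. (us, vs)) \<subseteq> Brels Q P m n" "level_rels P (Bgraphs Q P m n) (\<lambda>vs. (us, vs)) \<subseteq> Brels Q P m n"
  unfolding Brels_def by blast+

lemma Bmap_compatible:
  assumes Q: "sbimodule Q" "sbimodule Q'" and P: "sbimodule P" "sbimodule P'"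
    and h: "sbimod_map Q Q' h" and h': "sbimod_map P P' h'" and f: "f permutes {..<m}" and g: "g permutes {..<n}"
  defines "T \<equiv> \<lambda>d. (map (vrelabel f id h) (fst d), map (vrelabel id g h') (snd d))"
  shows "d \<in> Bgraphs Q P m n \<Longrightarrow> T d \<in> Bgraphs Q' P' m n"
    "compatible (Bmod Q' P' m n) (Bgraphs Q P m n) (Brels Q P m n) (\<lambda>d. Bclass Q' P' m n (T d))"
proof -
  have G: "T d \<in> Bgraphs Q' P' m n" if d: "d \<in> Bgraphs Q P m n" for d
  proof -
    have d': "cgraph Q P (fst d, snd d)" "set (all_outs (fst d)) = {..<m}" "set (all_ins (snd d)) = {..<n}"
      using d by (simp_all add: Bgraphs_iff)
    thus ?thesis
      using cgraph_vrelabel[OF d'(1) h h', of f id g] permutes_inj_on[OF f] permutes_inj_on[OF g]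
        permutes_image[OF f] permutes_image[OF g]
      unfolding Bgraphs_iff T_def fst_conv snd_conv all_simps set_map by (simp del: set_concat)
  qed
  thus "d \<in> Bgraphs Q P m n \<Longrightarrow> T d \<in> Bgraphs Q' P' m n" .
  show "compatible (Bmod Q' P' m n) (Bgraphs Q P m n) (Brels Q P m n) (\<lambda>d. Bclass Q' P' m n (T d))"
    unfolding Bmod_def Bclass_def
  proof (rule Box_compatibleI[OF Q(1) P(1) presented_module])
    show "coset (Brels Q' P' m n) (gen (T d)) \<in> carrier (presented (Bgraphs Q' P' m n) (Brels Q' P' m n))"
      if "d \<in> Bgraphs Q P m n" for d using G[OF that] by (rule gen_coset_in)
    show "lin (presented (Bgraphs Q' P' m n) (Brels Q' P' m n)) (\<lambda>d. coset (Brels Q' P' m n) (gen (T d))) r = \<zero>\<^bsub>presented (Bgraphs Q' P' m n) (Brels Q' P' m n)\<^esub>"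
      if "r \<in> level_rels Q (Bgraphs Q P m n) (\<lambda>us. (us, vs))" for r vs
      by (rule level_compatible_map[OF Q h Bgraphs_admissible_top
            Bgraphs_admissible_top[where vs = "map (vrelabel id g h') vs"] Brels_levels(1) _ G that, where f = f and g = id])
         (simp_all add: T_def)
    show "lin (presented (Bgraphs Q' P' m n) (Brels Q' P' m n)) (\<lambda>d. coset (Brels Q' P' m n) (gen (T d))) r = \<zero>\<^bsub>presented (Bgraphs Q' P' m n) (Brels Q' P' m n)\<^esub>"
      if "r \<in> level_rels P (Bgraphs Q P m n) (\<lambda>vs. (us, vs))" for r us
      by (rule level_compatible_map[OF P h' Bgraphs_admissible_bot
            Bgraphs_admissible_bot[where us = "map (vrelabel f id h) us"] Brels_levels(2) _ G that, where f = id and g = g])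
         (simp_all add: T_def)
    fix us vs and e :: "nat \<Rightarrow> nat" assume d: "(us, vs) \<in> Bgraphs Q P m n" and e: "inj_on e (set (all_ins us))"
    have eqT: "T (map (relabel id e) us, map (relabel e id) vs) =
      (map (relabel id e) (fst (T (us, vs))), map (relabel e id) (snd (T (us, vs))))"
      by (auto simp: T_def intro!: vertex_eqI)
    have "inj_on e (set (all_ins (fst (T (us, vs)))))" using e by (simp add: T_def del: set_concat)
    hence "Bclass Q' P' m n (map (relabel id e) (fst (T (us, vs))), map (relabel e id) (snd (T (us, vs)))) = Bclass Q' P' m n (T (us, vs))"
      using Bclass_rename[of "fst (T (us, vs))" "snd (T (us, vs))" Q' P' m n e] G[OF d] by simp
    thus "coset (Brels Q' P' m n) (gen (T (map (relabel id e) us, map (relabel e id) vs))) = coset (Brels Q' P' m n) (gen (T (us, vs)))"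
      unfolding eqT Bclass_def .
  qed
qed

lemma Box_pbim:
  "Box Q P = pbim (Bgraphs Q P) (Brels Q P) (\<lambda>\<sigma> d. (map (relabel \<sigma> id) (fst d), snd d)) (\<lambda>\<tau> d. (fst d, map (relabel id \<tau>) (snd d)))"
  by (simp add: Box_def pbim_def Bmod_def Bclass_def fun_eq_iff case_prod_beta')

lemma Box_presentation:
  assumes Q: "sbimodule Q" and P: "sbimodule P"
  shows "bim_presentation (Bgraphs Q P) (Brels Q P) (\<lambda>\<sigma> d. (map (relabel \<sigma> id) (fst d), snd d)) (\<lambda>\<tau> d. (fst d, map (relabel id \<tau>) (snd d)))"
  unfolding bim_presentation_def
proof (intro conjI allI impI ballI)
  show "presentation (Bgraphs Q P m n) (Brels Q P m n)" for m n by (rule Brels_presentation[OF Q P])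
  show "Bgraphs Q P m n = {}" if "m = 0 \<or> n = 0" for m n
  proof -
    have "d \<notin> Bgraphs Q P m n" for d
    proof
      assume d: "d \<in> Bgraphs Q P m n"
      then obtain u us where u: "fst d = u # us" by (cases "fst d") (auto simp: Bgraphs_iff cgraph_def conn2_def)
      hence "outs u \<noteq> []" "ins u \<noteq> []" "set (ins u) \<subseteq> set (all_outs (snd d))"
        using d by (auto simp: Bgraphs_iff cgraph_def matching_def lvl_Cons)
      moreover from this obtain v vs where "snd d = v # vs" by (cases "snd d") auto
      moreover from this have "ins v \<noteq> []" using d by (auto simp: Bgraphs_iff cgraph_def matching_def lvl_Cons)
      ultimately show False using d u that by (auto simp: Bgraphs_iff)
    qed
    thus ?thesis by blast
  qed
  note c = Bmap_compatible[OF Q Q P P sbimod_map_id sbimod_map_id, unfolded vrelabel_id]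
  fix m n
  show "(map (relabel \<sigma> id) (fst d), snd d) \<in> Bgraphs Q P m n" if "\<sigma> permutes {..<m}" "d \<in> Bgraphs Q P m n" for \<sigma> d
    using c(1)[OF that(1) permutes_id that(2)] by (simp add: map_relabel_id)
  show "compatible (presented (Bgraphs Q P m n) (Brels Q P m n)) (Bgraphs Q P m n) (Brels Q P m n)
      (\<lambda>d. coset (Brels Q P m n) (gen (map (relabel \<sigma> id) (fst d), snd d)))" if "\<sigma> permutes {..<m}" for \<sigma>
    using c(2)[OF that permutes_id, of n] by (simp add: Bmod_def Bclass_def map_relabel_id)
  show "(fst d, map (relabel id \<tau>) (snd d)) \<in> Bgraphs Q P m n" if "\<tau> permutes {..<n}" "d \<in> Bgraphs Q P m n" for \<tau> d
    using c(1)[OF permutes_id that] by (simp add: map_relabel_id)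
  show "compatible (presented (Bgraphs Q P m n) (Brels Q P m n)) (Bgraphs Q P m n) (Brels Q P m n)
      (\<lambda>d. coset (Brels Q P m n) (gen (fst d, map (relabel id \<tau>) (snd d))))" if "\<tau> permutes {..<n}" for \<tau>
    using c(2)[OF permutes_id that, of m] by (simp add: Bmod_def Bclass_def map_relabel_id)
qed (auto simp: map_relabel_id intro!: vertex_eqI)

lemma Box_sbimodule: "sbimodule Q \<Longrightarrow> sbimodule P \<Longrightarrow> sbimodule (Box Q P)"
  unfolding Box_pbim by (rule pbim_sbimodule[OF Box_presentation])

lemma md_Box [simp]: "md (Box Q P) m n = Bmod Q P m n"
  by (simp add: Box_def)

lemma Bmod_module: "kmod (Bmod Q P m n)"
  unfolding Bmod_def by (rule presented_module)

lemma Bclass_in: "d \<in> Bgraphs Q P m n \<Longrightarrow> Bclass Q P m n d \<in> carrier (Bmod Q P m n)"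
  unfolding Bmod_def Bclass_def by (rule gen_coset_in)

lemma Bmod_eqI:
  assumes "kmod M" "linear_map (Bmod Q P m n) M f" "linear_map (Bmod Q P m n) M h"
    "\<And>d. d \<in> Bgraphs Q P m n \<Longrightarrow> f (Bclass Q P m n d) = h (Bclass Q P m n d)" "A \<in> carrier (Bmod Q P m n)"
  shows "f A = h A"
  using presented_eqI[OF assms(1) assms(2,3)[unfolded Bmod_def]] assms(4,5) unfolding Bmod_def Bclass_def by blast

lemma Box_gen:
  assumes "sbimodule Q" "sbimodule P" "d \<in> Bgraphs Q P m n"
  shows "\<sigma> permutes {..<m} \<Longrightarrow> lact (Box Q P) m n \<sigma> (Bclass Q P m n d) = Bclass Q P m n (map (relabel \<sigma> id) (fst d), snd d)"
    "\<tau> permutes {..<n} \<Longrightarrow> ract (Box Q P) m n \<tau> (Bclass Q P m n d) = Bclass Q P m n (fst d, map (relabel id (inv_into UNIV \<tau>)) (snd d))"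
  using pbim_gen[OF Box_presentation[OF assms(1,2)] assms(3)] unfolding Box_pbim Bclass_def by simp_all

lemma lift_Bmod:
  assumes "sbimodule Q" "sbimodule P" "kmod M" "compatible M (Bgraphs Q P m n) (Brels Q P m n) \<phi>"
  shows "linear_map (Bmod Q P m n) M (lift M \<phi>)" "d \<in> Bgraphs Q P m n \<Longrightarrow> lift M \<phi> (Bclass Q P m n d) = \<phi> d"
  using lift_linear[OF assms(3) Brels_presentation[OF assms(1,2)] assms(4)]
    lift_gen[OF assms(3) Brels_presentation[OF assms(1,2)] assms(4)] by (simp_all add: Bmod_def Bclass_def)

lemma Box_map_gen:
  assumes Q: "sbimodule Q" "sbimodule Q'" and P: "sbimodule P" "sbimodule P'"
    and h: "sbimod_map Q Q' h" and h': "sbimod_map P P' h'"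
  shows "linear_map (Bmod Q P m n) (Bmod Q' P' m n) (Box_map Q' P' h h' m n)"
    "d \<in> Bgraphs Q P m n \<Longrightarrow> Box_map Q' P' h h' m n (Bclass Q P m n d) = Bclass Q' P' m n (map (vmap h) (fst d), map (vmap h') (snd d))"
    "d \<in> Bgraphs Q P m n \<Longrightarrow> (map (vmap h) (fst d), map (vmap h') (snd d)) \<in> Bgraphs Q' P' m n"
proof -
  note c = Bmap_compatible[OF Q P h h' permutes_id permutes_id, unfolded vrelabel_id, where m = m and n = n]
  have eq: "Box_map Q' P' h h' m n = lift (Bmod Q' P' m n) (\<lambda>d. Bclass Q' P' m n (map (vmap h) (fst d), map (vmap h') (snd d)))"
    by (simp add: Box_map_def case_prod_beta')
  show "linear_map (Bmod Q P m n) (Bmod Q' P' m n) (Box_map Q' P' h h' m n)"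
    "d \<in> Bgraphs Q P m n \<Longrightarrow> Box_map Q' P' h h' m n (Bclass Q P m n d) = Bclass Q' P' m n (map (vmap h) (fst d), map (vmap h') (snd d))"
    unfolding eq using lift_Bmod[OF Q(1) P(1) Bmod_module c(2)] by blast+
  show "d \<in> Bgraphs Q P m n \<Longrightarrow> (map (vmap h) (fst d), map (vmap h') (snd d)) \<in> Bgraphs Q' P' m n" by (rule c(1))
qed

lemma leveq_props:
  assumes "sbimodule P" "leveq P xs ys" "lvl xs"
  shows "lvl ys" "in_sets xs = in_sets ys" "out_sets xs = out_sets ys" "\<forall>y\<in>set ys. well_decorated P y"
proof -
  obtain zs where zs: "list_all2 (veq P) xs zs" "mset zs = mset ys" using assms(2) by (auto simp: leveq_def)
  from zs(1) assms(3) have "lvl zs \<and> in_sets xs = in_sets zs \<and> out_sets xs = out_sets zs \<and> (\<forall>z\<in>set zs. well_decorated P z)"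
  proof (induction rule: list_all2_induct)
    case (Cons x xs z zs)
    hence v: "set (outs x) = set (outs z)" "set (ins x) = set (ins z)" "distinct (outs z)" "distinct (ins z)" "well_decorated P z"
      by (auto simp: veq_def reord_def)
    have "outs z \<noteq> []" "ins z \<noteq> []" using v(1,2) Cons(4) by (auto simp: lvl_Cons)
    thus ?case using Cons v by (auto simp: lvl_Cons in_sets_simps all_Union simp del: set_concat)
  qed (simp add: lvl_def)
  thus "lvl ys" "in_sets xs = in_sets ys" "out_sets xs = out_sets ys" "\<forall>y\<in>set ys. well_decorated P y"
    using lvl_mset[OF zs(2)] sets_mset[OF zs(2)] mset_eq_setD[OF zs(2)] by auto
qed

lemma leveq_mset:
  assumes "sbimodule P" "lvl xs" "\<forall>x\<in>set xs. well_decorated P x" "mset xs = mset ys" shows "leveq P xs ys"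
  unfolding leveq_def
proof (intro exI conjI)
  show "list_all2 (veq P) xs xs"
  proof (rule list.rel_refl_strong)
    fix x assume "x \<in> set xs"
    moreover have "distinct (outs x)" "distinct (ins x)"
      using assms(2) \<open>x \<in> set xs\<close> by (auto simp: lvl_def distinct_concat_iff)
    ultimately show "veq P x x" using assms(3) by (intro veq_refl[OF assms(1)]) auto
  qed
qed (rule assms(4))

lemma leveq_refl: "sbimodule P \<Longrightarrow> lvl xs \<Longrightarrow> \<forall>x\<in>set xs. well_decorated P x \<Longrightarrow> leveq P xs xs"
  by (rule leveq_mset) auto


section \<open>Pieces of a graph as vertices\<close>

definition listing :: "nat list \<Rightarrow> nat list \<Rightarrow> ('b, 'a) graph2 \<Rightarrow> bool" where
  "listing os is d \<longleftrightarrow> distinct os \<and> distinct is \<and> set os = set (all_outs (fst d)) \<and> set is = set (all_ins (snd d))"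

text \<open>
  A piece carries the edge names of the surrounding graph.  Numbering its outputs and inputs by listings
  gives an element of \<open>Q \<boxtimes>\<^sub>c P\<close>; \<open>pc\<close> uses the listings read off the piece, as \<open>contract\<close> does.
\<close>

definition localize :: "nat list \<Rightarrow> nat list \<Rightarrow> ('b, 'a) graph2 \<Rightarrow> ('b, 'a) graph2" where
  "localize os is d = (map (relabel (position os) id) (fst d), map (relabel id (position is)) (snd d))"

definition Bcl ::
    "('k::field, 'b, 'y) sbimod_scheme \<Rightarrow> ('k, 'a, 'x) sbimod_scheme \<Rightarrow> nat list \<Rightarrow> nat list \<Rightarrow>
     ('b, 'a) graph2 \<Rightarrow> (('b, 'a) graph2 \<Rightarrow>\<^sub>0 'k) set" where
  "Bcl Q P os is d = Bclass Q P (length os) (length is) (localize os is d)"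

definition pc ::
    "('k::field, 'b, 'y) sbimod_scheme \<Rightarrow> ('k, 'a, 'x) sbimod_scheme \<Rightarrow>
     ('b, 'a) graph2 \<Rightarrow> (('b, 'a) graph2 \<Rightarrow>\<^sub>0 'k) set vertex" where
  "pc Q P d = Vertex (all_outs (fst d)) (all_ins (snd d)) (Bcl Q P (all_outs (fst d)) (all_ins (snd d)) d)"

lemma contract_pc: "contract Q P d = map (pc Q P) (components d)"
  by (simp add: contract_def pc_def Bcl_def localize_def split_beta Let_def)

lemma pc_contracts: "contracts (pc Q P)"
  by (simp add: contracts_def pc_def)

lemma cgraph_listing: "cgraph Q P d \<Longrightarrow> listing (all_outs (fst d)) (all_ins (snd d)) d"
  by (simp add: listing_def cgraph_def matching_def lvl_def)

lemma localize_in: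
  fixes Q :: "('k::field, 'b, 'y) sbimod_scheme" and P :: "('k, 'a, 'x) sbimod_scheme"
  assumes "cgraph Q P d" "listing os is d"
  shows "localize os is d \<in> Bgraphs Q P (length os) (length is)"
proof -
  have d: "cgraph Q P (fst d, snd d)" using assms(1) by simp
  have l: "distinct os" "distinct is" "set (all_outs (fst d)) = set os" "set (all_ins (snd d)) = set is"
    using assms(2) by (simp_all add: listing_def del: set_concat)
  have "cgraph Q P (localize os is d)"
    using cgraph_vrelabel[OF d sbimod_map_id sbimod_map_id, of "position os" id "position is"] l(3,4)
      inj_on_position[OF l(1)] inj_on_position[OF l(2)]
    unfolding vrelabel_id localize_def by (simp del: set_concat)
  thus ?thesis unfolding Bgraphs_iff localize_def fst_conv snd_conv all_simps set_map
    using position_image[OF l(1)] position_image[OF l(2)] l(3,4) by (simp del: set_concat)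
qed

lemma Bcl_in: "cgraph Q P d \<Longrightarrow> listing os is d \<Longrightarrow> Bcl Q P os is d \<in> carrier (Bmod Q P (length os) (length is))"
  unfolding Bcl_def by (intro Bclass_in localize_in)

lemma map_relabel_cong:
  assumes "\<And>e. e \<in> set (all_outs vs) \<Longrightarrow> f e = f' e" "\<And>e. e \<in> set (all_ins vs) \<Longrightarrow> g e = g' e"
  shows "map (relabel f g) vs = map (relabel f' g') vs"
proof (rule map_cong[OF refl])
  fix v assume "v \<in> set vs"
  thus "relabel f g v = relabel f' g' v"
    using assms vertex_edges[of v vs] by (intro vertex_eqI) (auto simp del: set_concat)
qed

lemma map_relabel_comp: "map (relabel f g) (map (relabel f' g') vs) = map (relabel (f \<circ> f') (g \<circ> g')) vs"
  by (simp add: relabel_comp)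

lemma Bcl_recoord:
  assumes Q: "sbimodule Q" "sbimodule P" and d: "cgraph Q P d" "listing as bs d" and r: "reord os as" "reord is bs"
  shows "Bcl Q P os is d = recoord (Box Q P) os is as bs (Bcl Q P as bs d)"
proof -
  let ?L = "localize as bs d" and ?m = "length os" and ?n = "length is"
  have l: "length as = ?m" "length bs = ?n" using reord_length[OF r(1)] reord_length[OF r(2)] by auto
  have L: "?L \<in> Bgraphs Q P ?m ?n" using localize_in[OF d] l by simp
  have p: "tr os as permutes {..<?m}" "tr bs is permutes {..<?n}"
    using tr_permutes[OF r(1)] tr_permutes'[OF reord_sym[OF r(2)]] by auto
  let ?L' = "(fst ?L, map (relabel id (tr is bs)) (snd ?L))"
  have L': "?L' \<in> Bgraphs Q P ?m ?n"
    using Bmap_compatible(1)[OF Q(1,1,2,2) sbimod_map_id sbimod_map_id permutes_id _ L, of "tr is bs"]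
      tr_permutes[OF r(2)] by (simp add: vrelabel_id map_relabel_id)
  have "recoord (Box Q P) os is as bs (Bcl Q P as bs d) =
      lact (Box Q P) ?m ?n (tr os as) (ract (Box Q P) ?m ?n (tr bs is) (Bclass Q P ?m ?n ?L))"
    by (simp add: recoord_def Bcl_def l)
  also have "\<dots> = lact (Box Q P) ?m ?n (tr os as) (Bclass Q P ?m ?n ?L')"
    using Box_gen(2)[OF Q L p(2)] inv_tr[OF reord_sym[OF r(2)]] by simp
  also have "\<dots> = Bclass Q P ?m ?n (map (relabel (tr os as) id) (fst ?L), map (relabel id (tr is bs)) (snd ?L))"
    using Box_gen(1)[OF Q L' p(1)] by simp
  also have "(map (relabel (tr os as) id) (fst ?L), map (relabel id (tr is bs)) (snd ?L)) = localize os is d"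
    unfolding localize_def fst_conv snd_conv map_relabel_comp
    using d(2) tr_position[OF r(1)] tr_position[OF r(2)] r
    by (intro arg_cong2[of _ _ _ _ Pair] map_relabel_cong) (simp_all add: listing_def reord_def del: set_concat)
  finally show ?thesis by (simp add: Bcl_def)
qed

lemma Bcl_leveq:
  assumes Q: "sbimodule Q" "sbimodule P" and d: "cgraph Q P (a, b)" "listing os is (a, b)"
    and e: "leveq Q a a'" "leveq P b b'"
  shows "Bcl Q P os is (a, b) = Bcl Q P os is (a', b')" "cgraph Q P (a', b')" "listing os is (a', b')"
proof -
  let ?m = "length os" and ?n = "length is"
  have l: "lvl a" "lvl b" using d(1) by (auto simp: cgraph_def matching_def)
  have s: "distinct os" "distinct is" "set os = set (all_outs a)" "set is = set (all_ins b)"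
    using d(2) by (simp_all add: listing_def)
  have ea: "leveq Q (map (relabel (position os) id) a) (map (relabel (position os) id) a')"
    using leveq_vrelabel[OF Q(1) sbimod_map_id e(1), of "position os" id] inj_on_position[OF s(1)] s(3)
    by (simp add: vrelabel_id del: set_concat)
  have eb: "leveq P (map (relabel id (position is)) b) (map (relabel id (position is)) b')"
    using leveq_vrelabel[OF Q(2) sbimod_map_id e(2), of id "position is"] inj_on_position[OF s(2)] s(4)
    by (simp add: vrelabel_id del: set_concat)
  note A = class_leveq[OF Q(1) Bgraphs_admissible_top Brels_levels(1)[of Q P ?m ?n] _ ea]
  note B = class_leveq[OF Q(2) Bgraphs_admissible_bot Brels_levels(2)[of P Q ?m ?n] _ eb]
  show "Bcl Q P os is (a, b) = Bcl Q P os is (a', b')"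
    using A(1)[of "map (relabel id (position is)) b"] A(2)[of "map (relabel id (position is)) b"]
      B(1)[of "map (relabel (position os) id) a'"] localize_in[OF d]
    by (simp add: Bcl_def Bclass_def localize_def)
  note pa = leveq_props[OF Q(1) e(1) l(1)] and pb = leveq_props[OF Q(2) e(2) l(2)]
  show "cgraph Q P (a', b')" using cgraph_same_sets[OF d(1) pa(1) pb(1) pa(2) pb(3) pa(4) pb(4)] .
  show "listing os is (a', b')" using d(2) pa(3) pb(2) unfolding listing_def fst_conv snd_conv all_Union by simp
qed

text \<open>The vertex of a piece depends on the piece only, up to listings.\<close>

lemma pc_veq:
  assumes Q: "sbimodule Q" "sbimodule P" and d: "cgraph Q P (a, b)" and e: "leveq Q a a'" "leveq P b b'"
  shows "veq (Box Q P) (pc Q P (a, b)) (pc Q P (a', b'))"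
proof -
  note l = cgraph_listing[OF d] and l1 = Bcl_leveq[OF Q d _ e]
  note l' = cgraph_listing[OF l1(2)[OF l]] and l2 = l1(3)[OF l]
  have r: "reord (all_outs a) (all_outs a')" "reord (all_ins b) (all_ins b')"
    using l l' l2 by (simp_all add: listing_def reord_def del: set_concat)
  have "Bcl Q P (all_outs a) (all_ins b) (a, b) = Bcl Q P (all_outs a) (all_ins b) (a', b')"
    using l1(1)[OF l] by simp
  also have "\<dots> = recoord (Box Q P) (all_outs a) (all_ins b) (all_outs a') (all_ins b') (Bcl Q P (all_outs a') (all_ins b') (a', b'))"
    using Bcl_recoord[OF Q l1(2)[OF l] l' ] r by simp
  finally show ?thesis
    using r Bcl_in[OF l1(2)[OF l] l'] by (simp add: veq_def pc_def well_decorated_def)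
qed

definition decorated :: "('k, 'a, 'x) sbimod_scheme \<Rightarrow> 'a vertex list \<Rightarrow> bool" where
  "decorated P vs \<longleftrightarrow> (\<forall>v\<in>set vs. well_decorated P v)"

lemma decomp_cgraph:
  assumes "decomp D us vs" "matching us vs" "decorated Q us" "decorated P vs" "d \<in> set D"
  shows "cgraph Q P d"
  using decomp_piece[OF assms(1,2,5)] assms(3,4) by (auto simp: cgraph_def decorated_def)

text \<open>
  Decompositions are unique up to the order of pieces and of the vertices in them, and the vertex
  of a piece ignores the latter up to listings.
\<close>

lemma pcs_leveq:
  assumes Q: "sbimodule Q" "sbimodule P" and m: "matching us vs" "decorated Q us" "decorated P vs"
    and D: "decomp D us vs" "decomp D' us vs"
  shows "leveq (Box Q P) (map (pc Q P) D) (map (pc Q P) D')"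
proof -
  obtain D'' where D'': "mset D'' = mset D'"
    "list_all2 (\<lambda>d d'. mset (fst d) = mset (fst d') \<and> mset (snd d) = mset (snd d')) D D''"
    using decomp_unique[OF m(1) D] by blast
  have "list_all2 (veq (Box Q P)) (map (pc Q P) D) (map (pc Q P) D'')"
    unfolding list_all2_map1 list_all2_map2
  proof (rule list.rel_mono_strong[OF D''(2)])
    fix d d' assume d: "d \<in> set D" and e: "mset (fst d) = mset (fst d') \<and> mset (snd d) = mset (snd d')"
    note c = decomp_cgraph[OF D(1) m d]
    have "leveq Q (fst d) (fst d')" "leveq P (snd d) (snd d')"
      using c e by (auto simp: cgraph_def matching_def intro!: leveq_mset Q)
    thus "veq (Box Q P) (pc Q P d) (pc Q P d')" using pc_veq[OF Q, of "fst d" "snd d" "fst d'" "snd d'"] c by simp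
  qed
  moreover have "mset (map (pc Q P) D'') = mset (map (pc Q P) D')" unfolding mset_map D''(1) ..
  ultimately show ?thesis unfolding leveq_def by blast
qed

lemma pcs_level:
  fixes Q :: "('k::field, 'b, 'y) sbimod_scheme" and P :: "('k, 'a, 'x) sbimod_scheme"
  assumes m: "matching us vs" "decorated Q us" "decorated P vs" and D: "decomp D us vs"
  shows "lvl (map (pc Q P) D)" "decorated (Box Q P) (map (pc Q P) D)"
    "set (all_outs (map (pc Q P) D)) = set (all_outs us)" "set (all_ins (map (pc Q P) D)) = set (all_ins vs)"
proof -
  show "lvl (map (pc Q P) D)" using contracts_lvl[OF pc_contracts D m(1)] .
  show "set (all_outs (map (pc Q P) D)) = set (all_outs us)" "set (all_ins (map (pc Q P) D)) = set (all_ins vs)"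
    using contracts_edges[OF pc_contracts D] .
  have "well_decorated (Box Q P) (pc Q P d)" if d: "d \<in> set D" for d
    using Bcl_in[OF decomp_cgraph[OF D m d] cgraph_listing[OF decomp_cgraph[OF D m d]]]
    by (simp add: well_decorated_def pc_def)
  thus "decorated (Box Q P) (map (pc Q P) D)" by (simp add: decorated_def)
qed

lemma pc_relabel:
  assumes d: "cgraph Q P (a, b)" and inj: "inj_on f (set (all_outs a))" "inj_on g (set (all_ins b))" "inj_on e (set (all_ins a))"
  shows "pc Q P (map (relabel f e) a, map (relabel e g) b) = relabel f g (pc Q P (a, b))"
proof -
  let ?os = "all_outs a" and ?is = "all_ins b"
  have l: "distinct ?os" "distinct ?is" using cgraph_listing[OF d] by (simp_all add: listing_def)
  have "localize (map f ?os) (map g ?is) (map (relabel f e) a, map (relabel e g) b) =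
      (map (relabel id e) (map (relabel (position ?os) id) a), map (relabel e id) (map (relabel id (position ?is)) b))"
    unfolding localize_def fst_conv snd_conv map_relabel_comp
    using position_map[OF l(1) inj(1)] position_map[OF l(2) inj(2)]
    by (intro arg_cong2[of _ _ _ _ Pair] map_relabel_cong) (simp_all del: set_concat)
  moreover have "(map (relabel (position ?os) id) a, map (relabel id (position ?is)) b) \<in> Bgraphs Q P (length ?os) (length ?is)"
    using localize_in[OF d cgraph_listing[OF d]] by (simp add: localize_def)
  moreover have "inj_on e (set (all_ins (map (relabel (position ?os) id) a)))" using inj(3) unfolding all_simps by simp
  ultimately have "Bcl Q P (map f ?os) (map g ?is) (map (relabel f e) a, map (relabel e g) b) = Bcl Q P ?os ?is (a, b)"
    using Bclass_rename[of "map (relabel (position ?os) id) a" "map (relabel id (position ?is)) b" Q P "length ?os" "length ?is" e]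
    by (simp add: Bcl_def localize_def del: map_map)
  thus ?thesis by (simp add: pc_def relabel_def del: map_map)
qed

lemma pc_vmap:
  assumes Q: "sbimodule Q" "sbimodule Q'" and P: "sbimodule P" "sbimodule P'"
    and h: "sbimod_map Q Q' h" and h': "sbimod_map P P' h'" and d: "cgraph Q P d"
  shows "vmap (Box_map Q' P' h h') (pc Q P d) = pc Q' P' (map (vmap h) (fst d), map (vmap h') (snd d))"
proof -
  let ?os = "all_outs (fst d)" and ?is = "all_ins (snd d)"
  have eq: "(map (vmap h) (fst (localize ?os ?is d)), map (vmap h') (snd (localize ?os ?is d))) =
      localize ?os ?is (map (vmap h) (fst d), map (vmap h') (snd d))"
    by (auto simp: localize_def intro!: vertex_eqI)
  show ?thesis
    using Box_map_gen(2)[OF Q P h h' localize_in[OF d cgraph_listing[OF d]]]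
    by (intro vertex_eqI) (simp_all only: eq pc_def vertex_simps vertex.sel fst_conv snd_conv all_simps Bcl_def)
qed

lemma Bcl_linear_bot:
  assumes P: "sbimodule P" and d: "cgraph Q P (a, v # b)" "listing os is (a, v # b)"
  shows "linear_map (md P (length (outs v)) (length (ins v))) (Bmod Q P (length os) (length is))
    (\<lambda>p. Bcl Q P os is (a, Vertex (outs v) (ins v) p # b))"
  using class_linear[OF P Bgraphs_admissible_bot Brels_levels(2)[of P Q "length os" "length is" "map (relabel (position os) id) a"],
      of "[]" "relabel id (position is) v" "map (relabel id (position is)) b"]
    localize_in[OF d]
  by (simp add: Bcl_def localize_def Bclass_def Bmod_def relabel_def)

lemma Bcl_linear_top:
  assumes Q: "sbimodule Q" and d: "cgraph Q P (u # a, b)" "listing os is (u # a, b)"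
  shows "linear_map (md Q (length (outs u)) (length (ins u))) (Bmod Q P (length os) (length is))
    (\<lambda>p. Bcl Q P os is (Vertex (outs u) (ins u) p # a, b))"
  using class_linear[OF Q Bgraphs_admissible_top Brels_levels(1)[of Q P "length os" "length is" "map (relabel id (position is)) b"],
      of "[]" "relabel (position os) id u" "map (relabel (position os) id) a"]
    localize_in[OF d]
  by (simp add: Bcl_def localize_def Bclass_def Bmod_def relabel_def)

section \<open>Vertical composition of one-level graphs\<close>

lemma is_properadD:
  assumes "is_properad P"
  shows "sbimodule P" "sbimod_map (Box P P) P (mu P)" "sbimod_map Ibim P (eta P)"
    "p \<in> elts P m n \<Longrightarrow> 0 < m \<Longrightarrow> 0 < n \<Longrightarrow>
      mu P m n (Box_map P P (eta P) (\<lambda>_ _ x. x) m n (Bclass Ibim P m n (idgraph m, [Vertex [0..<m] [0..<n] p]))) = p"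
    "p \<in> elts P m n \<Longrightarrow> 0 < m \<Longrightarrow> 0 < n \<Longrightarrow>
      mu P m n (Box_map P P (\<lambda>_ _ x. x) (eta P) m n (Bclass P Ibim m n ([Vertex [0..<m] [0..<n] p], idgraph n))) = p"
    "(us, vs, ws) \<in> graphs3 P m n \<Longrightarrow>
      mu P m n (Box_map P P (mu P) (\<lambda>_ _ x. x) m n (Bclass (Box P P) P m n (contract P P (us, vs), ws))) =
      mu P m n (Box_map P P (\<lambda>_ _ x. x) (mu P) m n (Bclass P (Box P P) m n (us, contract P P (vs, ws))))"
proof -
  note A = assms[unfolded is_properad_def]
  show "sbimodule P" "sbimod_map (Box P P) P (mu P)" "sbimod_map Ibim P (eta P)" using A by blast+
  show "mu P m n (Box_map P P (eta P) (\<lambda>_ _ x. x) m n (Bclass Ibim P m n (idgraph m, [Vertex [0..<m] [0..<n] p]))) = p"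
    if "p \<in> elts P m n" "0 < m" "0 < n"
    using A[THEN conjunct2, THEN conjunct2, THEN conjunct2, THEN conjunct1, rule_format, OF that(1) conjI[OF that(2,3)]] .
  show "mu P m n (Box_map P P (\<lambda>_ _ x. x) (eta P) m n (Bclass P Ibim m n ([Vertex [0..<m] [0..<n] p], idgraph n))) = p"
    if "p \<in> elts P m n" "0 < m" "0 < n"
    using A[THEN conjunct2, THEN conjunct2, THEN conjunct2, THEN conjunct2, THEN conjunct1, rule_format, OF that(1) conjI[OF that(2,3)]] .
  show "mu P m n (Box_map P P (mu P) (\<lambda>_ _ x. x) m n (Bclass (Box P P) P m n (contract P P (us, vs), ws))) =
      mu P m n (Box_map P P (\<lambda>_ _ x. x) (mu P) m n (Bclass P (Box P P) m n (us, contract P P (vs, ws))))"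
    if "(us, vs, ws) \<in> graphs3 P m n"
    using A[THEN conjunct2, THEN conjunct2, THEN conjunct2, THEN conjunct2, THEN conjunct2, rule_format, OF that] by simp
qed

lemma Sgraphs_matching:
  assumes "us \<in> Sgraphs P m N" "vs \<in> Sgraphs P' N n"
  shows "matching us vs" "decorated P us" "decorated P' vs"
  using assms by (auto simp: Sgraphs_iff matching_def decorated_def simp del: set_concat)

lemma leveq_Cons:
  assumes P: "sbimodule P" and "veq P v v'" "lvl vs" "decorated P vs" shows "leveq P (v # vs) (v' # vs)"
proof -
  have "list_all2 (veq P) vs vs"
  proof (rule list.rel_refl_strong)
    fix x assume x: "x \<in> set vs"
    hence "distinct (outs x)" "distinct (ins x)" using assms(3) by (auto simp: lvl_def distinct_concat_iff)
    thus "veq P x x" using assms(4) x by (intro veq_refl[OF P]) (auto simp: decorated_def)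
  qed
  thus ?thesis using assms(2) by (intro leveqI) simp
qed

lemma leveq_vmap:
  assumes "sbimodule P" "sbimod_map P P' h" "leveq P xs ys" shows "leveq P' (map (vmap h) xs) (map (vmap h) ys)"
  using leveq_vrelabel[OF assms, of id id] by (simp add: vrelabel_id)

lemma map_vmap_id: "map (vmap (\<lambda>_ _ x. x)) vs = vs"
  by (auto intro!: map_idI vertex_eqI)

section \<open>Contraction is compatible with the relations\<close>

context
  fixes P :: "('k::field, 'a, 'x) sbimod_scheme"
  assumes P: "sbimodule P"
begin

definition Cclass :: "nat \<Rightarrow> nat \<Rightarrow> 'a vertex list \<Rightarrow> 'a vertex list \<Rightarrow> (((('a, 'a) graph2 \<Rightarrow>\<^sub>0 'k) set) vertex list \<Rightarrow>\<^sub>0 'k) set" where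
  "Cclass m n us vs = Sclass (Box P P) m n (contract P P (us, vs))"

lemma pcs_Sgraph:
  assumes u: "us \<in> Sgraphs P m N" and v: "vs \<in> Sgraphs P N n" and D: "decomp D us vs"
  shows "map (pc P P) D \<in> Sgraphs (Box P P) m n"
proof -
  have "D \<noteq> []" using D u by (auto simp: decomp_def Sgraphs_iff)
  thus ?thesis using pcs_level[OF Sgraphs_matching[OF u v] D] u v
    unfolding Sgraphs_iff decorated_def by (simp del: set_concat)
qed

lemma Cclass_decomp:
  assumes u: "us \<in> Sgraphs P m N" and v: "vs \<in> Sgraphs P N n" and D: "decomp D us vs"
  shows "Cclass m n us vs = Sclass (Box P P) m n (map (pc P P) D)"
proof -
  note m = Sgraphs_matching[OF u v]
  have C: "decomp (components (us, vs)) us vs" by (rule decomp_components[OF m(1)])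
  show ?thesis unfolding Cclass_def contract_pc
    using Sclass_leveq(1)[OF Box_sbimodule[OF P P] pcs_Sgraph[OF u v C] pcs_leveq[OF P P m C D]] .
qed

lemma Cclass_in: "us \<in> Sgraphs P m N \<Longrightarrow> vs \<in> Sgraphs P N n \<Longrightarrow> Cclass m n us vs \<in> carrier (Smod (Box P P) m n)"
  unfolding Cclass_def contract_pc
  using Sclass_in[OF pcs_Sgraph] decomp_components Sgraphs_matching(1) by metis

lemma Cclass_mset:
  assumes u: "us \<in> Sgraphs P m N" "us' \<in> Sgraphs P m N" "mset us = mset us'"
    and v: "vs \<in> Sgraphs P N n" "vs' \<in> Sgraphs P N n" "mset vs = mset vs'"
  shows "Cclass m n us vs = Cclass m n us' vs'"
proof -
  have C: "decomp (components (us, vs)) us vs" by (rule decomp_components[OF Sgraphs_matching(1)[OF u(1) v(1)]])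
  show ?thesis using Cclass_decomp[OF u(1) v(1) C] Cclass_decomp[OF u(2) v(2) decomp_cong[OF C refl u(3) v(3)]] by simp
qed

lemma Cclass_head:
  assumes u: "us \<in> Sgraphs P m N" and v: "vs \<in> Sgraphs P N n" and D: "decomp ((a, b) # D) us vs"
    and us': "us' \<in> Sgraphs P m N" and vs': "vs' \<in> Sgraphs P N n" and D': "decomp ((a', b') # D) us' vs'"
    and e: "leveq P a a'" "leveq P b b'"
  shows "Cclass m n us vs = Cclass m n us' vs'"
proof -
  note m = Sgraphs_matching[OF u v]
  note c = decomp_cgraph[OF D m]
  have l: "lvl (map (pc P P) D)" "decorated (Box P P) (map (pc P P) D)"
    using pcs_level(1,2)[OF m D] by (simp_all add: lvl_Cons decorated_def)
  have "veq (Box P P) (pc P P (a, b)) (pc P P (a', b'))"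
    using pc_veq[OF P P c e] by simp
  hence "leveq (Box P P) (map (pc P P) ((a, b) # D)) (map (pc P P) ((a', b') # D))"
    using leveq_Cons[OF Box_sbimodule[OF P P] _ l] by simp
  thus ?thesis
    using Cclass_decomp[OF u v D] Cclass_decomp[OF us' vs' D'] Sclass_leveq(1)[OF Box_sbimodule[OF P P] pcs_Sgraph[OF u v D]] by simp
qed

text \<open>
  A vertex of the lower level lies in a single piece, which is moved to the front.  A relation at the vertex becomes a
  relation at the decoration of the contracted piece, while the other pieces stay the same.
\<close>

lemma Cclass_compatible_bot:
  assumes u: "us \<in> Sgraphs P m N"
  shows "compatible (Smod (Box P P) m n) (Sgraphs P N n) (Srels P N n) (Cclass m n us)"
  unfolding compatible_def Srels_def
proof (intro conjI ballI)
  show "Cclass m n us vs \<in> carrier (Smod (Box P P) m n)" if "vs \<in> Sgraphs P N n" for vs using Cclass_in[OF u that] .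
  fix r assume r: "r \<in> level_rels P (Sgraphs P N n) (\<lambda>vs. vs)"
  show "lin (Smod (Box P P) m n) (Cclass m n us) r = \<zero>\<^bsub>Smod (Box P P) m n\<^esub>"
  proof (rule level_compatibleI(1)[OF P Sgraphs_admissible Smod_module Cclass_in[OF u] _ _ _ r])
    fix xs ys assume x: "xs \<in> Sgraphs P N n" "mset xs = mset ys"
    thus "Cclass m n us xs = Cclass m n us ys"
      using Cclass_mset[OF u u refl x(1) _ x(2)] admissibleD(3)[OF Sgraphs_admissible x] by simp
  next
    fix v v' ys assume v: "v # ys \<in> Sgraphs P N n" "veq P v v'"
    hence v': "v' # ys \<in> Sgraphs P N n"
      using admissibleD(2)[OF Sgraphs_admissible, of "[]" v ys P N n v'] by (simp add: veq_def)
    obtain a b D where D: "decomp ((a, v # b) # D) us (v # ys)"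
      using decomp_bot_vertex[OF Sgraphs_matching(1)[OF u v(1)]] .
    have D': "decomp ((a, v' # b) # D) us (v' # ys)"
      using v(2) D by (intro decomp_same_sets[OF D]) (auto simp: decomp_def in_sets_simps veq_def reord_def)
    note c = decomp_cgraph[OF D Sgraphs_matching[OF u v(1)], of "(a, v # b)"]
    have l: "lvl a" "decorated P a" "lvl b" "decorated P b"
      using c by (auto simp: cgraph_def matching_def lvl_Cons decorated_def)
    show "Cclass m n us (v # ys) = Cclass m n us (v' # ys)"
      using Cclass_head[OF u v(1) D u v' D'] leveq_refl[OF P l(1)] leveq_Cons[OF P v(2) l(3,4)] l(2)
      by (simp add: decorated_def)
  next
    fix v ys assume v: "v # ys \<in> Sgraphs P N n"
    obtain a b D where D: "decomp ((a, v # b) # D) us (v # ys)"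
      using decomp_bot_vertex[OF Sgraphs_matching(1)[OF u v]] .
    note c = decomp_cgraph[OF D Sgraphs_matching[OF u v], of "(a, v # b)", simplified]
    let ?v = "\<lambda>p. Vertex (outs v) (ins v) p" and ?os = "all_outs a" and ?is = "all_ins (v # b)"
    have l: "listing ?os ?is (a, v # b)" using cgraph_listing[OF c] by simp
    have g: "pc P P (a, v # b) # map (pc P P) D \<in> Sgraphs (Box P P) m n" using pcs_Sgraph[OF u v D] by simp
    have "linear_map (md P (length (outs v)) (length (ins v))) (Smod (Box P P) m n)
        (\<lambda>p. Sclass (Box P P) m n (Vertex ?os ?is (Bcl P P ?os ?is (a, ?v p # b)) # map (pc P P) D))"
      using linear_map_comp[OF Bcl_linear_bot[OF P c l]] Sclass_linear[OF Box_sbimodule[OF P P] g]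
      by (simp add: pc_def)
    moreover have "Sclass (Box P P) m n (Vertex ?os ?is (Bcl P P ?os ?is (a, ?v p # b)) # map (pc P P) D) = Cclass m n us (?v p # ys)"
      if p: "p \<in> elts P (length (outs v)) (length (ins v))" for p
    proof -
      have "?v p # ys \<in> Sgraphs P N n" using admissible_deco[OF Sgraphs_admissible, of "[]" v ys P N n p] v p by simp
      moreover have "decomp ((a, ?v p # b) # D) us (?v p # ys)"
        using D by (intro decomp_same_sets[OF D]) (auto simp: decomp_def in_sets_simps)
      ultimately show ?thesis using Cclass_decomp[OF u] by (simp add: pc_def)
    qed
    ultimately show "linear_map (md P (length (outs v)) (length (ins v))) (Smod (Box P P) m n) (\<lambda>p. Cclass m n us (?v p # ys))"
      by (rule linear_map_cong[OF _ _ sbimoduleD(1)[OF P]])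
  qed
qed

lemma Cclass_compatible_top:
  assumes w: "vs \<in> Sgraphs P N n"
  shows "compatible (Smod (Box P P) m n) (Sgraphs P m N) (Srels P m N) (\<lambda>us. Cclass m n us vs)"
  unfolding compatible_def Srels_def
proof (intro conjI ballI)
  show "Cclass m n us vs \<in> carrier (Smod (Box P P) m n)" if "us \<in> Sgraphs P m N" for us using Cclass_in[OF that w] .
  fix r assume r: "r \<in> level_rels P (Sgraphs P m N) (\<lambda>us. us)"
  show "lin (Smod (Box P P) m n) (\<lambda>us. Cclass m n us vs) r = \<zero>\<^bsub>Smod (Box P P) m n\<^esub>"
  proof (rule level_compatibleI(1)[OF P Sgraphs_admissible Smod_module Cclass_in[OF _ w] _ _ _ r])
    fix xs ys assume x: "xs \<in> Sgraphs P m N" "mset xs = mset ys"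
    thus "Cclass m n xs vs = Cclass m n ys vs"
      using Cclass_mset[OF x(1) _ x(2) w w refl] admissibleD(3)[OF Sgraphs_admissible x] by simp
  next
    fix v v' ys assume v: "v # ys \<in> Sgraphs P m N" "veq P v v'"
    hence v': "v' # ys \<in> Sgraphs P m N"
      using admissibleD(2)[OF Sgraphs_admissible, of "[]" v ys P m N v'] by (simp add: veq_def)
    obtain a b D where D: "decomp ((v # a, b) # D) (v # ys) vs"
      using decomp_top_vertex[OF Sgraphs_matching(1)[OF v(1) w]] .
    have D': "decomp ((v' # a, b) # D) (v' # ys) vs"
      using v(2) D by (intro decomp_same_sets[OF D]) (auto simp: decomp_def in_sets_simps veq_def reord_def)
    note c = decomp_cgraph[OF D Sgraphs_matching[OF v(1) w], of "(v # a, b)"]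
    have l: "lvl a" "decorated P a" "lvl b" "decorated P b"
      using c by (auto simp: cgraph_def matching_def lvl_Cons decorated_def)
    show "Cclass m n (v # ys) vs = Cclass m n (v' # ys) vs"
      using Cclass_head[OF v(1) w D v' w D'] leveq_refl[OF P l(3)] leveq_Cons[OF P v(2) l(1,2)] l(4)
      by (simp add: decorated_def)
  next
    fix v ys assume v: "v # ys \<in> Sgraphs P m N"
    obtain a b D where D: "decomp ((v # a, b) # D) (v # ys) vs"
      using decomp_top_vertex[OF Sgraphs_matching(1)[OF v w]] .
    note c = decomp_cgraph[OF D Sgraphs_matching[OF v w], of "(v # a, b)", simplified]
    let ?v = "\<lambda>p. Vertex (outs v) (ins v) p" and ?os = "all_outs (v # a)" and ?is = "all_ins b"
    have l: "listing ?os ?is (v # a, b)" using cgraph_listing[OF c] by simp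
    have g: "pc P P (v # a, b) # map (pc P P) D \<in> Sgraphs (Box P P) m n" using pcs_Sgraph[OF v w D] by simp
    have "linear_map (md P (length (outs v)) (length (ins v))) (Smod (Box P P) m n)
        (\<lambda>p. Sclass (Box P P) m n (Vertex ?os ?is (Bcl P P ?os ?is (?v p # a, b)) # map (pc P P) D))"
      using linear_map_comp[OF Bcl_linear_top[OF P c l]] Sclass_linear[OF Box_sbimodule[OF P P] g]
      by (simp add: pc_def)
    moreover have "Sclass (Box P P) m n (Vertex ?os ?is (Bcl P P ?os ?is (?v p # a, b)) # map (pc P P) D) = Cclass m n (?v p # ys) vs"
      if p: "p \<in> elts P (length (outs v)) (length (ins v))" for p
    proof -
      have "?v p # ys \<in> Sgraphs P m N" using admissible_deco[OF Sgraphs_admissible, of "[]" v ys P m N p] v p by simp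
      moreover have "decomp ((?v p # a, b) # D) (?v p # ys) vs"
        using D by (intro decomp_same_sets[OF D]) (auto simp: decomp_def in_sets_simps)
      ultimately show ?thesis using Cclass_decomp[OF _ w] by (simp add: pc_def)
    qed
    ultimately show "linear_map (md P (length (outs v)) (length (ins v))) (Smod (Box P P) m n) (\<lambda>p. Cclass m n (?v p # ys) vs)"
      by (rule linear_map_cong[OF _ _ sbimoduleD(1)[OF P]])
  qed
qed

lemma Cclass_bilinear:
  "bilinear_map (Smod P m N) (Smod P N n) (Smod (Box P P) m n) (lift2 (Smod (Box P P) m n) (Cclass m n))"
  "us \<in> Sgraphs P m N \<Longrightarrow> vs \<in> Sgraphs P N n \<Longrightarrow>
    lift2 (Smod (Box P P) m n) (Cclass m n) (Sclass P m N us) (Sclass P N n vs) = Cclass m n us vs"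
  using lift2_bilinear[OF Smod_module Srels_presentation[OF P] Srels_presentation[OF P] Cclass_compatible_top Cclass_compatible_bot]
  by (simp_all add: Smod_def Sclass_def[of P])

end

definition composite :: "('k::field, 'a) properad_data \<Rightarrow> ('a, 'a) graph2 list \<Rightarrow> 'a vertex list" where
  "composite P D = map (vmap (mu P)) (map (pc P P) D)"

lemma composite_simps: "composite P (D @ D') = composite P D @ composite P D'" "composite P [] = []"
  "composite P (concat Ds) = concat (map (composite P) Ds)"
  by (simp_all add: composite_def[abs_def] map_concat comp_def)

lemma composite_contracts: "composite P D = map (\<lambda>d. vmap (mu P) (pc P P d)) D" "contracts (\<lambda>d. vmap (mu P) (pc P P d))"
  by (simp_all add: composite_def contracts_def pc_def)

lemma SPROP_simps [simp]:
  "md (SPROP P) = Smod P" "lact (SPROP P) = lact (Sten P)" "ract (SPROP P) = ract (Sten P)" "hcomp (SPROP P) = Sprod P"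
  "unit (SPROP P) = Sten_map Ibim P (eta P)"
  by (simp_all add: SPROP_def fun_eq_iff)

lemma sbimodule_SPROP: "sbimodule (SPROP P) = sbimodule (Sten P)"
  by (simp add: sbimodule_def)

lemma bilinear_comp: "bilinear_map L M N f \<Longrightarrow> linear_map N N' g \<Longrightarrow> bilinear_map L M N' (\<lambda>x y. g (f x y))"
  by (auto simp: bilinear_map_def intro: linear_map_comp)

text \<open>Any decomposition may take the place of the list of components in the definition.\<close>

lemma SPROP_vcomp:
  assumes P: "is_properad P"
  shows "bilinear_map (Smod P m N) (Smod P N n) (Smod P m n) (vcomp (SPROP P) m N n)"
    "us \<in> Sgraphs P m N \<Longrightarrow> vs \<in> Sgraphs P N n \<Longrightarrow> decomp D us vs \<Longrightarrow>
      vcomp (SPROP P) m N n (Sclass P m N us) (Sclass P N n vs) = Sclass P m n (composite P D)"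
    "us \<in> Sgraphs P m N \<Longrightarrow> vs \<in> Sgraphs P N n \<Longrightarrow> decomp D us vs \<Longrightarrow> composite P D \<in> Sgraphs P m n"
proof -
  note p = is_properadD(1,2)[OF P]
  have eq: "vcomp (SPROP P) m N n A B = Sten_map (Box P P) P (mu P) m n (lift2 (Smod (Box P P) m n) (Cclass P m n) A B)" for A B
  proof -
    have "Cclass P m n = (\<lambda>us vs. Sclass (Box P P) m n (contract P P (us, vs)))"
      by (intro ext) (rule Cclass_def[OF p(1)])
    thus ?thesis by (simp add: SPROP_def lift2_def)
  qed
  have "linear_map (Smod (Box P P) m n) (Smod P m n) (Sten_map (Box P P) P (mu P) m n)"
    using sbimod_mapD(1)[OF Sten_map_sbimod[OF Box_sbimodule[OF p(1,1)] p]] by simp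
  thus "bilinear_map (Smod P m N) (Smod P N n) (Smod P m n) (vcomp (SPROP P) m N n)"
    unfolding eq[abs_def] by (rule bilinear_comp[OF Cclass_bilinear(1)[OF p(1)]])
  assume u: "us \<in> Sgraphs P m N" and v: "vs \<in> Sgraphs P N n" and D: "decomp D us vs"
  note g = Sten_map_gen[OF Box_sbimodule[OF p(1,1)] p pcs_Sgraph[OF p(1) u v D]]
  show "vcomp (SPROP P) m N n (Sclass P m N us) (Sclass P N n vs) = Sclass P m n (composite P D)"
    unfolding eq Cclass_bilinear(2)[OF p(1) u v] Cclass_decomp[OF p(1) u v D] composite_def by (rule g(1))
  show "composite P D \<in> Sgraphs P m n" unfolding composite_def by (rule g(2))
qed

lemma composite_relabel:
  assumes P: "is_properad P" and m: "matching us vs" "decorated P us" "decorated P vs" and D: "decomp D us vs"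
    and inj: "inj_on f (set (all_outs us))" "inj_on e (set (all_ins us))" "inj_on g (set (all_ins vs))"
  obtains D' where "decomp D' (map (relabel f e) us) (map (relabel e g) vs)" "composite P D' = map (relabel f g) (composite P D)"
proof
  let ?D = "map (map_prod (map (relabel f e)) (map (relabel e g))) D"
  show "decomp ?D (map (relabel f e) us) (map (relabel e g) vs)"
    using decomp_relabel[OF D m(1) inj(2), of f "\<lambda>_ _ x. x" g "\<lambda>_ _ x. x"] by (simp add: vrelabel_id)
  have "vmap (mu P) (pc P P (map_prod (map (relabel f e)) (map (relabel e g)) d)) = relabel f g (vmap (mu P) (pc P P d))"
    if d: "d \<in> set D" for d
  proof -
    note c = decomp_cgraph[OF D m d]
    have s: "set (fst d) \<subseteq> set us" "set (snd d) \<subseteq> set vs" using decomp_piece(3,4)[OF D m(1) d] by auto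
    have "set (all_outs (fst d)) \<subseteq> set (all_outs us)" "set (all_ins (fst d)) \<subseteq> set (all_ins us)"
      "set (all_ins (snd d)) \<subseteq> set (all_ins vs)" using s by auto
    hence "pc P P (map (relabel f e) (fst d), map (relabel e g) (snd d)) = relabel f g (pc P P d)"
      using pc_relabel[of P P "fst d" "snd d" f g e] c inj inj_on_subset by (metis prod.collapse)
    moreover have "vmap (mu P) (relabel f g w) = relabel f g (vmap (mu P) w)" for w by (auto intro: vertex_eqI)
    ultimately show ?thesis by (cases d) simp
  qed
  thus "composite P ?D = map (relabel f g) (composite P D)" by (simp add: composite_def)
qed

lemma properad_vertex_listing:
  assumes P: "is_properad P" and d: "cgraph P P d" "listing os is d"
  shows "veq P (vmap (mu P) (pc P P d)) (Vertex os is (mu P (length os) (length is) (Bcl P P os is d)))"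
proof -
  note p = is_properadD(1,2)[OF P]
  note l = cgraph_listing[OF d(1)]
  let ?os = "all_outs (fst d)" and ?is = "all_ins (snd d)"
  have r: "reord ?os os" "reord ?is is" using d(2) l by (simp_all add: listing_def reord_def)
  have b: "Bcl P P os is d \<in> elts (Box P P) (length os) (length is)" using Bcl_in[OF d] by simp
  show ?thesis
    using Bcl_recoord[OF p(1,1) d r] recoord_map[OF Box_sbimodule[OF p(1,1)] p(2) r b] r sbimod_mapD(2)[OF p(2) b]
    by (simp add: veq_def pc_def well_decorated_def)
qed

lemma graphs3_iff: "(us, vs, ws) \<in> graphs3 P m n \<longleftrightarrow> matching us vs \<and> matching vs ws \<and> conn3 us vs ws \<and>
    decorated P us \<and> decorated P vs \<and> decorated P ws \<and> set (all_outs us) = {..<m} \<and> set (all_ins ws) = {..<n}"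
  (is "?l \<longleftrightarrow> ?r")
proof -
  have "?l \<longleftrightarrow> matching us vs \<and> matching vs ws \<and> connected_graph [map shape us, map shape vs, map shape ws] \<and>
    decorated P us \<and> decorated P vs \<and> decorated P ws \<and> set (all_outs us) = {..<m} \<and> set (all_ins ws) = {..<n}"
    by (auto simp: graphs3_def is_level_iff matching_def decorated_def simp del: set_concat)
  thus ?thesis using connected_graph3[of us vs ws] by blast
qed

text \<open>Contracting one half leaves a connected graph, so both sides of the associativity axiom make sense.\<close>

lemma contract_graph3:
  assumes P: "sbimodule P" and g: "(us, vs, ws) \<in> graphs3 P m n"
  shows "decomp D us vs \<Longrightarrow> (map (pc P P) D, ws) \<in> Bgraphs (Box P P) P m n"
    "decomp D' vs ws \<Longrightarrow> (us, map (pc P P) D') \<in> Bgraphs P (Box P P) m n"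
proof -
  have m: "matching us vs" "matching vs ws" "conn3 us vs ws" "decorated P us" "decorated P vs" "decorated P ws"
    "set (all_outs us) = {..<m}" "set (all_ins ws) = {..<n}" using g unfolding graphs3_iff by auto
  show "(map (pc P P) D, ws) \<in> Bgraphs (Box P P) P m n" if D: "decomp D us vs"
    using pcs_level[OF m(1,4,5) D] conn3_contract[OF pc_contracts m(1,2) D] m
    unfolding Bgraphs_iff cgraph_def matching_def decorated_def by (simp del: set_concat)
  show "(us, map (pc P P) D') \<in> Bgraphs P (Box P P) m n" if D: "decomp D' vs ws"
    using pcs_level[OF m(2,5,6) D] conn3_contract'[OF pc_contracts m(1,2) D m(3)] m
    unfolding Bgraphs_iff cgraph_def matching_def decorated_def by (simp del: set_concat)
qed

text \<open>
  The associativity axiom speaks of components and of graphs with numbered inputs and outputs.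
  Uniqueness of decompositions and a change of listings remove both restrictions.
\<close>

lemma properad_assoc_piece:
  assumes P: "is_properad P" and m: "matching us vs" "matching vs ws" and c: "conn3 us vs ws"
    and dec: "decorated P us" "decorated P vs" "decorated P ws" and D: "decomp D us vs" "decomp D' vs ws"
  shows "veq P (vmap (mu P) (pc P P (composite P D, ws))) (vmap (mu P) (pc P P (us, composite P D')))"
    "matching (composite P D) ws" "conn2 (composite P D) ws" "matching us (composite P D')" "conn2 us (composite P D')"
proof -
  note p = is_properadD[OF P]
  note BB = Box_sbimodule[OF p(1,1)]
  let ?os = "all_outs us" and ?is = "all_ins ws"
  let ?m = "length ?os" and ?n = "length ?is"
  let ?us = "map (relabel (position ?os) id) us" and ?ws = "map (relabel id (position ?is)) ws"
  have l: "distinct ?os" "distinct ?is" using m by (simp_all add: matching_def lvl_def)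
  note io = inj_on_position[OF l(1)] and ii = inj_on_position[OF l(2)]
  have lv: "lvl ?us" "lvl ?ws"
    using m lvl_relabel[of us "position ?os" id "\<lambda>_ _ x. x"] lvl_relabel[of ws id "position ?is" "\<lambda>_ _ x. x"] io ii
    by (simp_all add: matching_def vrelabel_id)
  have "conn3 ?us vs ?ws" using c by (simp add: conn3_def del: set_concat)
  hence g3: "(?us, vs, ?ws) \<in> graphs3 P ?m ?n"
    using m dec lv position_image[OF l(1)] position_image[OF l(2)]
    by (simp add: graphs3_iff matching_def decorated_def well_decorated_def del: set_concat)
  have cg: "cgraph P P (composite P D, ws)" "cgraph P P (us, composite P D')"
  proof -
    have c1: "conn2 (composite P D) ws"
      using conn3_contract[OF composite_contracts(2) m D(1)] c by (simp add: composite_contracts(1))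
    have c2: "conn2 us (composite P D')"
      using conn3_contract'[OF composite_contracts(2) m D(2) c] by (simp add: composite_contracts(1))
    have w: "decorated P (map (vmap (mu P)) vs')" if "decorated (Box P P) vs'" for vs'
      using that sbimod_mapD(2)[OF p(2)] by (auto simp: decorated_def well_decorated_def)
    note q = pcs_level[OF m(1) dec(1,2) D(1)] and q' = pcs_level[OF m(2) dec(2,3) D(2)]
    show "cgraph P P (composite P D, ws)"
      using c1 m dec w[OF q(2)] q(1,4) unfolding cgraph_def matching_def composite_def fst_conv snd_conv lvl_vmap all_simps
      by (simp add: decorated_def)
    show "cgraph P P (us, composite P D')"
      using c2 m dec w[OF q'(2)] q'(1,3) unfolding cgraph_def matching_def composite_def fst_conv snd_conv lvl_vmap all_simps
      by (simp add: decorated_def)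
  qed
  thus "matching (composite P D) ws" "conn2 (composite P D) ws" "matching us (composite P D')" "conn2 us (composite P D')"
    by (simp_all add: cgraph_def)
  have oD: "set (all_outs (composite P D)) = set ?os" "set (all_ins (composite P D')) = set ?is"
    using contracts_edges(1)[OF composite_contracts(2) D(1)] contracts_edges(2)[OF composite_contracts(2) D(2)]
    by (simp_all only: composite_contracts(1))
  have ls: "listing ?os ?is (composite P D, ws)" "listing ?os ?is (us, composite P D')"
    using l oD by (simp_all add: listing_def del: set_concat)
  have e1: "Box_map P P (mu P) (\<lambda>_ _ x. x) ?m ?n (Bclass (Box P P) P ?m ?n (contract P P (?us, vs), ?ws)) =
      Bcl P P ?os ?is (composite P D, ws)"
  proof -
    have dm: "matching ?us vs" "decorated P ?us" using g3 by (auto simp: graphs3_iff)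
    let ?C = "components (?us, vs)"
    have C: "decomp ?C ?us vs" by (rule decomp_components[OF dm(1)])
    obtain D1 where D1: "decomp D1 ?us (map (relabel id id) vs)"
      "composite P D1 = map (relabel (position ?os) id) (composite P D)"
      using composite_relabel[OF P m(1) dec(1,2) D(1) io, of id id] by auto
    have lq: "leveq P (composite P ?C) (composite P D1)"
      unfolding composite_def using leveq_vmap[OF BB p(2) pcs_leveq[OF p(1,1) dm(1,2) dec(2) C]] D1(1)
      by (simp add: map_relabel_id)
    have "Box_map P P (mu P) (\<lambda>_ _ x. x) ?m ?n (Bclass (Box P P) P ?m ?n (contract P P (?us, vs), ?ws)) =
        Bclass P P ?m ?n (composite P ?C, ?ws)"
      "(composite P ?C, ?ws) \<in> Bgraphs P P ?m ?n"
      using Box_map_gen(2,3)[OF BB p(1) p(1,1,2) sbimod_map_id contract_graph3(1)[OF p(1) g3 C]]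
      by (simp_all add: contract_pc composite_def map_vmap_id del: map_map)
    thus ?thesis
      using class_leveq(1)[OF p(1) Bgraphs_admissible_top Brels_levels(1)[of P P ?m ?n] _ lq, of ?ws] D1(2)
      by (simp add: Bclass_def Bcl_def localize_def)
  qed
  have e2: "Box_map P P (\<lambda>_ _ x. x) (mu P) ?m ?n (Bclass P (Box P P) ?m ?n (?us, contract P P (vs, ?ws))) =
      Bcl P P ?os ?is (us, composite P D')"
  proof -
    have dm: "matching vs ?ws" "decorated P ?ws" using g3 by (auto simp: graphs3_iff)
    let ?C = "components (vs, ?ws)"
    have C: "decomp ?C vs ?ws" by (rule decomp_components[OF dm(1)])
    obtain D1 where D1: "decomp D1 (map (relabel id id) vs) ?ws"
      "composite P D1 = map (relabel id (position ?is)) (composite P D')"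
      using composite_relabel[OF P m(2) dec(2,3) D(2) _ _ ii, of id id] by auto
    have lq: "leveq P (composite P ?C) (composite P D1)"
      unfolding composite_def using leveq_vmap[OF BB p(2) pcs_leveq[OF p(1,1) dm(1) dec(2) dm(2) C]] D1(1)
      by (simp add: map_relabel_id)
    have "Box_map P P (\<lambda>_ _ x. x) (mu P) ?m ?n (Bclass P (Box P P) ?m ?n (?us, contract P P (vs, ?ws))) =
        Bclass P P ?m ?n (?us, composite P ?C)"
      "(?us, composite P ?C) \<in> Bgraphs P P ?m ?n"
      using Box_map_gen(2,3)[OF p(1,1) BB p(1) sbimod_map_id p(2) contract_graph3(2)[OF p(1) g3 C]]
      by (simp_all add: contract_pc composite_def map_vmap_id del: map_map)
    thus ?thesis
      using class_leveq(1)[OF p(1) Bgraphs_admissible_bot Brels_levels(2)[of P P ?m ?n] _ lq, of ?us] D1(2)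
      by (simp add: Bclass_def Bcl_def localize_def)
  qed
  have "mu P ?m ?n (Bcl P P ?os ?is (composite P D, ws)) = mu P ?m ?n (Bcl P P ?os ?is (us, composite P D'))"
    using p(6)[OF g3] e1 e2 by simp
  thus "veq P (vmap (mu P) (pc P P (composite P D, ws))) (vmap (mu P) (pc P P (us, composite P D')))"
    using properad_vertex_listing[OF P cg(1) ls(1)] properad_vertex_listing[OF P cg(2) ls(2)] veq_trans[OF p(1)] veq_sym[OF p(1)]
    by metis
qed

section \<open>Block permutations\<close>

lemma permutes_inverseI:
  assumes "f \<circ> g = id" "g \<circ> f = id" "\<And>i. i \<notin> S \<Longrightarrow> f i = i"
  shows "f permutes S" "inv_into UNIV f = g"
proof -
  have "bij f" using assms(1,2) by (rule o_bij[rotated])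
  thus "f permutes S" using assms(3) by (simp add: permutes_def bij_iff)
  show "inv_into UNIV f = g" using assms(1,2) by (rule inv_unique_comp)
qed

lemma block_sum_inverse:
  assumes "\<sigma> permutes {..<m}" "\<sigma>' permutes {..<m'}"
  shows "block_sum m \<sigma> \<sigma>' \<circ> block_sum m (inv_into UNIV \<sigma>) (inv_into UNIV \<sigma>') = id"
    "block_sum m (inv_into UNIV \<sigma>) (inv_into UNIV \<sigma>') \<circ> block_sum m \<sigma> \<sigma>' = id"
  using permutes_in_image[OF assms(1)] permutes_in_image[OF permutes_inv[OF assms(1)]]
    permutes_inverses[OF assms(1)] permutes_inverses[OF assms(2)]
  by (auto simp: fun_eq_iff block_sum_def)

lemma block_sum_permutes:
  assumes "\<sigma> permutes {..<m}" "\<sigma>' permutes {..<m'}"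
  shows "block_sum m \<sigma> \<sigma>' permutes {..<m + m'}"
    "inv_into UNIV (block_sum m \<sigma> \<sigma>') = block_sum m (inv_into UNIV \<sigma>) (inv_into UNIV \<sigma>')"
proof -
  have "block_sum m \<sigma> \<sigma>' i = i" if "i \<notin> {..<m + m'}" for i
    using that permutes_not_in[OF assms(2), of "i - m"] by (simp add: block_sum_def)
  thus "block_sum m \<sigma> \<sigma>' permutes {..<m + m'}"
    "inv_into UNIV (block_sum m \<sigma> \<sigma>') = block_sum m (inv_into UNIV \<sigma>) (inv_into UNIV \<sigma>')"
    using permutes_inverseI[OF block_sum_inverse[OF assms]] by blast+
qed

lemma block_swap_permutes:
  "block_swap m m' permutes {..<m + m'}" "inv_into UNIV (block_swap m m') = block_swap m' m"
proof -
  have "block_swap m m' \<circ> block_swap m' m = id" for m m' by (auto simp: fun_eq_iff block_swap_def)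
  thus "block_swap m m' permutes {..<m + m'}" "inv_into UNIV (block_swap m m') = block_swap m' m"
    using permutes_inverseI[of "block_swap m m'" "block_swap m' m" "{..<m + m'}"] by (auto simp: block_swap_def)
qed


section \<open>Identity graphs\<close>

lemma Ibim_sbimodule: "sbimodule (Ibim :: ('k::field, 'k) sbimod)"
proof -
  have "kmod (md (Ibim :: ('k, 'k) sbimod) m n)" for m n
  proof (rule kmodI)
    show "abelian_group (md (Ibim :: ('k, 'k) sbimod) m n)"
    proof (rule abelian_groupI)
      fix x assume "x \<in> elts (Ibim :: ('k, 'k) sbimod) m n"
      thus "\<exists>y\<in>elts (Ibim :: ('k, 'k) sbimod) m n. y \<oplus>\<^bsub>md Ibim m n\<^esub> x = \<zero>\<^bsub>md Ibim m n\<^esub>"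
        by (intro bexI[of _ "- x"]) (auto simp: Ibim_def split: if_splits)
    qed (auto simp: Ibim_def split: if_splits)
  qed (auto simp: Ibim_def algebra_simps split: if_splits)
  thus ?thesis unfolding sbimodule_def
    by (simp add: linear_map_def) (auto simp: Ibim_def split: if_splits)
qed

text \<open>
  The graph of identities with arbitrary edge names and an arbitrary decoration in place of the unit.
\<close>

definition strands :: "'b \<Rightarrow> nat list \<Rightarrow> 'b vertex list" where
  "strands c xs = map (\<lambda>i. Vertex [i] [i] c) xs"

lemma strands_simps [simp]: "all_outs (strands c xs) = xs" "all_ins (strands c xs) = xs"
  "in_sets (strands c xs) = (\<lambda>i. {i}) ` set xs" "out_sets (strands c xs) = (\<lambda>i. {i}) ` set xs"
  "set (strands c xs) = (\<lambda>i. Vertex [i] [i] c) ` set xs"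
  by (induction xs) (auto simp: strands_def in_sets_def out_sets_def)

lemma idgraph_strands: "idgraph n = strands 1 [0..<n]"
  by (simp add: idgraph_def strands_def)

lemma vmap_strands: "map (vmap f) (strands c xs) = strands (f (Suc 0) (Suc 0) c) xs"
  by (simp add: strands_def vmap_def)

lemma strands_lvl: "distinct xs \<Longrightarrow> lvl (strands c xs)"
  by (auto simp: lvl_def simp del: set_concat)

lemma idgraph_Sgraph: "0 < n \<Longrightarrow> (idgraph n :: 'k::field vertex list) \<in> Sgraphs Ibim n n"
  unfolding Sgraphs_iff idgraph_strands strands_simps
  by (auto simp: strands_lvl well_decorated_def Ibim_def lessThan_atLeast0) (simp add: strands_def)

lemma strands_conn:
  "outs v \<noteq> [] \<Longrightarrow> conn2 (strands c (outs v)) [v]" "ins v \<noteq> [] \<Longrightarrow> conn2 [v] (strands c (ins v))"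
  by (auto simp: conn2_def in_sets_simps strands_def[of c "[]"] simp del: set_concat) (auto simp: strands_def)

text \<open>The unit laws are stated for vertices with numbered edges; here the edges have arbitrary names.\<close>

lemma properad_unit_piece:
  assumes P: "is_properad P" and v: "well_decorated P v" "lvl [v]"
  defines "c \<equiv> eta P (Suc 0) (Suc 0) 1"
  shows "vmap (mu P) (pc P P (strands c (outs v), [v])) = v" "vmap (mu P) (pc P P ([v], strands c (ins v))) = v"
proof -
  note p = is_properadD[OF P]
  let ?a = "length (outs v)" and ?b = "length (ins v)" and ?os = "outs v" and ?is = "ins v"
  let ?w = "Vertex [0..<?a] [0..<?b] (deco v)"
  have l: "distinct ?os" "distinct ?is" "?os \<noteq> []" "?is \<noteq> []" using v(2) by (auto simp: lvl_Cons)
  hence ab: "0 < ?a" "0 < ?b" by auto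
  have dv: "deco v \<in> elts P ?a ?b" using v(1) by (simp add: well_decorated_def)
  have lw: "lvl [?w]" using ab by (simp add: lvl_Cons)
  have one: "well_decorated Ibim (Vertex [i] [i] (1::'a))" for i by (simp add: well_decorated_def Ibim_def)
  have g1: "(idgraph ?a, [?w]) \<in> Bgraphs Ibim P ?a ?b"
    using ab lw dv strands_conn(1)[of ?w 1] one
    by (auto simp: Bgraphs_iff cgraph_def matching_def idgraph_strands strands_lvl well_decorated_def simp del: set_concat)
  have g2: "([?w], idgraph ?b) \<in> Bgraphs P Ibim ?a ?b"
    using ab lw dv strands_conn(2)[of ?w 1] one
    by (auto simp: Bgraphs_iff cgraph_def matching_def idgraph_strands strands_lvl well_decorated_def simp del: set_concat)
  have e1: "mu P ?a ?b (Bclass P P ?a ?b (strands c [0..<?a], [?w])) = deco v"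
    and G1: "(strands c [0..<?a], [?w]) \<in> Bgraphs P P ?a ?b"
    using p(4)[OF dv ab] Box_map_gen(2,3)[OF Ibim_sbimodule p(1,1,1,3) sbimod_map_id g1]
    by (simp_all add: idgraph_strands vmap_strands c_def map_vmap_id[of "[_]", simplified])
  have e2: "mu P ?a ?b (Bclass P P ?a ?b ([?w], strands c [0..<?b])) = deco v"
    and G2: "([?w], strands c [0..<?b]) \<in> Bgraphs P P ?a ?b"
    using p(5)[OF dv ab] Box_map_gen(2,3)[OF p(1,1) Ibim_sbimodule p(1) sbimod_map_id p(3) g2]
    by (simp_all add: idgraph_strands vmap_strands c_def map_vmap_id[of "[_]", simplified])
  let ?f = "\<lambda>i. ?os ! i" and ?g = "\<lambda>i. ?is ! i"
  have mp: "map ?f [0..<?a] = ?os" "map ?g [0..<?b] = ?is" by (simp_all add: map_nth)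
  have ij: "inj_on ?f {0..<?a}" "inj_on ?g {0..<?b}" using l by (auto intro: inj_on_nth)
  have wv: "relabel id (position ?is) v = Vertex ?os [0..<?b] (deco v)" "relabel (position ?os) id v = Vertex [0..<?a] ?is (deco v)"
    using l by (simp_all add: relabel_def map_position_self)
  have ps: "map (relabel (position xs) id) (strands c xs) = map (relabel id (\<lambda>i. xs ! i)) (strands c [0..<length xs])"
    "map (relabel id (position xs)) (strands c xs) = map (relabel (\<lambda>i. xs ! i) id) (strands c [0..<length xs])" if "distinct xs" for xs
    using that by (auto simp: strands_def relabel_def intro!: nth_equalityI)
  have "Bcl P P ?os ?is (strands c ?os, [v]) = Bclass P P ?a ?b (map (relabel id ?f) (strands c [0..<?a]), map (relabel ?f id) [?w])"
    using mp(1) by (simp add: Bcl_def localize_def ps(1)[OF l(1)] wv) (simp add: relabel_def)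
  also have "\<dots> = Bclass P P ?a ?b (strands c [0..<?a], [?w])"
    using Bclass_rename[OF G1, of ?f] ij(1) by simp
  finally show "vmap (mu P) (pc P P (strands c (outs v), [v])) = v"
    using e1 by (intro vertex_eqI) (simp_all add: pc_def)
  have "Bcl P P ?os ?is ([v], strands c ?is) = Bclass P P ?a ?b (map (relabel id ?g) [?w], map (relabel ?g id) (strands c [0..<?b]))"
    using mp(2) by (simp add: Bcl_def localize_def ps(2)[OF l(2)] wv) (simp add: relabel_def)
  also have "\<dots> = Bclass P P ?a ?b ([?w], strands c [0..<?b])"
    using Bclass_rename[OF G2, of ?g] ij(2) by simp
  finally show "vmap (mu P) (pc P P ([v], strands c (ins v))) = v"
    using e2 by (intro vertex_eqI) (simp_all add: pc_def)
qed

lemma strands_mset: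
  assumes "distinct ys" "set ys = set xs" "distinct xs"
  shows "mset (strands c ys) = mset (strands c xs)"
  using assms set_eq_iff_mset_eq_distinct[of ys xs] by (simp add: strands_def)

lemma concat_strands: "concat (map (\<lambda>v. strands c (f v)) vs) = strands c (concat (map f vs))"
  by (simp add: strands_def map_concat comp_def)

lemma strands_decomp:
  assumes "lvl vs"
  shows "distinct ys \<Longrightarrow> set ys = set (all_outs vs) \<Longrightarrow> decomp (map (\<lambda>v. (strands c (outs v), [v])) vs) (strands c ys) vs"
    "distinct ys \<Longrightarrow> set ys = set (all_ins vs) \<Longrightarrow> decomp (map (\<lambda>v. ([v], strands c (ins v))) vs) vs (strands c ys)"
proof -
  have ne: "\<forall>v\<in>set vs. outs v \<noteq> [] \<and> ins v \<noteq> []" and d: "distinct (all_outs vs)" "distinct (all_ins vs)"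
    using assms by (simp_all add: lvl_def)
  have c: "concat (map (\<lambda>v. [v]) vs) = vs" by (induction vs) auto
  show "decomp (map (\<lambda>v. (strands c (outs v), [v])) vs) (strands c ys) vs" if "distinct ys" "set ys = set (all_outs vs)"
    using ne strands_mset[OF that d(1), of c]
    by (auto simp: decomp_def tops_def bots_def comp_def c concat_strands strands_conn simp del: set_concat)
  show "decomp (map (\<lambda>v. ([v], strands c (ins v))) vs) vs (strands c ys)" if "distinct ys" "set ys = set (all_ins vs)"
    using ne strands_mset[OF that d(2), of c]
    by (auto simp: decomp_def tops_def bots_def comp_def c concat_strands strands_conn simp del: set_concat)
qed

lemma lvl_single: "lvl vs \<Longrightarrow> v \<in> set vs \<Longrightarrow> lvl [v]"
  by (auto simp: lvl_def distinct_concat_iff)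

lemma lvl_concat: "lvl (concat xss) \<Longrightarrow> xs \<in> set xss \<Longrightarrow> lvl xs"
  by (induction xss) (auto simp: lvl_append)

section \<open>Multilinear maps on modules of one-level graphs\<close>

lemma bilinear_pre:
  assumes f: "bilinear_map L M N f" and g: "linear_map L' L g" and k: "linear_map M' M k"
  shows "bilinear_map L' M' N (\<lambda>x y. f (g x) (k y))"
  unfolding bilinear_map_def
proof (intro conjI ballI)
  show "linear_map M' N (\<lambda>y. f (g x) (k y))" if "x \<in> carrier L'" for x
    using linear_map_comp[OF k bilinear_mapD(1)[OF f linear_mapD(1)[OF g that]]] .
  show "linear_map L' N (\<lambda>x. f (g x) (k y))" if "y \<in> carrier M'" for y
    using linear_map_comp[OF g bilinear_mapD(2)[OF f linear_mapD(1)[OF k that]]] .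
qed

lemma bilinear_flip: "bilinear_map L M N f \<Longrightarrow> bilinear_map M L N (\<lambda>y x. f x y)"
  by (simp add: bilinear_map_def)

lemma Smod_eqI2:
  assumes M: "kmod M" and f: "bilinear_map (Smod P m n) (Smod P' m' n') M f" and h: "bilinear_map (Smod P m n) (Smod P' m' n') M h"
    and eq: "\<And>us vs. us \<in> Sgraphs P m n \<Longrightarrow> vs \<in> Sgraphs P' m' n' \<Longrightarrow> f (Sclass P m n us) (Sclass P' m' n' vs) = h (Sclass P m n us) (Sclass P' m' n' vs)"
    and A: "A \<in> carrier (Smod P m n)" and B: "B \<in> carrier (Smod P' m' n')"
  shows "f A B = h A B"
  by (rule Smod_eqI[OF M bilinear_mapD(2)[OF f B] bilinear_mapD(2)[OF h B] _ A],
      rule Smod_eqI[OF M bilinear_mapD(1)[OF f Sclass_in] bilinear_mapD(1)[OF h Sclass_in] eq B])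

lemma Sclass_mset:
  assumes "sbimodule P" "us \<in> Sgraphs P m n" "mset us = mset vs" shows "Sclass P m n us = Sclass P m n vs"
  using class_mset[OF assms(1) Sgraphs_admissible _ assms(2,3), of "Srels P m n"] by (simp add: Srels_def Sclass_def)

lemma Sprod_equivariant:
  assumes P: "sbimodule P" and x: "x \<in> carrier (Smod P m n)" and y: "y \<in> carrier (Smod P m' n')"
  shows "\<sigma> permutes {..<m} \<Longrightarrow> \<sigma>' permutes {..<m'} \<Longrightarrow>
      Sprod P m n m' n' (lact (Sten P) m n \<sigma> x) (lact (Sten P) m' n' \<sigma>' y) =
      lact (Sten P) (m + m') (n + n') (block_sum m \<sigma> \<sigma>') (Sprod P m n m' n' x y)"
    "\<tau> permutes {..<n} \<Longrightarrow> \<tau>' permutes {..<n'} \<Longrightarrow>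
      Sprod P m n m' n' (ract (Sten P) m n \<tau> x) (ract (Sten P) m' n' \<tau>' y) =
      ract (Sten P) (m + m') (n + n') (block_sum n \<tau> \<tau>') (Sprod P m n m' n' x y)"
proof -
  note S = sbimoduleD[OF Sten_sbimodule[OF P], unfolded md_Sten] and b = Sprod_bilinear[OF P]
  note cl = Smap_compatible(2)[OF P P sbimod_map_id, unfolded vrelabel_id]
  have sh: "map (relabel f g) us @ map (relabel ((+) m) ((+) n)) (map (relabel f' g') vs) =
      map (relabel (block_sum m f f') (block_sum n g g')) (us @ map (relabel ((+) m) ((+) n)) vs)"
    if us: "us \<in> Sgraphs P m n" for f g f' g' us vs
    using us unfolding map_append map_relabel_comp
    by (intro arg_cong2[of _ _ _ _ "(@)"] map_relabel_cong) (auto simp: block_sum_def Sgraphs_iff simp del: set_concat)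
  have bid: "block_sum k id id = id" for k by (auto simp: block_sum_def)
  show "Sprod P m n m' n' (lact (Sten P) m n \<sigma> x) (lact (Sten P) m' n' \<sigma>' y) =
      lact (Sten P) (m + m') (n + n') (block_sum m \<sigma> \<sigma>') (Sprod P m n m' n' x y)" if s: "\<sigma> permutes {..<m}" "\<sigma>' permutes {..<m'}"
  proof (rule Smod_eqI2[OF Smod_module bilinear_pre[OF b(1) S(3)[OF s(1)] S(3)[OF s(2)]]
        bilinear_comp[OF b(1) S(3)[OF block_sum_permutes(1)[OF s]]] _ x y])
    fix us vs assume us: "us \<in> Sgraphs P m n" and vs: "vs \<in> Sgraphs P m' n'"
    show "Sprod P m n m' n' (lact (Sten P) m n \<sigma> (Sclass P m n us)) (lact (Sten P) m' n' \<sigma>' (Sclass P m' n' vs)) =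
        lact (Sten P) (m + m') (n + n') (block_sum m \<sigma> \<sigma>') (Sprod P m n m' n' (Sclass P m n us) (Sclass P m' n' vs))"
      unfolding Sten_gen(1)[OF P us s(1)] Sten_gen(1)[OF P vs s(2)] b(2)[OF us vs]
        b(2)[OF cl[OF s(1) permutes_id us] cl[OF s(2) permutes_id vs]]
        Sten_gen(1)[OF P Sprod_graph[OF us vs] block_sum_permutes(1)[OF s]] sh[OF us] bid ..
  qed
  show "Sprod P m n m' n' (ract (Sten P) m n \<tau> x) (ract (Sten P) m' n' \<tau>' y) =
      ract (Sten P) (m + m') (n + n') (block_sum n \<tau> \<tau>') (Sprod P m n m' n' x y)" if s: "\<tau> permutes {..<n}" "\<tau>' permutes {..<n'}"
  proof (rule Smod_eqI2[OF Smod_module bilinear_pre[OF b(1) S(4)[OF s(1)] S(4)[OF s(2)]]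
        bilinear_comp[OF b(1) S(4)[OF block_sum_permutes(1)[OF s]]] _ x y])
    fix us vs assume us: "us \<in> Sgraphs P m n" and vs: "vs \<in> Sgraphs P m' n'"
    note i = permutes_inv[OF s(1)] permutes_inv[OF s(2)]
    show "Sprod P m n m' n' (ract (Sten P) m n \<tau> (Sclass P m n us)) (ract (Sten P) m' n' \<tau>' (Sclass P m' n' vs)) =
        ract (Sten P) (m + m') (n + n') (block_sum n \<tau> \<tau>') (Sprod P m n m' n' (Sclass P m n us) (Sclass P m' n' vs))"
      unfolding Sten_gen(2)[OF P us s(1)] Sten_gen(2)[OF P vs s(2)] b(2)[OF us vs]
        b(2)[OF cl[OF permutes_id i(1) us] cl[OF permutes_id i(2) vs]]
        Sten_gen(2)[OF P Sprod_graph[OF us vs] block_sum_permutes(1)[OF s]] block_sum_permutes(2)[OF s] sh[OF us] bid ..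
  qed
qed

lemma Sprod_assoc:
  assumes P: "sbimodule P" and x: "x \<in> carrier (Smod P m n)" and y: "y \<in> carrier (Smod P m' n')" and z: "z \<in> carrier (Smod P m'' n'')"
  shows "Sprod P (m + m') (n + n') m'' n'' (Sprod P m n m' n' x y) z =
    Sprod P m n (m' + m'') (n' + n'') x (Sprod P m' n' m'' n'' y z)"
proof -
  note b = Sprod_bilinear[OF P]
  have B: "bilinear_map (Smod P m n) (Smod P (m' + m'') (n' + n'')) (Smod P (m + m' + m'') (n + n' + n'')) (Sprod P m n (m' + m'') (n' + n''))"
    using b(1)[of m n "m' + m''" "n' + n''"] by (simp only: add.assoc)
  show ?thesis
  proof (rule Smod_eqI2[OF Smod_module bilinear_comp[OF b(1) bilinear_mapD(2)[OF b(1) z]]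
        bilinear_pre[OF B linear_map_id bilinear_mapD(2)[OF b(1) z]] _ x y])
    fix us vs assume us: "us \<in> Sgraphs P m n" and vs: "vs \<in> Sgraphs P m' n'"
    show "Sprod P (m + m') (n + n') m'' n'' (Sprod P m n m' n' (Sclass P m n us) (Sclass P m' n' vs)) z =
        Sprod P m n (m' + m'') (n' + n'') (Sclass P m n us) (Sprod P m' n' m'' n'' (Sclass P m' n' vs) z)"
    proof (rule Smod_eqI[OF Smod_module bilinear_mapD(1)[OF b(1)]
        linear_map_comp[OF bilinear_mapD(1)[OF b(1) Sclass_in[OF vs]] bilinear_mapD(1)[OF B Sclass_in[OF us]]] _ z])
      show "Sprod P m n m' n' (Sclass P m n us) (Sclass P m' n' vs) \<in> carrier (Smod P (m + m') (n + n'))"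
        using bilinear_mapD(3)[OF b(1) Sclass_in[OF us] Sclass_in[OF vs]] .
      fix ws assume ws: "ws \<in> Sgraphs P m'' n''"
      have "map (relabel ((+) (m + m')) ((+) (n + n'))) ws = map (relabel ((+) m) ((+) n)) (map (relabel ((+) m') ((+) n')) ws)"
        unfolding map_relabel_comp by (rule map_relabel_cong) simp_all
      thus "Sprod P (m + m') (n + n') m'' n'' (Sprod P m n m' n' (Sclass P m n us) (Sclass P m' n' vs)) (Sclass P m'' n'' ws) =
        Sprod P m n (m' + m'') (n' + n'') (Sclass P m n us) (Sprod P m' n' m'' n'' (Sclass P m' n' vs) (Sclass P m'' n'' ws))"
        unfolding b(2)[OF us vs] b(2)[OF vs ws] b(2)[OF Sprod_graph[OF us vs] ws] b(2)[OF us Sprod_graph[OF vs ws]]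
        by (simp add: add.assoc del: map_map)
    qed
  qed
qed

lemma Sprod_comm:
  assumes P: "sbimodule P" and x: "x \<in> carrier (Smod P m n)" and y: "y \<in> carrier (Smod P m' n')"
  shows "Sprod P m' n' m n y x = lact (Sten P) (m + m') (n + n') (block_swap m m')
    (ract (Sten P) (m + m') (n + n') (block_swap n' n) (Sprod P m n m' n' x y))"
proof -
  note b = Sprod_bilinear[OF P] and S = sbimoduleD[OF Sten_sbimodule[OF P], unfolded md_Sten]
  have sw: "block_swap m m' permutes {..<m + m'}" "block_swap n' n permutes {..<n + n'}"
    using block_swap_permutes(1)[of m m'] block_swap_permutes(1)[of n' n] by (simp_all only: add.commute)
  have B: "bilinear_map (Smod P m n) (Smod P m' n') (Smod P (m + m') (n + n')) (\<lambda>x y. Sprod P m' n' m n y x)"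
    using bilinear_flip[OF b(1)[of m' n' m n]] by (simp only: add.commute)
  show ?thesis
  proof (rule Smod_eqI2[OF Smod_module B bilinear_comp[OF b(1) linear_map_comp[OF S(4)[OF sw(2)] S(3)[OF sw(1)]]] _ x y])
    fix us vs assume us: "us \<in> Sgraphs P m n" and vs: "vs \<in> Sgraphs P m' n'"
    let ?G = "us @ map (relabel ((+) m) ((+) n)) vs" and ?G' = "vs @ map (relabel ((+) m') ((+) n')) us"
    have G1: "map (relabel id (block_swap n n')) ?G \<in> Sgraphs P (m + m') (n + n')"
      using Smap_compatible(2)[OF P P sbimod_map_id permutes_id _ Sprod_graph[OF us vs], of "block_swap n n'", unfolded vrelabel_id]
        block_swap_permutes(1) by simp
    have G2: "?G' \<in> Sgraphs P (m + m') (n + n')" using Sprod_graph[OF vs us] by (simp only: add.commute)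
    have "map (relabel (block_swap m m') id) (map (relabel id (block_swap n n')) ?G) = map (relabel ((+) m') ((+) n')) us @ vs"
    proof -
      have "map (relabel (block_swap m m') (block_swap n n')) us = map (relabel ((+) m') ((+) n')) us"
        using us by (intro map_relabel_cong) (auto simp: block_swap_def Sgraphs_iff simp del: set_concat)
      moreover have "map (relabel (block_swap m m' \<circ> (+) m) (block_swap n n' \<circ> (+) n)) vs = map (relabel id id) vs"
        using vs by (intro map_relabel_cong) (auto simp: block_swap_def Sgraphs_iff simp del: set_concat)
      ultimately show ?thesis unfolding map_append map_relabel_comp map_relabel_id by simp
    qed
    hence "lact (Sten P) (m + m') (n + n') (block_swap m m') (ract (Sten P) (m + m') (n + n') (block_swap n' n)
        (Sprod P m n m' n' (Sclass P m n us) (Sclass P m' n' vs))) = Sclass P (m + m') (n + n') (map (relabel ((+) m') ((+) n')) us @ vs)"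
      unfolding b(2)[OF us vs] Sten_gen(2)[OF P Sprod_graph[OF us vs] sw(2)] block_swap_permutes(2) Sten_gen(1)[OF P G1 sw(1)]
      by (simp only:)
    also have "\<dots> = Sclass P (m + m') (n + n') ?G'"
      by (rule Sclass_mset[OF P G2, symmetric]) simp
    also have "\<dots> = Sprod P m' n' m n (Sclass P m' n' vs) (Sclass P m n us)"
      unfolding b(2)[OF vs us] by (simp only: add.commute)
    finally show "Sprod P m' n' m n (Sclass P m' n' vs) (Sclass P m n us) =
      lact (Sten P) (m + m') (n + n') (block_swap m m') (ract (Sten P) (m + m') (n + n') (block_swap n' n)
        (Sprod P m n m' n' (Sclass P m n us) (Sclass P m' n' vs)))" ..
  qed
qed

lemma Sten_map_Sprod:
  assumes P: "sbimodule P" "sbimodule P'" and h: "sbimod_map P P' h"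
    and x: "x \<in> carrier (Smod P m n)" and y: "y \<in> carrier (Smod P m' n')"
  shows "Sten_map P P' h (m + m') (n + n') (Sprod P m n m' n' x y) =
    Sprod P' m n m' n' (Sten_map P P' h m n x) (Sten_map P P' h m' n' y)"
proof -
  note b = Sprod_bilinear[OF P(1)] and b' = Sprod_bilinear[OF P(2)] and L = sbimod_mapD(1)[OF Sten_map_sbimod[OF P h], unfolded md_Sten]
  note g = Sten_map_gen[OF P h]
  show ?thesis
  proof (rule Smod_eqI2[OF Smod_module bilinear_comp[OF b(1) L] bilinear_pre[OF b'(1) L L] _ x y])
    fix us vs assume us: "us \<in> Sgraphs P m n" and vs: "vs \<in> Sgraphs P m' n'"
    have "map (vmap h) (us @ map (relabel ((+) m) ((+) n)) vs) = map (vmap h) us @ map (relabel ((+) m) ((+) n)) (map (vmap h) vs)"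
      by (auto intro!: vertex_eqI)
    thus "Sten_map P P' h (m + m') (n + n') (Sprod P m n m' n' (Sclass P m n us) (Sclass P m' n' vs)) =
      Sprod P' m n m' n' (Sten_map P P' h m n (Sclass P m n us)) (Sten_map P P' h m' n' (Sclass P m' n' vs))"
      unfolding b(2)[OF us vs] g(1)[OF us] g(1)[OF vs] g(1)[OF Sprod_graph[OF us vs]] b'(2)[OF g(2)[OF us] g(2)[OF vs]]
      by (simp only:)
  qed
qed

section \<open>The free PROP on a properad\<close>

lemma tops_concat: "tops (concat Ds) = concat (map tops Ds)" "bots (concat Ds) = concat (map bots Ds)"
  by (induction Ds) simp_all

text \<open>
  Let \<open>C\<close> decompose the upper two levels and \<open>F\<close> the graph of the composites of these pieces over the
  lowest level.  The pieces of \<open>F\<close> partition the pieces of \<open>C\<close>, so that each of them stands for a connected three-level graph,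
  where \<open>P\<close> is associative.  Contracting the lower two levels of these three-level graphs instead
  gives a decomposition for the other bracketing, with equivalent vertices.
\<close>

lemma SPROP_vcomp_assoc_graphs:
  assumes P: "is_properad P" and us: "us \<in> Sgraphs P m M" and vs: "vs \<in> Sgraphs P M N" and ws: "ws \<in> Sgraphs P N n"
  shows "vcomp (SPROP P) m N n (vcomp (SPROP P) m M N (Sclass P m M us) (Sclass P M N vs)) (Sclass P N n ws) =
    vcomp (SPROP P) m M n (Sclass P m M us) (vcomp (SPROP P) M N n (Sclass P M N vs) (Sclass P N n ws))"
proof -
  note p = is_properadD(1,2)[OF P] and V = SPROP_vcomp(2,3)[OF P]
  let ?c = "\<lambda>d. vmap (mu P) (pc P P d)"
  note cc = composite_contracts[of P]
  note m1 = Sgraphs_matching[OF us vs] and m2 = Sgraphs_matching[OF vs ws]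
  define C where "C = components (us, vs)"
  have C: "decomp C us vs" unfolding C_def by (rule decomp_components[OF m1(1)])
  have uv: "composite P C \<in> Sgraphs P m N" by (rule V(2)[OF us vs C])
  define F where "F = components (composite P C, ws)"
  note mF = Sgraphs_matching[OF uv ws]
  have F: "decomp F (composite P C) ws" unfolding F_def by (rule decomp_components[OF mF(1)])
  have "mset (concat (map fst F)) = mset (map ?c C)" using F by (simp add: decomp_def tops_def cc(1))
  \<comment> \<open>the pieces of \<open>C\<close>, grouped by the piece of \<open>F\<close> in which their contractions lie\<close>
  then obtain xss where xss: "map (map ?c) xss = map fst F" "mset (concat xss) = mset C" using mset_map_split by blast
  \<comment> \<open>one entry for each three-level graph: the pieces of its upper two levels, and its lowest level\<close>
  define T where "T = zip xss (map snd F)"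
  have len: "length xss = length F" using xss(1) by (metis length_map)
  have T: "map fst T = xss" "map snd T = map snd F" using len by (simp_all add: T_def)
  have FT: "F = map (\<lambda>t. (map ?c (fst t), snd t)) T"
  proof (rule nth_equalityI)
    fix i assume i: "i < length F"
    have "map ?c (xss ! i) = fst (F ! i)" using arg_cong[OF xss(1), of "\<lambda>l. l ! i"] i len by simp
    thus "F ! i = map (\<lambda>t. (map ?c (fst t), snd t)) T ! i" using i len by (simp add: T_def)
  qed (use len in \<open>simp add: T_def\<close>)
  let ?g = "\<lambda>t. tops (fst t)" and ?h = "\<lambda>t. bots (fst t)"
  have gh: "concat (map ?g T) = tops (concat xss)" "concat (map ?h T) = bots (concat xss)"
    unfolding tops_concat T(1)[symmetric] by (simp_all add: comp_def)
  have mg: "mset (concat (map ?g T)) = mset us" "mset (concat (map ?h T)) = mset vs"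
    unfolding gh using mset_tops[OF xss(2)] mset_bots[OF xss(2)] C by (simp_all add: decomp_def)
  have mw: "mset (concat (map snd T)) = mset ws" unfolding T(2) using F by (simp add: decomp_def bots_def)
  let ?K = "\<lambda>t. components (?h t, snd t)"
  have piece: "veq P (?c (composite P (fst t), snd t)) (?c (?g t, composite P (?K t))) \<and> decomp (?K t) (?h t) (snd t) \<and>
      matching (?g t) (composite P (?K t)) \<and> conn2 (?g t) (composite P (?K t))" if t: "t \<in> set T" for t
  proof -
    have l: "lvl (concat (map ?g T))" "lvl (concat (map ?h T))" "lvl (concat (map snd T))"
      using lvl_mset[OF mg(1)] lvl_mset[OF mg(2)] lvl_mset[OF mw] m1(1) m2(1) by (simp_all add: matching_def)
    have lt: "lvl (?g t)" "lvl (?h t)" "lvl (snd t)"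
      using lvl_concat[OF l(1)] lvl_concat[OF l(2)] lvl_concat[OF l(3)] t by simp_all
    have s: "set (?g t) \<subseteq> set us" "set (?h t) \<subseteq> set vs" "set (snd t) \<subseteq> set ws"
      using mset_eq_setD[OF mg(1)] mset_eq_setD[OF mg(2)] mset_eq_setD[OF mw] t by auto
    hence d: "decorated P (?g t)" "decorated P (?h t)" "decorated P (snd t)"
      using m1(2,3) m2(3) by (auto simp: decorated_def)
    have "set (fst t) \<subseteq> set C" using mset_eq_setD[OF xss(2)] t unfolding T(1)[symmetric] by auto
    hence D: "decomp (fst t) (?g t) (?h t)" using C unfolding decomp_def by blast
    have mgh: "matching (?g t) (?h t)" using lt decomp_edges[OF D] by (simp add: matching_def)
    have "(map ?c (fst t), snd t) \<in> set F" using t unfolding FT by auto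
    note pF = decomp_piece(1,2)[OF F mF(1) this, unfolded fst_conv snd_conv]
    have mhw: "matching (?h t) (snd t)"
      using pF(1) lt contracts_all(2)[OF cc(2), of "fst t"] by (simp add: matching_def del: set_concat)
    have c3: "conn3 (?g t) (?h t) (snd t)" using conn3_contract[OF cc(2) mgh mhw D] pF(2) by simp
    have K: "decomp (?K t) (?h t) (snd t)" by (rule decomp_components[OF mhw])
    show ?thesis using properad_assoc_piece(1,4,5)[OF P mgh mhw c3 d D K] K by simp
  qed
  define G where "G = concat (map ?K T)"
  have G: "decomp G vs ws"
    unfolding G_def using decomp_concat[of T ?K ?h snd] piece by (intro decomp_cong[OF _ refl mg(2) mw]) blast
  have cG: "composite P G = concat (map (\<lambda>t. composite P (?K t)) T)" unfolding G_def composite_simps by (simp add: comp_def)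
  have vw: "composite P G \<in> Sgraphs P M n" by (rule V(2)[OF vs ws G])
  define H where "H = map (\<lambda>t. (?g t, composite P (?K t))) T"
  have H: "decomp H us (composite P G)"
    using piece mg(1) unfolding decomp_def H_def cG matching_def by (auto simp: tops_def bots_def comp_def simp del: set_concat)
  have "list_all2 (veq P) (composite P F) (composite P H)"
    unfolding cc(1) FT H_def list_all2_map1 list_all2_map2
    using piece by (intro list.rel_refl_strong) (simp add: cc(1))
  hence "Sclass P m n (composite P F) = Sclass P m n (composite P H)"
    using Sclass_leveq(1)[OF p(1) V(2)[OF uv ws F]] leveqI by blast
  thus ?thesis unfolding V(1)[OF us vs C] V(1)[OF uv ws F] V(1)[OF vs ws G] V(1)[OF us vw H] .
qed

lemma SPROP_vcomp_assoc:
  assumes P: "is_properad P" and x: "x \<in> carrier (Smod P m M)" and y: "y \<in> carrier (Smod P M N)" and z: "z \<in> carrier (Smod P N n)"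
  shows "vcomp (SPROP P) m N n (vcomp (SPROP P) m M N x y) z = vcomp (SPROP P) m M n x (vcomp (SPROP P) M N n y z)"
proof -
  note b = SPROP_vcomp(1)[OF P]
  show ?thesis
  proof (rule Smod_eqI2[OF Smod_module bilinear_comp[OF b bilinear_mapD(2)[OF b z]]
        bilinear_pre[OF b linear_map_id bilinear_mapD(2)[OF b z]] _ x y])
    fix us vs assume us: "us \<in> Sgraphs P m M" and vs: "vs \<in> Sgraphs P M N"
    show "vcomp (SPROP P) m N n (vcomp (SPROP P) m M N (Sclass P m M us) (Sclass P M N vs)) z =
        vcomp (SPROP P) m M n (Sclass P m M us) (vcomp (SPROP P) M N n (Sclass P M N vs) z)"
      by (rule Smod_eqI[OF Smod_module bilinear_mapD(1)[OF b bilinear_mapD(3)[OF b Sclass_in[OF us] Sclass_in[OF vs]]]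
            linear_map_comp[OF bilinear_mapD(1)[OF b Sclass_in[OF vs]] bilinear_mapD(1)[OF b Sclass_in[OF us]]]
            SPROP_vcomp_assoc_graphs[OF P us vs] z])
  qed
qed

lemma SPROP_vcomp_equivariant:
  assumes P: "is_properad P" and x: "x \<in> carrier (Smod P m N)" and y: "y \<in> carrier (Smod P N n)"
  shows "\<sigma> permutes {..<m} \<Longrightarrow> vcomp (SPROP P) m N n (lact (Sten P) m N \<sigma> x) y = lact (Sten P) m n \<sigma> (vcomp (SPROP P) m N n x y)"
    "\<tau> permutes {..<n} \<Longrightarrow> vcomp (SPROP P) m N n x (ract (Sten P) N n \<tau> y) = ract (Sten P) m n \<tau> (vcomp (SPROP P) m N n x y)"
    "\<rho> permutes {..<N} \<Longrightarrow> vcomp (SPROP P) m N n (ract (Sten P) m N \<rho> x) y = vcomp (SPROP P) m N n x (lact (Sten P) N n \<rho> y)"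
proof -
  note p = is_properadD(1,2)[OF P] and V = SPROP_vcomp(2,3)[OF P] and b = SPROP_vcomp(1)[OF P]
  note S = sbimoduleD[OF Sten_sbimodule[OF p(1)], unfolded md_Sten]
  note cl = Smap_compatible(2)[OF p(1,1) sbimod_map_id, unfolded vrelabel_id]
  have comps: "decomp (components (us, vs)) us vs" if "us \<in> Sgraphs P m N" "vs \<in> Sgraphs P N n" for us vs
    using decomp_components[OF Sgraphs_matching(1)[OF that]] .
  have rl: "vcomp (SPROP P) m N n (Sclass P m N (map (relabel f e) us)) (Sclass P N n (map (relabel e g) vs)) =
      Sclass P m n (map (relabel f g) (composite P D))"
    if us: "us \<in> Sgraphs P m N" and vs: "vs \<in> Sgraphs P N n" and D: "decomp D us vs"
      and f: "f permutes {..<m}" "e permutes {..<N}" "g permutes {..<n}" for us vs f e g D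
  proof -
    obtain D' where D': "decomp D' (map (relabel f e) us) (map (relabel e g) vs)" "composite P D' = map (relabel f g) (composite P D)"
      using composite_relabel[OF P Sgraphs_matching[OF us vs] D, of f e g]
        permutes_inj_on[OF f(1)] permutes_inj_on[OF f(2)] permutes_inj_on[OF f(3)] by blast
    show ?thesis using V(1)[OF cl[OF f(1,2) us] cl[OF f(2,3) vs] D'(1)] D'(2) by simp
  qed
  show "vcomp (SPROP P) m N n (lact (Sten P) m N \<sigma> x) y = lact (Sten P) m n \<sigma> (vcomp (SPROP P) m N n x y)" if s: "\<sigma> permutes {..<m}"
  proof (rule Smod_eqI2[OF Smod_module bilinear_pre[OF b S(3)[OF s] linear_map_id] bilinear_comp[OF b S(3)[OF s]] _ x y])
    fix us vs assume us: "us \<in> Sgraphs P m N" and vs: "vs \<in> Sgraphs P N n"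
    note D = comps[OF us vs]
    show "vcomp (SPROP P) m N n (lact (Sten P) m N \<sigma> (Sclass P m N us)) (Sclass P N n vs) =
        lact (Sten P) m n \<sigma> (vcomp (SPROP P) m N n (Sclass P m N us) (Sclass P N n vs))"
      using rl[OF us vs D s permutes_id permutes_id]
      unfolding Sten_gen(1)[OF p(1) us s] V(1)[OF us vs D] Sten_gen(1)[OF p(1) V(2)[OF us vs D] s] map_relabel_id .
  qed
  show "vcomp (SPROP P) m N n x (ract (Sten P) N n \<tau> y) = ract (Sten P) m n \<tau> (vcomp (SPROP P) m N n x y)" if s: "\<tau> permutes {..<n}"
  proof (rule Smod_eqI2[OF Smod_module bilinear_pre[OF b linear_map_id S(4)[OF s]] bilinear_comp[OF b S(4)[OF s]] _ x y])
    fix us vs assume us: "us \<in> Sgraphs P m N" and vs: "vs \<in> Sgraphs P N n"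
    note D = comps[OF us vs]
    show "vcomp (SPROP P) m N n (Sclass P m N us) (ract (Sten P) N n \<tau> (Sclass P N n vs)) =
        ract (Sten P) m n \<tau> (vcomp (SPROP P) m N n (Sclass P m N us) (Sclass P N n vs))"
      using rl[OF us vs D permutes_id permutes_id permutes_inv[OF s]]
      unfolding Sten_gen(2)[OF p(1) vs s] V(1)[OF us vs D] Sten_gen(2)[OF p(1) V(2)[OF us vs D] s] map_relabel_id .
  qed
  show "vcomp (SPROP P) m N n (ract (Sten P) m N \<rho> x) y = vcomp (SPROP P) m N n x (lact (Sten P) N n \<rho> y)" if s: "\<rho> permutes {..<N}"
  proof (rule Smod_eqI2[OF Smod_module bilinear_pre[OF b S(4)[OF s] linear_map_id] bilinear_pre[OF b linear_map_id S(3)[OF s]] _ x y])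
    fix us vs assume us: "us \<in> Sgraphs P m N" and vs: "vs \<in> Sgraphs P N n"
    let ?vs = "map (relabel \<rho> id) vs"
    have vs': "?vs \<in> Sgraphs P N n" by (rule cl[OF s permutes_id vs])
    note D = comps[OF us vs']
    have "map (relabel (inv_into UNIV \<rho>) id) ?vs = vs"
      unfolding map_relabel_comp using permutes_inverses(2)[OF s] by (simp add: comp_def id_def map_relabel_id[unfolded id_def])
    thus "vcomp (SPROP P) m N n (ract (Sten P) m N \<rho> (Sclass P m N us)) (Sclass P N n vs) =
        vcomp (SPROP P) m N n (Sclass P m N us) (lact (Sten P) N n \<rho> (Sclass P N n vs))"
      using rl[OF us vs' D permutes_id permutes_inv[OF s] permutes_id]
      unfolding Sten_gen(2)[OF p(1) us s] Sten_gen(1)[OF p(1) vs s] V(1)[OF us vs' D] map_relabel_id by (simp only:)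
  qed
qed

text \<open>
  Two decompositions placed side by side decompose the juxtaposition of the graphs.
\<close>

lemma SPROP_interchange:
  assumes P: "is_properad P" and x: "x \<in> carrier (Smod P m N)" and y: "y \<in> carrier (Smod P N n)"
    and x': "x' \<in> carrier (Smod P m' N')" and y': "y' \<in> carrier (Smod P N' n')"
  shows "vcomp (SPROP P) (m + m') (N + N') (n + n') (Sprod P m N m' N' x x') (Sprod P N n N' n' y y') =
    Sprod P m n m' n' (vcomp (SPROP P) m N n x y) (vcomp (SPROP P) m' N' n' x' y')"
proof -
  note p = is_properadD(1,2)[OF P] and V = SPROP_vcomp(2,3)[OF P] and b = SPROP_vcomp(1)[OF P]
  note h = Sprod_bilinear[OF p(1)]
  have gens: "vcomp (SPROP P) (m + m') (N + N') (n + n') (Sprod P m N m' N' (Sclass P m N us) (Sclass P m' N' us'))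
      (Sprod P N n N' n' (Sclass P N n vs) (Sclass P N' n' vs')) =
    Sprod P m n m' n' (vcomp (SPROP P) m N n (Sclass P m N us) (Sclass P N n vs)) (vcomp (SPROP P) m' N' n' (Sclass P m' N' us') (Sclass P N' n' vs'))"
    if us: "us \<in> Sgraphs P m N" and vs: "vs \<in> Sgraphs P N n" and us': "us' \<in> Sgraphs P m' N'" and vs': "vs' \<in> Sgraphs P N' n'" for us vs us' vs'
  proof -
    note M = Sgraphs_matching[OF us vs] and M' = Sgraphs_matching[OF us' vs']
    have D: "decomp (components (us, vs)) us vs" and D': "decomp (components (us', vs')) us' vs'"
      by (rule decomp_components[OF M(1)], rule decomp_components[OF M'(1)])
    obtain D2 where D2: "decomp D2 (map (relabel ((+) m) ((+) N)) us') (map (relabel ((+) N) ((+) n)) vs')"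
      "composite P D2 = map (relabel ((+) m) ((+) n)) (composite P (components (us', vs')))"
      using composite_relabel[OF P M' D', of "(+) m" "(+) N" "(+) n"] by auto
    show ?thesis
      unfolding h(2)[OF us us'] h(2)[OF vs vs'] V(1)[OF us vs D] V(1)[OF us' vs' D'] h(2)[OF V(2)[OF us vs D] V(2)[OF us' vs' D']]
        V(1)[OF Sprod_graph[OF us us'] Sprod_graph[OF vs vs'] decomp_append[OF D D2(1)]] composite_simps D2(2) ..
  qed
  show ?thesis
  proof (rule Smod_eqI2[OF Smod_module bilinear_pre[OF b bilinear_mapD(2)[OF h(1) x'] bilinear_mapD(2)[OF h(1) y']]
        bilinear_comp[OF b bilinear_mapD(2)[OF h(1) bilinear_mapD(3)[OF b x' y']]] _ x y])
    fix us vs assume us: "us \<in> Sgraphs P m N" and vs: "vs \<in> Sgraphs P N n"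
    show "vcomp (SPROP P) (m + m') (N + N') (n + n') (Sprod P m N m' N' (Sclass P m N us) x') (Sprod P N n N' n' (Sclass P N n vs) y') =
      Sprod P m n m' n' (vcomp (SPROP P) m N n (Sclass P m N us) (Sclass P N n vs)) (vcomp (SPROP P) m' N' n' x' y')"
      by (rule Smod_eqI2[OF Smod_module bilinear_pre[OF b bilinear_mapD(1)[OF h(1) Sclass_in[OF us]] bilinear_mapD(1)[OF h(1) Sclass_in[OF vs]]]
            bilinear_comp[OF b bilinear_mapD(1)[OF h(1) bilinear_mapD(3)[OF b Sclass_in[OF us] Sclass_in[OF vs]]]] gens[OF us vs] x' y'])
  qed
qed

text \<open>
  Over or under identities, every vertex forms a piece together with the strands attached to it.
\<close>

lemma SPROP_unit:
  assumes P: "is_properad P" and x: "x \<in> carrier (Smod P m n)" and mn: "0 < m" "0 < n"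
  shows "vcomp (SPROP P) m m n (unit (SPROP P) m m (Sone m)) x = x" "vcomp (SPROP P) m n n x (unit (SPROP P) n n (Sone n)) = x"
proof -
  note p = is_properadD[OF P] and V = SPROP_vcomp(2,3)[OF P] and b = SPROP_vcomp(1)[OF P]
  let ?c = "eta P (Suc 0) (Suc 0) 1"
  have u: "unit (SPROP P) k k (Sone k) = Sclass P k k (strands ?c [0..<k])" "strands ?c [0..<k] \<in> Sgraphs P k k" if "0 < k" for k
    using Sten_map_gen[OF Ibim_sbimodule p(1,3) idgraph_Sgraph[OF that]] by (simp_all add: Sone_def idgraph_strands vmap_strands)
  show "vcomp (SPROP P) m m n (unit (SPROP P) m m (Sone m)) x = x"
    unfolding u(1)[OF mn(1)]
  proof (rule Smod_eqI[OF Smod_module bilinear_mapD(1)[OF b Sclass_in[OF u(2)[OF mn(1)]]] linear_map_id _ x])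
    fix vs assume vs: "vs \<in> Sgraphs P m n"
    hence l: "lvl vs" "\<forall>v\<in>set vs. well_decorated P v" "set (all_outs vs) = {..<m}" by (simp_all add: Sgraphs_iff)
    have D: "decomp (map (\<lambda>v. (strands ?c (outs v), [v])) vs) (strands ?c [0..<m]) vs"
      using l(3) by (intro strands_decomp(1)[OF l(1)]) (simp_all add: lessThan_atLeast0 del: set_concat)
    have "composite P (map (\<lambda>v. (strands ?c (outs v), [v])) vs) = vs"
      using l properad_unit_piece(1)[OF P] lvl_single[OF l(1)] by (auto simp: composite_def intro!: map_idI)
    thus "vcomp (SPROP P) m m n (Sclass P m m (strands ?c [0..<m])) (Sclass P m n vs) = Sclass P m n vs"
      using V(1)[OF u(2)[OF mn(1)] vs D] by simp
  qed
  show "vcomp (SPROP P) m n n x (unit (SPROP P) n n (Sone n)) = x"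
    unfolding u(1)[OF mn(2)]
  proof (rule Smod_eqI[OF Smod_module bilinear_mapD(2)[OF b Sclass_in[OF u(2)[OF mn(2)]]] linear_map_id _ x])
    fix vs assume vs: "vs \<in> Sgraphs P m n"
    hence l: "lvl vs" "\<forall>v\<in>set vs. well_decorated P v" "set (all_ins vs) = {..<n}" by (simp_all add: Sgraphs_iff)
    have D: "decomp (map (\<lambda>v. ([v], strands ?c (ins v))) vs) vs (strands ?c [0..<n])"
      using l(3) by (intro strands_decomp(2)[OF l(1)]) (simp_all add: lessThan_atLeast0 del: set_concat)
    have "composite P (map (\<lambda>v. ([v], strands ?c (ins v))) vs) = vs"
      using l properad_unit_piece(2)[OF P] lvl_single[OF l(1)] by (auto simp: composite_def intro!: map_idI)
    thus "vcomp (SPROP P) m n n (Sclass P m n vs) (Sclass P n n (strands ?c [0..<n])) = Sclass P m n vs"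
      using V(1)[OF vs u(2)[OF mn(2)] D] by simp
  qed
qed

lemma SPROP_PROP:
  assumes P: "is_properad P" shows "is_PROP (SPROP P)"
proof -
  note p = is_properadD[OF P]
  note U = Sten_map_sbimod[OF Ibim_sbimodule p(1,3)]
  show ?thesis
    unfolding is_PROP_def sbimodule_SPROP SPROP_simps md_Sten
  proof (intro conjI allI ballI impI; (elim conjE)?)
    show "sbimodule (Sten P)" by (rule Sten_sbimodule[OF p(1)])
    show "sbimod_map (Sten Ibim) (SPROP P) (Sten_map Ibim P (eta P))" using U by (simp add: sbimod_map_def)
  qed (rule SPROP_vcomp(1)[OF P] SPROP_vcomp_equivariant[OF P] SPROP_vcomp_assoc[OF P] Sprod_bilinear(1)[OF p(1)]
      Sprod_equivariant[OF p(1)] Sprod_assoc[OF p(1)] Sprod_comm[OF p(1)] SPROP_interchange[OF P]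
      SPROP_unit[OF P, unfolded SPROP_simps] Sten_map_Sprod[OF Ibim_sbimodule p(1,3)]; assumption)+
qed


section \<open>Functoriality of the free PROP\<close>

lemma comp_mor_apply: "x \<in> elts P m n \<Longrightarrow> comp_mor P g f m n x = g m n (f m n x)"
  by (simp add: comp_mor_def compose_def)

lemma id_mor_apply: "x \<in> elts P m n \<Longrightarrow> id_mor P m n x = x"
  by (simp add: id_mor_def)

lemma sbimod_map_comp:
  assumes P: "sbimodule P" and f: "sbimod_map P Q f" and g: "sbimod_map Q R g"
  shows "sbimod_map P R (\<lambda>m n x. g m n (f m n x))"
  using linear_map_comp[OF sbimod_mapD(1)[OF f] sbimod_mapD(1)[OF g]] sbimod_mapD[OF f] sbimod_mapD[OF g]
  by (simp add: sbimod_map_def)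

lemma comp_mor_sbimod:
  assumes "sbimodule P" "sbimod_map P Q f" "sbimod_map Q R g" shows "sbimod_map P R (comp_mor P g f)"
  by (rule sbimod_map_cong[OF sbimod_map_comp[OF assms] _ assms(1)]) (simp add: comp_mor_apply)

lemma id_mor_sbimod: "sbimodule P \<Longrightarrow> sbimod_map P P (id_mor P)"
  by (rule sbimod_map_cong[OF sbimod_map_id]) (simp_all add: id_mor_apply)

lemma Sten_map_id:
  assumes P: "sbimodule P" shows "Sten_map P P (id_mor P) = id_mor (SPROP P)"
proof (intro ext)
  fix m n A show "Sten_map P P (id_mor P) m n A = id_mor (SPROP P) m n A"
  proof (cases "A \<in> carrier (Smod P m n)")
    case True
    have "Sten_map P P (id_mor P) m n A = A"
    proof (rule Smod_eqI[OF Smod_module _ linear_map_id _ True])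
      show "linear_map (Smod P m n) (Smod P m n) (Sten_map P P (id_mor P) m n)"
        using sbimod_mapD(1)[OF Sten_map_sbimod[OF P P id_mor_sbimod[OF P]]] by simp
      fix vs assume vs: "vs \<in> Sgraphs P m n"
      have "map (vmap (id_mor P)) vs = vs"
        using vs by (auto simp: Sgraphs_iff well_decorated_def id_mor_apply intro!: map_idI vertex_eqI)
      thus "Sten_map P P (id_mor P) m n (Sclass P m n vs) = Sclass P m n vs"
        using Sten_map_gen(1)[OF P P id_mor_sbimod[OF P] vs] by simp
    qed
    thus ?thesis using True by (simp add: id_mor_apply)
  qed (simp add: Sten_map_def id_mor_def)
qed

lemma Sten_map_comp:
  assumes P: "sbimodule P" "sbimodule P'" "sbimodule P''" and f: "sbimod_map P P' f" and g: "sbimod_map P' P'' g"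
    and eq: "\<And>m n x. x \<in> elts P m n \<Longrightarrow> k m n x = g m n (f m n x)" and A: "A \<in> carrier (Smod P m n)"
  shows "Sten_map P' P'' g m n (Sten_map P P' f m n A) = Sten_map P P'' k m n A"
proof -
  have k: "sbimod_map P P'' k" by (rule sbimod_map_cong[OF sbimod_map_comp[OF P(1) f g] _ P(1)]) (simp add: eq)
  note L = sbimod_mapD(1)[OF Sten_map_sbimod, unfolded md_Sten]
  show ?thesis
  proof (rule Smod_eqI[OF Smod_module linear_map_comp[OF L[OF P(1,2) f] L[OF P(2,3) g]] L[OF P(1,3) k] _ A])
    fix vs assume vs: "vs \<in> Sgraphs P m n"
    have "map (vmap g) (map (vmap f) vs) = map (vmap k) vs"
      using vs by (auto simp: Sgraphs_iff well_decorated_def eq intro!: vertex_eqI)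
    thus "Sten_map P' P'' g m n (Sten_map P P' f m n (Sclass P m n vs)) = Sten_map P P'' k m n (Sclass P m n vs)"
      unfolding Sten_map_gen(1)[OF P(1,2) f vs] Sten_map_gen(1)[OF P(2,3) g Sten_map_gen(2)[OF P(1,2) f vs]]
        Sten_map_gen(1)[OF P(1,3) k vs] by (simp only:)
  qed
qed

lemma Sten_map_comp_mor:
  assumes P: "sbimodule P" "sbimodule P'" "sbimodule P''" and f: "sbimod_map P P' f" and g: "sbimod_map P' P'' g"
  shows "Sten_map P P'' (comp_mor P g f) = comp_mor (SPROP P) (Sten_map P' P'' g) (Sten_map P P' f)"
proof (intro ext)
  fix m n A show "Sten_map P P'' (comp_mor P g f) m n A = comp_mor (SPROP P) (Sten_map P' P'' g) (Sten_map P P' f) m n A"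
  proof (cases "A \<in> carrier (Smod P m n)")
    case True
    thus ?thesis using Sten_map_comp[OF P f g _ True, of "comp_mor P g f"] by (simp add: comp_mor_apply)
  qed (simp add: Sten_map_def comp_mor_def compose_def)
qed

lemma Properad_HomD:
  assumes "f \<in> Properad_Hom P Q"
  shows "sbimod_map P Q f" "extensional_mor P f"
    "A \<in> elts (Box P P) m n \<Longrightarrow> f m n (mu P m n A) = mu Q m n (Box_map Q Q f f m n A)"
    "c \<in> elts Ibim m n \<Longrightarrow> f m n (eta P m n c) = eta Q m n c"
  using assms unfolding Properad_Hom_def by blast+

text \<open>
  This serves the functoriality of \<open>S\<^sub>\<otimes>\<close> and also, with the properad underlying a PROP as target, the
  extension of a morphism to the free PROP.
\<close>

lemma composite_hom:
  assumes P: "is_properad P" "is_properad P'" and f: "f \<in> Properad_Hom P P'"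
    and M: "matching us vs" "decorated P us" "decorated P vs" and D: "decomp D us vs"
  defines "D' \<equiv> map (map_prod (map (vmap f)) (map (vmap f))) D"
  shows "decomp D' (map (vmap f) us) (map (vmap f) vs)" "map (vmap f) (composite P D) = composite P' D'"
proof -
  note p = is_properadD[OF P(1)] and p' = is_properadD[OF P(2)] and F = Properad_HomD[OF f]
  show "decomp D' (map (vmap f) us) (map (vmap f) vs)"
    unfolding D'_def using decomp_relabel[OF D M(1), of id id f id f] by (simp add: vrelabel_id)
  have "vmap f (vmap (mu P) (pc P P d)) = vmap (mu P') (pc P' P' (map_prod (map (vmap f)) (map (vmap f)) d))" if d: "d \<in> set D" for d
  proof -
    note c = decomp_cgraph[OF D M d]
    have "Bcl P P (all_outs (fst d)) (all_ins (snd d)) d \<in> elts (Box P P) (length (all_outs (fst d))) (length (all_ins (snd d)))"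
      using Bcl_in[OF c cgraph_listing[OF c]] by simp
    hence "vmap f (vmap (mu P) (pc P P d)) = vmap (mu P') (vmap (Box_map P' P' f f) (pc P P d))"
      by (intro vertex_eqI) (simp_all add: pc_def F(3))
    thus ?thesis using pc_vmap[OF p(1) p'(1) p(1) p'(1) F(1) F(1) c] by (cases d) simp
  qed
  thus "map (vmap f) (composite P D) = composite P' D'" by (simp add: composite_def D'_def)
qed

lemma Sten_map_Hom:
  assumes P: "is_properad P" "is_properad P'" and f: "f \<in> Properad_Hom P P'"
  shows "Sten_map P P' f \<in> PROP_Hom (SPROP P) (SPROP P')"
proof -
  note p = is_properadD[OF P(1)] and p' = is_properadD[OF P(2)] and F = Properad_HomD[OF f]
  let ?S = "Sten_map P P' f"
  note L = sbimod_mapD(1)[OF Sten_map_sbimod[OF p(1) p'(1) F(1)], unfolded md_Sten]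
  note g = Sten_map_gen[OF p(1) p'(1) F(1)]
  note V = SPROP_vcomp[OF P(1)] and V' = SPROP_vcomp[OF P(2)]
  have "?S m n (vcomp (SPROP P) m N n x y) = vcomp (SPROP P') m N n (?S m N x) (?S N n y)"
    if x: "x \<in> carrier (Smod P m N)" and y: "y \<in> carrier (Smod P N n)" for m N n x y
  proof (rule Smod_eqI2[OF Smod_module bilinear_comp[OF V(1) L] bilinear_pre[OF V'(1) L L] _ x y])
    fix us vs assume us: "us \<in> Sgraphs P m N" and vs: "vs \<in> Sgraphs P N n"
    note M = Sgraphs_matching[OF us vs]
    let ?D = "components (us, vs)"
    have D: "decomp ?D us vs" by (rule decomp_components[OF M(1)])
    note c = composite_hom[OF P f M D]
    show "?S m n (vcomp (SPROP P) m N n (Sclass P m N us) (Sclass P N n vs)) =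
        vcomp (SPROP P') m N n (?S m N (Sclass P m N us)) (?S N n (Sclass P N n vs))"
      unfolding V(2)[OF us vs D] g(1)[OF us] g(1)[OF vs] V'(2)[OF g(2)[OF us] g(2)[OF vs] c(1)] g(1)[OF V(3)[OF us vs D]] c(2) ..
  qed
  moreover have "?S m n (Sten_map Ibim P (eta P) m n A) = Sten_map Ibim P' (eta P') m n A" if "A \<in> carrier (Smod Ibim m n)" for m n A
    using Sten_map_comp[OF Ibim_sbimodule p(1) p'(1) p(3) F(1) _ that] F(4) by metis
  moreover have "sbimod_map (SPROP P) (SPROP P') ?S"
    using Sten_map_sbimod[OF p(1) p'(1) F(1)] by (simp add: sbimod_map_def)
  moreover have "extensional_mor (SPROP P) ?S" by (simp add: extensional_mor_def Sten_map_def)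
  ultimately show ?thesis unfolding PROP_Hom_def using Sten_map_Sprod[OF p(1) p'(1) F(1)] by simp
qed

section \<open>Evaluation of one-level graphs in a PROP\<close>

lemma is_PROPD:
  assumes "is_PROP Q"
  shows "sbimodule Q" "bilinear_map (md Q m N) (md Q N n) (md Q m n) (vcomp Q m N n)"
    "x \<in> elts Q m N \<Longrightarrow> y \<in> elts Q N n \<Longrightarrow> \<sigma> permutes {..<m} \<Longrightarrow> vcomp Q m N n (lact Q m N \<sigma> x) y = lact Q m n \<sigma> (vcomp Q m N n x y)"
    "x \<in> elts Q m N \<Longrightarrow> y \<in> elts Q N n \<Longrightarrow> \<tau> permutes {..<n} \<Longrightarrow> vcomp Q m N n x (ract Q N n \<tau> y) = ract Q m n \<tau> (vcomp Q m N n x y)"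
    "x \<in> elts Q m N \<Longrightarrow> y \<in> elts Q N n \<Longrightarrow> \<rho> permutes {..<N} \<Longrightarrow> vcomp Q m N n (ract Q m N \<rho> x) y = vcomp Q m N n x (lact Q N n \<rho> y)"
    "x \<in> elts Q m M \<Longrightarrow> y \<in> elts Q M N \<Longrightarrow> z \<in> elts Q N n \<Longrightarrow> vcomp Q m N n (vcomp Q m M N x y) z = vcomp Q m M n x (vcomp Q M N n y z)"
    "bilinear_map (md Q m n) (md Q m' n') (md Q (m + m') (n + n')) (hcomp Q m n m' n')"
    "x \<in> elts Q m n \<Longrightarrow> x' \<in> elts Q m' n' \<Longrightarrow> \<sigma> permutes {..<m} \<Longrightarrow> \<sigma>' permutes {..<m'} \<Longrightarrow>
      hcomp Q m n m' n' (lact Q m n \<sigma> x) (lact Q m' n' \<sigma>' x') = lact Q (m + m') (n + n') (block_sum m \<sigma> \<sigma>') (hcomp Q m n m' n' x x')"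
    "x \<in> elts Q m n \<Longrightarrow> x' \<in> elts Q m' n' \<Longrightarrow> \<tau> permutes {..<n} \<Longrightarrow> \<tau>' permutes {..<n'} \<Longrightarrow>
      hcomp Q m n m' n' (ract Q m n \<tau> x) (ract Q m' n' \<tau>' x') = ract Q (m + m') (n + n') (block_sum n \<tau> \<tau>') (hcomp Q m n m' n' x x')"
    "x \<in> elts Q m n \<Longrightarrow> x' \<in> elts Q m' n' \<Longrightarrow> x'' \<in> elts Q m'' n'' \<Longrightarrow>
      hcomp Q (m + m') (n + n') m'' n'' (hcomp Q m n m' n' x x') x'' = hcomp Q m n (m' + m'') (n' + n'') x (hcomp Q m' n' m'' n'' x' x'')"
    "x \<in> elts Q m n \<Longrightarrow> x' \<in> elts Q m' n' \<Longrightarrow> hcomp Q m' n' m n x' x =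
      lact Q (m + m') (n + n') (block_swap m m') (ract Q (m + m') (n + n') (block_swap n' n) (hcomp Q m n m' n' x x'))"
    "x \<in> elts Q m N \<Longrightarrow> y \<in> elts Q N n \<Longrightarrow> x' \<in> elts Q m' N' \<Longrightarrow> y' \<in> elts Q N' n' \<Longrightarrow>
      vcomp Q (m + m') (N + N') (n + n') (hcomp Q m N m' N' x x') (hcomp Q N n N' n' y y') =
      hcomp Q m n m' n' (vcomp Q m N n x y) (vcomp Q m' N' n' x' y')"
    "sbimod_map (Sten Ibim) Q (unit Q)"
    "x \<in> elts Q m n \<Longrightarrow> 0 < m \<Longrightarrow> 0 < n \<Longrightarrow> vcomp Q m m n (unit Q m m (Sone m)) x = x"
    "x \<in> elts Q m n \<Longrightarrow> 0 < m \<Longrightarrow> 0 < n \<Longrightarrow> vcomp Q m n n x (unit Q n n (Sone n)) = x"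
    "A \<in> elts (Sten Ibim) m n \<Longrightarrow> B \<in> elts (Sten Ibim) m' n' \<Longrightarrow>
      unit Q (m + m') (n + n') (Sprod Ibim m n m' n' A B) = hcomp Q m n m' n' (unit Q m n A) (unit Q m' n' B)"
  using assms[unfolded is_PROP_def] by meson+

lemma hcomp_list_Cons: "vs \<noteq> [] \<Longrightarrow> hcomp_list Q (v # vs) =
    hcomp Q (length (outs v)) (length (ins v)) (length (all_outs vs)) (length (all_ins vs)) (deco v) (hcomp_list Q vs)"
  by (cases vs) simp_all

lemma decorated_simps [simp]: "decorated P (v # vs) \<longleftrightarrow> well_decorated P v \<and> decorated P vs" "decorated P []"
    "decorated P (us @ vs) \<longleftrightarrow> decorated P us \<and> decorated P vs"
  by (auto simp: decorated_def)

lemma hcomp_list_relabel: "vs \<noteq> [] \<Longrightarrow> hcomp_list Q (map (relabel f g) vs) = hcomp_list Q vs"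
proof (induction vs)
  case (Cons v vs) thus ?case
    by (cases "vs = []") (simp_all only: list.map hcomp_list_Cons list.map_disc_iff all_simps length_map vertex_simps hcomp_list.simps not_False_eq_True)
qed simp

text \<open>
  The value of a level whose outputs and inputs are listed by \<open>os\<close> and \<open>is\<close>.  The
  fixed numbering of \<open>eval_level\<close> is the case of increasing listings (\<open>eval_level_ev\<close>); free listings let a
  level be cut into parts without renumbering their edges.
\<close>

definition ev :: "('k::field, 'a) PROP_data \<Rightarrow> nat list \<Rightarrow> nat list \<Rightarrow> 'a vertex list \<Rightarrow> 'a" where
  "ev Q os is vs = recoord Q os is (all_outs vs) (all_ins vs) (hcomp_list Q vs)"

context
  fixes Q :: "('k::field, 'a) PROP_data"
  assumes Q: "is_PROP Q"
begin

lemma hcomp_in: "x \<in> elts Q m n \<Longrightarrow> y \<in> elts Q m' n' \<Longrightarrow> hcomp Q m n m' n' x y \<in> elts Q (m + m') (n + n')"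
  by (rule bilinear_mapD(3)[OF is_PROPD(7)[OF Q]])

lemma vcomp_in: "x \<in> elts Q m N \<Longrightarrow> y \<in> elts Q N n \<Longrightarrow> vcomp Q m N n x y \<in> elts Q m n"
  by (rule bilinear_mapD(3)[OF is_PROPD(2)[OF Q]])

lemma hcomp_list_in:
  "vs \<noteq> [] \<Longrightarrow> decorated Q vs \<Longrightarrow> hcomp_list Q vs \<in> elts Q (length (all_outs vs)) (length (all_ins vs))"
proof (induction vs)
  case (Cons v vs) thus ?case
    by (cases "vs = []") (simp_all add: hcomp_list_Cons well_decorated_def hcomp_in del: length_concat)
qed simp

lemma hcomp_list_append:
  assumes "us \<noteq> []" "vs \<noteq> []" "decorated Q us" "decorated Q vs"
  shows "hcomp_list Q (us @ vs) = hcomp Q (length (all_outs us)) (length (all_ins us)) (length (all_outs vs)) (length (all_ins vs))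
    (hcomp_list Q us) (hcomp_list Q vs)"
  using assms
proof (induction us)
  case (Cons u us)
  show ?case
  proof (cases "us = []")
    case True thus ?thesis using Cons by (simp add: hcomp_list_Cons)
  next
    case False
    have u: "deco u \<in> elts Q (length (outs u)) (length (ins u))" using Cons by (simp add: well_decorated_def)
    show ?thesis
      using False Cons is_PROPD(10)[OF Q u hcomp_list_in[of us] hcomp_list_in[of vs]]
      by (simp add: hcomp_list_Cons del: length_concat)
  qed
qed simp

lemma recoord_hcomp:
  assumes r: "reord os as" "reord is bs" "reord os' as'" "reord is' bs'" "set os \<inter> set os' = {}" "set is \<inter> set is' = {}"
    and x: "x \<in> elts Q (length as) (length bs)" and y: "y \<in> elts Q (length as') (length bs')"
  shows "hcomp Q (length os) (length is) (length os') (length is') (recoord Q os is as bs x) (recoord Q os' is' as' bs' y) =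
    recoord Q (os @ os') (is @ is') (as @ as') (bs @ bs') (hcomp Q (length as) (length bs) (length as') (length bs') x y)"
proof -
  note l = reord_length[OF r(1)] reord_length[OF r(2)] reord_length[OF r(3)] reord_length[OF r(4)]
  have p: "tr os as permutes {..<length os}" "tr os' as' permutes {..<length os'}"
    "tr bs is permutes {..<length is}" "tr bs' is' permutes {..<length is'}"
    using tr_permutes[OF r(1)] tr_permutes[OF r(3)] tr_permutes'[OF reord_sym[OF r(2)]] tr_permutes'[OF reord_sym[OF r(4)]] by auto
  have x': "x \<in> elts Q (length os) (length is)" and y': "y \<in> elts Q (length os') (length is')" using x y l by simp_all
  have db: "set bs \<inter> set bs' = {}" using r by (simp add: reord_def)
  note c = act_closed(2)[OF is_PROPD(1)[OF Q]]
  have "hcomp Q (length os) (length is) (length os') (length is') (recoord Q os is as bs x) (recoord Q os' is' as' bs' y) =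
      lact Q (length os + length os') (length is + length is') (block_sum (length os) (tr os as) (tr os' as'))
        (ract Q (length os + length os') (length is + length is') (block_sum (length is) (tr bs is) (tr bs' is'))
          (hcomp Q (length os) (length is) (length os') (length is') x y))"
    unfolding recoord_def using is_PROPD(8)[OF Q c[OF x' p(3)] c[OF y' p(4)] p(1,2)] is_PROPD(9)[OF Q x' y' p(3,4)] by simp
  also have "block_sum (length is) (tr bs is) (tr bs' is') = tr (bs @ bs') (is @ is')"
    using tr_append[OF reord_sym[OF r(2)] reord_sym[OF r(4)] db] l by simp
  finally show ?thesis unfolding recoord_def using tr_append[OF r(1,3,5)] l by simp
qed

lemma ev_in:
  assumes "vs \<noteq> []" "decorated Q vs" "reord os (all_outs vs)" "reord is (all_ins vs)"
  shows "ev Q os is vs \<in> elts Q (length os) (length is)"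
  unfolding ev_def by (rule recoord_closed[OF is_PROPD(1)[OF Q] assms(3,4) hcomp_list_in[OF assms(1,2)]])

lemma ev_recoord:
  assumes "vs \<noteq> []" "decorated Q vs" "reord os as" "reord is bs" "reord as (all_outs vs)" "reord bs (all_ins vs)"
  shows "recoord Q os is as bs (ev Q as bs vs) = ev Q os is vs"
  unfolding ev_def by (rule recoord_comp[OF is_PROPD(1)[OF Q] assms(3-6) hcomp_list_in[OF assms(1,2)]])

lemma ev_single: "well_decorated Q v \<Longrightarrow> distinct (outs v) \<Longrightarrow> distinct (ins v) \<Longrightarrow> ev Q (outs v) (ins v) [v] = deco v"
  by (simp add: ev_def recoord_self[OF is_PROPD(1)[OF Q]] well_decorated_def)

lemma ev_append:
  assumes "us \<noteq> []" "vs \<noteq> []" "decorated Q us" "decorated Q vs" and r: "reord os (all_outs us)" "reord is (all_ins us)"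
    "reord os' (all_outs vs)" "reord is' (all_ins vs)" "set os \<inter> set os' = {}" "set is \<inter> set is' = {}"
  shows "ev Q (os @ os') (is @ is') (us @ vs) = hcomp Q (length os) (length is) (length os') (length is') (ev Q os is us) (ev Q os' is' vs)"
  unfolding ev_def recoord_hcomp[OF r hcomp_list_in[OF assms(1,3)] hcomp_list_in[OF assms(2,4)]]
    hcomp_list_append[OF assms(1-4)] by simp

lemma ev_swap:
  assumes ne: "us \<noteq> []" "vs \<noteq> []" "decorated Q us" "decorated Q vs" and l: "lvl (us @ vs)"
    and r: "reord os (all_outs (us @ vs))" "reord is (all_ins (us @ vs))"
  shows "ev Q os is (us @ vs) = ev Q os is (vs @ us)"
proof -
  let ?o = "all_outs us" and ?i = "all_ins us" and ?o' = "all_outs vs" and ?i' = "all_ins vs"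
  have d: "distinct (?o @ ?o')" "distinct (?i' @ ?i)" using l by (auto simp: lvl_def simp del: set_concat)
  note H = hcomp_list_in[OF ne(1,3)] hcomp_list_in[OF ne(2,4)]
  have "hcomp_list Q (vs @ us) = lact Q (length ?o + length ?o') (length ?i + length ?i') (block_swap (length ?o) (length ?o'))
      (ract Q (length ?o + length ?o') (length ?i + length ?i') (block_swap (length ?i') (length ?i)) (hcomp_list Q (us @ vs)))"
    unfolding hcomp_list_append[OF ne(2,1,4,3)] hcomp_list_append[OF ne] by (rule is_PROPD(11)[OF Q H])
  also have "\<dots> = recoord Q (?o' @ ?o) (?i' @ ?i) (?o @ ?o') (?i @ ?i') (hcomp_list Q (us @ vs))"
    unfolding recoord_def tr_swap[OF d(1)] tr_swap[OF d(2)] by (simp add: add.commute del: length_concat)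
  finally have eq: "hcomp_list Q (vs @ us) = recoord Q (?o' @ ?o) (?i' @ ?i) (?o @ ?o') (?i @ ?i') (hcomp_list Q (us @ vs))" .
  have "reord os (?o' @ ?o)" "reord is (?i' @ ?i)" "reord (?o' @ ?o) (?o @ ?o')" "reord (?i' @ ?i) (?i @ ?i')"
    using r d by (auto simp: reord_def simp del: set_concat)
  thus ?thesis
    using recoord_comp[OF is_PROPD(1)[OF Q], of os "?o' @ ?o" "is" "?i' @ ?i" "?o @ ?o'" "?i @ ?i'" "hcomp_list Q (us @ vs)"]
      hcomp_list_in[of "us @ vs"] ne by (simp add: ev_def eq del: length_concat)
qed

lemma ev_linear:
  assumes "lvl (v # vs)" "decorated Q (v # vs)" and r: "reord os (all_outs (v # vs))" "reord is (all_ins (v # vs))"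
  shows "linear_map (md Q (length (outs v)) (length (ins v))) (md Q (length os) (length is)) (\<lambda>p. ev Q os is (Vertex (outs v) (ins v) p # vs))"
proof (cases "vs = []")
  case True
  thus ?thesis using recoord_linear[OF is_PROPD(1)[OF Q], of os "outs v" "is" "ins v"] r by (simp add: ev_def)
next
  case False
  have "linear_map (md Q (length (outs v)) (length (ins v))) (md Q (length (outs v) + length (all_outs vs)) (length (ins v) + length (all_ins vs)))
      (\<lambda>p. hcomp Q (length (outs v)) (length (ins v)) (length (all_outs vs)) (length (all_ins vs)) p (hcomp_list Q vs))"
    using bilinear_mapD(2)[OF is_PROPD(7)[OF Q] hcomp_list_in[OF False]] assms(2) by simp
  from linear_map_comp[OF this] recoord_linear[OF is_PROPD(1)[OF Q] r] show ?thesis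
    by (simp add: ev_def hcomp_list_Cons[OF False] del: length_concat)
qed

lemma ev_relabel:
  assumes "vs \<noteq> []" "reord os (all_outs vs)" "reord is (all_ins vs)" "inj_on f (set os)" "inj_on g (set is)"
  shows "ev Q (map f os) (map g is) (map (relabel f g) vs) = ev Q os is vs"
proof -
  have "inj_on g (set (all_ins vs))" using assms(3,5) by (simp add: reord_def del: set_concat)
  thus ?thesis
    unfolding ev_def recoord_def all_simps hcomp_list_relabel[OF assms(1)] tr_map[OF assms(4,2)]
    using tr_map[OF _ reord_sym[OF assms(3)], of g] by simp
qed

text \<open>
  Equality of values is required under all listings; then it is a congruence for
  juxtaposition, and can be checked for single vertices and for exchanging two blocks.
\<close>

definition evq :: "'a vertex list \<Rightarrow> 'a vertex list \<Rightarrow> bool" where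
  "evq us vs \<longleftrightarrow> lvl us \<and> lvl vs \<and> decorated Q us \<and> decorated Q vs \<and> (us = [] \<longleftrightarrow> vs = []) \<and>
     set (all_outs us) = set (all_outs vs) \<and> set (all_ins us) = set (all_ins vs) \<and>
     (\<forall>os is. reord os (all_outs us) \<and> reord is (all_ins us) \<longrightarrow> ev Q os is us = ev Q os is vs)"

lemma evq_refl: "lvl us \<Longrightarrow> decorated Q us \<Longrightarrow> evq us us"
  by (simp add: evq_def)

lemma evq_reord: "evq us vs \<Longrightarrow> reord os (all_outs us) = reord os (all_outs vs) \<and> reord is (all_ins us) = reord is (all_ins vs)"
  by (simp add: evq_def reord_def lvl_def del: set_concat)

lemma evq_trans: assumes "evq us vs" "evq vs ws" shows "evq us ws"
  using assms evq_reord[OF assms(1)] unfolding evq_def by simp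

lemma evq_append:
  assumes u: "evq us us'" and v: "evq vs vs'" and l: "lvl (us @ vs)" shows "evq (us @ vs) (us' @ vs')"
proof (cases "us = [] \<or> vs = []")
  case True thus ?thesis using u v by (auto simp: evq_def)
next
  case False
  note U = u[unfolded evq_def] and V = v[unfolded evq_def]
  have l': "lvl (us' @ vs')" using U V l unfolding lvl_append by simp
  let ?o = "all_outs us" and ?i = "all_ins us" and ?o' = "all_outs vs" and ?i' = "all_ins vs"
  have d: "distinct ?o" "distinct ?i" "distinct ?o'" "distinct ?i'" "set ?o \<inter> set ?o' = {}" "set ?i \<inter> set ?i' = {}"
    using l unfolding lvl_append by (auto simp: lvl_def)
  have rr: "reord ?o (all_outs us')" "reord ?i (all_ins us')" "reord ?o' (all_outs vs')" "reord ?i' (all_ins vs')"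
    using evq_reord[OF u] evq_reord[OF v] reord_refl d by blast+
  have eq: "ev Q (?o @ ?o') (?i @ ?i') (us @ vs) = ev Q (?o @ ?o') (?i @ ?i') (us' @ vs')"
    using False U V ev_append[of us vs ?o ?i ?o' ?i'] ev_append[of us' vs' ?o ?i ?o' ?i'] d rr reord_refl by simp
  have "ev Q os is (us @ vs) = ev Q os is (us' @ vs')" if r: "reord os (all_outs (us @ vs))" "reord is (all_ins (us @ vs))" for os "is"
  proof -
    have "ev Q os is (us @ vs) = recoord Q os is (?o @ ?o') (?i @ ?i') (ev Q (?o @ ?o') (?i @ ?i') (us @ vs))"
      using ev_recoord[of "us @ vs" os "?o @ ?o'" "is" "?i @ ?i'"] r False U V reord_refl[of "?o @ ?o'"] reord_refl[of "?i @ ?i'"] d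
      by (simp add: del: set_concat)
    also have "\<dots> = ev Q os is (us' @ vs')"
      unfolding eq using ev_recoord[of "us' @ vs'" os "?o @ ?o'" "is" "?i @ ?i'"] r False U V
        reord_append[OF rr(1,3) d(5)] reord_append[OF rr(2,4) d(6)] by simp
    finally show ?thesis .
  qed
  thus ?thesis unfolding evq_def using l l' U V by (simp del: set_concat)
qed

lemma evq_Cons: "evq us us' \<Longrightarrow> lvl (v # us) \<Longrightarrow> well_decorated Q v \<Longrightarrow> evq (v # us) (v # us')"
  using evq_append[of "[v]" "[v]" us us'] evq_refl[of "[v]"] by (simp add: lvl_Cons)

text \<open>
  The first vertex of one level is moved to its place in the other by exchanging it with the block of
  vertices before it, which is the commutativity of the horizontal composition.
\<close>

lemma evq_mset:
  assumes "lvl us" "decorated Q us" "mset us = mset vs" shows "evq us vs"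
  using assms
proof (induction us arbitrary: vs)
  case (Cons u us)
  have "u \<in> set vs" using Cons(4) by (metis list.set_intros(1) mset_eq_setD)
  then obtain vs1 vs2 where vs: "vs = vs1 @ u # vs2" by (meson split_list)
  have m: "mset us = mset (vs1 @ vs2)" using Cons(4) vs by simp
  have e: "evq us (vs1 @ vs2)" using Cons m by (simp add: lvl_Cons)
  have 1: "evq (u # us) (u # vs1 @ vs2)" using evq_Cons[OF e Cons(2)] Cons(3) by simp
  hence l: "lvl (u # vs1 @ vs2)" "decorated Q (u # vs1 @ vs2)" by (simp_all add: evq_def)
  have l1: "lvl ([u] @ vs1)" "lvl vs2" "lvl (([u] @ vs1) @ vs2)" using l(1) lvl_append[of "u # vs1" vs2] by simp_all
  have "evq ([u] @ vs1) (vs1 @ [u])"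
  proof (cases "vs1 = []")
    case False
    have "lvl (vs1 @ [u])" using lvl_mset[of "[u] @ vs1" "vs1 @ [u]"] l1(1) by simp
    thus ?thesis using ev_swap[of "[u]" vs1] False l l1(1) unfolding evq_def by (auto simp del: set_concat)
  qed (use evq_refl[of "[u]"] l l1 in simp)
  from evq_append[OF this evq_refl[OF l1(2)] l1(3)] have "evq (([u] @ vs1) @ vs2) ((vs1 @ [u]) @ vs2)" using l(2) by simp
  thus ?case using evq_trans[OF 1] vs by simp
qed (simp add: evq_refl)

lemma evq_veq:
  assumes v: "veq Q v v'" and l: "lvl (v # vs)" "decorated Q vs" shows "evq (v # vs) (v' # vs)"
proof -
  note S = is_PROPD(1)[OF Q]
  have w: "well_decorated Q v" "well_decorated Q v'" using veq_well_decorated[OF S v] by auto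
  have r: "reord (outs v) (outs v')" "reord (ins v) (ins v')" "deco v = recoord Q (outs v) (ins v) (outs v') (ins v') (deco v')"
    using v by (auto simp: veq_def)
  have "lvl [v]" "lvl [v']" using l r(1,2) by (auto simp: lvl_Cons reord_def)
  moreover have "ev Q os is [v] = ev Q os is [v']" if "reord os (outs v)" "reord is (ins v)" for os "is"
    using recoord_comp[OF S that r(1,2)] w(2) r(3) by (simp add: ev_def well_decorated_def)
  ultimately have "evq [v] [v']" using w r(1,2) by (simp add: evq_def reord_def)
  thus ?thesis using evq_append[of "[v]" "[v']" vs vs] evq_refl[of vs] l by (simp add: lvl_Cons)
qed

end

lemma eval_level_ev:
  assumes "lvl vs" "set (all_outs vs) = {..<m}" "set (all_ins vs) = {..<n}"
  shows "eval_level Q m n vs = ev Q [0..<m] [0..<n] vs"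
proof -
  have r: "reord [0..<m] (all_outs vs)" "reord [0..<n] (all_ins vs)"
    using assms by (simp_all add: reord_def lvl_def lessThan_atLeast0 del: set_concat)
  have t: "tr [0..<m] (all_outs vs) = list_perm (all_outs vs)" "tr [0..<n] (all_ins vs) = list_perm (all_ins vs)"
    unfolding tr_def using assms(2,3)
    by (intro arg_cong[of _ _ list_perm] map_idI; use position_upt in blast)+
  show ?thesis unfolding eval_level_def ev_def recoord_def t(1)[symmetric] t(2)[symmetric] inv_tr[OF r(2)] by simp
qed

lemma ev_hom:
  assumes Q: "is_PROP Q" "is_PROP Q'" and h: "sbimod_map Q Q' h"
    and hh: "\<And>m n m' n' x y. x \<in> elts Q m n \<Longrightarrow> y \<in> elts Q m' n' \<Longrightarrow>
      h (m + m') (n + n') (hcomp Q m n m' n' x y) = hcomp Q' m n m' n' (h m n x) (h m' n' y)"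
    and vs: "vs \<noteq> []" "decorated Q vs" "reord os (all_outs vs)" "reord is (all_ins vs)"
  shows "h (length os) (length is) (ev Q os is vs) = ev Q' os is (map (vmap h) vs)"
proof -
  have "h (length (all_outs vs)) (length (all_ins vs)) (hcomp_list Q vs) = hcomp_list Q' (map (vmap h) vs)"
    using vs(1,2)
  proof (induction vs)
    case (Cons v vs)
    show ?case
    proof (cases "vs = []")
      case False
      have "hcomp_list Q' (map (vmap h) (v # vs)) = hcomp Q' (length (outs v)) (length (ins v)) (length (all_outs vs)) (length (all_ins vs))
          (h (length (outs v)) (length (ins v)) (deco v)) (h (length (all_outs vs)) (length (all_ins vs)) (hcomp_list Q vs))"
        using False Cons hcomp_list_Cons[of "map (vmap h) vs" Q' "vmap h v"] by (simp del: length_concat)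
      thus ?thesis
        using hh[of "deco v" _ _ "hcomp_list Q vs", OF _ hcomp_list_in[OF Q(1) False]] Cons(3)
        by (simp add: hcomp_list_Cons[OF False] well_decorated_def del: length_concat)
    qed simp
  qed simp
  thus ?thesis unfolding ev_def using recoord_map[OF is_PROPD(1)[OF Q(1)] h vs(3,4) hcomp_list_in[OF Q(1) vs(1,2)]] by simp
qed


section \<open>Vertical composition and evaluation\<close>

context
  fixes Q :: "('k::field, 'a) PROP_data"
  assumes Q: "is_PROP Q"
begin

lemma recoord_vcomp:
  assumes r: "reord os as" "reord es fs" "reord is bs" and x: "x \<in> elts Q (length as) (length fs)" and y: "y \<in> elts Q (length fs) (length bs)"
  shows "vcomp Q (length os) (length es) (length is) (recoord Q os es as fs x) (recoord Q es is fs bs y) =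
    recoord Q os is as bs (vcomp Q (length as) (length fs) (length bs) x y)"
proof -
  note l = reord_length[OF r(1)] reord_length[OF r(2)] reord_length[OF r(3)] and S = sbimoduleD[OF is_PROPD(1)[OF Q]]
  let ?m = "length os" and ?N = "length es" and ?n = "length is"
  have p: "tr os as permutes {..<?m}" "tr fs es permutes {..<?N}" "tr es fs permutes {..<?N}" "tr bs is permutes {..<?n}"
    using tr_permutes[OF r(1)] tr_permutes'[OF reord_sym[OF r(2)]] tr_permutes[OF r(2)] tr_permutes'[OF reord_sym[OF r(3)]] by auto
  have x': "x \<in> elts Q ?m ?N" and y': "y \<in> elts Q ?N ?n" using x y l by simp_all
  note c = act_closed[OF is_PROPD(1)[OF Q]]
  have "lact Q ?N ?n (tr fs es) (lact Q ?N ?n (tr es fs) y) = lact Q ?N ?n (tr fs es \<circ> tr es fs) y"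
    using S(7)[OF y' p(2,3)] by simp
  also have "\<dots> = y"
    using tr_comp[OF reord_sym[OF r(2)] r(2)] tr_self[of fs] r(2) S(5)[OF y'] by (simp add: reord_def)
  finally have inv: "lact Q ?N ?n (tr fs es) (lact Q ?N ?n (tr es fs) y) = y" .
  have "vcomp Q ?m ?N ?n (recoord Q os es as fs x) (recoord Q es is fs bs y) =
      lact Q ?m ?n (tr os as) (vcomp Q ?m ?N ?n (ract Q ?m ?N (tr fs es) x) (ract Q ?N ?n (tr bs is) (lact Q ?N ?n (tr es fs) y)))"
    unfolding recoord_def S(9)[OF y' p(3,4)]
    by (rule is_PROPD(3)[OF Q c(2)[OF x' p(2)] c(2)[OF c(1)[OF y' p(3)] p(4)] p(1)])
  also have "\<dots> = lact Q ?m ?n (tr os as) (ract Q ?m ?n (tr bs is) (vcomp Q ?m ?N ?n x (lact Q ?N ?n (tr fs es) (lact Q ?N ?n (tr es fs) y))))"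
    using is_PROPD(4)[OF Q c(2)[OF x' p(2)] c(1)[OF y' p(3)] p(4)] is_PROPD(5)[OF Q x' c(1)[OF y' p(3)] p(2)] by simp
  finally show ?thesis unfolding inv by (simp add: recoord_def l)
qed

text \<open>
  By balancedness the listing \<open>es\<close> of the internal edges is immaterial (\<open>vev_middle\<close>).
\<close>

definition vev :: "nat list \<Rightarrow> nat list \<Rightarrow> nat list \<Rightarrow> ('a, 'a) graph2 \<Rightarrow> 'a" where
  "vev os es is d = vcomp Q (length os) (length es) (length is) (ev Q os es (fst d)) (ev Q es is (snd d))"

definition good :: "('a, 'a) graph2 \<Rightarrow> bool" where
  "good d \<longleftrightarrow> matching (fst d) (snd d) \<and> fst d \<noteq> [] \<and> snd d \<noteq> [] \<and> decorated Q (fst d) \<and> decorated Q (snd d)"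

definition glisting :: "nat list \<Rightarrow> nat list \<Rightarrow> nat list \<Rightarrow> ('a, 'a) graph2 \<Rightarrow> bool" where
  "glisting os es is d \<longleftrightarrow> reord os (all_outs (fst d)) \<and> reord es (all_ins (fst d)) \<and> reord es (all_outs (snd d)) \<and> reord is (all_ins (snd d))"

lemma good_glisting: "good d \<Longrightarrow> reord os (all_outs (fst d)) \<Longrightarrow> reord is (all_ins (snd d)) \<Longrightarrow> glisting os (all_ins (fst d)) is d"
  by (simp add: good_def glisting_def matching_def lvl_def reord_def del: set_concat)

lemma vev_in: "good d \<Longrightarrow> glisting os es is d \<Longrightarrow> vev os es is d \<in> elts Q (length os) (length is)"
  unfolding vev_def good_def glisting_def by (intro vcomp_in[OF Q] ev_in[OF Q]) auto

lemma vev_recoord: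
  assumes g: "good d" "glisting os es is d" "glisting as fs bs d"
  shows "recoord Q os is as bs (vev as fs bs d) = vev os es is d"
proof -
  have d: "fst d \<noteq> []" "snd d \<noteq> []" "decorated Q (fst d)" "decorated Q (snd d)" using g(1) by (auto simp: good_def)
  have r: "reord os (all_outs (fst d))" "reord es (all_ins (fst d))" "reord es (all_outs (snd d))" "reord is (all_ins (snd d))"
    "reord as (all_outs (fst d))" "reord fs (all_ins (fst d))" "reord fs (all_outs (snd d))" "reord bs (all_ins (snd d))"
    using g(2,3) by (auto simp: glisting_def)
  have rr: "reord os as" "reord es fs" "reord is bs" using r reord_trans reord_sym by blast+
  show ?thesis
    using recoord_vcomp[OF rr ev_in[OF Q d(1,3) r(5,6)] ev_in[OF Q d(2,4) r(7,8)]]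
      ev_recoord[OF Q d(1,3) rr(1,2) r(5,6)] ev_recoord[OF Q d(2,4) rr(2,3) r(7,8)]
    by (simp add: vev_def)
qed

lemma vev_middle:
  assumes g: "good d" "glisting os es is d" "glisting os fs is d" shows "vev os es is d = vev os fs is d"
  using vev_recoord[OF g] recoord_self[OF is_PROPD(1)[OF Q] _ _ vev_in[OF g(1,3)]] g(3)
  by (simp add: glisting_def reord_def)

lemma vev_evq:
  assumes d: "good (us, vs)" "glisting os es is (us, vs)" and e: "evq Q us us'" "evq Q vs vs'"
  shows "vev os es is (us, vs) = vev os es is (us', vs')" "good (us', vs')" "glisting os es is (us', vs')"
  using d e evq_reord[OF Q e(1)] evq_reord[OF Q e(2)]
  unfolding vev_def good_def glisting_def evq_def[OF Q] matching_def by auto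

text \<open>
  Contraction of a piece inside a PROP.  It agrees with contraction in the underlying
  properad (\<open>vertex_of_mu\<close>).
\<close>

definition vertex_of :: "('a, 'a) graph2 \<Rightarrow> 'a vertex" where
  "vertex_of d = Vertex (all_outs (fst d)) (all_ins (snd d)) (vev (all_outs (fst d)) (all_ins (fst d)) (all_ins (snd d)) d)"

lemma vertex_of_contracts: "contracts vertex_of"
  by (simp add: contracts_def vertex_of_def)

lemma vertex_of_decorated: "good d \<Longrightarrow> well_decorated Q (vertex_of d)"
  using vev_in[of d "all_outs (fst d)" "all_ins (fst d)" "all_ins (snd d)"] good_glisting[of d "all_outs (fst d)" "all_ins (snd d)"]
  by (simp add: well_decorated_def vertex_of_def good_def matching_def lvl_def reord_def del: set_concat)

text \<open>The interchange law splits off one piece at a time.\<close>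

lemma ev_pieces:
  assumes "D \<noteq> []" "\<forall>d\<in>set D. good d" "lvl (tops D)" "lvl (bots D)"
  shows "vcomp Q (length (all_outs (tops D))) (length (all_ins (tops D))) (length (all_ins (bots D)))
      (ev Q (all_outs (tops D)) (all_ins (tops D)) (tops D)) (ev Q (all_ins (tops D)) (all_ins (bots D)) (bots D)) =
    ev Q (all_outs (tops D)) (all_ins (bots D)) (map vertex_of D)"
  using assms
proof (induction D)
  case (Cons d D)
  let ?o = "all_outs (fst d)" and ?e = "all_ins (fst d)" and ?i = "all_ins (snd d)"
  have g: "good d" using Cons by simp
  have l: "lvl (fst d)" "lvl (snd d)" "set ?e = set (all_outs (snd d))" "fst d \<noteq> []" "snd d \<noteq> []"
    "decorated Q (fst d)" "decorated Q (snd d)" using g by (auto simp: good_def matching_def)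
  have di: "distinct ?o" "distinct ?e" "distinct ?i" "distinct (all_outs (snd d))" using l by (auto simp: lvl_def)
  have wd: "well_decorated Q (vertex_of d)" by (rule vertex_of_decorated[OF g])
  have single: "ev Q ?o ?i [vertex_of d] = vev ?o ?e ?i d"
    using ev_single[OF Q wd] di by (simp add: vertex_of_def)
  show ?case
  proof (cases "D = []")
    case True thus ?thesis using single by (simp add: vev_def del: length_concat)
  next
    case False
    let ?o' = "all_outs (tops D)" and ?e' = "all_ins (tops D)" and ?i' = "all_ins (bots D)"
    have lD: "lvl (tops D)" "lvl (bots D)" "set ?o \<inter> set ?o' = {}" "set ?e \<inter> set ?e' = {}" "set ?i \<inter> set ?i' = {}"
      using Cons(4,5) unfolding tops_simps lvl_append by simp_all
    have E': "set ?e' = set (all_outs (bots D))"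
      using Cons(3) by (fastforce simp: good_def matching_def tops_def bots_def)
    have dD: "decorated Q (tops D)" "decorated Q (bots D)" using Cons(3) by (auto simp: good_def tops_def bots_def decorated_def)
    have neD: "tops D \<noteq> []" "bots D \<noteq> []" using False Cons(3) by (cases D; simp add: good_def)+
    have di': "distinct ?o'" "distinct ?e'" "distinct ?i'" "distinct (all_outs (bots D))" using lD(1,2) by (auto simp: lvl_def)
    have r: "reord ?o ?o" "reord ?e ?e" "reord ?e (all_outs (snd d))" "reord ?i ?i" "reord ?o' ?o'" "reord ?e' ?e'" "reord ?e' (all_outs (bots D))" "reord ?i' ?i'"
      using di di' l(3) E' by (simp_all add: reord_def del: set_concat)
    note IH = Cons(1)[OF False _ lD(1,2)]
    have wD: "decorated Q (map vertex_of D)" using Cons(3) vertex_of_decorated by (auto simp: decorated_def)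
    have "vcomp Q (length ?o + length ?o') (length ?e + length ?e') (length ?i + length ?i')
        (ev Q (?o @ ?o') (?e @ ?e') (fst d @ tops D)) (ev Q (?e @ ?e') (?i @ ?i') (snd d @ bots D)) =
      hcomp Q (length ?o) (length ?i) (length ?o') (length ?i') (vev ?o ?e ?i d)
        (vcomp Q (length ?o') (length ?e') (length ?i') (ev Q ?o' ?e' (tops D)) (ev Q ?e' ?i' (bots D)))"
      unfolding ev_append[OF Q l(4) neD(1) l(6) dD(1) r(1,2,5,6) lD(3,4)] ev_append[OF Q l(5) neD(2) l(7) dD(2) r(3,4,7,8) lD(4,5)] vev_def
      by (rule is_PROPD(12)[OF Q ev_in[OF Q l(4,6) r(1,2)] ev_in[OF Q l(5,7) r(3,4)] ev_in[OF Q neD(1) dD(1) r(5,6)] ev_in[OF Q neD(2) dD(2) r(7,8)]])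
    also have "\<dots> = hcomp Q (length ?o) (length ?i) (length ?o') (length ?i') (ev Q ?o ?i [vertex_of d]) (ev Q ?o' ?i' (map vertex_of D))"
      using IH Cons(3) single by simp
    also have "\<dots> = ev Q (?o @ ?o') (?i @ ?i') ([vertex_of d] @ map vertex_of D)"
      using ev_append[OF Q, of "[vertex_of d]" "map vertex_of D" ?o ?i ?o' ?i'] False wd wD lD(3,5) di di' contracts_all[OF vertex_of_contracts, of D]
        vertex_of_contracts by (simp add: contracts_def reord_refl del: set_concat map_map)
    finally show ?thesis by (simp del: length_concat add: length_append)
  qed
qed simp

text \<open>
  Listing both levels piece by piece does not change their values, and then \<open>ev_pieces\<close> applies.
\<close>

lemma ev_decomp:
  assumes g: "good (us, vs)" "glisting os es is (us, vs)" and D: "decomp D us vs"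
  shows "vev os es is (us, vs) = ev Q os is (map vertex_of D)" "\<forall>d\<in>set D. good d" "decorated Q (map vertex_of D)"
proof -
  have m: "matching us vs" "decorated Q us" "decorated Q vs" "us \<noteq> []" using g(1) by (auto simp: good_def)
  have ne: "D \<noteq> []" using D m(4) by (auto simp: decomp_def)
  show gd: "\<forall>d\<in>set D. good d"
  proof
    fix d assume d: "d \<in> set D"
    note p = decomp_piece[OF D m(1) d]
    obtain u w where u: "fst d = u # w" using p(2) by (cases "fst d") (auto simp: conn2_def)
    have "ins u \<noteq> []" "set (ins u) \<subseteq> set (all_outs (snd d))" using p(1) u by (auto simp: matching_def lvl_Cons)
    hence "snd d \<noteq> []" by auto
    thus "good d" using p m(2,3) u by (auto simp: good_def decorated_def)
  qed
  have md: "matching (tops D) (bots D)" using decomp_matching[OF D m(1)] .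
  have e: "evq Q us (tops D)" "evq Q vs (bots D)" using D m by (auto simp: decomp_def matching_def intro!: evq_mset[OF Q])
  note V = vev_evq[OF g e]
  let ?o = "all_outs (tops D)" and ?e = "all_ins (tops D)" and ?i = "all_ins (bots D)"
  have gl: "glisting ?o ?e ?i (tops D, bots D)" using md by (simp add: glisting_def matching_def lvl_def reord_def del: set_concat)
  show wD: "decorated Q (map vertex_of D)" using gd vertex_of_decorated by (auto simp: decorated_def)
  have "vev os es is (us, vs) = recoord Q os is ?o ?i (vev ?o ?e ?i (tops D, bots D))"
    unfolding V(1) using vev_recoord[OF V(2,3) gl] by simp
  also have "vev ?o ?e ?i (tops D, bots D) = ev Q ?o ?i (map vertex_of D)"
    using ev_pieces[OF ne gd] md by (simp add: vev_def matching_def)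
  also have "recoord Q os is ?o ?i \<dots> = ev Q os is (map vertex_of D)"
    using ev_recoord[OF Q, of "map vertex_of D" os ?o "is" ?i] ne wD V(3) gl contracts_all[OF vertex_of_contracts, of D]
    by (simp add: glisting_def del: map_map)
  finally show "vev os es is (us, vs) = ev Q os is (map vertex_of D)" .
qed

end

lemma matching_nonempty: assumes "matching us vs" "us \<noteq> []" shows "vs \<noteq> []"
proof -
  obtain u us' where "us = u # us'" using assms(2) by (cases us) auto
  thus ?thesis using assms(1) by (auto simp: matching_def lvl_Cons)
qed

section \<open>Restriction of a homomorphism along the generators of a free PROP\<close>

lemma loc_graph:
  assumes "vs \<noteq> []" "lvl vs" "decorated P vs"
  shows "map (relabel (position (all_outs vs)) (position (all_ins vs))) vs \<in> Sgraphs P (length (all_outs vs)) (length (all_ins vs))"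
proof -
  have d: "distinct (all_outs vs)" "distinct (all_ins vs)" using assms(2) by (simp_all add: lvl_def)
  have "lvl (map (vrelabel (position (all_outs vs)) (position (all_ins vs)) (\<lambda>_ _ x. x)) vs)"
    using lvl_relabel[OF assms(2)] inj_on_position[OF d(1)] inj_on_position[OF d(2)] by blast
  thus ?thesis
    using assms position_image[OF d(1)] position_image[OF d(2)]
    unfolding Sgraphs_iff vrelabel_id all_simps set_map by (auto simp: decorated_def well_decorated_def simp del: set_concat)
qed

text \<open>
  Numbering the edges in the order in which they occur makes the graph the horizontal product of
  its vertices.  Every class arises from such a graph by a change of listings.
\<close>

lemma Sclass_recoord:
  assumes P: "sbimodule P" and vs: "vs \<in> Sgraphs P m n"
  shows "Sclass P m n vs = recoord (Sten P) [0..<m] [0..<n] (all_outs vs) (all_ins vs)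
    (Sclass P (length (all_outs vs)) (length (all_ins vs)) (map (relabel (position (all_outs vs)) (position (all_ins vs))) vs))"
proof -
  let ?o = "all_outs vs" and ?i = "all_ins vs"
  have v: "vs \<noteq> []" "lvl vs" "decorated P vs" "set ?o = {..<m}" "set ?i = {..<n}"
    using vs by (simp_all add: Sgraphs_iff decorated_def del: set_concat)
  have r: "reord [0..<m] ?o" "reord [0..<n] ?i"
    using v(2,4,5) by (simp_all add: reord_def lvl_def lessThan_atLeast0 del: set_concat)
  have l: "length ?o = m" "length ?i = n" using reord_length[OF r(1)] reord_length[OF r(2)] by simp_all
  let ?w = "map (relabel (position ?o) (position ?i)) vs"
  have w: "?w \<in> Sgraphs P m n" using loc_graph[OF v(1-3)] unfolding l .
  have p: "tr [0..<m] ?o permutes {..<m}" "tr ?i [0..<n] permutes {..<n}"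
    using tr_permutes[OF r(1)] tr_permutes'[OF reord_sym[OF r(2)]] by simp_all
  have w': "map (relabel id (tr [0..<n] ?i)) ?w \<in> Sgraphs P m n"
    using Smap_compatible(2)[OF P P sbimod_map_id permutes_id tr_permutes[OF r(2), simplified] w] by (simp add: vrelabel_id)
  have "recoord (Sten P) [0..<m] [0..<n] ?o ?i (Sclass P m n ?w) =
      Sclass P m n (map (relabel (tr [0..<m] ?o) id) (map (relabel id (tr [0..<n] ?i)) ?w))"
    unfolding recoord_def length_upt diff_zero Sten_gen(2)[OF P w p(2)] inv_tr[OF reord_sym[OF r(2)]] Sten_gen(1)[OF P w' p(1)] ..
  also have "map (relabel (tr [0..<m] ?o) id) (map (relabel id (tr [0..<n] ?i)) ?w) = vs"
    unfolding map_relabel_comp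
    using map_relabel_cong[of vs "(tr [0..<m] ?o \<circ> id) \<circ> position ?o" id "(id \<circ> tr [0..<n] ?i) \<circ> position ?i" id]
      tr_position[OF r(1)] tr_position[OF r(2)] v(4,5) by (simp add: map_relabel_id lessThan_atLeast0 del: set_concat)
  finally show ?thesis unfolding l ..
qed

text \<open>
  A level is, up to the actions, the horizontal product of its vertices, so a multiplicative map is determined by its
  restriction to single vertices.
\<close>

lemma Sten_hom_ev:
  assumes P: "sbimodule P" and Q: "is_PROP Q" and h: "sbimod_map (Sten P) Q h"
    and hh: "\<And>m n m' n' A B. A \<in> carrier (Smod P m n) \<Longrightarrow> B \<in> carrier (Smod P m' n') \<Longrightarrow>
      h (m + m') (n + n') (Sprod P m n m' n' A B) = hcomp Q m n m' n' (h m n A) (h m' n' B)"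
    and vs: "vs \<in> Sgraphs P m n"
  shows "h m n (Sclass P m n vs) = ev Q [0..<m] [0..<n] (map (vmap (\<lambda>m n x. h m n (Sincl P m n x))) vs)"
proof -
  let ?k = "\<lambda>m n x. h m n (Sincl P m n x)"
  let ?L = "\<lambda>vs. map (relabel (position (all_outs vs)) (position (all_ins vs))) vs"
  have main: "h (length (all_outs vs)) (length (all_ins vs)) (Sclass P (length (all_outs vs)) (length (all_ins vs)) (?L vs)) =
      hcomp_list Q (map (vmap ?k) vs)" if "vs \<noteq> []" "lvl vs" "decorated P vs" for vs
    using that
  proof (induction vs)
    case (Cons v vs)
    let ?a = "length (outs v)" and ?b = "length (ins v)"
    have v: "outs v \<noteq> []" "ins v \<noteq> []" "distinct (outs v)" "distinct (ins v)" "deco v \<in> elts P ?a ?b"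
      using Cons(3,4) by (auto simp: lvl_Cons well_decorated_def)
    have s: "relabel (position (outs v)) (position (ins v)) v = Vertex [0..<?a] [0..<?b] (deco v)"
      using v by (simp add: relabel_def map_position_self)
    have i: "Sincl P ?a ?b (deco v) = Sclass P ?a ?b [Vertex [0..<?a] [0..<?b] (deco v)]"
      using v by (simp add: Sincl_def)
    show ?case
    proof (cases "vs = []")
      case True thus ?thesis using s i by simp
    next
      case False
      have ld: "lvl vs" "decorated P vs" using Cons(3,4) by (simp_all add: lvl_Cons)
      let ?o = "all_outs vs" and ?i = "all_ins vs"
      have d: "distinct (outs v @ ?o)" "distinct (ins v @ ?i)" using Cons(3) by (simp_all add: lvl_def)
      have p1: "relabel (position (outs v @ ?o)) (position (ins v @ ?i)) v = relabel (position (outs v)) (position (ins v)) v"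
        using position_append1[OF d(1)] position_append1[OF d(2)] by (intro vertex_eqI) simp_all
      have p2: "map (relabel (position (outs v @ ?o)) (position (ins v @ ?i))) vs = map (relabel ((+) ?a) ((+) ?b)) (?L vs)"
        unfolding map_relabel_comp
        using position_append2[OF d(1)] position_append2[OF d(2)] by (intro map_relabel_cong) (simp_all del: set_concat)
      have L: "?L (v # vs) = [Vertex [0..<?a] [0..<?b] (deco v)] @ map (relabel ((+) ?a) ((+) ?b)) (?L vs)"
        using p1 p2 s by (simp del: map_map)
      have g: "[Vertex [0..<?a] [0..<?b] (deco v)] \<in> Sgraphs P ?a ?b" using Sincl_graph[of ?a ?b "deco v" P] v by simp
      note g' = loc_graph[OF False ld]
      have "Sclass P (?a + length ?o) (?b + length ?i) (?L (v # vs)) =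
          Sprod P ?a ?b (length ?o) (length ?i) (Sincl P ?a ?b (deco v)) (Sclass P (length ?o) (length ?i) (?L vs))"
        unfolding i L by (rule Sprod_bilinear(2)[OF P g g', symmetric])
      moreover have "Sincl P ?a ?b (deco v) \<in> carrier (Smod P ?a ?b)" using i Sclass_in[OF g] by simp
      ultimately have "h (?a + length ?o) (?b + length ?i) (Sclass P (?a + length ?o) (?b + length ?i) (?L (v # vs))) =
          hcomp Q ?a ?b (length ?o) (length ?i) (?k ?a ?b (deco v)) (hcomp_list Q (map (vmap ?k) vs))"
        using hh[OF _ Sclass_in[OF g'], of "Sincl P ?a ?b (deco v)"] Cons(1)[OF False ld] by simp
      thus ?thesis using hcomp_list_Cons[of "map (vmap ?k) vs" Q "vmap ?k v"] False
        by (simp only: list.map concat.simps length_append map_is_Nil_conv not_False_eq_True simp_thms vertex_simps all_simps)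
    qed
  qed simp
  let ?o = "all_outs vs" and ?i = "all_ins vs"
  have v: "vs \<noteq> []" "lvl vs" "decorated P vs" "set ?o = {..<m}" "set ?i = {..<n}"
    using vs by (simp_all add: Sgraphs_iff decorated_def del: set_concat)
  have r: "reord [0..<m] ?o" "reord [0..<n] ?i"
    using v(2,4,5) by (simp_all add: reord_def lvl_def lessThan_atLeast0 del: set_concat)
  have "h m n (Sclass P m n vs) = recoord Q [0..<m] [0..<n] ?o ?i (h (length ?o) (length ?i) (Sclass P (length ?o) (length ?i) (?L vs)))"
    unfolding Sclass_recoord[OF P vs]
    using recoord_map[OF Sten_sbimodule[OF P] h r] Sclass_in[OF loc_graph[OF v(1-3)]] by simp
  thus ?thesis unfolding main[OF v(1-3)] ev_def all_simps .
qed


section \<open>The properad underlying a PROP\<close>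

lemma Uc_simps [simp]:
  "md (Uc Q) = md Q" "lact (Uc Q) = lact Q" "ract (Uc Q) = ract Q"
  "mu (Uc Q) m n = lift (md Q m n) (eval_graph Q m n)" "eta (Uc Q) m n c = unit Q m n (Sincl Ibim m n c)"
  by (simp_all add: Uc_def)

lemma Uc_same [simp]:
  "sbimodule (Uc Q) = sbimodule Q" "well_decorated (Uc Q) = well_decorated Q" "decorated (Uc Q) = decorated Q"
  "veq (Uc Q) = veq Q" "sbimod_map P (Uc Q) = sbimod_map P Q" "sbimod_map (Uc Q) R = sbimod_map Q R"
  by (simp_all add: sbimodule_def fun_eq_iff well_decorated_def decorated_def veq_def recoord_def sbimod_map_def)

lemma tr_of_permutation:
  assumes "\<sigma> permutes {..<m}"
  shows "tr (map (inv_into UNIV \<sigma>) [0..<m]) [0..<m] = \<sigma>" "tr [0..<m] (map \<sigma> [0..<m]) = \<sigma>"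
    "reord (map (inv_into UNIV \<sigma>) [0..<m]) [0..<m]" "reord [0..<m] (map \<sigma> [0..<m])"
proof -
  note i = permutes_inv[OF assms]
  have im: "\<rho> ` {0..<m} = {0..<m}" if "\<rho> permutes {..<m}" for \<rho> using permutes_image[OF that] by (simp add: lessThan_atLeast0)
  show r: "reord (map (inv_into UNIV \<sigma>) [0..<m]) [0..<m]" "reord [0..<m] (map \<sigma> [0..<m])"
    using im[OF i] im[OF assms] permutes_inj_on[OF i] permutes_inj_on[OF assms] by (simp_all add: reord_def distinct_map)
  have out: "\<not> k < m \<Longrightarrow> \<sigma> k = k" for k using permutes_not_in[OF assms] by simp
  have lt: "k < m \<Longrightarrow> \<sigma> k < m" for k using permutes_in_image[OF assms, of k] by simp
  have "position (map (inv_into UNIV \<sigma>) [0..<m]) k = \<sigma> k" if k: "k < m" for k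
    using position_nth[of "map (inv_into UNIV \<sigma>) [0..<m]" "\<sigma> k"] r(1) lt[OF k] permutes_inverses(2)[OF assms]
    by (simp add: reord_def)
  thus "tr (map (inv_into UNIV \<sigma>) [0..<m]) [0..<m] = \<sigma>" using out by (auto simp: tr_eq fun_eq_iff)
  show "tr [0..<m] (map \<sigma> [0..<m]) = \<sigma>" using out lt by (auto simp: tr_eq fun_eq_iff)
qed

context
  fixes Q :: "('k::field, 'a) PROP_data"
  assumes Q: "is_PROP Q"
begin

lemma ev_act:
  assumes v: "vs \<noteq> []" "decorated Q vs"
  shows "\<sigma> permutes {..<m} \<Longrightarrow> reord [0..<m] (all_outs vs) \<Longrightarrow> reord is (all_ins vs) \<Longrightarrow>
      ev Q [0..<m] is (map (relabel \<sigma> id) vs) = lact Q m (length is) \<sigma> (ev Q [0..<m] is vs)"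
    "\<tau> permutes {..<n} \<Longrightarrow> reord os (all_outs vs) \<Longrightarrow> reord [0..<n] (all_ins vs) \<Longrightarrow>
      ev Q os [0..<n] (map (relabel id (inv_into UNIV \<tau>)) vs) = ract Q (length os) n \<tau> (ev Q os [0..<n] vs)"
proof -
  note S = sbimoduleD[OF is_PROPD(1)[OF Q]]
  show "ev Q [0..<m] is (map (relabel \<sigma> id) vs) = lact Q m (length is) \<sigma> (ev Q [0..<m] is vs)"
    if s: "\<sigma> permutes {..<m}" and r: "reord [0..<m] (all_outs vs)" "reord is (all_ins vs)"
  proof -
    note t = tr_of_permutation[OF s]
    let ?l = "map (inv_into UNIV \<sigma>) [0..<m]"
    have l: "map \<sigma> ?l = [0..<m]" using permutes_inverses(1)[OF s] by (auto intro: map_idI)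
    have di: "distinct is" using r(2) by (simp add: reord_def)
    have "ev Q (map \<sigma> ?l) (map id is) (map (relabel \<sigma> id) vs) = ev Q ?l is vs"
      using ev_relabel[OF Q v(1) reord_trans[OF t(3) r(1)] r(2), of \<sigma> id] permutes_inj_on[OF s] by simp
    also have "\<dots> = recoord Q ?l is [0..<m] is (ev Q [0..<m] is vs)"
      by (rule ev_recoord[OF Q v t(3) reord_refl[OF di] r, symmetric])
    also have "\<dots> = lact Q m (length is) \<sigma> (ev Q [0..<m] is vs)"
      using S(6)[OF ev_in[OF Q v r]] by (simp add: recoord_def t(1) tr_self[OF di])
    finally show ?thesis unfolding l by simp
  qed
  show "ev Q os [0..<n] (map (relabel id (inv_into UNIV \<tau>)) vs) = ract Q (length os) n \<tau> (ev Q os [0..<n] vs)"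
    if s: "\<tau> permutes {..<n}" and r: "reord os (all_outs vs)" "reord [0..<n] (all_ins vs)"
  proof -
    note t = tr_of_permutation[OF s]
    let ?l = "map \<tau> [0..<n]"
    have l: "map (inv_into UNIV \<tau>) ?l = [0..<n]" using permutes_inverses(2)[OF s] by (auto intro: map_idI)
    have do: "distinct os" using r(1) by (simp add: reord_def)
    have "ev Q (map id os) (map (inv_into UNIV \<tau>) ?l) (map (relabel id (inv_into UNIV \<tau>)) vs) = ev Q os ?l vs"
      using ev_relabel[OF Q v(1) r(1) reord_trans[OF reord_sym[OF t(4)] r(2)], of id "inv_into UNIV \<tau>"] permutes_inj_on[OF permutes_inv[OF s]] by simp
    also have "\<dots> = recoord Q os ?l os [0..<n] (ev Q os [0..<n] vs)"
      by (rule ev_recoord[OF Q v reord_refl[OF do] reord_sym[OF t(4)] r, symmetric])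
    also have "\<dots> = ract Q (length os) n \<tau> (ev Q os [0..<n] vs)"
      using S(5)[OF act_closed(2)[OF is_PROPD(1)[OF Q] ev_in[OF Q v r]], of \<tau>] s by (simp add: recoord_def t(2) tr_self[OF do])
    finally show ?thesis unfolding l by simp
  qed
qed

lemma vev_linear:
  "good Q (u # us, vs) \<Longrightarrow> glisting os es is (u # us, vs) \<Longrightarrow>
    linear_map (md Q (length (outs u)) (length (ins u))) (md Q (length os) (length is)) (\<lambda>p. vev Q os es is (Vertex (outs u) (ins u) p # us, vs))"
  "good Q (us, v # vs) \<Longrightarrow> glisting os es is (us, v # vs) \<Longrightarrow>
    linear_map (md Q (length (outs v)) (length (ins v))) (md Q (length os) (length is)) (\<lambda>p. vev Q os es is (us, Vertex (outs v) (ins v) p # vs))"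
  unfolding vev_def[OF Q] good_def[OF Q] glisting_def[OF Q] fst_conv snd_conv matching_def
  by (elim conjE, rule linear_map_comp[OF ev_linear[OF Q] bilinear_mapD(2)[OF is_PROPD(2)[OF Q] ev_in[OF Q]]]; assumption)
     (elim conjE, rule linear_map_comp[OF ev_linear[OF Q] bilinear_mapD(1)[OF is_PROPD(2)[OF Q] ev_in[OF Q]]]; assumption)

lemma cgraph_good: "cgraph (Uc Q) (Uc Q) d \<Longrightarrow> good Q d"
proof -
  assume c: "cgraph (Uc Q) (Uc Q) d"
  hence m: "matching (fst d) (snd d)" "fst d \<noteq> []" by (auto simp: cgraph_def conn2_def)
  thus "good Q d" using c matching_nonempty[OF m] by (simp add: good_def[OF Q] cgraph_def decorated_def)
qed

lemma eval_graph_vev: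
  assumes d: "(us, vs) \<in> Bgraphs (Uc Q) (Uc Q) m n"
  shows "good Q (us, vs)" "glisting [0..<m] (all_ins us) [0..<n] (us, vs)"
    "eval_graph Q m n (us, vs) = vev Q [0..<m] (all_ins us) [0..<n] (us, vs)"
proof -
  let ?e = "all_ins us"
  have c: "cgraph (Uc Q) (Uc Q) (us, vs)" "set (all_outs us) = {..<m}" "set (all_ins vs) = {..<n}"
    using d by (simp_all add: Bgraphs_iff del: set_concat)
  show g: "good Q (us, vs)" by (rule cgraph_good[OF c(1)])
  hence m: "lvl us" "lvl vs" "set ?e = set (all_outs vs)" "us \<noteq> []" "vs \<noteq> []" by (simp_all add: good_def[OF Q] matching_def)
  have de: "distinct ?e" using m(1) by (simp add: lvl_def)
  show gl: "glisting [0..<m] ?e [0..<n] (us, vs)"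
    using c(2,3) m by (simp add: glisting_def[OF Q] reord_def lvl_def lessThan_atLeast0 del: set_concat)
  note r = gl[unfolded glisting_def[OF Q] fst_conv snd_conv]
  have ij: "inj_on (position ?e) (set ?e)" by (rule inj_on_position[OF de])
  have im: "position ?e ` set ?e = {..<length ?e}" by (rule position_image[OF de])
  have l: "lvl (map (relabel id (position ?e)) us)" "lvl (map (relabel (position ?e) id) vs)"
    using lvl_relabel[OF m(1) _ ij, of id "\<lambda>_ _ x. x"] lvl_relabel[OF m(2), of "position ?e" id "\<lambda>_ _ x. x"] ij m(3) by (simp_all add: vrelabel_id)
  have "eval_level Q m (length ?e) (map (relabel id (position ?e)) us) = ev Q (map id [0..<m]) (map (position ?e) ?e) (map (relabel id (position ?e)) us)"
    unfolding map_position_self[OF de] list.map_id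
    by (rule eval_level_ev[OF l(1)]) (unfold all_simps set_map, use c(2) im in simp_all)
  also have "\<dots> = ev Q [0..<m] ?e us" using ev_relabel[OF Q m(4), of "[0..<m]" ?e id "position ?e"] r ij by simp
  finally have e1: "eval_level Q m (length ?e) (map (relabel id (position ?e)) us) = ev Q [0..<m] ?e us" .
  have "eval_level Q (length ?e) n (map (relabel (position ?e) id) vs) = ev Q (map (position ?e) ?e) (map id [0..<n]) (map (relabel (position ?e) id) vs)"
    unfolding map_position_self[OF de] list.map_id
    by (rule eval_level_ev[OF l(2)]) (unfold all_simps set_map m(3)[symmetric], use c(3) im in simp_all)
  also have "\<dots> = ev Q ?e [0..<n] vs" using ev_relabel[OF Q m(5), of ?e "[0..<n]" "position ?e" id] r ij by simp
  finally have e2: "eval_level Q (length ?e) n (map (relabel (position ?e) id) vs) = ev Q ?e [0..<n] vs" .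
  show "eval_graph Q m n (us, vs) = vev Q [0..<m] ?e [0..<n] (us, vs)"
    unfolding eval_graph_def vev_def[OF Q] Let_def prod.case fst_conv snd_conv e1 e2 by simp
qed

lemma eval_graph_evq:
  assumes d: "(us, vs) \<in> Bgraphs (Uc Q) (Uc Q) m n" "(us', vs') \<in> Bgraphs (Uc Q) (Uc Q) m n" and e: "evq Q us us'" "evq Q vs vs'"
  shows "eval_graph Q m n (us, vs) = eval_graph Q m n (us', vs')"
proof -
  note v = eval_graph_vev[OF d(1)] and v' = eval_graph_vev[OF d(2)]
  note w = vev_evq[OF Q v(1,2) e]
  show ?thesis unfolding v(3) v'(3) w(1) by (rule vev_middle[OF Q w(2,3) v'(2)])
qed

lemma eval_graph_compatible: "compatible (md Q m n) (Bgraphs (Uc Q) (Uc Q) m n) (Brels (Uc Q) (Uc Q) m n) (eval_graph Q m n)"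
proof -
  let ?G = "Bgraphs (Uc Q) (Uc Q) m n" and ?M = "md Q m n"
  have S: "sbimodule (Uc Q)" using is_PROPD(1)[OF Q] by simp
  note M = sbimoduleD(1)[OF is_PROPD(1)[OF Q]]
  have in': "eval_graph Q m n d \<in> carrier ?M" if "d \<in> ?G" for d
    using eval_graph_vev[of "fst d" "snd d" m n] vev_in[OF Q, of d "[0..<m]" "all_ins (fst d)" "[0..<n]"] that by simp
  have evq_dest: "evq Q us us" "evq Q vs vs" "lvl us" "lvl vs" "decorated Q us" "decorated Q vs" if "(us, vs) \<in> ?G" for us vs
    using eval_graph_vev(1)[OF that] by (auto simp: good_def[OF Q] matching_def intro!: evq_refl[OF Q])
  show ?thesis
  proof (rule Box_compatibleI[OF S S M in'])
    fix vs r assume r: "r \<in> level_rels (Uc Q) ?G (\<lambda>us. (us, vs))"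
    note A = Bgraphs_admissible_top[of "Uc Q" "Uc Q" m n vs]
    show "lin ?M (eval_graph Q m n) r = \<zero>\<^bsub>?M\<^esub>"
    proof (rule level_compatibleI(1)[OF S A M in' _ _ _ r])
      fix xs ys assume x: "(xs, vs) \<in> ?G" "mset xs = mset ys"
      show "eval_graph Q m n (xs, vs) = eval_graph Q m n (ys, vs)"
        by (rule eval_graph_evq[OF x(1) admissibleD(3)[OF A x] evq_mset[OF Q evq_dest(3,5)[OF x(1)] x(2)] evq_dest(2)[OF x(1)]])
    next
      fix v v' ys assume x: "(v # ys, vs) \<in> ?G" and v: "veq (Uc Q) v v'"
      have v2: "veq Q v v'" "reord (outs v) (outs v')" "reord (ins v) (ins v')" "well_decorated (Uc Q) v'" using v by (auto simp: veq_def)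
      have x': "(v' # ys, vs) \<in> ?G" using admissibleD(2)[OF A, of "[]" v ys v'] x v2 by simp
      show "eval_graph Q m n (v # ys, vs) = eval_graph Q m n (v' # ys, vs)"
        using eval_graph_evq[OF x x' evq_veq[OF Q v2(1) evq_dest(3)[OF x]] evq_dest(2)[OF x]] evq_dest(5)[OF x] by simp
    next
      fix v ys assume x: "(v # ys, vs) \<in> ?G"
      have "linear_map (md Q (length (outs v)) (length (ins v))) ?M (\<lambda>p. eval_graph Q m n (Vertex (outs v) (ins v) p # ys, vs))"
        by (rule linear_map_cong[OF vev_linear(1)[OF eval_graph_vev(1,2)[OF x], simplified] _ M])
           (use eval_graph_vev(3) admissible_deco[OF A, of "[]" v ys] x in simp)
      thus "linear_map (md (Uc Q) (length (outs v)) (length (ins v))) ?M (\<lambda>p. eval_graph Q m n (Vertex (outs v) (ins v) p # ys, vs))" by simp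
    qed
  next
    fix us r assume r: "r \<in> level_rels (Uc Q) ?G (\<lambda>vs. (us, vs))"
    note A = Bgraphs_admissible_bot[of "Uc Q" "Uc Q" m n us]
    show "lin ?M (eval_graph Q m n) r = \<zero>\<^bsub>?M\<^esub>"
    proof (rule level_compatibleI(1)[OF S A M in' _ _ _ r])
      fix xs ys assume x: "(us, xs) \<in> ?G" "mset xs = mset ys"
      show "eval_graph Q m n (us, xs) = eval_graph Q m n (us, ys)"
        by (rule eval_graph_evq[OF x(1) admissibleD(3)[OF A x] evq_dest(1)[OF x(1)] evq_mset[OF Q evq_dest(4,6)[OF x(1)] x(2)]])
    next
      fix v v' ys assume x: "(us, v # ys) \<in> ?G" and v: "veq (Uc Q) v v'"
      have v2: "veq Q v v'" "reord (outs v) (outs v')" "reord (ins v) (ins v')" "well_decorated (Uc Q) v'" using v by (auto simp: veq_def)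
      have x': "(us, v' # ys) \<in> ?G" using admissibleD(2)[OF A, of "[]" v ys v'] x v2 by simp
      show "eval_graph Q m n (us, v # ys) = eval_graph Q m n (us, v' # ys)"
        using eval_graph_evq[OF x x' evq_dest(1)[OF x] evq_veq[OF Q v2(1) evq_dest(4)[OF x]]] evq_dest(6)[OF x] by simp
    next
      fix v ys assume x: "(us, v # ys) \<in> ?G"
      have "linear_map (md Q (length (outs v)) (length (ins v))) ?M (\<lambda>p. eval_graph Q m n (us, Vertex (outs v) (ins v) p # ys))"
        by (rule linear_map_cong[OF vev_linear(2)[OF eval_graph_vev(1,2)[OF x], simplified] _ M])
           (use eval_graph_vev(3) admissible_deco[OF A, of "[]" v ys] x in simp)
      thus "linear_map (md (Uc Q) (length (outs v)) (length (ins v))) ?M (\<lambda>p. eval_graph Q m n (us, Vertex (outs v) (ins v) p # ys))" by simp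
    qed
  next
    fix us vs and f :: "nat \<Rightarrow> nat" assume x: "(us, vs) \<in> ?G" and f: "inj_on f (set (all_ins us))"
    have x': "(map (relabel id f) us, map (relabel f id) vs) \<in> ?G"
      using cgraph_vrelabel[OF _ sbimod_map_id sbimod_map_id _ f, of "Uc Q" "Uc Q" vs id id] x
      unfolding vrelabel_id Bgraphs_iff by (simp del: set_concat)
    note v = eval_graph_vev[OF x] and v' = eval_graph_vev(3)[OF x']
    have g: "us \<noteq> []" "vs \<noteq> []" "reord [0..<m] (all_outs us)" "reord (all_ins us) (all_ins us)" "reord (all_ins us) (all_outs vs)"
      "reord [0..<n] (all_ins vs)" using v(1,2) by (simp_all add: good_def[OF Q] glisting_def[OF Q])
    show "eval_graph Q m n (map (relabel id f) us, map (relabel f id) vs) = eval_graph Q m n (us, vs)"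
      using ev_relabel[OF Q g(1,3,4) inj_on_id f] ev_relabel[OF Q g(2,5,6) f inj_on_id]
      unfolding v v' all_simps by (simp add: vev_def[OF Q])
  qed
qed

lemma mu_Uc:
  shows "d \<in> Bgraphs (Uc Q) (Uc Q) m n \<Longrightarrow> mu (Uc Q) m n (Bclass (Uc Q) (Uc Q) m n d) = eval_graph Q m n d"
    "sbimod_map (Box (Uc Q) (Uc Q)) (Uc Q) (mu (Uc Q))"
proof -
  have S: "sbimodule (Uc Q)" using is_PROPD(1)[OF Q] by simp
  note M = sbimoduleD(1)[OF is_PROPD(1)[OF Q]]
  show "d \<in> Bgraphs (Uc Q) (Uc Q) m n \<Longrightarrow> mu (Uc Q) m n (Bclass (Uc Q) (Uc Q) m n d) = eval_graph Q m n d"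
    using lift_Bmod(2)[OF S S M eval_graph_compatible] by simp
  have "sbimod_map (Box (Uc Q) (Uc Q)) Q (\<lambda>m n. lift (md Q m n) (eval_graph Q m n))"
    unfolding Box_pbim
  proof (rule pbim_map[OF Box_presentation[OF S S] is_PROPD(1)[OF Q] eval_graph_compatible])
    fix m n d and \<sigma> :: "nat \<Rightarrow> nat" assume d: "d \<in> Bgraphs (Uc Q) (Uc Q) m n"
    obtain us vs where uv: "d = (us, vs)" by (cases d)
    note x = d[unfolded uv]
    note v = eval_graph_vev[OF x]
    have g: "us \<noteq> []" "vs \<noteq> []" "decorated Q us" "decorated Q vs" "reord [0..<m] (all_outs us)" "reord (all_ins us) (all_ins us)"
      "reord (all_ins us) (all_outs vs)" "reord [0..<n] (all_ins vs)" using v(1,2) by (simp_all add: good_def[OF Q] glisting_def[OF Q])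
    note e1 = ev_in[OF Q g(1,3,5,6)] and e2 = ev_in[OF Q g(2,4,7,8)]
    note T = Bmap_compatible(1)[OF S S S S sbimod_map_id sbimod_map_id _ _ x, unfolded vrelabel_id fst_conv snd_conv]
    have T1: "(map (relabel \<sigma> id) us, vs) \<in> Bgraphs (Uc Q) (Uc Q) m n" if "\<sigma> permutes {..<m}"
      using T[OF that permutes_id] by (simp add: map_relabel_id)
    have T2: "(us, map (relabel id \<rho>) vs) \<in> Bgraphs (Uc Q) (Uc Q) m n" if "\<rho> permutes {..<n}" for \<rho>
      using T[OF permutes_id that] by (simp add: map_relabel_id)
    show "eval_graph Q m n (map (relabel \<sigma> id) (fst d), snd d) = lact Q m n \<sigma> (eval_graph Q m n d)" if s: "\<sigma> permutes {..<m}"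
      using is_PROPD(3)[OF Q e1 e2, simplified length_upt diff_zero, OF s] ev_act(1)[OF g(1,3) s g(5,6)]
      unfolding uv fst_conv snd_conv eval_graph_vev(3)[OF T1[OF s]] v(3) vev_def[OF Q] all_simps list.map_id by simp
    show "eval_graph Q m n (fst d, map (relabel id (inv_into UNIV \<sigma>)) (snd d)) = ract Q m n \<sigma> (eval_graph Q m n d)" if s: "\<sigma> permutes {..<n}"
      using is_PROPD(4)[OF Q e1 e2, simplified length_upt diff_zero, OF s] ev_act(2)[OF g(2,4) s g(7,8)]
      unfolding uv fst_conv snd_conv eval_graph_vev(3)[OF T2[OF permutes_inv[OF s]]] v(3) vev_def[OF Q] by simp
  qed
  thus "sbimod_map (Box (Uc Q) (Uc Q)) (Uc Q) (mu (Uc Q))" by (simp add: sbimod_map_def)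
qed

lemma mu_Bcl:
  assumes c: "cgraph (Uc Q) (Uc Q) d" "listing os is d"
  shows "mu (Uc Q) (length os) (length is) (Bcl (Uc Q) (Uc Q) os is d) = vev Q os (all_ins (fst d)) is d"
proof -
  obtain us vs where uv: "d = (us, vs)" by (cases d)
  note l = localize_in[OF c]
  have g: "us \<noteq> []" "vs \<noteq> []" "matching us vs" using cgraph_good[OF c(1)] by (simp_all add: uv good_def[OF Q])
  have r: "reord os (all_outs us)" "reord is (all_ins vs)" "reord (all_ins us) (all_ins us)" "reord (all_ins us) (all_outs vs)"
    using c(2) g(3) by (simp_all add: uv listing_def matching_def lvl_def reord_def del: set_concat)
  have d: "distinct os" "distinct is" using r by (simp_all add: reord_def)
  have e: "ev Q [0..<length os] (all_ins us) (map (relabel (position os) id) us) = ev Q os (all_ins us) us"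
    "ev Q (all_ins us) [0..<length is] (map (relabel id (position is)) vs) = ev Q (all_ins us) is vs"
    using ev_relabel[OF Q g(1) r(1,3) inj_on_position[OF d(1)] inj_on_id] ev_relabel[OF Q g(2) r(4,2) inj_on_id inj_on_position[OF d(2)]]
    by (simp_all add: map_position_self d)
  show ?thesis
    unfolding Bcl_def mu_Uc(1)[OF l]
    unfolding localize_def uv fst_conv snd_conv
    unfolding eval_graph_vev(3)[OF l[unfolded localize_def uv fst_conv snd_conv]] vev_def[OF Q] fst_conv snd_conv all_simps list.map_id e length_upt diff_zero ..
qed

lemma vertex_of_mu: "cgraph (Uc Q) (Uc Q) d \<Longrightarrow> vmap (mu (Uc Q)) (pc (Uc Q) (Uc Q) d) = vertex_of Q d"
  using mu_Bcl[OF _ cgraph_listing] unfolding pc_def vmap_def vertex_of_def[OF Q] by simp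

text \<open>
  The unit of a PROP is multiplicative, so its value at the identity graph is the horizontal composite of copies of
  the unit of the underlying properad.
\<close>

lemma unit_strands:
  assumes "0 < m"
  shows "unit Q m m (Sone m) = ev Q [0..<m] [0..<m] (strands (eta (Uc Q) (Suc 0) (Suc 0) 1) [0..<m])"
    "decorated Q (strands (eta (Uc Q) (Suc 0) (Suc 0) 1) [0..<m])"
proof -
  show "unit Q m m (Sone m) = ev Q [0..<m] [0..<m] (strands (eta (Uc Q) (Suc 0) (Suc 0) 1) [0..<m])"
    using Sten_hom_ev[OF Ibim_sbimodule Q is_PROPD(13)[OF Q] _ idgraph_Sgraph[OF assms]] is_PROPD(16)[OF Q]
    by (simp add: Sone_def idgraph_strands vmap_strands)
  have "(1::'k) \<in> elts Ibim (Suc 0) (Suc 0)" by (simp add: Ibim_def)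
  hence "eta (Uc Q) (Suc 0) (Suc 0) 1 \<in> elts Q (Suc 0) (Suc 0)"
    using sbimod_mapD(2)[OF is_PROPD(13)[OF Q] sbimod_mapD(2)[OF Sincl_sbimod[OF Ibim_sbimodule]]] by simp
  thus "decorated Q (strands (eta (Uc Q) (Suc 0) (Suc 0) 1) [0..<m])" by (auto simp: decorated_def well_decorated_def)
qed

text \<open>
  By \<open>ev_decomp\<close>, either contraction of two levels evaluates to their vertical composite, so that both sides
  are vertical composites of all three levels.
\<close>

lemma Uc_assoc:
  assumes g: "(us, vs, ws) \<in> graphs3 (Uc Q) m n"
  shows "mu (Uc Q) m n (Box_map (Uc Q) (Uc Q) (mu (Uc Q)) (\<lambda>_ _ x. x) m n (Bclass (Box (Uc Q) (Uc Q)) (Uc Q) m n (contract (Uc Q) (Uc Q) (us, vs), ws))) =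
    mu (Uc Q) m n (Box_map (Uc Q) (Uc Q) (\<lambda>_ _ x. x) (mu (Uc Q)) m n (Bclass (Uc Q) (Box (Uc Q) (Uc Q)) m n (us, contract (Uc Q) (Uc Q) (vs, ws))))"
proof -
  let ?U = "Uc Q"
  have S: "sbimodule ?U" using is_PROPD(1)[OF Q] by simp
  note BB = Box_sbimodule[OF S S]
  note G = g[unfolded graphs3_iff]
  have m: "matching us vs" "matching vs ws" "decorated ?U us" "decorated ?U vs" "decorated ?U ws" using G by auto
  define D where "D = components (us, vs)"
  define D' where "D' = components (vs, ws)"
  have D: "decomp D us vs" "decomp D' vs ws" unfolding D_def D'_def using decomp_components m by blast+
  have vo: "map (vmap (mu ?U)) (map (pc ?U ?U) D) = map (vertex_of Q) D" "map (vmap (mu ?U)) (map (pc ?U ?U) D') = map (vertex_of Q) D'"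
    using vertex_of_mu decomp_cgraph[OF D(1) m(1,3,4)] decomp_cgraph[OF D(2) m(2,4,5)] by simp_all
  have gd: "good Q (us, vs)" "good Q (vs, ws)"
  proof -
    have "us \<noteq> []" using G by (simp add: conn3_def)
    moreover from matching_nonempty[OF m(1) this] have "vs \<noteq> []" .
    moreover from matching_nonempty[OF m(2) this] have "ws \<noteq> []" .
    ultimately show "good Q (us, vs)" "good Q (vs, ws)" using m by (simp_all add: good_def[OF Q])
  qed
  note c = contract_graph3(1)[OF S g D(1)] contract_graph3(2)[OF S g D(2)]
  have B1: "Box_map ?U ?U (mu ?U) (\<lambda>_ _ x. x) m n (Bclass (Box ?U ?U) ?U m n (contract ?U ?U (us, vs), ws)) = Bclass ?U ?U m n (map (vertex_of Q) D, ws)"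
    "(map (vertex_of Q) D, ws) \<in> Bgraphs ?U ?U m n"
    using Box_map_gen(2,3)[OF BB S S S mu_Uc(2) sbimod_map_id c(1)] unfolding fst_conv snd_conv vo map_vmap_id unfolding contract_pc D_def by auto
  have B2: "Box_map ?U ?U (\<lambda>_ _ x. x) (mu ?U) m n (Bclass ?U (Box ?U ?U) m n (us, contract ?U ?U (vs, ws))) = Bclass ?U ?U m n (us, map (vertex_of Q) D')"
    "(us, map (vertex_of Q) D') \<in> Bgraphs ?U ?U m n"
    using Box_map_gen(2,3)[OF S S BB S sbimod_map_id mu_Uc(2) c(2)] unfolding fst_conv snd_conv vo map_vmap_id unfolding contract_pc D'_def by auto
  note v1 = eval_graph_vev[OF B1(2)] and v2 = eval_graph_vev[OF B2(2)]
  let ?e = "all_ins (map (vertex_of Q) D)" and ?f = "all_ins us"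
  have r1: "reord [0..<m] (all_outs us)" "reord ?f ?f" "reord ?f (all_outs (map (vertex_of Q) D'))" "reord [0..<n] (all_ins (map (vertex_of Q) D'))"
    using v2(2) by (simp_all add: glisting_def[OF Q])
  have r2: "reord ?e ?e" "reord ?e (all_outs ws)" "reord [0..<n] (all_ins ws)"
    using v1(2) by (simp_all add: glisting_def[OF Q])
  have r3: "reord ?f (all_outs vs)" "reord ?e (all_ins vs)"
    using m r1(2) r2(1,2) by (simp_all add: matching_def lvl_def reord_def del: set_concat map_map)
  have e1: "ev Q [0..<m] ?e (map (vertex_of Q) D) = vev Q [0..<m] ?f ?e (us, vs)"
    using ev_decomp(1)[OF Q gd(1) _ D(1), of "[0..<m]" ?f ?e] r1 r3 by (simp add: glisting_def[OF Q])
  have e2: "ev Q ?f [0..<n] (map (vertex_of Q) D') = vev Q ?f ?e [0..<n] (vs, ws)"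
    using ev_decomp(1)[OF Q gd(2) _ D(2), of ?f ?e "[0..<n]"] r2 r3 by (simp add: glisting_def[OF Q])
  have ne: "us \<noteq> []" "vs \<noteq> []" "ws \<noteq> []" "decorated Q us" "decorated Q vs" "decorated Q ws" using gd by (simp_all add: good_def[OF Q])
  note a = is_PROPD(6)[OF Q ev_in[OF Q ne(1,4) r1(1,2)] ev_in[OF Q ne(2,5) r3] ev_in[OF Q ne(3,6) r2(2,3)]]
  show ?thesis
    unfolding B1(1) B2(1) mu_Uc(1)[OF B1(2)] mu_Uc(1)[OF B2(2)] v1(3) v2(3)
    using a unfolding vev_def[OF Q] fst_conv snd_conv e1 e2 .
qed

lemma Uc_properad: "is_properad (Uc Q)"
  unfolding is_properad_def
proof (intro conjI allI ballI impI)
  let ?U = "Uc Q"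
  show S: "sbimodule ?U" using is_PROPD(1)[OF Q] by simp
  show "sbimod_map (Box ?U ?U) ?U (mu ?U)" by (rule mu_Uc(2))
  have "eta ?U = (\<lambda>m n c. unit Q m n (Sincl Ibim m n c))" by (simp add: Uc_def)
  thus E: "sbimod_map Ibim ?U (eta ?U)"
    using sbimod_map_comp[OF Ibim_sbimodule Sincl_sbimod[OF Ibim_sbimodule] is_PROPD(13)[OF Q]] by simp
  let ?c = "eta ?U (Suc 0) (Suc 0) 1"
  have one: "well_decorated Ibim (Vertex [i] [i] (1::'k))" for i by (simp add: well_decorated_def Ibim_def)
  fix m n p assume p: "p \<in> elts ?U m n" and mn: "0 < m \<and> 0 < n"
  let ?w = "Vertex [0..<m] [0..<n] p"
  have w: "lvl [?w]" "well_decorated ?U ?w" using p mn by (auto simp: lvl_Cons well_decorated_def)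
  have ew: "ev Q [0..<m] [0..<n] [?w] = p" using ev_single[OF Q, of ?w] w by simp
  show "mu ?U m n (Box_map ?U ?U (eta ?U) (\<lambda>_ _ x. x) m n (Bclass Ibim ?U m n (idgraph m, [?w]))) = p"
  proof -
    have g: "(idgraph m, [?w]) \<in> Bgraphs Ibim ?U m n"
      using w strands_conn(1)[of ?w 1] one mn unfolding Bgraphs_iff cgraph_def matching_def fst_conv snd_conv idgraph_strands strands_simps
      by (auto simp: strands_lvl lessThan_atLeast0)
    note b = Box_map_gen(2,3)[OF Ibim_sbimodule S S S E sbimod_map_id g, unfolded fst_conv snd_conv idgraph_strands vmap_strands map_vmap_id]
    show ?thesis
      unfolding idgraph_strands b(1) mu_Uc(1)[OF b(2)] eval_graph_vev(3)[OF b(2)] strands_simps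
      using is_PROPD(14)[OF Q, of p m n] p mn unit_strands(1)[of m] ew by (simp add: vev_def[OF Q])
  qed
  show "mu ?U m n (Box_map ?U ?U (\<lambda>_ _ x. x) (eta ?U) m n (Bclass ?U Ibim m n ([?w], idgraph n))) = p"
  proof -
    have g: "([?w], idgraph n) \<in> Bgraphs ?U Ibim m n"
      using w strands_conn(2)[of ?w 1] one mn unfolding Bgraphs_iff cgraph_def matching_def fst_conv snd_conv idgraph_strands strands_simps
      by (auto simp: strands_lvl lessThan_atLeast0)
    note b = Box_map_gen(2,3)[OF S S Ibim_sbimodule S sbimod_map_id E g, unfolded fst_conv snd_conv idgraph_strands vmap_strands map_vmap_id]
    show ?thesis
      unfolding idgraph_strands b(1) mu_Uc(1)[OF b(2)] eval_graph_vev(3)[OF b(2)]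
      using is_PROPD(15)[OF Q, of p m n] p mn unit_strands(1)[of n] ew by (simp add: vev_def[OF Q])
  qed
next
  fix m n t assume "t \<in> graphs3 (Uc Q) m n"
  thus "case t of (us, vs, ws) \<Rightarrow>
      mu (Uc Q) m n (Box_map (Uc Q) (Uc Q) (mu (Uc Q)) (\<lambda>_ _ x. x) m n (Bclass (Box (Uc Q) (Uc Q)) (Uc Q) m n (contract (Uc Q) (Uc Q) (us, vs), ws))) =
      mu (Uc Q) m n (Box_map (Uc Q) (Uc Q) (\<lambda>_ _ x. x) (mu (Uc Q)) m n (Bclass (Uc Q) (Box (Uc Q) (Uc Q)) m n (us, contract (Uc Q) (Uc Q) (vs, ws))))"
    using Uc_assoc by (cases t) (simp only: prod.case)
qed

end

lemma PROP_HomD: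
  assumes "g \<in> PROP_Hom Q Q'"
  shows "sbimod_map Q Q' g" "extensional_mor Q g"
    "x \<in> elts Q m N \<Longrightarrow> y \<in> elts Q N n \<Longrightarrow> g m n (vcomp Q m N n x y) = vcomp Q' m N n (g m N x) (g N n y)"
    "x \<in> elts Q m n \<Longrightarrow> x' \<in> elts Q m' n' \<Longrightarrow> g (m + m') (n + n') (hcomp Q m n m' n' x x') = hcomp Q' m n m' n' (g m n x) (g m' n' x')"
    "A \<in> elts (Sten Ibim) m n \<Longrightarrow> g m n (unit Q m n A) = unit Q' m n A"
  using assms unfolding PROP_Hom_def by blast+

lemma Uc_map_Hom:
  assumes Q: "is_PROP Q" "is_PROP Q'" and g: "g \<in> PROP_Hom Q Q'"
  shows "Uc_map g \<in> Properad_Hom (Uc Q) (Uc Q')"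
proof -
  note H = PROP_HomD[OF g]
  let ?U = "Uc Q" and ?U' = "Uc Q'"
  have S: "sbimodule ?U" "sbimodule ?U'" and H1: "sbimod_map ?U ?U' g" using is_PROPD(1)[OF Q(1)] is_PROPD(1)[OF Q(2)] H(1) by simp_all
  note B = Box_map_gen[OF S S H1 H1]
  have "g m n (mu ?U m n A) = mu ?U' m n (Box_map ?U' ?U' g g m n A)" if A: "A \<in> carrier (Bmod ?U ?U m n)" for m n A
  proof (rule Bmod_eqI[OF sbimoduleD(1)[OF S(2)] _ _ _ A])
    show "linear_map (Bmod ?U ?U m n) (md ?U' m n) (\<lambda>A. g m n (mu ?U m n A))"
      using linear_map_comp[OF sbimod_mapD(1)[OF mu_Uc(2)[OF Q(1)]] sbimod_mapD(1)[OF H1]] by simp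
    show "linear_map (Bmod ?U ?U m n) (md ?U' m n) (\<lambda>A. mu ?U' m n (Box_map ?U' ?U' g g m n A))"
      using linear_map_comp[OF B(1) sbimod_mapD(1)[OF mu_Uc(2)[OF Q(2)], unfolded md_Box]] by simp
    fix d assume d: "d \<in> Bgraphs ?U ?U m n"
    obtain us vs where uv: "d = (us, vs)" by (cases d)
    note x = d[unfolded uv] and x' = B(3)[OF d, unfolded uv fst_conv snd_conv]
    note v = eval_graph_vev[OF Q(1) x]
    have r: "us \<noteq> []" "vs \<noteq> []" "decorated Q us" "decorated Q vs" "reord [0..<m] (all_outs us)" "reord (all_ins us) (all_ins us)"
      "reord (all_ins us) (all_outs vs)" "reord [0..<n] (all_ins vs)" using v(1,2) by (simp_all add: good_def[OF Q(1)] glisting_def[OF Q(1)])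
    show "g m n (mu ?U m n (Bclass ?U ?U m n d)) = mu ?U' m n (Box_map ?U' ?U' g g m n (Bclass ?U ?U m n d))"
      using H(3)[OF ev_in[OF Q(1) r(1,3,5,6)] ev_in[OF Q(1) r(2,4,7,8)]]
        ev_hom[OF Q H(1) H(4) r(1,3,5,6)] ev_hom[OF Q H(1) H(4) r(2,4,7,8)]
      unfolding uv mu_Uc(1)[OF Q(1) x] B(2)[OF x] fst_conv snd_conv mu_Uc(1)[OF Q(2) x'] v(3) eval_graph_vev(3)[OF Q(2) x'] all_simps
      by (simp add: vev_def[OF Q(1)] vev_def[OF Q(2)])
  qed
  moreover have "Sincl Ibim m n c \<in> elts (Sten Ibim) m n" if "c \<in> elts Ibim m n" for m n and c :: 'a
    using sbimod_mapD(2)[OF Sincl_sbimod[OF Ibim_sbimodule] that] .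
  ultimately show ?thesis
    using H1 H(2) H(5) by (simp add: Properad_Hom_def Uc_map_def extensional_mor_def del: Uc_simps(4))
qed

section \<open>The adjunction\<close>

text \<open>
  Internal edges can be renamed to an initial segment of the natural numbers.  Then both levels are generators of
  free symmetric algebras, where vertical composition is defined.
\<close>

lemma Bmod_eqI_standard:
  assumes P: "sbimodule Q" "sbimodule P" and M: "kmod M" and f: "linear_map (Bmod Q P m n) M f" "linear_map (Bmod Q P m n) M h"
    and eq: "\<And>us vs N. us \<in> Sgraphs Q m N \<Longrightarrow> vs \<in> Sgraphs P N n \<Longrightarrow> conn2 us vs \<Longrightarrow> (us, vs) \<in> Bgraphs Q P m n \<Longrightarrow>
      f (Bclass Q P m n (us, vs)) = h (Bclass Q P m n (us, vs))"
    and A: "A \<in> carrier (Bmod Q P m n)"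
  shows "f A = h A"
proof (rule Bmod_eqI[OF M f _ A])
  fix d assume d: "d \<in> Bgraphs Q P m n"
  obtain us vs where uv: "d = (us, vs)" by (cases d)
  let ?e = "all_ins us"
  let ?us = "map (relabel id (position ?e)) us" and ?vs = "map (relabel (position ?e) id) vs"
  have x: "cgraph Q P (us, vs)" "set (all_outs us) = {..<m}" "set (all_ins vs) = {..<n}" using d unfolding uv Bgraphs_iff by simp_all
  have e: "distinct ?e" "set ?e = set (all_outs vs)" "us \<noteq> []" "matching us vs"
    using x(1) by (simp_all add: cgraph_def matching_def lvl_def conn2_def)
  note i = inj_on_position[OF e(1)]
  have c: "cgraph Q P (?us, ?vs)"
    using cgraph_vrelabel[OF x(1) sbimod_map_id sbimod_map_id _ i, of id id] by (simp add: vrelabel_id)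
  have b: "(?us, ?vs) \<in> Bgraphs Q P m n"
    unfolding Bgraphs_iff fst_conv snd_conv all_simps set_map using c x(2,3) by simp
  have ne: "vs \<noteq> []" by (rule matching_nonempty[OF e(4,3)])
  have S: "?us \<in> Sgraphs Q m (length ?e)" "?vs \<in> Sgraphs P (length ?e) n"
    using c e(3) ne x(2,3) position_image[OF e(1)]
    unfolding Sgraphs_iff all_simps set_map e(2)[symmetric] cgraph_def matching_def by simp_all
  have "Bclass Q P m n (?us, ?vs) = Bclass Q P m n d"
    using Bclass_rename[OF d[unfolded uv] i] uv by simp
  thus "f (Bclass Q P m n d) = h (Bclass Q P m n d)"
    using eq[OF S _ b] c by (simp add: cgraph_def del: map_map)
qed

text \<open>
  A connected graph is its own only component, so its two levels compose to a single vertex: the inclusion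
  \<open>P \<rightarrow> U\<^sub>c(S\<^sub>\<otimes>(P))\<close> respects composition.
\<close>

lemma Sincl_mu:
  assumes P: "is_properad P" and us: "us \<in> Sgraphs P m N" and vs: "vs \<in> Sgraphs P N n" and c: "conn2 us vs"
  shows "Sincl P m n (mu P m n (Bclass P P m n (us, vs))) = vcomp (SPROP P) m N n (Sclass P m N us) (Sclass P N n vs)"
proof -
  note p = is_properadD[OF P] and M = Sgraphs_matching[OF us vs]
  have s: "set (all_outs us) = {..<m}" "set (all_ins vs) = {..<n}" "us \<noteq> []" "vs \<noteq> []" using us vs by (simp_all add: Sgraphs_iff)
  have cg: "cgraph P P (us, vs)" using M c by (simp add: cgraph_def decorated_def)
  have l: "listing [0..<m] [0..<n] (us, vs)" using s by (simp add: listing_def lessThan_atLeast0 del: set_concat)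
  have D: "decomp [(us, vs)] us vs" using M c by (simp add: decomp_def matching_def)
  have loc: "localize [0..<m] [0..<n] (us, vs) = (us, vs)"
    using map_relabel_cong[of us "position [0..<m]" id id id] map_relabel_cong[of vs id id "position [0..<n]" id] s
    by (simp add: localize_def map_relabel_id del: set_concat)
  have mn: "0 < m" "0 < n"
  proof -
    obtain u us' v vs' where "us = u # us'" "vs = v # vs'" using s(3,4) by (meson neq_Nil_conv)
    moreover have "outs u \<noteq> []" "ins v \<noteq> []" using M(1) calculation by (simp_all add: matching_def lvl_Cons)
    ultimately have "{..<m} \<noteq> {}" "{..<n} \<noteq> {}" using s(1,2) by auto
    thus "0 < m" "0 < n" by auto
  qed
  have "veq P (vmap (mu P) (pc P P (us, vs))) (Vertex [0..<m] [0..<n] (mu P m n (Bclass P P m n (us, vs))))"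
    using properad_vertex_listing[OF P cg l] by (simp add: Bcl_def loc)
  hence "Sclass P m n (composite P [(us, vs)]) = Sclass P m n [Vertex [0..<m] [0..<n] (mu P m n (Bclass P P m n (us, vs)))]"
    using Sclass_leveq(1)[OF p(1) SPROP_vcomp(3)[OF P us vs D]] by (simp add: composite_def leveqI)
  thus ?thesis unfolding SPROP_vcomp(2)[OF P us vs D] using mn by (simp add: Sincl_def)
qed

lemma Sten_map_Sincl:
  assumes P: "sbimodule P" "sbimodule P'" and f: "sbimod_map P P' f" and x: "x \<in> elts P m n"
  shows "Sten_map P P' f m n (Sincl P m n x) = Sincl P' m n (f m n x)"
proof (cases "m = 0 \<or> n = 0")
  case True
  thus ?thesis using linear_map_zero[OF sbimod_mapD(1)[OF Sten_map_sbimod[OF P f]], unfolded md_Sten, OF Smod_module Smod_module, of m n] by (simp add: Sincl_def)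
next
  case False
  thus ?thesis using Sten_map_gen(1)[OF P f Sincl_graph[OF _ _ x]] by (simp add: Sincl_def vmap_def)
qed

lemma adj_apply: "x \<in> elts P m n \<Longrightarrow> adj P h m n x = h m n (Sincl P m n x)"
  by (simp add: adj_def Uc_map_def comp_mor_apply)

lemma adj_extensional: "extensional_mor P (adj P h)"
  by (simp add: adj_def comp_mor_def extensional_mor_def compose_def)

context
  fixes P :: "('k::field, 'a) properad_data" and Q :: "('k, 'b) PROP_data"
  assumes P: "is_properad P" and Q: "is_PROP Q"
begin

lemma hom_ev:
  assumes h: "h \<in> PROP_Hom (SPROP P) Q" and vs: "vs \<in> Sgraphs P m n"
  shows "h m n (Sclass P m n vs) = ev Q [0..<m] [0..<n] (map (vmap (adj P h)) vs)"
proof -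
  note H = PROP_HomD[OF h]
  have eq: "map (vmap (\<lambda>m n x. h m n (Sincl P m n x))) vs = map (vmap (adj P h)) vs"
    using vs by (auto simp: Sgraphs_iff well_decorated_def adj_apply intro!: vertex_eqI)
  have "sbimod_map (Sten P) Q h" using H(1) by (simp add: sbimod_map_def)
  from Sten_hom_ev[OF is_properadD(1)[OF P] Q this _ vs] H(4)
  have "h m n (Sclass P m n vs) = ev Q [0..<m] [0..<n] (map (vmap (\<lambda>m n x. h m n (Sincl P m n x))) vs)" by simp
  thus ?thesis unfolding eq .
qed

lemma adj_Hom:
  assumes h: "h \<in> PROP_Hom (SPROP P) Q" shows "adj P h \<in> Properad_Hom P (Uc Q)"
proof -
  let ?k = "adj P h" and ?U = "Uc Q"
  note H = PROP_HomD[OF h] and p = is_properadD[OF P]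
  have U: "is_properad ?U" by (rule Uc_properad[OF Q])
  note u = is_properadD[OF U]
  have "sbimod_map (Sten P) Q h" using H(1) by (simp add: sbimod_map_def)
  hence k: "sbimod_map P ?U ?k"
    using comp_mor_sbimod[OF p(1) Sincl_sbimod[OF p(1)]] by (simp add: adj_def Uc_map_def)
  note B = Box_map_gen[OF p(1) u(1) p(1) u(1) k k]
  have "?k m n (mu P m n A) = mu ?U m n (Box_map ?U ?U ?k ?k m n A)" if A: "A \<in> carrier (Bmod P P m n)" for m n A
  proof (rule Bmod_eqI_standard[OF p(1,1) sbimoduleD(1)[OF u(1)] _ _ _ A])
    show "linear_map (Bmod P P m n) (md ?U m n) (\<lambda>A. ?k m n (mu P m n A))"
      using linear_map_comp[OF sbimod_mapD(1)[OF p(2)] sbimod_mapD(1)[OF k]] by simp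
    show "linear_map (Bmod P P m n) (md ?U m n) (\<lambda>A. mu ?U m n (Box_map ?U ?U ?k ?k m n A))"
      by (rule linear_map_comp[OF B(1) sbimod_mapD(1)[OF u(2), unfolded md_Box]])
    fix us vs N assume us: "us \<in> Sgraphs P m N" and vs: "vs \<in> Sgraphs P N n" and c: "conn2 us vs" and d: "(us, vs) \<in> Bgraphs P P m n"
    let ?us = "map (vmap ?k) us" and ?vs = "map (vmap ?k) vs"
    note x = B(3)[OF d, unfolded fst_conv snd_conv]
    have s: "set (all_ins us) = {..<N}" using us by (simp add: Sgraphs_iff)
    note v = eval_graph_vev[OF Q x]
    have gl: "glisting [0..<m] [0..<N] [0..<n] (?us, ?vs)"
      using v(2) s unfolding glisting_def[OF Q] fst_conv snd_conv all_simps by (simp add: reord_def lessThan_atLeast0 del: set_concat)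
    have "mu P m n (Bclass P P m n (us, vs)) \<in> elts P m n"
      using sbimod_mapD(2)[OF p(2)] Bclass_in[OF d] by simp
    hence "?k m n (mu P m n (Bclass P P m n (us, vs))) = h m n (vcomp (SPROP P) m N n (Sclass P m N us) (Sclass P N n vs))"
      by (simp add: adj_apply Sincl_mu[OF P us vs c])
    also have "\<dots> = vcomp Q m N n (h m N (Sclass P m N us)) (h N n (Sclass P N n vs))"
      using H(3)[of "Sclass P m N us" m N "Sclass P N n vs" n] Sclass_in[OF us] Sclass_in[OF vs] by simp
    also have "\<dots> = vev Q [0..<m] [0..<N] [0..<n] (?us, ?vs)"
      unfolding hom_ev[OF h us] hom_ev[OF h vs] by (simp add: vev_def[OF Q])
    also have "\<dots> = eval_graph Q m n (?us, ?vs)" unfolding v(3) by (rule vev_middle[OF Q v(1) gl v(2)])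
    also have "\<dots> = mu ?U m n (Box_map ?U ?U ?k ?k m n (Bclass P P m n (us, vs)))"
      unfolding B(2)[OF d] fst_conv snd_conv mu_Uc(1)[OF Q x] ..
    finally show "?k m n (mu P m n (Bclass P P m n (us, vs))) = mu ?U m n (Box_map ?U ?U ?k ?k m n (Bclass P P m n (us, vs)))" .
  qed
  moreover have "?k m n (eta P m n c) = eta ?U m n c" if c: "c \<in> elts Ibim m n" for m n c
    using H(5)[OF sbimod_mapD(2)[OF Sincl_sbimod[OF Ibim_sbimodule] c]] Sten_map_Sincl[OF Ibim_sbimodule p(1,3) c]
      sbimod_mapD(2)[OF p(3) c] by (simp add: adj_apply)
  ultimately show ?thesis using k adj_extensional[of P h] by (simp add: Properad_Hom_def del: Uc_simps)
qed

lemma adj_inj: "inj_on (adj P) (PROP_Hom (SPROP P) Q)"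
proof (rule inj_onI, intro ext)
  fix h h' m n A assume h: "h \<in> PROP_Hom (SPROP P) Q" and h': "h' \<in> PROP_Hom (SPROP P) Q" and eq: "adj P h = adj P h'"
  note H = PROP_HomD[OF h] and H' = PROP_HomD[OF h']
  show "h m n A = h' m n A"
  proof (cases "A \<in> carrier (Smod P m n)")
    case True
    show ?thesis
      by (rule Smod_eqI[OF sbimoduleD(1)[OF is_PROPD(1)[OF Q]] sbimod_mapD(1)[OF H(1), unfolded SPROP_simps] sbimod_mapD(1)[OF H'(1), unfolded SPROP_simps] _ True])
         (simp add: hom_ev[OF h] hom_ev[OF h'] eq)
  next
    case False
    thus ?thesis using H(2) H'(2) by (simp add: extensional_mor_def extensional_def)
  qed
qed

text \<open>
  The extension of \<open>f\<close> sends a level to the value in \<open>Q\<close> of its image under \<open>f\<close>.  It respects vertical composition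
  because \<open>f\<close> respects the composition of every piece, and \<open>ev_decomp\<close> evaluates vertical composites in
  \<open>Q\<close> on pieces.
\<close>

lemma adj_surj:
  assumes f: "f \<in> Properad_Hom P (Uc Q)" shows "\<exists>h\<in>PROP_Hom (SPROP P) Q. adj P h = f"
proof -
  let ?U = "Uc Q"
  note F = Properad_HomD[OF f] and p = is_properadD[OF P]
  have U: "is_properad ?U" by (rule Uc_properad[OF Q])
  have F1: "sbimod_map P Q f" using F(1) by simp
  note SQ = is_PROPD(1)[OF Q]
  note MQ = sbimoduleD(1)[OF SQ]
  define E where "E = (\<lambda>m n vs. ev Q [0..<m] [0..<n] (map (vmap f) vs))"
  have dec: "decorated Q (map (vmap f) vs)" if "decorated P vs" for vs
    using that sbimod_mapD(2)[OF F1] by (auto simp: decorated_def well_decorated_def)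
  have S: "map (vmap f) vs \<noteq> []" "lvl (map (vmap f) vs)" "decorated Q (map (vmap f) vs)" "reord [0..<m] (all_outs (map (vmap f) vs))"
    "reord [0..<n] (all_ins (map (vmap f) vs))" if "vs \<in> Sgraphs P m n" for vs m n
    using that dec[of vs] unfolding Sgraphs_iff lvl_vmap all_simps
    by (auto simp: decorated_def reord_def lvl_def lessThan_atLeast0 simp del: set_concat)
  have E_in: "E m n vs \<in> elts Q m n" if "vs \<in> Sgraphs P m n" for vs m n
    using ev_in[OF Q S(1,3-5)[OF that]] by (simp add: E_def)
  have E_evq: "E m n vs = E m n vs'" if "vs \<in> Sgraphs P m n" "evq Q (map (vmap f) vs) (map (vmap f) vs')" for vs vs' m n
    using that(2) S(4,5)[OF that(1)] unfolding E_def evq_def[OF Q] by blast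
  have comp: "compatible (md Q m n) (Sgraphs P m n) (Srels P m n) (E m n)" for m n
    unfolding compatible_def
  proof (intro conjI ballI E_in)
    note A = Sgraphs_admissible[of P m n]
    fix r assume r: "r \<in> Srels P m n"
    show "lin (md Q m n) (E m n) r = \<zero>\<^bsub>md Q m n\<^esub>"
    proof (rule level_compatibleI(1)[OF p(1) A MQ E_in _ _ _ r[unfolded Srels_def]])
      fix xs ys assume x: "xs \<in> Sgraphs P m n" "mset xs = mset ys"
      show "E m n xs = E m n ys" by (rule E_evq[OF x(1) evq_mset[OF Q S(2,3)[OF x(1)]]]) (simp add: x(2))
    next
      fix v v' ys assume x: "v # ys \<in> Sgraphs P m n" and v: "veq P v v'"
      have "veq Q (vmap f v) (vmap f v')"
        using v recoord_map[OF p(1) F1] sbimod_mapD(2)[OF F1] by (auto simp: veq_def well_decorated_def)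
      thus "E m n (v # ys) = E m n (v' # ys)"
        using S(2,3)[OF x] by (intro E_evq[OF x]) (simp add: evq_veq[OF Q])
    next
      fix v ys assume x: "v # ys \<in> Sgraphs P m n"
      have "linear_map (md P (length (outs v)) (length (ins v))) (md Q m n)
          (\<lambda>p. ev Q [0..<m] [0..<n] (Vertex (outs (vmap f v)) (ins (vmap f v)) (f (length (outs v)) (length (ins v)) p) # map (vmap f) ys))"
        using linear_map_comp[OF sbimod_mapD(1)[OF F1] ev_linear[OF Q, of "vmap f v" "map (vmap f) ys" "[0..<m]" "[0..<n]", unfolded vertex_simps]]
          S(2-5)[OF x] by simp
      thus "linear_map (md P (length (outs v)) (length (ins v))) (md Q m n) (\<lambda>p. E m n (Vertex (outs v) (ins v) p # ys))"
        by (simp add: E_def vmap_def)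
    qed
  qed
  define h where "h = (\<lambda>m n. restrict (lift (md Q m n) (E m n)) (carrier (Smod P m n)))"
  have h_gen: "h m n (Sclass P m n vs) = E m n vs" if "vs \<in> Sgraphs P m n" for m n vs
    using lift_Smod(2)[OF p(1) MQ comp that] Sclass_in[OF that] by (simp add: h_def)
  have "sbimod_map (Sten P) Q (\<lambda>m n. lift (md Q m n) (E m n))"
    unfolding Sten_pbim
  proof (rule pbim_map[OF Sten_presentation[OF p(1)] SQ comp])
    fix m n vs and \<sigma> :: "nat \<Rightarrow> nat" assume vs: "vs \<in> Sgraphs P m n"
    have eq: "map (vmap f) (map (relabel a b) vs) = map (relabel a b) (map (vmap f) vs)" for a b
      by (auto intro: vertex_eqI)
    note s = S[OF vs]
    show "E m n (map (relabel \<sigma> id) vs) = lact Q m n \<sigma> (E m n vs)" if "\<sigma> permutes {..<m}"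
      unfolding E_def eq using ev_act(1)[OF Q s(1,3) that s(4,5)] by simp
    show "E m n (map (relabel id (inv_into UNIV \<sigma>)) vs) = ract Q m n \<sigma> (E m n vs)" if "\<sigma> permutes {..<n}"
      unfolding E_def eq using ev_act(2)[OF Q s(1,3) that s(4,5)] by simp
  qed
  hence h1: "sbimod_map (Sten P) Q h"
    by (rule sbimod_map_cong[OF _ _ Sten_sbimodule[OF p(1)]]) (simp add: h_def)
  note L = sbimod_mapD(1)[OF h1, unfolded md_Sten]
  have "h \<in> PROP_Hom (SPROP P) Q"
    unfolding PROP_Hom_def mem_Collect_eq SPROP_simps
  proof (intro conjI allI ballI)
    show "sbimod_map (SPROP P) Q h" using h1 by (simp add: sbimod_map_def)
    show "extensional_mor (SPROP P) h" by (simp add: extensional_mor_def h_def)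
  next
    fix m N n x y assume x: "x \<in> carrier (Smod P m N)" and y: "y \<in> carrier (Smod P N n)"
    note V = SPROP_vcomp[OF P]
    show "h m n (vcomp (SPROP P) m N n x y) = vcomp Q m N n (h m N x) (h N n y)"
    proof (rule Smod_eqI2[OF MQ bilinear_comp[OF V(1) L] bilinear_pre[OF is_PROPD(2)[OF Q] L L] _ x y])
      fix us vs assume us: "us \<in> Sgraphs P m N" and vs: "vs \<in> Sgraphs P N n"
      note M = Sgraphs_matching[OF us vs]
      have D: "decomp (components (us, vs)) us vs" by (rule decomp_components[OF M(1)])
      let ?us = "map (vmap f) us" and ?vs = "map (vmap f) vs"
      let ?D = "map (map_prod (map (vmap f)) (map (vmap f))) (components (us, vs))"
      note c = composite_hom[OF P U f M D]
      note s = S[OF us] and t = S[OF vs]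
      have m: "matching ?us ?vs" using M(1) unfolding matching_def lvl_vmap all_simps .
      have g: "good Q (?us, ?vs)" using s t m by (simp add: good_def[OF Q])
      have gl: "glisting [0..<m] [0..<N] [0..<n] (?us, ?vs)" using s t by (simp add: glisting_def[OF Q])
      have "cgraph ?U ?U d" if "d \<in> set ?D" for d
        using decomp_cgraph[where Q = ?U and P = ?U, OF c(1) m _ _ that] s(3) t(3) by simp
      hence "composite ?U ?D = map (vertex_of Q) ?D"
        unfolding composite_contracts(1) using vertex_of_mu[OF Q] by (intro map_cong refl) blast
      hence "E m n (composite P (components (us, vs))) = vev Q [0..<m] [0..<N] [0..<n] (?us, ?vs)"
        unfolding E_def c(2) ev_decomp(1)[OF Q g gl c(1)] by simp
      thus "h m n (vcomp (SPROP P) m N n (Sclass P m N us) (Sclass P N n vs)) = vcomp Q m N n (h m N (Sclass P m N us)) (h N n (Sclass P N n vs))"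
        unfolding V(2)[OF us vs D] h_gen[OF V(3)[OF us vs D]] h_gen[OF us] h_gen[OF vs] by (simp add: E_def vev_def[OF Q])
    qed
  next
    fix m n m' n' x y assume x: "x \<in> carrier (Smod P m n)" and y: "y \<in> carrier (Smod P m' n')"
    note V = Sprod_bilinear[OF p(1)]
    show "h (m + m') (n + n') (Sprod P m n m' n' x y) = hcomp Q m n m' n' (h m n x) (h m' n' y)"
    proof (rule Smod_eqI2[OF MQ bilinear_comp[OF V(1) L] bilinear_pre[OF is_PROPD(7)[OF Q] L L] _ x y])
      fix us vs assume us: "us \<in> Sgraphs P m n" and vs: "vs \<in> Sgraphs P m' n'"
      let ?us = "map (vmap f) us" and ?vs = "map (vmap f) vs"
      let ?ws = "map (relabel ((+) m) ((+) n)) ?vs"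
      note s = S[OF us] and t = S[OF vs]
      have up: "[0..<a + b] = [0..<a] @ map ((+) a) [0..<b]" for a b :: nat
        by (rule nth_equalityI) (auto simp: nth_append)
      have eq: "map (vmap f) (us @ map (relabel ((+) m) ((+) n)) vs) = ?us @ ?ws" by (auto intro: vertex_eqI)
      have w: "?ws \<noteq> []" "decorated Q ?ws" "reord (map ((+) m) [0..<m']) (all_outs ?ws)" "reord (map ((+) n) [0..<n']) (all_ins ?ws)"
        using t(1,3) reord_map[OF inj_on_add t(4)] reord_map[OF inj_on_add t(5)] unfolding all_simps
        by (auto simp: decorated_def well_decorated_def)
      have "E (m + m') (n + n') (us @ map (relabel ((+) m) ((+) n)) vs) =
          ev Q ([0..<m] @ map ((+) m) [0..<m']) ([0..<n] @ map ((+) n) [0..<n']) (?us @ ?ws)"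
        unfolding E_def eq up ..
      also have "\<dots> = hcomp Q m n m' n' (ev Q [0..<m] [0..<n] ?us) (ev Q (map ((+) m) [0..<m']) (map ((+) n) [0..<n']) ?ws)"
        using ev_append[OF Q s(1) w(1) s(3) w(2) s(4,5) w(3,4)] by (simp add: disjoint_iff)
      also have "ev Q (map ((+) m) [0..<m']) (map ((+) n) [0..<n']) ?ws = ev Q [0..<m'] [0..<n'] ?vs"
        by (rule ev_relabel[OF Q t(1,4,5) inj_on_add inj_on_add])
      finally show "h (m + m') (n + n') (Sprod P m n m' n' (Sclass P m n us) (Sclass P m' n' vs)) =
          hcomp Q m n m' n' (h m n (Sclass P m n us)) (h m' n' (Sclass P m' n' vs))"
        unfolding V(2)[OF us vs] h_gen[OF Sprod_graph[OF us vs]] h_gen[OF us] h_gen[OF vs] by (simp add: E_def)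
    qed
  next
    fix m n and A assume A: "A \<in> elts (Sten (Ibim :: ('k, 'k) sbimod)) m n"
    note g = Sten_map_gen[OF Ibim_sbimodule p(1,3)]
    show "h m n (Sten_map Ibim P (eta P) m n A) = unit Q m n A"
    proof (rule Smod_eqI[OF MQ _ sbimod_mapD(1)[OF is_PROPD(13)[OF Q], unfolded md_Sten] _ A[unfolded md_Sten]])
      show "linear_map (Smod Ibim m n) (md Q m n) (\<lambda>A. h m n (Sten_map Ibim P (eta P) m n A))"
        using linear_map_comp[OF sbimod_mapD(1)[OF Sten_map_sbimod[OF Ibim_sbimodule p(1,3)]] sbimod_mapD(1)[OF h1]] by simp
      fix vs :: "'k vertex list" assume vs: "vs \<in> Sgraphs Ibim m n"
      have eq: "map (vmap f) (map (vmap (eta P)) vs) = map (vmap (\<lambda>m n x. unit Q m n (Sincl Ibim m n x))) vs"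
        using vs F(4) by (auto simp: Sgraphs_iff well_decorated_def intro!: vertex_eqI)
      have "unit Q m n (Sclass Ibim m n vs) = ev Q [0..<m] [0..<n] (map (vmap (\<lambda>m n x. unit Q m n (Sincl Ibim m n x))) vs)"
        using Sten_hom_ev[OF Ibim_sbimodule Q is_PROPD(13)[OF Q] _ vs] is_PROPD(16)[OF Q] by simp
      thus "h m n (Sten_map Ibim P (eta P) m n (Sclass Ibim m n vs)) = unit Q m n (Sclass Ibim m n vs)"
        unfolding g(1)[OF vs] h_gen[OF g(2)[OF vs]] E_def eq ..
    qed
  qed
  moreover have "adj P h m n x = f m n x" for m n x
  proof (cases "x \<in> elts P m n")
    case True
    show ?thesis
    proof (cases "m = 0 \<or> n = 0")
      case True
      hence "elts Q m n = {\<zero>\<^bsub>md Q m n\<^esub>}" using sbimoduleD(2)[OF SQ] by blast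
      moreover have "h m n (Sincl P m n x) \<in> elts Q m n" "f m n x \<in> elts Q m n"
        using sbimod_mapD(2)[OF h1 sbimod_mapD(2)[OF Sincl_sbimod[OF p(1)]]] sbimod_mapD(2)[OF F1] \<open>x \<in> elts P m n\<close> by blast+
      ultimately show ?thesis using \<open>x \<in> elts P m n\<close> by (simp add: adj_apply)
    next
      case False
      have "h m n (Sincl P m n x) = ev Q [0..<m] [0..<n] [Vertex [0..<m] [0..<n] (f m n x)]"
        using h_gen[OF Sincl_graph[OF _ _ True]] False by (simp add: Sincl_def E_def vmap_def)
      also have "\<dots> = f m n x"
        using ev_single[OF Q, of "Vertex [0..<m] [0..<n] (f m n x)"] sbimod_mapD(2)[OF F1 True] by (simp add: well_decorated_def)
      finally show ?thesis using True by (simp add: adj_apply)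
    qed
  next
    case False
    thus ?thesis using F(2) adj_extensional[of P h] by (simp add: extensional_mor_def extensional_def)
  qed
  ultimately show ?thesis by (intro bexI[of _ h] ext)
qed

lemma adj_bij: "bij_betw (adj P) (PROP_Hom (SPROP P) Q) (Properad_Hom P (Uc Q))"
  unfolding bij_betw_def using adj_inj adj_Hom adj_surj by blast

end

lemma adj_natural:
  assumes P: "is_properad P'" "is_properad P" and f: "f \<in> Properad_Hom P' P"
  shows "adj P' (comp_mor (SPROP P') g (comp_mor (SPROP P') h (Sten_map P' P f))) = comp_mor P' (Uc_map g) (comp_mor P' (adj P h) f)"
proof (intro ext)
  note p = is_properadD(1)[OF P(2)] and p' = is_properadD(1)[OF P(1)] and F = Properad_HomD(1)[OF f]
  fix m n x
  show "adj P' (comp_mor (SPROP P') g (comp_mor (SPROP P') h (Sten_map P' P f))) m n x = comp_mor P' (Uc_map g) (comp_mor P' (adj P h) f) m n x"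
  proof (cases "x \<in> elts P' m n")
    case True
    have "Sincl P' m n x \<in> elts (SPROP P') m n" using sbimod_mapD(2)[OF Sincl_sbimod[OF p'] True] by simp
    thus ?thesis
      using True sbimod_mapD(2)[OF F True] by (simp add: adj_apply comp_mor_apply Uc_map_def Sten_map_Sincl[OF p' p F True] del: SPROP_simps)
  qed (simp add: adj_def comp_mor_def compose_def)
qed

theorem proposition43:
  fixes P :: "('k::field_char_0, 'a) properad_data"
    and P' :: "('k, 'a1) properad_data"
    and P'' :: "('k, 'a2) properad_data"
    and Q :: "('k, 'b) PROP_data"
    and Q' :: "('k, 'b1) PROP_data"
    and Q'' :: "('k, 'b2) PROP_data"
  assumes "is_properad P" and "is_properad P'" and "is_properad P''"
    and "is_PROP Q" and "is_PROP Q'" and "is_PROP Q''"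
  shows "
    \<comment> \<open>the functor from PROPs to properads\<close>
    is_properad (Uc Q) \<and>
    (\<forall>g\<in>PROP_Hom Q Q'. Uc_map g \<in> Properad_Hom (Uc Q) (Uc Q')) \<and>
    Uc_map (id_mor Q) = id_mor (Uc Q) \<and>
    (\<forall>g\<in>PROP_Hom Q Q'. \<forall>g'\<in>PROP_Hom Q' Q''.
       Uc_map (comp_mor Q g' g) = comp_mor (Uc Q) (Uc_map g') (Uc_map g)) \<and>
    \<comment> \<open>the functor from properads to PROPs\<close>
    is_PROP (SPROP P) \<and>
    (\<forall>f\<in>Properad_Hom P P'. Sten_map P P' f \<in> PROP_Hom (SPROP P) (SPROP P')) \<and>
    Sten_map P P (id_mor P) = id_mor (SPROP P) \<and>
    (\<forall>f\<in>Properad_Hom P P'. \<forall>f'\<in>Properad_Hom P' P''.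
       Sten_map P P'' (comp_mor P f' f) =
       comp_mor (SPROP P) (Sten_map P' P'' f') (Sten_map P P' f)) \<and>
    \<comment> \<open>the bijection of Hom-sets, natural in both arguments\<close>
    bij_betw (adj P) (PROP_Hom (SPROP P) Q) (Properad_Hom P (Uc Q)) \<and>
    (\<forall>f\<in>Properad_Hom P' P. \<forall>h\<in>PROP_Hom (SPROP P) Q. \<forall>g\<in>PROP_Hom Q Q'.
       adj P' (comp_mor (SPROP P') g (comp_mor (SPROP P') h (Sten_map P' P f))) =
       comp_mor P' (Uc_map g) (comp_mor P' (adj P h) f))"
proof (intro conjI ballI)
  note S = is_properadD(1)[OF assms(1)] is_properadD(1)[OF assms(2)] is_properadD(1)[OF assms(3)]
  show "Uc_map (id_mor Q) = id_mor (Uc Q)" by (simp add: Uc_map_def id_mor_def)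
  show "Uc_map (comp_mor Q g' g) = comp_mor (Uc Q) (Uc_map g') (Uc_map g)" for g g' by (simp add: Uc_map_def comp_mor_def)
  show "Sten_map P P'' (comp_mor P f' f) = comp_mor (SPROP P) (Sten_map P' P'' f') (Sten_map P P' f)"
    if "f \<in> Properad_Hom P P'" "f' \<in> Properad_Hom P' P''" for f f'
    by (rule Sten_map_comp_mor[OF S Properad_HomD(1)[OF that(1)] Properad_HomD(1)[OF that(2)]])
qed (simp_all only: Uc_properad[OF assms(4)] Uc_map_Hom[OF assms(4,5)] SPROP_PROP[OF assms(1)] Sten_map_Hom[OF assms(1,2)]
    Sten_map_id[OF is_properadD(1)[OF assms(1)]] adj_bij[OF assms(1,4)] adj_natural[OF assms(2,1)])

end
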